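(* Let $h=(2,3,\dots,n,n)$, i.e. $h(j)=j+1$ for $j\in[n-1]$ and $h(n)=n$, let $Y(h)$ be the twin of the regular semisimple Hessenberg variety $X(h)$ with $H^*(Y(h))$ carrying the dagger action, and let $\mathbf U$ be the alternating one-dimensional $\mathfrak{S}_n$-module. Then \[ H_{\Pi_n}(q)=R(H^*(Y(h));q)\otimes\mathbf U, \] and both sides equal \[ \sum_{I\subset[n-1]}\left(\mathrm{Ind}_{\mathfrak{S}_I}^{\mathfrak{S}_n}\mathbf 1\right)(q-1)^{n-1-|I|}. \]
   Context: The permutohedron $\Pi_n\subset\mathbb R^n$ is the convex hull of $\{(w(1),\dots,w(n))\mid w\in\mathfrak{S}_n\}$, an $(n-1)$-dimensional simple polytope; $\mathfrak{S}_n$ acts on $\mathbb R^n$ by permuting coordinates, preserving $\Pi_n$ and permuting its faces. $F_i(\Pi_n)$ is the complex vector space with basis the $i$-dimensional faces of $\Pi_n$, a permutation $\mathfrak{S}_n$-module; $F_{\Pi_n}(q)=\sum_{i=0}^{n-1}F_i(\Pi_n)q^i$ and $H_{\Pi_n}(q)=F_{\Pi_n}(q-1)$ (with coefficients in the representation ring $R(\mathfrak{S}_n)$). $\mathbf 1$ is the trivial one-dimensional module. For $I=\{i_1<\cdots<i_d\}\subset[n-1]$, $\mathfrak{S}_I=\mathfrak{S}_{i_1}\times\mathfrak{S}_{i_2-i_1}\times\cdots\times\mathfrak{S}_{n-i_d}\subset\mathfrak{S}_n$ (Young subgroup); $\mathfrak{S}_\emptyset=\mathfrak{S}_n$. Twin: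 with $S$ real diagonal with distinct entries, $T\subset U(n)$ the diagonal torus, $M_h$ the Hermitian matrices with $(i,j)$ entry zero when $i>h(j)$ or $j>h(i)$, $Y(h)=\{gT\in U(n)/T\mid gSg^{-1}\in M_h\}$ with left $T$-action. Complex coefficients, $H^*(BT)=\mathbb C[t_1,\dots,t_n]$, $\deg t_i=2$. $H^*_T(Y(h))$ is identified with the set of $f\in\mathrm{Map}(\mathfrak{S}_n,\mathbb C[t_1,\dots,t_n])$ with $f(v)\equiv f(w)\pmod{t_i-t_j}$ whenever $v=w(i,j)$, $j<i\le h(j)$; $H^*(Y(h))=H^*_T(Y(h))/(t_1,\dots,t_n)$; the dagger action $(\sigma\dagger f)(w)=f(\sigma^{-1}w)$ descends to $H^*(Y(h))$. $R(A;q)=\sum_i[A_{2i}]q^i$ for a graded module $A=\bigoplus A_{2i}$. *)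

theory Defs
  imports
    "HOL-Analysis.Analysis"
    "HOL-Algebra.UnivPoly"
    "HOL-Algebra.Sym_Groups"
    "HOL-Library.Poly_Mapping"
    "Jordan_Normal_Form.VS_Connect"
begin

section \<open>The representation ring of a group\<close>

text \<open>
  Vector spaces of arbitrary type cannot be collected into one set, so isomorphism classes of
  finite-dimensional complex representations are represented by matrix representations: a pair
  of a degree and a matrix-valued map, of which only the values on the carrier of the group
  matter.
\<close>

type_synonym 'g mrep = "nat \<times> ('g \<Rightarrow> complex mat)"

definition mreps :: "('g, 'b) monoid_scheme \<Rightarrow> 'g mrep set" where
  "mreps G = {(d, \<rho>).
     (\<forall>g\<in>carrier G. \<rho> g \<in> carrier_mat d d) \<and>
     \<rho> \<one>\<^bsub>G\<^esub> = 1\<^sub>m d \<and>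
     (\<forall>g\<in>carrier G. \<forall>g'\<in>carrier G. \<rho> (g \<otimes>\<^bsub>G\<^esub> g') = \<rho> g * \<rho> g')}"

definition mrep_iso :: "('g, 'b) monoid_scheme \<Rightarrow> 'g mrep \<Rightarrow> 'g mrep \<Rightarrow> bool" where
  "mrep_iso G A B \<longleftrightarrow> fst A = fst B \<and>
     (\<exists>P\<in>carrier_mat (fst A) (fst A). invertible_mat P \<and>
        (\<forall>g\<in>carrier G. P * snd A g = snd B g * P))"

definition mrep_zero :: "'g mrep" where
  "mrep_zero = (0, \<lambda>g. 1\<^sub>m 0)"

definition mrep_one :: "'g mrep" where
  "mrep_one = (1, \<lambda>g. 1\<^sub>m 1)"

definition mrep_sum :: "'g mrep \<Rightarrow> 'g mrep \<Rightarrow> 'g mrep" where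
  "mrep_sum A B = (fst A + fst B,
     \<lambda>g. four_block_mat (snd A g) (0\<^sub>m (fst A) (fst B)) (0\<^sub>m (fst B) (fst A)) (snd B g))"

text \<open>The tensor product is given by Kronecker products of matrices.\<close>

definition mrep_tensor :: "'g mrep \<Rightarrow> 'g mrep \<Rightarrow> 'g mrep" where
  "mrep_tensor A B = (fst A * fst B,
     \<lambda>g. Matrix.mat (fst A * fst B) (fst A * fst B)
       (\<lambda>(i, j). (snd A g) $$ (i div fst B, j div fst B) * (snd B g) $$ (i mod fst B, j mod fst B)))"

text \<open>
  Grothendieck group of the commutative monoid of isomorphism classes under direct sum: a pair
  of representations \<open>(A, B)\<close> stands for the virtual representation \<open>[A] - [B]\<close>.
\<close>

definition vrep_rel ::
  "('g, 'b) monoid_scheme \<Rightarrow> (('g mrep \<times> 'g mrep) \<times> ('g mrep \<times> 'g mrep)) set" where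
  "vrep_rel G = {((A, B), (C, D)). {A, B, C, D} \<subseteq> mreps G \<and>
     (\<exists>E\<in>mreps G.
        mrep_iso G (mrep_sum (mrep_sum A D) E) (mrep_sum (mrep_sum C B) E))}"

definition rep_ring :: "('g, 'b) monoid_scheme \<Rightarrow> ('g mrep \<times> 'g mrep) set ring" where
  "rep_ring G =
     \<lparr>carrier = (mreps G \<times> mreps G) // vrep_rel G,
      mult = (\<lambda>X Y. \<Union>(A, B)\<in>X. \<Union>(C, D)\<in>Y. vrep_rel G ``
        {(mrep_sum (mrep_tensor A C) (mrep_tensor B D),
          mrep_sum (mrep_tensor A D) (mrep_tensor B C))}),
      one = vrep_rel G `` {(mrep_one, mrep_zero)},
      zero = vrep_rel G `` {(mrep_zero, mrep_zero)},
      add = (\<lambda>X Y. \<Union>(A, B)\<in>X. \<Union>(C, D)\<in>Y.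
        vrep_rel G `` {(mrep_sum A C, mrep_sum B D)})\<rparr>"

text \<open>
  A \<open>G\<close>-module consists of a complex vector space \<open>V\<close> and an action \<open>\<alpha>\<close> of \<open>G\<close> on it; it affords
  the matrix representation \<open>A\<close> if it is isomorphic, as a \<open>G\<close>-module, to the space of column
  vectors on which \<open>G\<close> acts through \<open>A\<close>.
\<close>

definition affords ::
  "('g, 'b) monoid_scheme \<Rightarrow> (complex, 'v, 'c) module_scheme \<Rightarrow> ('g \<Rightarrow> 'v \<Rightarrow> 'v) \<Rightarrow> 'g mrep \<Rightarrow> bool"
  where
  "affords G V \<alpha> A \<longleftrightarrow> A \<in> mreps G \<and>
     (\<exists>\<phi>. linear_map class_ring V (module_vec TYPE(complex) (fst A)) \<phi> \<and>
        bij_betw \<phi> (carrier V) (carrier_vec (fst A)) \<and>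
        (\<forall>g\<in>carrier G. \<forall>v\<in>carrier V.
           \<alpha> g v \<in> carrier V \<and> \<phi> (\<alpha> g v) = snd A g *\<^sub>v \<phi> v))"

text \<open>
  The class \<open>[V]\<close> of a \<open>G\<close>-module. All matrix representations afforded by \<open>V\<close> are isomorphic, so
  this is a union of copies of one class; it is empty, hence not an element of the
  representation ring, unless \<open>V\<close> is a finite-dimensional \<open>G\<close>-module.
\<close>

definition rep_class ::
  "('g, 'b) monoid_scheme \<Rightarrow> (complex, 'v, 'c) module_scheme \<Rightarrow> ('g \<Rightarrow> 'v \<Rightarrow> 'v)
     \<Rightarrow> ('g mrep \<times> 'g mrep) set" where
  "rep_class G V \<alpha> = (\<Union>A\<in>{A. affords G V \<alpha> A}. vrep_rel G `` {(A, mrep_zero)})"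


section \<open>Some modules\<close>

text \<open>In the module records below, the unused ring fields are left undefined.\<close>

definition line_module :: "(complex, complex) module" where
  "line_module = \<lparr>carrier = UNIV, mult = undefined, one = undefined,
     zero = 0, add = (+), smult = (*)\<rparr>"

definition trivial_action :: "'g \<Rightarrow> complex \<Rightarrow> complex" where
  "trivial_action g z = z"

definition sign_action :: "(nat \<Rightarrow> nat) \<Rightarrow> complex \<Rightarrow> complex" where
  "sign_action \<sigma> z = of_int (sign \<sigma>) * z"

text \<open>
  The vector space with basis a finite set \<open>X\<close>, as the space of functions on \<open>X\<close>; if \<open>G\<close> acts on
  \<open>X\<close> by \<open>\<alpha>\<close>, the induced action sends the indicator function of \<open>x\<close> to that of \<open>\<alpha> g x\<close>.
\<close>

definition perm_module :: "'x set \<Rightarrow> (complex, 'x \<Rightarrow> complex) module" where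
  "perm_module X = \<lparr>carrier = X \<rightarrow>\<^sub>E UNIV, mult = undefined, one = undefined,
     zero = (\<lambda>x\<in>X. 0), add = (\<lambda>f f'. \<lambda>x\<in>X. f x + f' x), smult = (\<lambda>c f. \<lambda>x\<in>X. c * f x)\<rparr>"

definition perm_action ::
  "('g, 'b) monoid_scheme \<Rightarrow> ('g \<Rightarrow> 'x \<Rightarrow> 'x) \<Rightarrow> 'x set \<Rightarrow> 'g \<Rightarrow> ('x \<Rightarrow> complex) \<Rightarrow> ('x \<Rightarrow> complex)"
  where
  "perm_action G \<alpha> X g f = (\<lambda>x\<in>X. f (\<alpha> (inv\<^bsub>G\<^esub> g) x))"

text \<open>
  The module induced from an \<open>H\<close>-module \<open>V\<close>, in its realization by \<open>H\<close>-equivariant functions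
  \<open>G \<rightarrow> V\<close> with \<open>G\<close> acting by right translation.
\<close>

definition ind_module ::
  "('g, 'b) monoid_scheme \<Rightarrow> 'g set \<Rightarrow> (complex, 'v, 'c) module_scheme \<Rightarrow> ('g \<Rightarrow> 'v \<Rightarrow> 'v)
     \<Rightarrow> (complex, 'g \<Rightarrow> 'v) module" where
  "ind_module G H V \<alpha> =
     \<lparr>carrier = {f \<in> carrier G \<rightarrow>\<^sub>E carrier V.
        \<forall>h\<in>H. \<forall>g\<in>carrier G. f (h \<otimes>\<^bsub>G\<^esub> g) = \<alpha> h (f g)},
      mult = undefined, one = undefined,
      zero = (\<lambda>g\<in>carrier G. \<zero>\<^bsub>V\<^esub>),
      add = (\<lambda>f f'. \<lambda>g\<in>carrier G. f g \<oplus>\<^bsub>V\<^esub> f' g),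
      smult = (\<lambda>c f. \<lambda>g\<in>carrier G. c \<odot>\<^bsub>V\<^esub> f g)\<rparr>"

definition ind_action ::
  "('g, 'b) monoid_scheme \<Rightarrow> 'g \<Rightarrow> ('g \<Rightarrow> 'v) \<Rightarrow> ('g \<Rightarrow> 'v)" where
  "ind_action G g f = (\<lambda>x\<in>carrier G. f (x \<otimes>\<^bsub>G\<^esub> g))"

definition quot_module ::
  "(complex, 'v, 'c) module_scheme \<Rightarrow> 'v set \<Rightarrow> (complex, 'v set) module" where
  "quot_module M N =
     \<lparr>carrier = a_rcosets\<^bsub>M\<^esub> N, mult = undefined, one = undefined,
      zero = N, add = set_add M, smult = (\<lambda>c X. \<Union>x\<in>X. N +>\<^bsub>M\<^esub> (c \<odot>\<^bsub>M\<^esub> x))\<rparr>"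


section \<open>Young subgroups\<close>

text \<open>
  For \<open>I = {i\<^sub>1 < \<dots> < i\<^sub>d}\<close> the blocks are \<open>{1..i\<^sub>1}\<close>, \<open>{i\<^sub>1+1..i\<^sub>2}\<close>, \dots, \<open>{i\<^sub>d+1..n}\<close>.
\<close>

definition young_blocks :: "nat \<Rightarrow> nat set \<Rightarrow> nat set set" where
  "young_blocks n I = {{a<..b} | a b.
     a \<in> insert 0 I \<and> b \<in> insert n I \<and> a < b \<and> I \<inter> {a<..<b} = {}}"

definition young_subgroup :: "nat \<Rightarrow> nat set \<Rightarrow> (nat \<Rightarrow> nat) set" where
  "young_subgroup n I = {\<sigma> \<in> carrier (sym_group n). \<forall>B\<in>young_blocks n I. \<sigma> ` B = B}"


section \<open>The representation ring of the symmetric group and polynomials over it\<close>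

definition RS :: "nat \<Rightarrow> ((nat \<Rightarrow> nat) mrep \<times> (nat \<Rightarrow> nat) mrep) set ring" where
  "RS n = rep_ring (sym_group n)"

abbreviation RSq where
  "RSq n \<equiv> UP (RS n)"

definition const_RSq where
  "const_RSq n a = up_ring.monom (RSq n) a 0"

definition q_minus_1 where
  "q_minus_1 n = up_ring.monom (RSq n) \<one>\<^bsub>RS n\<^esub> 1 \<ominus>\<^bsub>RSq n\<^esub> \<one>\<^bsub>RSq n\<^esub>"

definition alt_class where
  "alt_class n = rep_class (sym_group n) line_module sign_action"

definition ind_class where
  "ind_class n I = rep_class (sym_group n)
     (ind_module (sym_group n) (young_subgroup n I) line_module trivial_action)
     (ind_action (sym_group n))"


section \<open>The permutohedron\<close>

text \<open>
  The coordinates of \<open>real^'n\<close> are numbered by a bijection \<open>e\<close> from \<open>{1..n}\<close> to \<open>'n\<close>: the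
  \<open>i\<close>-th coordinate of \<open>x\<close> is its component at \<open>e i\<close>. The symmetric group acts from the left,
  moving the \<open>i\<close>-th coordinate to the \<open>\<sigma> i\<close>-th place.
\<close>

definition vec_of_coords :: "nat \<Rightarrow> (nat \<Rightarrow> 'n::finite) \<Rightarrow> (nat \<Rightarrow> real) \<Rightarrow> real ^ 'n" where
  "vec_of_coords n e c = (\<chi> k. c (inv_into {1..n} e k))"

definition permute_coords ::
  "nat \<Rightarrow> (nat \<Rightarrow> 'n::finite) \<Rightarrow> (nat \<Rightarrow> nat) \<Rightarrow> real ^ 'n \<Rightarrow> real ^ 'n" where
  "permute_coords n e \<sigma> x = vec_of_coords n e (\<lambda>i. vec_nth x (e ((inv\<^bsub>sym_group n\<^esub> \<sigma>) i)))"

definition permutohedron :: "nat \<Rightarrow> (nat \<Rightarrow> 'n::finite) \<Rightarrow> (real ^ 'n) set" where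
  "permutohedron n e =
     convex hull ((\<lambda>w. vec_of_coords n e (\<lambda>i. real (w i))) ` carrier (sym_group n))"

definition perm_faces :: "nat \<Rightarrow> (nat \<Rightarrow> 'n::finite) \<Rightarrow> nat \<Rightarrow> (real ^ 'n) set set" where
  "perm_faces n e i = {F. F face_of permutohedron n e \<and> aff_dim F = int i}"

definition face_class where
  "face_class n e i = rep_class (sym_group n) (perm_module (perm_faces n e i))
     (perm_action (sym_group n) (\<lambda>\<sigma> F. permute_coords n e \<sigma> ` F) (perm_faces n e i))"

definition F_Pi where
  "F_Pi n e = (\<Oplus>\<^bsub>RSq n\<^esub>i\<in>{0..n - 1}. up_ring.monom (RSq n) (face_class n e i) i)"

text \<open>\<open>H_Pi (q) = F_Pi (q - 1)\<close>\<close>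

definition H_Pi where
  "H_Pi n e = UnivPoly.eval (RS n) (RSq n) (const_RSq n) (q_minus_1 n) (F_Pi n e)"


section \<open>The cohomology of the twin and the dagger action\<close>

text \<open>
  Polynomials over \<open>\<complex>\<close> in variables \<open>t\<^sub>i\<close>, \<open>i \<in> \<nat>\<close>, as finitely supported functions on
  exponent vectors; \<open>polys n\<close> is the polynomial ring in \<open>t\<^sub>1, \<dots>, t\<^sub>n\<close>.
\<close>

type_synonym cpoly = "(nat \<Rightarrow>\<^sub>0 nat) \<Rightarrow>\<^sub>0 complex"

definition polys :: "nat \<Rightarrow> cpoly set" where
  "polys n = {p. \<forall>m\<in>Poly_Mapping.keys p. Poly_Mapping.keys m \<subseteq> {1..n}}"

definition tvar :: "nat \<Rightarrow> cpoly" where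
  "tvar i = Poly_Mapping.single (Poly_Mapping.single i 1) 1"

definition const_poly :: "complex \<Rightarrow> cpoly" where
  "const_poly c = Poly_Mapping.single 0 c"

definition homogeneous :: "nat \<Rightarrow> cpoly \<Rightarrow> bool" where
  "homogeneous k p \<longleftrightarrow> (\<forall>m\<in>Poly_Mapping.keys p. (\<Sum>i\<in>Poly_Mapping.keys m. Poly_Mapping.lookup m i) = k)"

text \<open>
  \<open>Y(h)\<close> is the space of \<open>gT \<in> U(n)/T\<close> such that \<open>g S g\<inverse>\<close> has zero \<open>(i, j)\<close> entry whenever
  \<open>i > h j\<close> or \<open>j > h i\<close>, where \<open>S\<close> is real diagonal with distinct entries. \<open>HT n h\<close> is its
  equivariant cohomology for the left action of the diagonal torus \<open>T\<close>, in its description by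
  restriction to the fixed points. Unlike for the Hessenberg variety \<open>X(h)\<close>, the linear form in
  the congruence is \<open>t\<^sub>i - t\<^sub>j\<close> and does not involve \<open>w\<close>. The record keeps the complex vector
  space structure only; multiplication by \<open>t\<^sub>i\<close> enters through \<open>tHT\<close>.
\<close>

definition HT :: "nat \<Rightarrow> (nat \<Rightarrow> nat) \<Rightarrow> (complex, (nat \<Rightarrow> nat) \<Rightarrow> cpoly) module" where
  "HT n h =
     \<lparr>carrier = {f \<in> carrier (sym_group n) \<rightarrow>\<^sub>E polys n.
        \<forall>w\<in>carrier (sym_group n). \<forall>i\<in>{1..n}. \<forall>j\<in>{1..n}. j < i \<and> i \<le> h j \<longrightarrow>
          (\<exists>p\<in>polys n. f (w \<circ> Transposition.transpose i j) - f w = (tvar i - tvar j) * p)},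
      mult = undefined, one = undefined,
      zero = (\<lambda>w\<in>carrier (sym_group n). 0),
      add = (\<lambda>f f'. \<lambda>w\<in>carrier (sym_group n). f w + f' w),
      smult = (\<lambda>c f. \<lambda>w\<in>carrier (sym_group n). const_poly c * f w)\<rparr>"

text \<open>The submodule of \<open>HT n h\<close> generated by the ideal \<open>(t\<^sub>1, \<dots>, t\<^sub>n)\<close>.\<close>

definition tHT :: "nat \<Rightarrow> (nat \<Rightarrow> nat) \<Rightarrow> ((nat \<Rightarrow> nat) \<Rightarrow> cpoly) set" where
  "tHT n h = {(\<lambda>w\<in>carrier (sym_group n). \<Sum>i\<in>{1..n}. tvar i * f i w) | f.
     \<forall>i\<in>{1..n}. f i \<in> carrier (HT n h)}"

definition HY :: "nat \<Rightarrow> (nat \<Rightarrow> nat) \<Rightarrow> (complex, ((nat \<Rightarrow> nat) \<Rightarrow> cpoly) set) module" where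
  "HY n h = quot_module (HT n h) (tHT n h)"

text \<open>Since \<open>t\<^sub>i\<close> has degree 2, the part of degree \<open>2k\<close> comes from polynomials of degree \<open>k\<close>.\<close>

definition HY_graded ::
  "nat \<Rightarrow> (nat \<Rightarrow> nat) \<Rightarrow> nat \<Rightarrow> (complex, ((nat \<Rightarrow> nat) \<Rightarrow> cpoly) set) module" where
  "HY_graded n h k = (HY n h)\<lparr>carrier := {X \<in> carrier (HY n h).
     \<exists>f\<in>X. \<forall>w\<in>carrier (sym_group n). homogeneous k (f w)}\<rparr>"

definition dagger ::
  "nat \<Rightarrow> (nat \<Rightarrow> nat) \<Rightarrow> ((nat \<Rightarrow> nat) \<Rightarrow> cpoly) \<Rightarrow> ((nat \<Rightarrow> nat) \<Rightarrow> cpoly)" where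
  "dagger n \<sigma> f = (\<lambda>w\<in>carrier (sym_group n). f (inv\<^bsub>sym_group n\<^esub> \<sigma> \<otimes>\<^bsub>sym_group n\<^esub> w))"

definition dagger_HY ::
  "nat \<Rightarrow> (nat \<Rightarrow> nat) \<Rightarrow> ((nat \<Rightarrow> nat) \<Rightarrow> cpoly) set \<Rightarrow> ((nat \<Rightarrow> nat) \<Rightarrow> cpoly) set" where
  "dagger_HY n \<sigma> X = dagger n \<sigma> ` X"

text \<open>Elements of the carrier of a ring \<open>UP R\<close> are coefficient functions \<open>nat \<Rightarrow> 'a\<close>.\<close>

definition R_HY where
  "R_HY n h = (\<lambda>k. rep_class (sym_group n) (HY_graded n h k) (dagger_HY n))"

end

theory Submission
  imports Defs "HOL-Library.Function_Algebras"
begin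

text \<open>
  Both sides are expanded in the same family of classes in the representation ring. The space of
  functions on \<open>w\<close> that are invariant under right translation by a Young subgroup
  \<open>\<S>\<^sub>I\<close> affords the permutation module on its cosets; by Solomon's decomposition it is the direct
  sum over \<open>J \<subseteq> I\<close> of submodules with classes \<open>E J\<close>, obtained by symmetrizing over \<open>\<S>\<^sub>J\<close>
  the functions antisymmetrized over the Young subgroup of the complement of \<open>J\<close>.

  The faces of the permutohedron of dimension \<open>n - 1 - |I|\<close> correspond to the cosets of \<open>\<S>\<^sub>I\<close>:
  Abel summation shows where a linear functional attains its maximum on the vertices. Summing
  \<open>(q - 1)^(n - 1 - |I|)\<close> over \<open>I \<supseteq> J\<close> gives \<open>q^(n - 1 - |J|)\<close>, so that \<open>H_Pi\<close> is the sum of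
  \<open>E J q^(n - 1 - |J|)\<close>.

  On the other side, put \<open>x\<^sub>i = t\<^sub>i - t\<^bsub>i+1\<^esub>\<close> and \<open>x\<^sub>n = t\<^sub>n\<close>. The congruences say that the coefficient
  of a monomial, as a function of \<open>w\<close>, is invariant under the transpositions of \<open>i\<close> and \<open>i + 1\<close> for
  all \<open>x\<^sub>i\<close> that do not occur in it. Hence, modulo the ideal generated by the variables, only the
  squarefree monomials in \<open>x\<^sub>1, \<dots>, x\<^bsub>n-1\<^esub>\<close> survive, and the one with support \<open>I\<close> contributes the
  invariants of \<open>\<S>\<^sub>I\<close> modulo those of \<open>\<S>\<^sub>J\<close>, \<open>J \<subset> I\<close>. Twisting by the sign character turns this quotient
  into the submodule belonging to the complement of \<open>I\<close>.
\<close>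

section \<open>Operations on matrix representations up to isomorphism\<close>

text \<open>The modules to be compared live on unrelated types: cosets of tuples of polynomials,
  functions on faces, equivariant functions. Each is carried over to a subspace of the complex
  functions on the symmetric group under left translation. All operators used there multiply from
  the right, so equivariance is automatic. The splitting rests on positivity. The symmetrizer of J
  and the antisymmetrizer of the complementary Young subgroup are self-adjoint for the standard
  Hermitian form and are positive multiples of projections; definiteness of the form makes their
  composites injective on the relevant images, and finite dimension makes them surjective. The sign
  twist and the exponents have one source. The contribution of I to the cohomology is the image of
  \<open>FI n I\<close> under \<open>An n I\<close>, hence antisymmetrization after symmetrization.
  Multiplication by the sign exchanges the two characters but keeps the groups, so the result is
  symmetrization after antisymmetrization for the complement J of I, which is \<open>EJ n J\<close>.
  The degree |I| equals n - 1 - |J|, the exponent found on the polytope side.\<close>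

abbreviation dsum_mat :: "nat \<Rightarrow> nat \<Rightarrow> complex mat \<Rightarrow> complex mat \<Rightarrow> complex mat" where
  "dsum_mat a b P Q \<equiv> four_block_mat P (0\<^sub>m a b) (0\<^sub>m b a) Q"

definition kron :: "nat \<Rightarrow> nat \<Rightarrow> complex mat \<Rightarrow> complex mat \<Rightarrow> complex mat" where
  "kron p q P Q = Matrix.mat (p * q) (p * q)
     (\<lambda>(i, j). P $$ (i div q, j div q) * Q $$ (i mod q, j mod q))"

lemma kron_carrier [simp]: "kron p q P Q \<in> carrier_mat (p * q) (p * q)"
  by (simp add: kron_def)

lemma mrep_sum_simps:
  "fst (mrep_sum A B) = fst A + fst B"
  "snd (mrep_sum A B) g = dsum_mat (fst A) (fst B) (snd A g) (snd B g)"
  by (simp_all add: mrep_sum_def)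

lemma mrep_tensor_simps:
  "fst (mrep_tensor A B) = fst A * fst B"
  "snd (mrep_tensor A B) g = kron (fst A) (fst B) (snd A g) (snd B g)"
  by (simp_all add: mrep_tensor_def kron_def)

text \<open>This is the bijection between an index k of a Kronecker product and the pair
  \<open>(k div q, k mod q)\<close> of indices of the factors. It splits the inner sum of a matrix
  product into a double sum.\<close>

lemma sum_div_mod:
  fixes f :: "nat \<Rightarrow> nat \<Rightarrow> complex"
  shows "(\<Sum>k\<in>{0..<p * q}. f (k div q) (k mod q)) = (\<Sum>a\<in>{0..<p}. \<Sum>b\<in>{0..<q}. f a b)"
proof -
  have "(\<Sum>a\<in>{0..<p}. \<Sum>b\<in>{0..<q}. f a b) = (\<Sum>(a, b)\<in>{0..<p} \<times> {0..<q}. f a b)"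
    by (simp add: sum.cartesian_product)
  also have "\<dots> = (\<Sum>k\<in>{0..<p * q}. f (k div q) (k mod q))"
  proof (rule sum.reindex_bij_witness[where j = "\<lambda>(a, b). a * q + b" and i = "\<lambda>k. (k div q, k mod q)"])
    fix k assume "k \<in> {0..<p * q}"
    then have "k < p * q" "q > 0" by (auto intro: gr0I)
    then show "(k div q, k mod q) \<in> {0..<p} \<times> {0..<q}"
      by (auto simp: less_mult_imp_div_less)
  next
    fix x assume "x \<in> {0..<p} \<times> {0..<q}"
    then obtain a b where x: "x = (a, b)" "a < p" "b < q" by auto
    have "a * q + b < (a + 1) * q" using x by simp
    also have "\<dots> \<le> p * q" using x by (intro mult_right_mono) auto
    finally show "(case x of (a, b) \<Rightarrow> a * q + b) \<in> {0..<p * q}" using x by simp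
  qed auto
  finally show ?thesis by simp
qed

lemma kron_mult:
  assumes "P \<in> carrier_mat p p" "P' \<in> carrier_mat p p" "Q \<in> carrier_mat q q" "Q' \<in> carrier_mat q q"
  shows "kron p q P Q * kron p q P' Q' = kron p q (P * P') (Q * Q')"
proof (rule eq_matI)
  fix i j assume "i < dim_row (kron p q (P * P') (Q * Q'))" "j < dim_col (kron p q (P * P') (Q * Q'))"
  then have ij: "i < p * q" "j < p * q" by (simp_all add: kron_def)
  then have q: "q > 0" by (auto intro: gr0I)
  have d: "i div q < p" "j div q < p" "i mod q < q" "j mod q < q"
    using ij q by (auto simp: less_mult_imp_div_less)
  have "(kron p q P Q * kron p q P' Q') $$ (i, j) =
    (\<Sum>k\<in>{0..<p * q}. P $$ (i div q, k div q) * P' $$ (k div q, j div q) *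
      (Q $$ (i mod q, k mod q) * Q' $$ (k mod q, j mod q)))"
    using ij by (simp add: kron_def scalar_prod_def mult_ac)
  also have "\<dots> = (\<Sum>a\<in>{0..<p}. \<Sum>b\<in>{0..<q}. P $$ (i div q, a) * P' $$ (a, j div q) *
      (Q $$ (i mod q, b) * Q' $$ (b, j mod q)))"
    by (rule sum_div_mod)
  also have "\<dots> = (P * P') $$ (i div q, j div q) * (Q * Q') $$ (i mod q, j mod q)"
    using assms d by (simp add: scalar_prod_def sum_product)
  also have "\<dots> = kron p q (P * P') (Q * Q') $$ (i, j)"
    using ij by (simp add: kron_def)
  finally show "(kron p q P Q * kron p q P' Q') $$ (i, j) = kron p q (P * P') (Q * Q') $$ (i, j)" .
qed (simp_all add: kron_def)

lemma kron_one: "kron p q (1\<^sub>m p) (1\<^sub>m q) = 1\<^sub>m (p * q)"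
proof (rule eq_matI)
  fix i j assume "i < dim_row (1\<^sub>m (p * q) :: complex mat)" "j < dim_col (1\<^sub>m (p * q) :: complex mat)"
  then have ij: "i < p * q" "j < p * q" by simp_all
  then have q: "q > 0" by (auto intro: gr0I)
  have d: "i div q < p" "j div q < p" "i mod q < q" "j mod q < q"
    using ij q by (auto simp: less_mult_imp_div_less)
  have "i = j \<longleftrightarrow> i div q = j div q \<and> i mod q = j mod q"
    by (metis div_mult_mod_eq)
  then show "kron p q (1\<^sub>m p) (1\<^sub>m q) $$ (i, j) = 1\<^sub>m (p * q) $$ (i, j)"
    using ij d by (simp add: kron_def)
qed (simp_all add: kron_def)

lemma dsum_mult:
  assumes "P \<in> carrier_mat p p" "P' \<in> carrier_mat p p" "Q \<in> carrier_mat q q" "Q' \<in> carrier_mat q q"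
  shows "dsum_mat p q P Q * dsum_mat p q P' Q' = dsum_mat p q (P * P') (Q * Q')"
proof -
  have "dsum_mat p q P Q * dsum_mat p q P' Q' =
    four_block_mat (P * P' + 0\<^sub>m p q * 0\<^sub>m q p) (P * 0\<^sub>m p q + 0\<^sub>m p q * Q')
      (0\<^sub>m q p * P' + Q * 0\<^sub>m q p) (0\<^sub>m q p * 0\<^sub>m p q + Q * Q')"
    by (rule mult_four_block_mat) (use assms in auto)
  also have "\<dots> = dsum_mat p q (P * P') (Q * Q')"
    using assms by (intro cong_four_block_mat) auto
  finally show ?thesis .
qed

lemma mrepsD:
  assumes "A \<in> mreps G"
  shows "\<And>g. g \<in> carrier G \<Longrightarrow> snd A g \<in> carrier_mat (fst A) (fst A)"
    and "snd A \<one>\<^bsub>G\<^esub> = 1\<^sub>m (fst A)"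
    and "\<And>g g'. g \<in> carrier G \<Longrightarrow> g' \<in> carrier G \<Longrightarrow> snd A (g \<otimes>\<^bsub>G\<^esub> g') = snd A g * snd A g'"
  using assms by (auto simp: mreps_def)

lemma mreps_dim:
  assumes "A \<in> mreps G" "g \<in> carrier G"
  shows "dim_row (snd A g) = fst A" "dim_col (snd A g) = fst A"
  using mrepsD(1)[OF assms] by auto

lemma mrepsI:
  assumes "\<And>g. g \<in> carrier G \<Longrightarrow> snd A g \<in> carrier_mat (fst A) (fst A)"
    and "snd A \<one>\<^bsub>G\<^esub> = 1\<^sub>m (fst A)"
    and "\<And>g g'. g \<in> carrier G \<Longrightarrow> g' \<in> carrier G \<Longrightarrow> snd A (g \<otimes>\<^bsub>G\<^esub> g') = snd A g * snd A g'"
  shows "A \<in> mreps G"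
  using assms by (cases A) (auto simp: mreps_def)

lemma mrep_zero_in [simp]: "mrep_zero \<in> mreps G"
  by (rule mrepsI) (auto simp: mrep_zero_def)

lemma mrep_one_in [simp]: "mrep_one \<in> mreps G"
  by (rule mrepsI) (auto simp: mrep_one_def)

lemma mrep_sum_in [simp]: "A \<in> mreps G \<Longrightarrow> B \<in> mreps G \<Longrightarrow> mrep_sum A B \<in> mreps G"
  using mrepsD[of A G] mrepsD[of B G]
  by (intro mrepsI) (auto simp: mrep_sum_simps dsum_mult)

lemma mrep_tensor_in [simp]: "A \<in> mreps G \<Longrightarrow> B \<in> mreps G \<Longrightarrow> mrep_tensor A B \<in> mreps G"
  using mrepsD[of A G] mrepsD[of B G]
  by (intro mrepsI) (auto simp: mrep_tensor_simps kron_mult kron_one)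

section \<open>Isomorphism as an equivalence relation compatible with sum and tensor product\<close>

lemma mrep_isoI:
  assumes "fst A = d" "fst B = d" "P \<in> carrier_mat d d" "Q \<in> carrier_mat d d"
    "P * Q = 1\<^sub>m d" "Q * P = 1\<^sub>m d" "\<And>g. g \<in> carrier G \<Longrightarrow> P * snd A g = snd B g * P"
  shows "mrep_iso G A B"
  using assms unfolding mrep_iso_def invertible_mat_def inverts_mat_def
  by (auto intro!: bexI[of _ P] exI[of _ Q])

lemma mrep_isoE:
  assumes "mrep_iso G A B"
  obtains P Q where "fst A = fst B" "P \<in> carrier_mat (fst A) (fst A)" "Q \<in> carrier_mat (fst A) (fst A)"
    "P * Q = 1\<^sub>m (fst A)" "Q * P = 1\<^sub>m (fst A)" "\<And>g. g \<in> carrier G \<Longrightarrow> P * snd A g = snd B g * P"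
proof -
  obtain P where P: "fst A = fst B" "P \<in> carrier_mat (fst A) (fst A)" "invertible_mat P"
    "\<forall>g\<in>carrier G. P * snd A g = snd B g * P"
    using assms unfolding mrep_iso_def by auto
  from P(3) obtain Q where Q: "inverts_mat P Q" "inverts_mat Q P" unfolding invertible_mat_def by auto
  have PQ: "P * Q = 1\<^sub>m (fst A)" using Q(1) P(2) unfolding inverts_mat_def by auto
  then have c: "dim_col Q = fst A" by (metis index_mult_mat(3) index_one_mat(3))
  have QP: "Q * P = 1\<^sub>m (dim_row Q)" using Q(2) unfolding inverts_mat_def by auto
  then have "dim_row Q = fst A" using P(2) by (metis carrier_matD(2) index_mult_mat(3) index_one_mat(3))
  with c PQ QP that P show ?thesis by (metis carrier_matI)
qed

lemma mrep_iso_sym: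
  assumes "A \<in> mreps G" "B \<in> mreps G" "mrep_iso G A B"
  shows "mrep_iso G B A"
  using assms(3)
proof (rule mrep_isoE)
  fix P Q assume h: "fst A = fst B" "P \<in> carrier_mat (fst A) (fst A)" "Q \<in> carrier_mat (fst A) (fst A)"
    "P * Q = 1\<^sub>m (fst A)" "Q * P = 1\<^sub>m (fst A)" "\<And>g. g \<in> carrier G \<Longrightarrow> P * snd A g = snd B g * P"
  show ?thesis
  proof (rule mrep_isoI[where P = Q and Q = P])
    fix g assume g: "g \<in> carrier G"
    note c = mrepsD(1)[OF assms(1) g] mrepsD(1)[OF assms(2) g]
    note c' = h(2,3) c(1) c(2)[folded h(1)]
    have "Q * snd B g = Q * snd B g * (P * Q)" using h c by simp
    also have "\<dots> = Q * (snd B g * P) * Q"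
      using c' by (simp add: assoc_mult_mat[of _ "fst A" "fst A" _ "fst A" _ "fst A"])
    also have "\<dots> = Q * (P * snd A g) * Q" using h g by simp
    also have "\<dots> = (Q * P) * snd A g * Q" using c' by (simp add: assoc_mult_mat[of _ "fst A" "fst A" _ "fst A" _ "fst A"])
    also have "\<dots> = snd A g * Q" using h c by simp
    finally show "Q * snd B g = snd A g * Q" .
  qed (use h in auto)
qed

lemma mrep_iso_trans:
  assumes "A \<in> mreps G" "B \<in> mreps G" "C \<in> mreps G" "mrep_iso G A B" "mrep_iso G B C"
  shows "mrep_iso G A C"
  using assms(4)
proof (rule mrep_isoE)
  fix P Q assume h: "fst A = fst B" "P \<in> carrier_mat (fst A) (fst A)" "Q \<in> carrier_mat (fst A) (fst A)"
    "P * Q = 1\<^sub>m (fst A)" "Q * P = 1\<^sub>m (fst A)" "\<And>g. g \<in> carrier G \<Longrightarrow> P * snd A g = snd B g * P"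
  show ?thesis using assms(5)
  proof (rule mrep_isoE)
    fix P' Q' assume h': "fst B = fst C" "P' \<in> carrier_mat (fst B) (fst B)" "Q' \<in> carrier_mat (fst B) (fst B)"
      "P' * Q' = 1\<^sub>m (fst B)" "Q' * P' = 1\<^sub>m (fst B)" "\<And>g. g \<in> carrier G \<Longrightarrow> P' * snd B g = snd C g * P'"
    let ?d = "fst A"
    note as = assoc_mult_mat[of _ ?d ?d _ ?d _ ?d]
    note c = h(2,3) h'(2,3)[folded h(1)]
    show ?thesis
    proof (rule mrep_isoI[where P = "P' * P" and Q = "Q * Q'"])
      have "P' * P * (Q * Q') = P' * (P * Q) * Q'" using c by (simp add: as)
      then show "P' * P * (Q * Q') = 1\<^sub>m ?d" using h h' c by simp
      have "Q * Q' * (P' * P) = Q * (Q' * P') * P" using c by (simp add: as)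
      then show "Q * Q' * (P' * P) = 1\<^sub>m ?d" using h h' c by simp
      fix g assume g: "g \<in> carrier G"
      note cg = mrepsD(1)[OF assms(1) g] mrepsD(1)[OF assms(2) g, folded h(1)]
        mrepsD(1)[OF assms(3) g, folded h'(1) h(1)]
      have "P' * P * snd A g = P' * (snd B g * P)" using c cg g h by (simp add: as)
      also have "\<dots> = (P' * snd B g) * P" using c cg by (simp add: as)
      also have "\<dots> = snd C g * (P' * P)" using c cg g h' by (simp add: as)
      finally show "P' * P * snd A g = snd C g * (P' * P)" .
    qed (use h h' in auto)
  qed
qed

text \<open>Commutativity, associativity, units and distributivity only relabel the standard basis,
  so each reduces to a bijection of indices and a comparison of entries. The intertwiner is the
  permutation matrix of \<pi>.\<close>

lemma mrep_iso_perm: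
  assumes A: "A \<in> mreps G" and B: "B \<in> mreps G" and d: "fst A = d" "fst B = d"
    and \<pi>: "bij_betw \<pi> {0..<d} {0..<d}"
    and e: "\<And>g i j. g \<in> carrier G \<Longrightarrow> i < d \<Longrightarrow> j < d \<Longrightarrow> snd B g $$ (\<pi> i, \<pi> j) = snd A g $$ (i, j)"
  shows "mrep_iso G A B"
proof -
  define \<rho> where "\<rho> = inv_into {0..<d} \<pi>"
  have \<rho>: "\<And>i. i < d \<Longrightarrow> \<rho> i < d \<and> \<pi> (\<rho> i) = i" and \<pi>': "\<And>i. i < d \<Longrightarrow> \<pi> i < d \<and> \<rho> (\<pi> i) = i"
    using \<pi> bij_betw_inv_into_left[OF \<pi>] bij_betw_inv_into_right[OF \<pi>] bij_betw_apply[OF \<pi>]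
      bij_betw_apply[OF bij_betw_inv_into[OF \<pi>]]
    unfolding \<rho>_def by auto
  define P :: "complex mat" where "P = Matrix.mat d d (\<lambda>(i, j). if \<rho> i = j then 1 else 0)"
  define Q :: "complex mat" where "Q = Matrix.mat d d (\<lambda>(i, j). if \<pi> i = j then 1 else 0)"
  show ?thesis
  proof (rule mrep_isoI[where P = P and Q = Q and d = d])
    have delta: "(\<Sum>k\<in>{0..<d}. (if c = k then 1 else 0) * f k) = f c" if "c < d" for c :: nat and f :: "nat \<Rightarrow> complex"
    proof -
      have "(\<Sum>k\<in>{0..<d}. (if c = k then 1 else 0) * f k) = (\<Sum>k\<in>{0..<d}. if c = k then f k else 0)"
        by (rule sum.cong) auto
      then show ?thesis using that by simp
    qed
    show "P * Q = 1\<^sub>m d"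
      using \<rho> \<pi>' by (intro eq_matI) (auto simp: P_def Q_def scalar_prod_def delta)
    show "Q * P = 1\<^sub>m d"
      using \<rho> \<pi>' by (intro eq_matI) (auto simp: P_def Q_def scalar_prod_def delta)
    fix g assume g: "g \<in> carrier G"
    note c = mrepsD(1)[OF A g] mrepsD(1)[OF B g]
    show "P * snd A g = snd B g * P"
    proof (rule eq_matI)
      fix i j assume "i < dim_row (snd B g * P)" "j < dim_col (snd B g * P)"
      then have ij: "i < d" "j < d" using c d by (auto simp: P_def)
      have "(P * snd A g) $$ (i, j) = (\<Sum>k\<in>{0..<d}. (if \<rho> i = k then 1 else 0) * snd A g $$ (k, j))"
        using ij c d by (simp add: P_def scalar_prod_def)
      also have "\<dots> = snd A g $$ (\<rho> i, j)" using \<rho> ij by (simp add: delta)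
      also have "\<dots> = snd B g $$ (i, \<pi> j)" using e[OF g, of "\<rho> i" j] \<rho> ij by simp
      also have "\<dots> = (\<Sum>k\<in>{0..<d}. (if \<pi> j = k then 1 else 0) * snd B g $$ (i, k))"
        using \<pi>' ij by (simp add: delta)
      also have "\<dots> = (\<Sum>k\<in>{0..<d}. snd B g $$ (i, k) * (if \<rho> k = j then 1 else 0))"
        using \<pi>' \<rho> ij by (intro sum.cong) auto
      also have "\<dots> = (snd B g * P) $$ (i, j)"
        using ij c d by (simp add: P_def scalar_prod_def)
      finally show "(P * snd A g) $$ (i, j) = (snd B g * P) $$ (i, j)" .
    qed (use c d in \<open>auto simp: P_def\<close>)
  qed (auto simp: P_def Q_def d)
qed

text \<open>Representations that agree on the carrier of the group may still differ as pairs,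
  because their values elsewhere are arbitrary; isomorphism ignores those values.\<close>

lemma mrep_iso_eq:
  assumes "A \<in> mreps G" "B \<in> mreps G" "fst A = fst B"
    and "\<And>g i j. g \<in> carrier G \<Longrightarrow> i < fst B \<Longrightarrow> j < fst B \<Longrightarrow> snd B g $$ (i, j) = snd A g $$ (i, j)"
  shows "mrep_iso G A B"
  using assms by (intro mrep_iso_perm[where \<pi> = id]) auto

lemma mrep_iso_refl: "A \<in> mreps G \<Longrightarrow> mrep_iso G A A"
  by (rule mrep_iso_eq) auto

lemma mrep_iso_sum:
  assumes "A \<in> mreps G" "B \<in> mreps G" "A' \<in> mreps G" "B' \<in> mreps G"
    and "mrep_iso G A A'" "mrep_iso G B B'"
  shows "mrep_iso G (mrep_sum A B) (mrep_sum A' B')"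
  using assms(5)
proof (rule mrep_isoE)
  fix P Q assume h: "fst A = fst A'" "P \<in> carrier_mat (fst A) (fst A)" "Q \<in> carrier_mat (fst A) (fst A)"
    "P * Q = 1\<^sub>m (fst A)" "Q * P = 1\<^sub>m (fst A)" "\<And>g. g \<in> carrier G \<Longrightarrow> P * snd A g = snd A' g * P"
  show ?thesis using assms(6)
  proof (rule mrep_isoE)
    fix P' Q' assume h': "fst B = fst B'" "P' \<in> carrier_mat (fst B) (fst B)" "Q' \<in> carrier_mat (fst B) (fst B)"
      "P' * Q' = 1\<^sub>m (fst B)" "Q' * P' = 1\<^sub>m (fst B)" "\<And>g. g \<in> carrier G \<Longrightarrow> P' * snd B g = snd B' g * P'"
    show ?thesis
      by (rule mrep_isoI[where P = "dsum_mat (fst A) (fst B) P P'" and Q = "dsum_mat (fst A) (fst B) Q Q'"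
            and d = "fst A + fst B"])
        (use h h' mrepsD(1)[OF assms(1)] mrepsD(1)[OF assms(2)] mrepsD(1)[OF assms(3)] mrepsD(1)[OF assms(4)]
          in \<open>auto simp: mrep_sum_simps dsum_mult\<close>)
  qed
qed

lemma mrep_iso_tensor:
  assumes "A \<in> mreps G" "B \<in> mreps G" "A' \<in> mreps G" "B' \<in> mreps G"
    and "mrep_iso G A A'" "mrep_iso G B B'"
  shows "mrep_iso G (mrep_tensor A B) (mrep_tensor A' B')"
  using assms(5)
proof (rule mrep_isoE)
  fix P Q assume h: "fst A = fst A'" "P \<in> carrier_mat (fst A) (fst A)" "Q \<in> carrier_mat (fst A) (fst A)"
    "P * Q = 1\<^sub>m (fst A)" "Q * P = 1\<^sub>m (fst A)" "\<And>g. g \<in> carrier G \<Longrightarrow> P * snd A g = snd A' g * P"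
  show ?thesis using assms(6)
  proof (rule mrep_isoE)
    fix P' Q' assume h': "fst B = fst B'" "P' \<in> carrier_mat (fst B) (fst B)" "Q' \<in> carrier_mat (fst B) (fst B)"
      "P' * Q' = 1\<^sub>m (fst B)" "Q' * P' = 1\<^sub>m (fst B)" "\<And>g. g \<in> carrier G \<Longrightarrow> P' * snd B g = snd B' g * P'"
    show ?thesis
      by (rule mrep_isoI[where P = "kron (fst A) (fst B) P P'" and Q = "kron (fst A) (fst B) Q Q'"
            and d = "fst A * fst B"])
        (use h h' mrepsD(1)[OF assms(1)] mrepsD(1)[OF assms(2)] mrepsD(1)[OF assms(3)] mrepsD(1)[OF assms(4)]
          in \<open>auto simp: mrep_tensor_simps kron_mult kron_one\<close>)
  qed
qed

section \<open>Semiring laws up to isomorphism\<close>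

lemma mrep_iso_sum_comm:
  assumes "A \<in> mreps G" "B \<in> mreps G"
  shows "mrep_iso G (mrep_sum A B) (mrep_sum B A)"
proof (rule mrep_iso_perm[where \<pi> = "\<lambda>i. if i < fst A then i + fst B else i - fst A"])
  show "bij_betw (\<lambda>i. if i < fst A then i + fst B else i - fst A) {0..<fst A + fst B} {0..<fst A + fst B}"
    by (rule bij_betw_byWitness[where f' = "\<lambda>i. if i < fst B then i + fst A else i - fst B"]) auto
qed (use assms mreps_dim[OF assms(1)] mreps_dim[OF assms(2)] in \<open>auto simp: mrep_sum_simps\<close>)

lemma mrep_iso_sum_assoc:
  assumes "A \<in> mreps G" "B \<in> mreps G" "C \<in> mreps G"
  shows "mrep_iso G (mrep_sum (mrep_sum A B) C) (mrep_sum A (mrep_sum B C))"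
proof (rule mrep_iso_eq)
  fix g i j
  assume "g \<in> carrier G" and ij: "i < fst (mrep_sum A (mrep_sum B C))" "j < fst (mrep_sum A (mrep_sum B C))"
  note d = mreps_dim[OF assms(1) this(1)] mreps_dim[OF assms(2) this(1)] mreps_dim[OF assms(3) this(1)]
  show "snd (mrep_sum A (mrep_sum B C)) g $$ (i, j) = snd (mrep_sum (mrep_sum A B) C) g $$ (i, j)"
    using ij by (auto simp: mrep_sum_simps d)
qed (simp_all add: assms mrep_sum_simps)

lemma mrep_iso_zero_sum:
  assumes "A \<in> mreps G"
  shows "mrep_iso G (mrep_sum mrep_zero A) A"
proof (rule mrep_iso_eq)
  fix g i j
  assume "g \<in> carrier G" and ij: "i < fst A" "j < fst A"
  note d = mreps_dim[OF assms(1) this(1)]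
  show "snd A g $$ (i, j) = snd (mrep_sum mrep_zero A) g $$ (i, j)"
    using ij by (simp add: mrep_sum_simps mrep_zero_def d)
qed (use assms in simp_all, simp add: mrep_sum_simps mrep_zero_def)

lemma mrep_iso_one_tensor:
  assumes "A \<in> mreps G"
  shows "mrep_iso G (mrep_tensor mrep_one A) A"
proof (rule mrep_iso_eq)
  fix g i j
  assume "g \<in> carrier G" and ij: "i < fst A" "j < fst A"
  note d = mreps_dim[OF assms(1) this(1)]
  show "snd A g $$ (i, j) = snd (mrep_tensor mrep_one A) g $$ (i, j)"
    using ij by (simp add: mrep_tensor_simps mrep_one_def kron_def d)
qed (use assms in simp_all, simp add: mrep_tensor_simps mrep_one_def)

lemma mrep_iso_tensor_comm:
  assumes "A \<in> mreps G" "B \<in> mreps G"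
  shows "mrep_iso G (mrep_tensor A B) (mrep_tensor B A)"
\<comment> \<open>An index i stands for the pair \<open>(i div fst B, i mod fst B)\<close>; the map
  swaps the two components and encodes the new pair with radix \<open>fst A\<close>.\<close>
proof (rule mrep_iso_perm[where \<pi> = "\<lambda>i. (i mod fst B) * fst A + i div fst B"])
  have *: "(i mod b) * a + i div b < a * b" "((i mod b) * a + i div b) div a = i mod b"
    "((i mod b) * a + i div b) mod a = i div b" if "i < a * b" for i a b :: nat
  proof -
    have ab: "a > 0" "b > 0" "i div b < a"
      using that by (auto intro!: gr0I simp: less_mult_imp_div_less)
    then have "i mod b < b" by simp
    have "(i mod b) * a + i div b < (i mod b + 1) * a" using ab by simp
    also have "\<dots> \<le> b * a" using \<open>i mod b < b\<close> by (intro mult_right_mono) auto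
    finally show "(i mod b) * a + i div b < a * b" by (simp add: mult.commute)
    show "((i mod b) * a + i div b) div a = i mod b" "((i mod b) * a + i div b) mod a = i div b"
      using ab by simp_all
  qed
  show "bij_betw (\<lambda>i. (i mod fst B) * fst A + i div fst B) {0..<fst A * fst B} {0..<fst A * fst B}"
    by (rule bij_betw_byWitness[where f' = "\<lambda>i. (i mod fst A) * fst B + i div fst A"])
      (use *[of _ "fst A" "fst B"] *[of _ "fst B" "fst A"] in \<open>auto simp: mult.commute[of "fst A" "fst B"]\<close>)
  show "snd (mrep_tensor B A) g $$ ((i mod fst B) * fst A + i div fst B, (j mod fst B) * fst A + j div fst B) =
    snd (mrep_tensor A B) g $$ (i, j)" if "i < fst A * fst B" "j < fst A * fst B" for g i j
    using *[OF that(1)] *[OF that(2)] that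
    by (simp add: mrep_tensor_simps kron_def mult.commute[of "snd A g $$ _"] mult.commute[of "fst B" "fst A"])
qed (use assms in \<open>auto simp: mrep_tensor_simps\<close>)

lemma mrep_iso_tensor_assoc:
  assumes "A \<in> mreps G" "B \<in> mreps G" "C \<in> mreps G"
  shows "mrep_iso G (mrep_tensor (mrep_tensor A B) C) (mrep_tensor A (mrep_tensor B C))"
proof (rule mrep_iso_eq)
  fix g i j
  assume ij: "i < fst (mrep_tensor A (mrep_tensor B C))" "j < fst (mrep_tensor A (mrep_tensor B C))"
  define a b c where "a = fst A" and "b = fst B" and "c = fst C"
  have *: "i div c < a * b" "i mod (b * c) < b * c" "i div (b * c) = i div c div b" "i mod (b * c) div c = i div c mod b"
    "i mod (b * c) mod c = i mod c" if "i < a * (b * c)" for i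
  proof -
    have p: "b > 0" "c > 0" using that by (auto intro!: gr0I)
    show "i div c < a * b" using that p by (simp add: less_mult_imp_div_less mult.assoc)
    show "i mod (b * c) < b * c" using p by simp
    show "i div (b * c) = i div c div b" by (metis div_mult2_eq mult.commute)
    show "i mod (b * c) div c = i div c mod b" using p by (simp add: mod_mult2_eq mult.commute[of b c])
    show "i mod (b * c) mod c = i mod c" by (simp add: mod_mod_cancel)
  qed
  have "i < a * (b * c)" "j < a * (b * c)" using ij by (simp_all add: mrep_tensor_simps a_def b_def c_def)
  with *[of i] *[of j] show "snd (mrep_tensor A (mrep_tensor B C)) g $$ (i, j) = snd (mrep_tensor (mrep_tensor A B) C) g $$ (i, j)"
    by (simp add: mrep_tensor_simps kron_def mult.assoc flip: a_def b_def c_def)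
qed (use assms in \<open>auto simp: mrep_tensor_simps\<close>)

text \<open>The index of the left factor is the more significant digit, so the rows of the tensor
  product already stand in the order of the two blocks and the matrices coincide entrywise.
  Distributivity in the other argument would permute rows; it is obtained later from
  commutativity.\<close>

lemma mrep_iso_distrib:
  assumes "A \<in> mreps G" "B \<in> mreps G" "C \<in> mreps G"
  shows "mrep_iso G (mrep_tensor (mrep_sum A B) C) (mrep_sum (mrep_tensor A C) (mrep_tensor B C))"
proof (rule mrep_iso_eq)
  fix g i j
  assume g: "g \<in> carrier G"
    and ij: "i < fst (mrep_sum (mrep_tensor A C) (mrep_tensor B C))"
      "j < fst (mrep_sum (mrep_tensor A C) (mrep_tensor B C))"
  define a b c where "a = fst A" and "b = fst B" and "c = fst C"
  have *: "i div c < a + b" "(i div c < a) = (i < a * c)"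
    "i \<ge> a * c \<Longrightarrow> (i - a * c) div c = i div c - a" "i \<ge> a * c \<Longrightarrow> (i - a * c) mod c = i mod c"
    if "i < a * c + b * c" for i
  proof -
    have p: "c > 0" using that by (auto intro!: gr0I)
    have "i < (a + b) * c" using that by (simp add: algebra_simps)
    then show "i div c < a + b" by (rule less_mult_imp_div_less)
    show "(i div c < a) = (i < a * c)" using p by (simp add: div_less_iff_less_mult)
    assume "i \<ge> a * c"
    then obtain k where k: "i = a * c + k" using le_Suc_ex by blast
    show "(i - a * c) div c = i div c - a" "(i - a * c) mod c = i mod c" using k p by simp_all
  qed
  note cc = mreps_dim[OF assms(1) g, folded a_def] mreps_dim[OF assms(2) g, folded b_def]
    mreps_dim[OF assms(3) g, folded c_def]
  have "i < a * c + b * c" "j < a * c + b * c" using ij by (simp_all add: mrep_sum_simps mrep_tensor_simps a_def b_def c_def)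
  with *[of i] *[of j] cc show "snd (mrep_sum (mrep_tensor A C) (mrep_tensor B C)) g $$ (i, j) =
    snd (mrep_tensor (mrep_sum A B) C) g $$ (i, j)"
    by (auto simp: mrep_sum_simps mrep_tensor_simps kron_def algebra_simps simp flip: a_def b_def c_def)
qed (simp_all add: assms mrep_tensor_simps mrep_sum_simps add_mult_distrib)

section \<open>The commutative semiring of isomorphism classes\<close>

definition mclass :: "('g, 'b) monoid_scheme \<Rightarrow> 'g mrep \<Rightarrow> 'g mrep set" where
  "mclass G A = {B \<in> mreps G. mrep_iso G A B}"

text \<open>The default \<open>mrep_zero\<close> makes this a representation for every argument.
  Hence \<open>cadd\<close> and \<open>cmul\<close> are total, and their associativity,
  commutativity and distributivity hold without side conditions, in the form that AC rewriting
  wants.\<close>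

definition mclass_rep :: "('g, 'b) monoid_scheme \<Rightarrow> 'g mrep set \<Rightarrow> 'g mrep" where
  "mclass_rep G X = (if \<exists>A\<in>mreps G. mclass G A = X then SOME A. A \<in> mreps G \<and> mclass G A = X else mrep_zero)"

definition cadd :: "('g, 'b) monoid_scheme \<Rightarrow> 'g mrep set \<Rightarrow> 'g mrep set \<Rightarrow> 'g mrep set" where
  "cadd G X Y = mclass G (mrep_sum (mclass_rep G X) (mclass_rep G Y))"

definition cmul :: "('g, 'b) monoid_scheme \<Rightarrow> 'g mrep set \<Rightarrow> 'g mrep set \<Rightarrow> 'g mrep set" where
  "cmul G X Y = mclass G (mrep_tensor (mclass_rep G X) (mclass_rep G Y))"

lemma mclass_eq_iff:
  assumes "A \<in> mreps G" "B \<in> mreps G"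
  shows "mclass G A = mclass G B \<longleftrightarrow> mrep_iso G A B"
proof
  assume "mclass G A = mclass G B"
  then have "B \<in> mclass G A" using assms mrep_iso_refl[OF assms(2)] by (simp add: mclass_def)
  then show "mrep_iso G A B" by (simp add: mclass_def)
next
  assume "mrep_iso G A B"
  then show "mclass G A = mclass G B"
    unfolding mclass_def using assms mrep_iso_trans mrep_iso_sym by blast
qed

lemma mclass_rep_in [simp]: "mclass_rep G X \<in> mreps G"
  unfolding mclass_rep_def by (auto intro: someI2)

lemma mclass_rep_iso:
  assumes "A \<in> mreps G"
  shows "mrep_iso G (mclass_rep G (mclass G A)) A"
proof -
  have ex: "\<exists>B. B \<in> mreps G \<and> mclass G B = mclass G A" using assms by blast
  from someI_ex[OF this] have "mclass G (mclass_rep G (mclass G A)) = mclass G A"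
    unfolding mclass_rep_def using ex by (simp add: Bex_def del: split_paired_Ex)
  then show ?thesis using assms by (simp add: mclass_eq_iff)
qed

lemma mclass_sum:
  assumes "A \<in> mreps G" "B \<in> mreps G"
  shows "mclass G (mrep_sum A B) = cadd G (mclass G A) (mclass G B)"
  unfolding cadd_def using assms mrep_iso_sum[OF _ _ _ _ mclass_rep_iso mclass_rep_iso]
  by (subst eq_commute) (simp add: mclass_eq_iff)

lemma mclass_tensor:
  assumes "A \<in> mreps G" "B \<in> mreps G"
  shows "mclass G (mrep_tensor A B) = cmul G (mclass G A) (mclass G B)"
  unfolding cmul_def using assms mrep_iso_tensor[OF _ _ _ _ mclass_rep_iso mclass_rep_iso]
  by (subst eq_commute) (simp add: mclass_eq_iff)

lemma cadd_commute: "cadd G X Y = cadd G Y X"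
  unfolding cadd_def by (simp add: mclass_eq_iff mrep_iso_sum_comm)

lemma cmul_commute: "cmul G X Y = cmul G Y X"
  unfolding cmul_def by (simp add: mclass_eq_iff mrep_iso_tensor_comm)

text \<open>An operation sees its arguments only through their representatives, so an arbitrary
  argument may be replaced by a genuine class, to which the laws up to isomorphism apply.\<close>

lemma cadd_mclass_rep: "cadd G X Y = cadd G (mclass G (mclass_rep G X)) (mclass G (mclass_rep G Y))"
  by (simp add: cadd_def[of G X] flip: mclass_sum)

lemma cmul_mclass_rep: "cmul G X Y = cmul G (mclass G (mclass_rep G X)) (mclass G (mclass_rep G Y))"
  by (simp add: cmul_def[of G X] flip: mclass_tensor)

lemma mclass_rep_mclass:
  "A \<in> mreps G \<Longrightarrow> mclass G (mclass_rep G (mclass G A)) = mclass G A"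
  by (simp add: mclass_eq_iff mclass_rep_iso)

lemma mclass_rep_cadd: "mclass G (mclass_rep G (cadd G X Y)) = cadd G X Y"
  by (simp add: cadd_def mclass_rep_mclass)

lemma mclass_rep_cmul: "mclass G (mclass_rep G (cmul G X Y)) = cmul G X Y"
  by (simp add: cmul_def mclass_rep_mclass)

lemma cadd_assoc: "cadd G (cadd G X Y) Z = cadd G X (cadd G Y Z)"
proof -
  let ?X = "mclass_rep G X" and ?Y = "mclass_rep G Y" and ?Z = "mclass_rep G Z"
  have "cadd G (cadd G X Y) Z = cadd G (cadd G (mclass G ?X) (mclass G ?Y)) (mclass G ?Z)"
    using cadd_mclass_rep[of G X Y] cadd_mclass_rep[of G "cadd G X Y" Z] by (simp add: mclass_rep_cadd)
  also have "\<dots> = cadd G (mclass G ?X) (cadd G (mclass G ?Y) (mclass G ?Z))"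
    by (simp add: mclass_eq_iff mrep_iso_sum_assoc flip: mclass_sum)
  also have "\<dots> = cadd G X (cadd G Y Z)"
    using cadd_mclass_rep[of G Y Z] cadd_mclass_rep[of G X "cadd G Y Z"] by (simp add: mclass_rep_cadd)
  finally show ?thesis .
qed

lemma cmul_assoc: "cmul G (cmul G X Y) Z = cmul G X (cmul G Y Z)"
proof -
  let ?X = "mclass_rep G X" and ?Y = "mclass_rep G Y" and ?Z = "mclass_rep G Z"
  have "cmul G (cmul G X Y) Z = cmul G (cmul G (mclass G ?X) (mclass G ?Y)) (mclass G ?Z)"
    using cmul_mclass_rep[of G X Y] cmul_mclass_rep[of G "cmul G X Y" Z] by (simp add: mclass_rep_cmul)
  also have "\<dots> = cmul G (mclass G ?X) (cmul G (mclass G ?Y) (mclass G ?Z))"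
    by (simp add: mclass_eq_iff mrep_iso_tensor_assoc flip: mclass_tensor)
  also have "\<dots> = cmul G X (cmul G Y Z)"
    using cmul_mclass_rep[of G Y Z] cmul_mclass_rep[of G X "cmul G Y Z"] by (simp add: mclass_rep_cmul)
  finally show ?thesis .
qed

lemma cmul_cadd_distrib: "cmul G (cadd G X Y) Z = cadd G (cmul G X Z) (cmul G Y Z)"
proof -
  let ?X = "mclass_rep G X" and ?Y = "mclass_rep G Y" and ?Z = "mclass_rep G Z"
  have "cmul G (cadd G X Y) Z = cmul G (cadd G (mclass G ?X) (mclass G ?Y)) (mclass G ?Z)"
    using cadd_mclass_rep[of G X Y] cmul_mclass_rep[of G "cadd G X Y" Z] by (simp add: mclass_rep_cadd)
  also have "\<dots> = cadd G (cmul G (mclass G ?X) (mclass G ?Z)) (cmul G (mclass G ?Y) (mclass G ?Z))"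
    by (simp add: mclass_eq_iff mrep_iso_distrib flip: mclass_tensor mclass_sum)
  also have "\<dots> = cadd G (cmul G X Z) (cmul G Y Z)"
    using cmul_mclass_rep[of G X Z] cmul_mclass_rep[of G Y Z] by simp
  finally show ?thesis .
qed

lemma cmul_cadd_distrib': "cmul G Z (cadd G X Y) = cadd G (cmul G Z X) (cmul G Z Y)"
  by (simp only: cmul_commute[of G Z] cmul_cadd_distrib)

lemma cadd_left_commute: "cadd G X (cadd G Y Z) = cadd G Y (cadd G X Z)"
  by (metis cadd_assoc cadd_commute)

lemma cmul_left_commute: "cmul G X (cmul G Y Z) = cmul G Y (cmul G X Z)"
  by (metis cmul_assoc cmul_commute)

lemmas cadd_ac = cadd_assoc cadd_commute cadd_left_commute
lemmas cmul_ac = cmul_assoc cmul_commute cmul_left_commute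

lemma cadd_zero: "A \<in> mreps G \<Longrightarrow> cadd G (mclass G mrep_zero) (mclass G A) = mclass G A"
  by (simp add: mclass_eq_iff mrep_iso_zero_sum flip: mclass_sum)

lemma cmul_one: "A \<in> mreps G \<Longrightarrow> cmul G (mclass G mrep_one) (mclass G A) = mclass G A"
  by (simp add: mclass_eq_iff mrep_iso_one_tensor flip: mclass_tensor)

lemma cmul_zero:
  assumes "A \<in> mreps G"
  shows "cmul G (mclass G mrep_zero) (mclass G A) = mclass G mrep_zero"
proof -
  have "mrep_iso G (mrep_tensor mrep_zero A) mrep_zero"
    using assms by (intro mrep_iso_eq) (simp_all, simp_all add: mrep_tensor_simps mrep_zero_def)
  then show ?thesis using assms by (simp add: mclass_eq_iff flip: mclass_tensor)
qed

section \<open>The representation ring is a commutative ring\<close>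

text \<open>The relation becomes an equation between sums of classes, where the bookkeeping with
  stabilizing summands is a matter of associativity and commutativity.\<close>

lemma vrep_rel_iff:
  "((A, B), (C, D)) \<in> vrep_rel G \<longleftrightarrow> A \<in> mreps G \<and> B \<in> mreps G \<and> C \<in> mreps G \<and> D \<in> mreps G \<and>
    (\<exists>E\<in>mreps G. cadd G (mclass G A) (cadd G (mclass G D) (mclass G E)) =
       cadd G (mclass G C) (cadd G (mclass G B) (mclass G E)))"
proof -
  have "mrep_iso G (mrep_sum (mrep_sum A D) E) (mrep_sum (mrep_sum C B) E) \<longleftrightarrow>
      cadd G (mclass G A) (cadd G (mclass G D) (mclass G E)) =
      cadd G (mclass G C) (cadd G (mclass G B) (mclass G E))"
    if "A \<in> mreps G" "B \<in> mreps G" "C \<in> mreps G" "D \<in> mreps G" "E \<in> mreps G" for E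
    using that by (subst mclass_eq_iff[symmetric]) (auto simp: mclass_sum cadd_assoc)
  then show ?thesis unfolding vrep_rel_def by auto
qed

lemma equiv_vrep_rel: "equiv (mreps G \<times> mreps G) (vrep_rel G)"
proof (rule equivI)
  show "vrep_rel G \<subseteq> (mreps G \<times> mreps G) \<times> (mreps G \<times> mreps G)"
    by (auto simp: vrep_rel_iff)
  show "refl_on (mreps G \<times> mreps G) (vrep_rel G)"
    by (rule refl_onI) (auto simp: vrep_rel_iff simp del: split_paired_Ex intro!: bexI[of _ mrep_zero])
  show "sym (vrep_rel G)"
    by (rule symI) (clarsimp simp: vrep_rel_iff, metis)
  show "trans (vrep_rel G)"
  proof (rule transI)
    fix x y z assume "(x, y) \<in> vrep_rel G" "(y, z) \<in> vrep_rel G"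
    moreover obtain A B C D H K where xyz: "x = (A, B)" "y = (C, D)" "z = (H, K)"
      by (cases x, cases y, cases z)
    ultimately obtain E E' where in': "A \<in> mreps G" "B \<in> mreps G" "C \<in> mreps G" "D \<in> mreps G" "E \<in> mreps G"
      "H \<in> mreps G" "K \<in> mreps G" "E' \<in> mreps G"
      and e: "cadd G (mclass G A) (cadd G (mclass G D) (mclass G E)) =
        cadd G (mclass G C) (cadd G (mclass G B) (mclass G E))"
        "cadd G (mclass G C) (cadd G (mclass G K) (mclass G E')) =
        cadd G (mclass G H) (cadd G (mclass G D) (mclass G E'))"
      by (auto simp: vrep_rel_iff)
    let ?a = "mclass G A" and ?b = "mclass G B" and ?c = "mclass G C" and ?d = "mclass G D"
      and ?h = "mclass G H" and ?k = "mclass G K" and ?e = "mclass G E" and ?f = "mclass G E'"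
    \<comment> \<open>The stabilizing summand for the composite is C + D + E + E': with it, the sum
      of the left sides of the two given equations appears, and can be replaced by the sum of the
      right sides.\<close>
    let ?r = "cadd G ?c (cadd G ?d (cadd G ?e ?f))"
    have "cadd G ?a (cadd G ?k ?r) = cadd G (cadd G ?a (cadd G ?d ?e)) (cadd G ?c (cadd G ?k ?f))"
      by (simp only: cadd_ac)
    also have "\<dots> = cadd G ?h (cadd G ?b ?r)"
      unfolding e by (simp only: cadd_ac)
    finally show "(x, z) \<in> vrep_rel G"
      using in' unfolding xyz vrep_rel_iff
      by (intro conjI bexI[of _ "mrep_sum C (mrep_sum D (mrep_sum E E'))"]) (auto simp: mclass_sum)
  qed
qed

section \<open>Classes of virtual representations and their operations\<close>

definition vcl :: "('g, 'b) monoid_scheme \<Rightarrow> 'g mrep \<Rightarrow> 'g mrep \<Rightarrow> ('g mrep \<times> 'g mrep) set" where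
  "vcl G A B = vrep_rel G `` {(A, B)}"

lemma vcl_in [simp]: "A \<in> mreps G \<Longrightarrow> B \<in> mreps G \<Longrightarrow> vcl G A B \<in> carrier (rep_ring G)"
  unfolding vcl_def rep_ring_def by (auto intro: quotientI)

lemma rep_ring_cases:
  assumes "X \<in> carrier (rep_ring G)"
  obtains A B where "A \<in> mreps G" "B \<in> mreps G" "X = vcl G A B"
  using assms unfolding vcl_def rep_ring_def by (auto elim!: quotientE)

lemma vcl_eq_iff:
  assumes "A \<in> mreps G" "B \<in> mreps G" "C \<in> mreps G" "D \<in> mreps G"
  shows "vcl G A B = vcl G C D \<longleftrightarrow> ((A, B), (C, D)) \<in> vrep_rel G"
  unfolding vcl_def using assms by (subst eq_equiv_class_iff[OF equiv_vrep_rel]) auto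

lemma vcl_eqI:
  assumes "A \<in> mreps G" "B \<in> mreps G" "C \<in> mreps G" "D \<in> mreps G"
    and "cadd G (mclass G A) (mclass G D) = cadd G (mclass G C) (mclass G B)"
  shows "vcl G A B = vcl G C D"
proof -
  have "cadd G (mclass G A) (cadd G (mclass G D) (mclass G mrep_zero)) =
       cadd G (mclass G C) (cadd G (mclass G B) (mclass G mrep_zero))"
    using assms(5) by (simp only: cadd_assoc[symmetric])
  then show ?thesis using assms by (auto simp: vcl_eq_iff vrep_rel_iff intro!: bexI[of _ mrep_zero])
qed

lemma vcl_mem: "A \<in> mreps G \<Longrightarrow> B \<in> mreps G \<Longrightarrow> (A, B) \<in> vcl G A B"
  unfolding vcl_def using equiv_class_self[OF equiv_vrep_rel] by (metis mem_Sigma_iff)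

lemma mem_vcl:
  assumes "A \<in> mreps G" "B \<in> mreps G" "(C, D) \<in> vcl G A B"
  shows "C \<in> mreps G" "D \<in> mreps G" "((A, B), (C, D)) \<in> vrep_rel G"
  using assms by (auto simp: vcl_def vrep_rel_iff)

text \<open>The operations of \<open>rep_ring\<close> are unions over all representatives;
  independence of the representative collapses such a union to one class.\<close>

lemma UN_const: "x0 \<in> X \<Longrightarrow> (\<And>x. x \<in> X \<Longrightarrow> f x = c) \<Longrightarrow> (\<Union>x\<in>X. f x) = c"
  by auto

lemma vcl_add:
  assumes "A \<in> mreps G" "B \<in> mreps G" "C \<in> mreps G" "D \<in> mreps G"
  shows "vcl G A B \<oplus>\<^bsub>rep_ring G\<^esub> vcl G C D = vcl G (mrep_sum A C) (mrep_sum B D)"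
proof -
  have *: "vcl G (mrep_sum A' C') (mrep_sum B' D') = vcl G (mrep_sum A C) (mrep_sum B D)"
    if m: "(A', B') \<in> vcl G A B" "(C', D') \<in> vcl G C D" for A' B' C' D'
  proof -
    note i = mem_vcl[OF assms(1,2) m(1)] mem_vcl[OF assms(3,4) m(2)]
    from i(3,6) obtain E E' where in': "E \<in> mreps G" "E' \<in> mreps G"
      and e: "cadd G (mclass G A) (cadd G (mclass G B') (mclass G E)) =
        cadd G (mclass G A') (cadd G (mclass G B) (mclass G E))"
        "cadd G (mclass G C) (cadd G (mclass G D') (mclass G E')) =
        cadd G (mclass G C') (cadd G (mclass G D) (mclass G E'))"
      by (auto simp: vrep_rel_iff)
    let ?a = "mclass G A" and ?b = "mclass G B" and ?c = "mclass G C" and ?d = "mclass G D"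
      and ?a' = "mclass G A'" and ?b' = "mclass G B'" and ?c' = "mclass G C'" and ?d' = "mclass G D'"
      and ?e = "mclass G E" and ?f = "mclass G E'"
    have "cadd G (cadd G ?a' ?c') (cadd G (cadd G ?b ?d) (cadd G ?e ?f)) =
      cadd G (cadd G ?a' (cadd G ?b ?e)) (cadd G ?c' (cadd G ?d ?f))" by (simp only: cadd_ac)
    also have "\<dots> = cadd G (cadd G ?a ?c) (cadd G (cadd G ?b' ?d') (cadd G ?e ?f))"
      unfolding e[symmetric] by (simp only: cadd_ac)
    finally show ?thesis using assms i in'
      by (subst vcl_eq_iff) (auto simp: vrep_rel_iff mclass_sum intro!: bexI[of _ "mrep_sum E E'"])
  qed
  have "vcl G A B \<oplus>\<^bsub>rep_ring G\<^esub> vcl G C D = (\<Union>(A', B')\<in>vcl G A B. \<Union>(C', D')\<in>vcl G C D.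
      vcl G (mrep_sum A' C') (mrep_sum B' D'))"
    unfolding rep_ring_def by (simp add: vcl_def)
  also have "\<dots> = vcl G (mrep_sum A C) (mrep_sum B D)"
    using * by (intro UN_const[OF vcl_mem[OF assms(1,2)]]) (auto intro!: UN_const[OF vcl_mem[OF assms(3,4)]])
  finally show ?thesis .
qed

lemma vcl_mult:
  assumes "A \<in> mreps G" "B \<in> mreps G" "C \<in> mreps G" "D \<in> mreps G"
  shows "vcl G A B \<otimes>\<^bsub>rep_ring G\<^esub> vcl G C D =
    vcl G (mrep_sum (mrep_tensor A C) (mrep_tensor B D)) (mrep_sum (mrep_tensor A D) (mrep_tensor B C))"
    (is "_ = vcl G (?P A B C D) (?N A B C D)")
proof -
  \<comment> \<open>Only one factor is changed here; the other follows through \<open>comm\<close>.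
    The equation \<open>e\<close> is multiplied by C on one side and by D on the other, crosswise,
    and the stabilizing summand E contributes the same term \<open>?r\<close> to both sides.\<close>
  have one: "vcl G (?P A' B' C D) (?N A' B' C D) = vcl G (?P A B C D) (?N A B C D)"
    if cd: "C \<in> mreps G" "D \<in> mreps G" and ab: "A \<in> mreps G" "B \<in> mreps G" and m: "(A', B') \<in> vcl G A B"
    for A B A' B' C D
  proof -
    note i = mem_vcl[OF ab m]
    from i(3) obtain E where in': "E \<in> mreps G"
      and e: "cadd G (mclass G A) (cadd G (mclass G B') (mclass G E)) =
        cadd G (mclass G A') (cadd G (mclass G B) (mclass G E))"
      by (auto simp: vrep_rel_iff)
    let ?a = "mclass G A" and ?b = "mclass G B" and ?c = "mclass G C" and ?d = "mclass G D"
      and ?a' = "mclass G A'" and ?b' = "mclass G B'" and ?e = "mclass G E"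
    let ?x = "cadd G ?a (cadd G ?b' ?e)" and ?y = "cadd G ?a' (cadd G ?b ?e)"
    let ?r = "cadd G (cmul G ?e ?c) (cmul G ?e ?d)"
    have "cadd G (cadd G (cmul G ?a' ?c) (cmul G ?b' ?d)) (cadd G (cadd G (cmul G ?a ?d) (cmul G ?b ?c)) ?r) =
      cadd G (cmul G ?y ?c) (cmul G ?x ?d)"
      by (simp only: cadd_ac cmul_cadd_distrib)
    also have "\<dots> = cadd G (cmul G ?x ?c) (cmul G ?y ?d)" by (simp only: e)
    also have "\<dots> = cadd G (cadd G (cmul G ?a ?c) (cmul G ?b ?d)) (cadd G (cadd G (cmul G ?a' ?d) (cmul G ?b' ?c)) ?r)"
      by (simp only: cadd_ac cmul_cadd_distrib)
    finally show ?thesis using cd ab i in'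
      by (subst vcl_eq_iff)
        (auto simp: vrep_rel_iff mclass_sum mclass_tensor
          intro!: bexI[of _ "mrep_sum (mrep_tensor E C) (mrep_tensor E D)"])
  qed
  have comm: "vcl G (?P A B C D) (?N A B C D) = vcl G (?P C D A B) (?N C D A B)"
    if "A \<in> mreps G" "B \<in> mreps G" "C \<in> mreps G" "D \<in> mreps G" for A B C D
    using that by (intro vcl_eqI) (auto simp: mclass_sum mclass_tensor cadd_ac cmul_ac)
  have *: "vcl G (?P A' B' C' D') (?N A' B' C' D') = vcl G (?P A B C D) (?N A B C D)"
    if m: "(A', B') \<in> vcl G A B" "(C', D') \<in> vcl G C D" for A' B' C' D'
  proof -
    note i = mem_vcl[OF assms(1,2) m(1)] mem_vcl[OF assms(3,4) m(2)]
    have "vcl G (?P A' B' C' D') (?N A' B' C' D') = vcl G (?P A B C' D') (?N A B C' D')"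
      by (rule one) (use i assms m in auto)
    also have "\<dots> = vcl G (?P C' D' A B) (?N C' D' A B)" by (rule comm) (use i assms in auto)
    also have "\<dots> = vcl G (?P C D A B) (?N C D A B)" by (rule one) (use i assms m in auto)
    also have "\<dots> = vcl G (?P A B C D) (?N A B C D)" by (rule comm) (use i assms in auto)
    finally show ?thesis .
  qed
  have "vcl G A B \<otimes>\<^bsub>rep_ring G\<^esub> vcl G C D = (\<Union>(A', B')\<in>vcl G A B. \<Union>(C', D')\<in>vcl G C D.
      vcl G (?P A' B' C' D') (?N A' B' C' D'))"
    unfolding rep_ring_def by (simp add: vcl_def)
  also have "\<dots> = vcl G (?P A B C D) (?N A B C D)"
    using * by (intro UN_const[OF vcl_mem[OF assms(1,2)]]) (auto intro!: UN_const[OF vcl_mem[OF assms(3,4)]])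
  finally show ?thesis .
qed

lemma rep_ring_zero: "\<zero>\<^bsub>rep_ring G\<^esub> = vcl G mrep_zero mrep_zero"
  by (simp add: rep_ring_def vcl_def)

lemma rep_ring_one: "\<one>\<^bsub>rep_ring G\<^esub> = vcl G mrep_one mrep_zero"
  by (simp add: rep_ring_def vcl_def)

lemmas mclass_simps = mclass_sum mclass_tensor cmul_cadd_distrib cmul_cadd_distrib'

lemma cring_rep_ring: "cring (rep_ring G)"
proof (rule cringI)
  show "abelian_group (rep_ring G)"
  proof (rule abelian_groupI)
    fix x y z assume "x \<in> carrier (rep_ring G)" "y \<in> carrier (rep_ring G)" "z \<in> carrier (rep_ring G)"
    then show "(x \<oplus>\<^bsub>rep_ring G\<^esub> y) \<oplus>\<^bsub>rep_ring G\<^esub> z = x \<oplus>\<^bsub>rep_ring G\<^esub> (y \<oplus>\<^bsub>rep_ring G\<^esub> z)"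
      by (elim rep_ring_cases) (simp add: vcl_add, rule vcl_eqI, simp_all add: mclass_simps cadd_ac cmul_ac)
  next
    fix x y assume xy: "x \<in> carrier (rep_ring G)" "y \<in> carrier (rep_ring G)"
    then show "x \<oplus>\<^bsub>rep_ring G\<^esub> y = y \<oplus>\<^bsub>rep_ring G\<^esub> x"
      by (elim rep_ring_cases) (simp add: vcl_add, rule vcl_eqI, simp_all add: mclass_simps cadd_ac cmul_ac)
    from xy show "x \<oplus>\<^bsub>rep_ring G\<^esub> y \<in> carrier (rep_ring G)"
      by (elim rep_ring_cases) (simp add: vcl_add)
  next
    fix x assume "x \<in> carrier (rep_ring G)"
    then show "\<zero>\<^bsub>rep_ring G\<^esub> \<oplus>\<^bsub>rep_ring G\<^esub> x = x"
      by (elim rep_ring_cases) (simp add: vcl_add rep_ring_zero cadd_zero, rule vcl_eqI, simp_all add: mclass_simps cadd_ac cmul_ac)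
  next
    fix x assume "x \<in> carrier (rep_ring G)"
    then obtain A B where AB: "A \<in> mreps G" "B \<in> mreps G" "x = vcl G A B" by (rule rep_ring_cases)
    then have "vcl G B A \<oplus>\<^bsub>rep_ring G\<^esub> x = \<zero>\<^bsub>rep_ring G\<^esub>"
      by (simp add: vcl_add rep_ring_zero, intro vcl_eqI, simp_all add: mclass_simps cadd_ac)
    then show "\<exists>y\<in>carrier (rep_ring G). y \<oplus>\<^bsub>rep_ring G\<^esub> x = \<zero>\<^bsub>rep_ring G\<^esub>" using AB by auto
  qed (simp add: rep_ring_zero)
  show "comm_monoid (rep_ring G)"
  proof (rule comm_monoidI)
    fix x y z assume "x \<in> carrier (rep_ring G)" "y \<in> carrier (rep_ring G)" "z \<in> carrier (rep_ring G)"
    then show "(x \<otimes>\<^bsub>rep_ring G\<^esub> y) \<otimes>\<^bsub>rep_ring G\<^esub> z = x \<otimes>\<^bsub>rep_ring G\<^esub> (y \<otimes>\<^bsub>rep_ring G\<^esub> z)"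
      by (elim rep_ring_cases) (simp add: vcl_mult, rule vcl_eqI, simp_all add: mclass_simps cadd_ac cmul_ac)
  next
    fix x y assume xy: "x \<in> carrier (rep_ring G)" "y \<in> carrier (rep_ring G)"
    then show "x \<otimes>\<^bsub>rep_ring G\<^esub> y = y \<otimes>\<^bsub>rep_ring G\<^esub> x"
      by (elim rep_ring_cases) (simp add: vcl_mult, rule vcl_eqI, simp_all add: mclass_simps cadd_ac cmul_ac)
    from xy show "x \<otimes>\<^bsub>rep_ring G\<^esub> y \<in> carrier (rep_ring G)"
      by (elim rep_ring_cases) (simp add: vcl_mult)
  next
    fix x assume "x \<in> carrier (rep_ring G)"
    then show "\<one>\<^bsub>rep_ring G\<^esub> \<otimes>\<^bsub>rep_ring G\<^esub> x = x"
      by (elim rep_ring_cases) (simp add: vcl_mult rep_ring_one, rule vcl_eqI, simp_all add: mclass_simps cmul_one cmul_zero, simp only: cadd_ac)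
  qed (simp add: rep_ring_one)
  fix x y z assume "x \<in> carrier (rep_ring G)" "y \<in> carrier (rep_ring G)" "z \<in> carrier (rep_ring G)"
  then show "(x \<oplus>\<^bsub>rep_ring G\<^esub> y) \<otimes>\<^bsub>rep_ring G\<^esub> z = x \<otimes>\<^bsub>rep_ring G\<^esub> z \<oplus>\<^bsub>rep_ring G\<^esub> y \<otimes>\<^bsub>rep_ring G\<^esub> z"
    by (elim rep_ring_cases) (simp add: vcl_mult vcl_add, rule vcl_eqI, simp_all add: mclass_simps cadd_ac cmul_ac)
qed

unbundle no vec_syntax

section \<open>Modules of complex functions\<close>

text \<open>Addition of functions is the pointwise one of the type class. With this scaling every
  type of complex-valued functions is a model of the locale \<open>vector_space\<close>, so spans,
  bases and linear maps are available for all domains at once.\<close>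

definition fscale :: "complex \<Rightarrow> ('x \<Rightarrow> complex) \<Rightarrow> 'x \<Rightarrow> complex" where
  "fscale c f = (\<lambda>x. c * f x)"

lemma fscale_apply [simp]: "fscale c f x = c * f x"
  by (simp add: fscale_def)

interpretation fvs: vector_space "fscale :: complex \<Rightarrow> ('x \<Rightarrow> complex) \<Rightarrow> 'x \<Rightarrow> complex"
  by unfold_locales (auto simp: fun_eq_iff algebra_simps)

interpretation fvp: vector_space_pair "fscale :: complex \<Rightarrow> ('x \<Rightarrow> complex) \<Rightarrow> 'x \<Rightarrow> complex"
    "fscale :: complex \<Rightarrow> ('y \<Rightarrow> complex) \<Rightarrow> 'y \<Rightarrow> complex"
  by unfold_locales

definition fmod :: "('x \<Rightarrow> complex) set \<Rightarrow> (complex, 'x \<Rightarrow> complex) module" where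
  "fmod S = \<lparr>carrier = S, mult = undefined, one = undefined, zero = 0, add = (+), smult = fscale\<rparr>"

lemma fmod_simps [simp]:
  "carrier (fmod S) = S" "\<zero>\<^bsub>fmod S\<^esub> = 0" "x \<oplus>\<^bsub>fmod S\<^esub> y = x + y" "c \<odot>\<^bsub>fmod S\<^esub> x = fscale c x"
  by (simp_all add: fmod_def)

text \<open>The axioms are imposed on S only, so that one action \<alpha> serves for a module and
  all its submodules. Finite dimension is expressed by a finite set whose span contains S, a
  condition that passes to subspaces at once.\<close>

definition gmod :: "('g, 'b) monoid_scheme \<Rightarrow> ('x \<Rightarrow> complex) set \<Rightarrow> ('g \<Rightarrow> ('x \<Rightarrow> complex) \<Rightarrow> ('x \<Rightarrow> complex)) \<Rightarrow> bool"
  where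
  "gmod G S \<alpha> \<longleftrightarrow> fvs.subspace S \<and> (\<exists>B. finite B \<and> S \<subseteq> fvs.span B) \<and>
     (\<forall>g\<in>carrier G. \<forall>v\<in>S. \<alpha> g v \<in> S) \<and>
     (\<forall>g\<in>carrier G. \<forall>u\<in>S. \<forall>v\<in>S. \<alpha> g (u + v) = \<alpha> g u + \<alpha> g v) \<and>
     (\<forall>g\<in>carrier G. \<forall>c. \<forall>v\<in>S. \<alpha> g (fscale c v) = fscale c (\<alpha> g v)) \<and>
     (\<forall>v\<in>S. \<alpha> \<one>\<^bsub>G\<^esub> v = v) \<and>
     (\<forall>g\<in>carrier G. \<forall>h\<in>carrier G. \<forall>v\<in>S. \<alpha> (g \<otimes>\<^bsub>G\<^esub> h) v = \<alpha> g (\<alpha> h v))"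

lemma gmodD:
  assumes "gmod G S \<alpha>"
  shows "fvs.subspace S" "\<exists>B. finite B \<and> S \<subseteq> fvs.span B"
    "\<And>g v. g \<in> carrier G \<Longrightarrow> v \<in> S \<Longrightarrow> \<alpha> g v \<in> S"
    "\<And>g u v. g \<in> carrier G \<Longrightarrow> u \<in> S \<Longrightarrow> v \<in> S \<Longrightarrow> \<alpha> g (u + v) = \<alpha> g u + \<alpha> g v"
    "\<And>g c v. g \<in> carrier G \<Longrightarrow> v \<in> S \<Longrightarrow> \<alpha> g (fscale c v) = fscale c (\<alpha> g v)"
    "\<And>v. v \<in> S \<Longrightarrow> \<alpha> \<one>\<^bsub>G\<^esub> v = v"
    "\<And>g h v. g \<in> carrier G \<Longrightarrow> h \<in> carrier G \<Longrightarrow> v \<in> S \<Longrightarrow> \<alpha> (g \<otimes>\<^bsub>G\<^esub> h) v = \<alpha> g (\<alpha> h v)"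
  using assms by (auto simp: gmod_def)

lemma gmodI:
  assumes "fvs.subspace S" "\<exists>B. finite B \<and> S \<subseteq> fvs.span B"
    "\<And>g v. g \<in> carrier G \<Longrightarrow> v \<in> S \<Longrightarrow> \<alpha> g v \<in> S"
    "\<And>g u v. g \<in> carrier G \<Longrightarrow> u \<in> S \<Longrightarrow> v \<in> S \<Longrightarrow> \<alpha> g (u + v) = \<alpha> g u + \<alpha> g v"
    "\<And>g c v. g \<in> carrier G \<Longrightarrow> v \<in> S \<Longrightarrow> \<alpha> g (fscale c v) = fscale c (\<alpha> g v)"
    "\<And>v. v \<in> S \<Longrightarrow> \<alpha> \<one>\<^bsub>G\<^esub> v = v"
    "\<And>g h v. g \<in> carrier G \<Longrightarrow> h \<in> carrier G \<Longrightarrow> v \<in> S \<Longrightarrow> \<alpha> (g \<otimes>\<^bsub>G\<^esub> h) v = \<alpha> g (\<alpha> h v)"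
  shows "gmod G S \<alpha>"
  using assms unfolding gmod_def by blast

lemma gmod_sum:
  assumes "gmod G S \<alpha>" "g \<in> carrier G" "\<And>i. i \<in> K \<Longrightarrow> f i \<in> S"
  shows "\<alpha> g (\<Sum>i\<in>K. f i) = (\<Sum>i\<in>K. \<alpha> g (f i))"
  using assms(3)
proof (induction K rule: infinite_finite_induct)
  case (insert x F)
  then show ?case using fvs.subspace_sum[OF gmodD(1)[OF assms(1)], of F f] gmodD(4)[OF assms(1,2), of "f x" "sum f F"]
    by (simp only: sum.insert insert_iff simp_thms)
next
  case empty
  have "\<alpha> g (fscale 0 0) = fscale 0 (\<alpha> g 0)" using gmodD(5)[OF assms(1,2)] fvs.subspace_0[OF gmodD(1)[OF assms(1)]] .
  then show ?case by (simp only: sum.empty fvs.scale_zero_left)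
next
  case (infinite A)
  have "\<alpha> g (fscale 0 0) = fscale 0 (\<alpha> g 0)" using gmodD(5)[OF assms(1,2)] fvs.subspace_0[OF gmodD(1)[OF assms(1)]] .
  then show ?case using infinite by (simp only: sum.infinite[OF infinite(1)] fvs.scale_zero_left)
qed

lemma vectorspace_fmod:
  assumes "fvs.subspace S"
  shows "vectorspace class_ring (fmod S)"
proof (intro vectorspace.intro moduleI abelian_groupI)
  fix x assume "x \<in> carrier (fmod S)"
  then show "\<exists>y\<in>carrier (fmod S). y \<oplus>\<^bsub>fmod S\<^esub> x = \<zero>\<^bsub>fmod S\<^esub>"
    using fvs.subspace_neg[OF assms] by (auto intro!: bexI[of _ "- x"])
next
  show "cring (class_ring :: complex ring)"
    using class_field domain.axioms(1) field.axioms(1) by blast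
next
  show "field (class_ring :: complex ring)" by (rule class_field)
qed (use assms in \<open>simp_all add: fvs.subspace_add fvs.subspace_0 fvs.subspace_scale fvs.scale_left_distrib
      fvs.scale_right_distrib add_ac\<close>)

text \<open>The module records of the development are bare operations about which no axiom is known
  in advance. An injective map that respects the operations pulls the axioms back from W; negation
  is recovered as scaling by -1.\<close>

lemma vectorspace_transport:
  assumes W: "vectorspace class_ring W" and inj: "inj_on T (carrier V)" and im: "\<And>x. x \<in> carrier V \<Longrightarrow> T x \<in> carrier W"
    and cl: "\<zero>\<^bsub>V\<^esub> \<in> carrier V" "\<And>x y. x \<in> carrier V \<Longrightarrow> y \<in> carrier V \<Longrightarrow> x \<oplus>\<^bsub>V\<^esub> y \<in> carrier V"
      "\<And>c x. x \<in> carrier V \<Longrightarrow> c \<odot>\<^bsub>V\<^esub> x \<in> carrier V"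
    and hom: "T \<zero>\<^bsub>V\<^esub> = \<zero>\<^bsub>W\<^esub>" "\<And>x y. x \<in> carrier V \<Longrightarrow> y \<in> carrier V \<Longrightarrow> T (x \<oplus>\<^bsub>V\<^esub> y) = T x \<oplus>\<^bsub>W\<^esub> T y"
      "\<And>c x. x \<in> carrier V \<Longrightarrow> T (c \<odot>\<^bsub>V\<^esub> x) = c \<odot>\<^bsub>W\<^esub> T x"
  shows "vectorspace (class_ring :: complex ring) V"
proof -
  interpret W: vectorspace "class_ring :: complex ring" W by (rule W)
  have eqI: "x = y" if "x \<in> carrier V" "y \<in> carrier V" "T x = T y" for x y
    using inj that by (auto dest: inj_onD)
  have WM: "(a + b) \<odot>\<^bsub>W\<^esub> x = a \<odot>\<^bsub>W\<^esub> x \<oplus>\<^bsub>W\<^esub> b \<odot>\<^bsub>W\<^esub> x" "(a * b) \<odot>\<^bsub>W\<^esub> x = a \<odot>\<^bsub>W\<^esub> (b \<odot>\<^bsub>W\<^esub> x)"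
    "1 \<odot>\<^bsub>W\<^esub> x = x" "0 \<odot>\<^bsub>W\<^esub> x = \<zero>\<^bsub>W\<^esub>" "a \<odot>\<^bsub>W\<^esub> x \<in> carrier W"
    "y \<in> carrier W \<Longrightarrow> a \<odot>\<^bsub>W\<^esub> (x \<oplus>\<^bsub>W\<^esub> y) = a \<odot>\<^bsub>W\<^esub> x \<oplus>\<^bsub>W\<^esub> a \<odot>\<^bsub>W\<^esub> y"
    if "x \<in> carrier W" for a b x y
    using W.smult_l_distr[of a b x] W.smult_assoc1[of a b x] W.smult_one[of x] W.smult_l_null[of x]
      W.smult_closed[of a x] W.smult_r_distr[of a x y] that by simp_all
  show ?thesis
  proof (intro vectorspace.intro moduleI abelian_groupI)
    fix x assume x: "x \<in> carrier V"
    have "(-1) \<odot>\<^bsub>W\<^esub> T x \<oplus>\<^bsub>W\<^esub> T x = \<zero>\<^bsub>W\<^esub>"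
      using WM(1)[OF im[OF x], of "-1" 1] WM(3,4)[OF im[OF x]] by simp
    then have "(-1) \<odot>\<^bsub>V\<^esub> x \<oplus>\<^bsub>V\<^esub> x = \<zero>\<^bsub>V\<^esub>" using x by (intro eqI) (simp_all add: cl hom)
    then show "\<exists>y\<in>carrier V. y \<oplus>\<^bsub>V\<^esub> x = \<zero>\<^bsub>V\<^esub>" using cl(3)[OF x] by blast
    show "\<zero>\<^bsub>V\<^esub> \<oplus>\<^bsub>V\<^esub> x = x" using x by (intro eqI) (simp_all add: cl hom im)
    show "\<one>\<^bsub>class_ring\<^esub> \<odot>\<^bsub>V\<^esub> x = x" using x by (intro eqI) (simp_all add: cl hom im WM)
  next
    fix x y assume x: "x \<in> carrier V" "y \<in> carrier V"
    show "x \<oplus>\<^bsub>V\<^esub> y = y \<oplus>\<^bsub>V\<^esub> x" using x by (intro eqI) (simp_all add: cl hom im W.a_comm)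
    fix z assume z: "z \<in> carrier V"
    show "x \<oplus>\<^bsub>V\<^esub> y \<oplus>\<^bsub>V\<^esub> z = x \<oplus>\<^bsub>V\<^esub> (y \<oplus>\<^bsub>V\<^esub> z)"
      using x z by (intro eqI) (simp_all add: cl hom im W.a_assoc)
  next
    fix a x y assume x: "x \<in> carrier V" "y \<in> carrier V"
    then show "a \<odot>\<^bsub>V\<^esub> (x \<oplus>\<^bsub>V\<^esub> y) = a \<odot>\<^bsub>V\<^esub> x \<oplus>\<^bsub>V\<^esub> a \<odot>\<^bsub>V\<^esub> y"
      by (intro eqI) (simp_all add: cl hom im WM)
  next
    fix a b x assume x: "x \<in> carrier V"
    then show "(a \<oplus>\<^bsub>class_ring\<^esub> b) \<odot>\<^bsub>V\<^esub> x = a \<odot>\<^bsub>V\<^esub> x \<oplus>\<^bsub>V\<^esub> b \<odot>\<^bsub>V\<^esub> x"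
      "a \<otimes>\<^bsub>class_ring\<^esub> b \<odot>\<^bsub>V\<^esub> x = a \<odot>\<^bsub>V\<^esub> (b \<odot>\<^bsub>V\<^esub> x)"
      by (intro eqI; simp add: cl hom im WM)+
  next
    show "cring (class_ring :: complex ring)"
    using class_field domain.axioms(1) field.axioms(1) by blast
  next
    show "field (class_ring :: complex ring)" by (rule class_field)
  qed (simp_all add: cl)
qed

section \<open>Modules and the matrix representations afforded by them\<close>

lemma affordsI:
  assumes "A \<in> mreps G" "vectorspace class_ring V" "bij_betw \<phi> (carrier V) (carrier_vec (fst A))"
    and "\<And>x y. x \<in> carrier V \<Longrightarrow> y \<in> carrier V \<Longrightarrow> \<phi> (x \<oplus>\<^bsub>V\<^esub> y) = \<phi> x + \<phi> y"
    and "\<And>c x. x \<in> carrier V \<Longrightarrow> \<phi> (c \<odot>\<^bsub>V\<^esub> x) = c \<cdot>\<^sub>v \<phi> x"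
    and "\<And>g v. g \<in> carrier G \<Longrightarrow> v \<in> carrier V \<Longrightarrow> \<alpha> g v \<in> carrier V"
    and "\<And>g v. g \<in> carrier G \<Longrightarrow> v \<in> carrier V \<Longrightarrow> \<phi> (\<alpha> g v) = snd A g *\<^sub>v \<phi> v"
  shows "affords G V \<alpha> A"
proof -
  have "linear_map class_ring V (module_vec TYPE(complex) (fst A)) \<phi>"
    unfolding linear_map_def mod_hom_def mod_hom_axioms_def module_hom_def
    using assms(2-5) vec_vs[where 'a = complex, of "fst A"]
    by (auto simp: vectorspace_def module_vec_simps bij_betw_def)
  then show ?thesis unfolding affords_def using assms by blast
qed

lemma affordsE:
  assumes "affords G V \<alpha> A"
  obtains \<phi> where "A \<in> mreps G" "vectorspace class_ring V" "bij_betw \<phi> (carrier V) (carrier_vec (fst A))"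
    "\<And>x y. x \<in> carrier V \<Longrightarrow> y \<in> carrier V \<Longrightarrow> \<phi> (x \<oplus>\<^bsub>V\<^esub> y) = \<phi> x + \<phi> y"
    "\<And>c x. x \<in> carrier V \<Longrightarrow> \<phi> (c \<odot>\<^bsub>V\<^esub> x) = c \<cdot>\<^sub>v \<phi> x"
    "\<And>g v. g \<in> carrier G \<Longrightarrow> v \<in> carrier V \<Longrightarrow> \<alpha> g v \<in> carrier V"
    "\<And>g v. g \<in> carrier G \<Longrightarrow> v \<in> carrier V \<Longrightarrow> \<phi> (\<alpha> g v) = snd A g *\<^sub>v \<phi> v"
proof -
  obtain \<phi> where 1: "A \<in> mreps G" "linear_map class_ring V (module_vec TYPE(complex) (fst A)) \<phi>"
     "bij_betw \<phi> (carrier V) (carrier_vec (fst A))"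
     "\<forall>g\<in>carrier G. \<forall>v\<in>carrier V. \<alpha> g v \<in> carrier V \<and> \<phi> (\<alpha> g v) = snd A g *\<^sub>v \<phi> v"
    using assms unfolding affords_def by auto
  show ?thesis
    by (rule that[of \<phi>])
      (use 1 in \<open>auto simp: linear_map_def mod_hom_def mod_hom_axioms_def module_hom_def module_vec_simps\<close>)
qed

lemma affords_transport:
  assumes "affords G W \<beta> A" and bij: "bij_betw T (carrier V) (carrier W)"
    and cl: "\<zero>\<^bsub>V\<^esub> \<in> carrier V" "\<And>x y. x \<in> carrier V \<Longrightarrow> y \<in> carrier V \<Longrightarrow> x \<oplus>\<^bsub>V\<^esub> y \<in> carrier V"
      "\<And>c x. x \<in> carrier V \<Longrightarrow> c \<odot>\<^bsub>V\<^esub> x \<in> carrier V"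
    and hom: "T \<zero>\<^bsub>V\<^esub> = \<zero>\<^bsub>W\<^esub>" "\<And>x y. x \<in> carrier V \<Longrightarrow> y \<in> carrier V \<Longrightarrow> T (x \<oplus>\<^bsub>V\<^esub> y) = T x \<oplus>\<^bsub>W\<^esub> T y"
      "\<And>c x. x \<in> carrier V \<Longrightarrow> T (c \<odot>\<^bsub>V\<^esub> x) = c \<odot>\<^bsub>W\<^esub> T x"
    and act: "\<And>g v. g \<in> carrier G \<Longrightarrow> v \<in> carrier V \<Longrightarrow> \<alpha> g v \<in> carrier V"
      "\<And>g v. g \<in> carrier G \<Longrightarrow> v \<in> carrier V \<Longrightarrow> T (\<alpha> g v) = \<beta> g (T v)"
  shows "affords G V \<alpha> A"
  using assms(1)
proof (rule affordsE)
  fix \<phi> assume h: "A \<in> mreps G" "vectorspace class_ring W" "bij_betw \<phi> (carrier W) (carrier_vec (fst A))"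
    "\<And>x y. x \<in> carrier W \<Longrightarrow> y \<in> carrier W \<Longrightarrow> \<phi> (x \<oplus>\<^bsub>W\<^esub> y) = \<phi> x + \<phi> y"
    "\<And>c x. x \<in> carrier W \<Longrightarrow> \<phi> (c \<odot>\<^bsub>W\<^esub> x) = c \<cdot>\<^sub>v \<phi> x"
    "\<And>g v. g \<in> carrier G \<Longrightarrow> v \<in> carrier W \<Longrightarrow> \<beta> g v \<in> carrier W"
    "\<And>g v. g \<in> carrier G \<Longrightarrow> v \<in> carrier W \<Longrightarrow> \<phi> (\<beta> g v) = snd A g *\<^sub>v \<phi> v"
  have im: "\<And>x. x \<in> carrier V \<Longrightarrow> T x \<in> carrier W" using bij by (auto simp: bij_betw_def)
  have "vectorspace class_ring V"
    by (rule vectorspace_transport[OF h(2) _ im cl hom]) (use bij in \<open>auto simp: bij_betw_def\<close>)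
  then show ?thesis
    by (rule affordsI[OF h(1) _ bij_betw_trans[OF bij h(3)]]) (simp_all add: hom act h im)
qed

text \<open>Induction over the truncations \<open>w k\<close> of v: the passage from k to k + 1 adds
  one multiple of a unit vector.\<close>

lemma mat_of_linear:
  fixes T :: "complex vec \<Rightarrow> complex vec"
  assumes T: "\<And>v. v \<in> carrier_vec a \<Longrightarrow> T v \<in> carrier_vec b"
    and add: "\<And>v w. v \<in> carrier_vec a \<Longrightarrow> w \<in> carrier_vec a \<Longrightarrow> T (v + w) = T v + T w"
    and sm: "\<And>c v. v \<in> carrier_vec a \<Longrightarrow> T (c \<cdot>\<^sub>v v) = c \<cdot>\<^sub>v T v"
    and v: "v \<in> carrier_vec a"
  shows "T v = Matrix.mat b a (\<lambda>(i, j). T (unit_vec a j) $ i) *\<^sub>v v"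
proof -
  define w where "w k = Matrix.vec a (\<lambda>j. if j < k then v $ j else 0)" for k
  have "T (w k) = Matrix.vec b (\<lambda>i. \<Sum>j\<in>{0..<k}. T (unit_vec a j) $ i * v $ j)" if "k \<le> a" for k
    using that
  proof (induction k)
    case 0
    have "w 0 = 0 \<cdot>\<^sub>v w 0" by (rule eq_vecI) (simp_all add: w_def)
    then have "T (w 0) = 0 \<cdot>\<^sub>v T (w 0)" using sm[of "w 0" 0] by (simp add: w_def)
    moreover have "T (w 0) \<in> carrier_vec b" by (rule T) (simp add: w_def)
    ultimately show ?case by (intro eq_vecI) (auto, metis carrier_vecD index_smult_vec(1) mult_zero_left)
  next
    case (Suc k)
    have "w (Suc k) = w k + v $ k \<cdot>\<^sub>v unit_vec a k"
      using Suc(2) by (intro eq_vecI) (auto simp: w_def unit_vec_def less_Suc_eq)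
    then have "T (w (Suc k)) = T (w k) + v $ k \<cdot>\<^sub>v T (unit_vec a k)"
      by (simp add: add sm w_def)
    moreover have "T (unit_vec a k) \<in> carrier_vec b" by (rule T) simp
    ultimately show ?case using Suc by (intro eq_vecI) (auto simp: algebra_simps)
  qed
  from this[of a] have "T (w a) = Matrix.vec b (\<lambda>i. \<Sum>j\<in>{0..<a}. T (unit_vec a j) $ i * v $ j)" by simp
  moreover have "w a = v" using v by (intro eq_vecI) (auto simp: w_def)
  ultimately show ?thesis using v by (intro eq_vecI) (auto simp: scalar_prod_def)
qed

lemma eq_mat_if_eq_on_vec:
  fixes A B :: "complex mat"
  assumes "A \<in> carrier_mat b a" "B \<in> carrier_mat b a" "\<And>v. v \<in> carrier_vec a \<Longrightarrow> A *\<^sub>v v = B *\<^sub>v v"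
  shows "A = B"
proof (rule eq_matI)
  fix i j assume ij: "i < dim_row B" "j < dim_col B"
  have "C $$ (i, j) = (C *\<^sub>v unit_vec a j) $ i" if "C \<in> carrier_mat b a" for C :: "complex mat"
    using that ij assms(2) by (auto simp: scalar_prod_right_unit[of _ a])
  from this[OF assms(1)] this[OF assms(2)] show "A $$ (i, j) = B $$ (i, j)"
    using assms(3)[of "unit_vec a j"] by simp
qed (use assms in auto)

text \<open>Each size is the trace of an identity matrix, and M * N and N * M have the same trace.
  Characteristic zero turns equality of traces into equality of sizes.\<close>

lemma inverse_mats_same_dim:
  fixes M N :: "complex mat"
  assumes M: "M \<in> carrier_mat b a" and N: "N \<in> carrier_mat a b" and "M * N = 1\<^sub>m b" "N * M = 1\<^sub>m a"
  shows "a = b"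
proof -
  have "of_nat b = (\<Sum>i\<in>{0..<b}. (M * N) $$ (i, i))" using assms(3) by simp
  also have "\<dots> = (\<Sum>i\<in>{0..<b}. \<Sum>j\<in>{0..<a}. M $$ (i, j) * N $$ (j, i))"
    using M N by (intro sum.cong) (auto simp: scalar_prod_def)
  also have "\<dots> = (\<Sum>j\<in>{0..<a}. \<Sum>i\<in>{0..<b}. N $$ (j, i) * M $$ (i, j))"
    by (subst sum.swap) (simp add: mult.commute)
  also have "\<dots> = (\<Sum>j\<in>{0..<a}. (N * M) $$ (j, j))"
    using M N by (intro sum.cong) (auto simp: scalar_prod_def)
  also have "\<dots> = of_nat a" using assms(4) by simp
  finally show ?thesis using of_nat_eq_iff by metis
qed

text \<open>Two coordinate maps of the same module differ by a change of basis M with inverse N.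
  These matrices are rectangular at first; that the degrees agree is itself a conclusion. It follows
  that \<open>rep_class\<close> consists of a single class.\<close>

lemma affords_iso:
  assumes "affords G V \<alpha> A" "affords G V \<alpha> B"
  shows "mrep_iso G A B"
  using assms(1)
proof (rule affordsE)
  fix \<phi> assume h: "A \<in> mreps G" "vectorspace class_ring V" "bij_betw \<phi> (carrier V) (carrier_vec (fst A))"
    "\<And>x y. x \<in> carrier V \<Longrightarrow> y \<in> carrier V \<Longrightarrow> \<phi> (x \<oplus>\<^bsub>V\<^esub> y) = \<phi> x + \<phi> y"
    "\<And>c x. x \<in> carrier V \<Longrightarrow> \<phi> (c \<odot>\<^bsub>V\<^esub> x) = c \<cdot>\<^sub>v \<phi> x"
    "\<And>g v. g \<in> carrier G \<Longrightarrow> v \<in> carrier V \<Longrightarrow> \<alpha> g v \<in> carrier V"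
    "\<And>g v. g \<in> carrier G \<Longrightarrow> v \<in> carrier V \<Longrightarrow> \<phi> (\<alpha> g v) = snd A g *\<^sub>v \<phi> v"
  show ?thesis using assms(2)
  proof (rule affordsE)
    fix \<psi> assume k: "B \<in> mreps G" "bij_betw \<psi> (carrier V) (carrier_vec (fst B))"
      "\<And>x y. x \<in> carrier V \<Longrightarrow> y \<in> carrier V \<Longrightarrow> \<psi> (x \<oplus>\<^bsub>V\<^esub> y) = \<psi> x + \<psi> y"
      "\<And>c x. x \<in> carrier V \<Longrightarrow> \<psi> (c \<odot>\<^bsub>V\<^esub> x) = c \<cdot>\<^sub>v \<psi> x"
      "\<And>g v. g \<in> carrier G \<Longrightarrow> v \<in> carrier V \<Longrightarrow> \<psi> (\<alpha> g v) = snd B g *\<^sub>v \<psi> v"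
    interpret V: vectorspace "class_ring :: complex ring" V by (rule h(2))
    have cl: "x \<oplus>\<^bsub>V\<^esub> y \<in> carrier V" "c \<odot>\<^bsub>V\<^esub> x \<in> carrier V" if "x \<in> carrier V" "y \<in> carrier V" for x y c
      using that V.smult_closed[of c x] by auto
    have main: "\<exists>M\<in>carrier_mat b a. \<forall>x\<in>carrier V. \<psi> x = M *\<^sub>v \<phi> x"
      if "bij_betw \<phi> (carrier V) (carrier_vec a)" "bij_betw \<psi> (carrier V) (carrier_vec b)"
        "\<And>x y. x \<in> carrier V \<Longrightarrow> y \<in> carrier V \<Longrightarrow> \<phi> (x \<oplus>\<^bsub>V\<^esub> y) = \<phi> x + \<phi> y"
        "\<And>c x. x \<in> carrier V \<Longrightarrow> \<phi> (c \<odot>\<^bsub>V\<^esub> x) = c \<cdot>\<^sub>v \<phi> x"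
        "\<And>x y. x \<in> carrier V \<Longrightarrow> y \<in> carrier V \<Longrightarrow> \<psi> (x \<oplus>\<^bsub>V\<^esub> y) = \<psi> x + \<psi> y"
        "\<And>c x. x \<in> carrier V \<Longrightarrow> \<psi> (c \<odot>\<^bsub>V\<^esub> x) = c \<cdot>\<^sub>v \<psi> x"
      for \<phi> \<psi> a b
    proof -
      define \<chi> where "\<chi> = inv_into (carrier V) \<phi>"
      have \<chi>: "v \<in> carrier_vec a \<Longrightarrow> \<chi> v \<in> carrier V \<and> \<phi> (\<chi> v) = v" "x \<in> carrier V \<Longrightarrow> \<chi> (\<phi> x) = x" for v x
        unfolding \<chi>_def using that(1) bij_betw_inv_into_left[OF that(1)] bij_betw_inv_into_right[OF that(1)]
          bij_betw_apply[OF bij_betw_inv_into[OF that(1)]] by auto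
      have a: "\<chi> (v + w) = \<chi> v \<oplus>\<^bsub>V\<^esub> \<chi> w" "\<chi> (c \<cdot>\<^sub>v v) = c \<odot>\<^bsub>V\<^esub> \<chi> v"
        if "v \<in> carrier_vec a" "w \<in> carrier_vec a" for v w c
        using \<chi>(1)[OF that(1)] \<chi>(1)[OF that(2)] \<chi>(2)[of "\<chi> v \<oplus>\<^bsub>V\<^esub> \<chi> w"] \<chi>(2)[of "c \<odot>\<^bsub>V\<^esub> \<chi> v"] \<open>\<And>x y. x \<in> carrier V \<Longrightarrow> y \<in> carrier V \<Longrightarrow> \<phi> (x \<oplus>\<^bsub>V\<^esub> y) = \<phi> x + \<phi> y\<close>
          \<open>\<And>c x. x \<in> carrier V \<Longrightarrow> \<phi> (c \<odot>\<^bsub>V\<^esub> x) = c \<cdot>\<^sub>v \<phi> x\<close> cl by auto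
      have \<psi>: "x \<in> carrier V \<Longrightarrow> \<psi> x \<in> carrier_vec b" for x using that(2) by (auto simp: bij_betw_def)
      define M where "M = Matrix.mat b a (\<lambda>(i, j). \<psi> (\<chi> (unit_vec a j)) $ i)"
      have "\<psi> (\<chi> v) = M *\<^sub>v v" if "v \<in> carrier_vec a" for v
        unfolding M_def
        by (rule mat_of_linear[OF _ _ _ that]) (use \<chi> a \<psi> \<open>\<And>x y. x \<in> carrier V \<Longrightarrow> y \<in> carrier V \<Longrightarrow> \<psi> (x \<oplus>\<^bsub>V\<^esub> y) = \<psi> x + \<psi> y\<close>
          \<open>\<And>c x. x \<in> carrier V \<Longrightarrow> \<psi> (c \<odot>\<^bsub>V\<^esub> x) = c \<cdot>\<^sub>v \<psi> x\<close> in auto)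
      then have "\<forall>x\<in>carrier V. \<psi> x = M *\<^sub>v \<phi> x" using \<chi>(2) that(1) by (metis bij_betw_apply)
      moreover have "M \<in> carrier_mat b a" by (simp add: M_def)
      ultimately show ?thesis by blast
    qed
    obtain M where M: "M \<in> carrier_mat (fst B) (fst A)" "\<And>x. x \<in> carrier V \<Longrightarrow> \<psi> x = M *\<^sub>v \<phi> x"
      using main[OF h(3) k(2) h(4,5) k(3,4)] by auto
    obtain N where N: "N \<in> carrier_mat (fst A) (fst B)" "\<And>x. x \<in> carrier V \<Longrightarrow> \<phi> x = N *\<^sub>v \<psi> x"
      using main[OF k(2) h(3) k(3,4) h(4,5)] by auto
    have \<phi>: "v \<in> carrier_vec (fst A) \<Longrightarrow> \<exists>x\<in>carrier V. v = \<phi> x" for v :: "complex Matrix.vec" using h(3) by (auto simp: bij_betw_def)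
    have \<psi>: "v \<in> carrier_vec (fst B) \<Longrightarrow> \<exists>x\<in>carrier V. v = \<psi> x" for v :: "complex Matrix.vec" using k(2) by (auto simp: bij_betw_def)
    have \<phi>c: "x \<in> carrier V \<Longrightarrow> \<phi> x \<in> carrier_vec (fst A)" for x using h(3) by (auto simp: bij_betw_def)
    have \<psi>c: "x \<in> carrier V \<Longrightarrow> \<psi> x \<in> carrier_vec (fst B)" for x using k(2) by (auto simp: bij_betw_def)
    have NM: "N * M = 1\<^sub>m (fst A)"
    proof (rule eq_mat_if_eq_on_vec[where a = "fst A" and b = "fst A"])
      fix v :: "complex Matrix.vec" assume v: "v \<in> carrier_vec (fst A)"
      then obtain x where "x \<in> carrier V" "v = \<phi> x" using \<phi> by blast
      then show "N * M *\<^sub>v v = 1\<^sub>m (fst A) *\<^sub>v v"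
        using v M(1) N(1) by (simp add: assoc_mult_mat_vec[of _ _ "fst B"] flip: M(2) N(2))
    qed (use M(1) N(1) in auto)
    have MN: "M * N = 1\<^sub>m (fst B)"
    proof (rule eq_mat_if_eq_on_vec[where a = "fst B" and b = "fst B"])
      fix v :: "complex Matrix.vec" assume v: "v \<in> carrier_vec (fst B)"
      then obtain x where "x \<in> carrier V" "v = \<psi> x" using \<psi> by blast
      then show "M * N *\<^sub>v v = 1\<^sub>m (fst B) *\<^sub>v v"
        using v M(1) N(1) by (simp add: assoc_mult_mat_vec[of _ _ "fst A"] flip: M(2) N(2))
    qed (use M(1) N(1) in auto)
    have d: "fst A = fst B" by (rule inverse_mats_same_dim[OF M(1) N(1) MN NM])
    show ?thesis
    proof (rule mrep_isoI[where P = M and Q = N and d = "fst A"])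
      fix g assume g: "g \<in> carrier G"
      note c = mrepsD(1)[OF h(1) g] mrepsD(1)[OF k(1) g]
      show "M * snd A g = snd B g * M"
      proof (rule eq_mat_if_eq_on_vec[where a = "fst A" and b = "fst B"])
        fix v :: "complex Matrix.vec" assume "v \<in> carrier_vec (fst A)"
        then obtain x where x: "x \<in> carrier V" "v = \<phi> x" using \<phi> by blast
        have "M * snd A g *\<^sub>v v = M *\<^sub>v (snd A g *\<^sub>v \<phi> x)"
          using M(1) c x \<phi>c by (simp add: assoc_mult_mat_vec[of _ _ "fst A"])
        also have "\<dots> = \<psi> (\<alpha> g x)" using h(6,7) M(2) g x by simp
        also have "\<dots> = snd B g *\<^sub>v (M *\<^sub>v \<phi> x)" using k(5) M(2) g x by simp
        also have "\<dots> = snd B g * M *\<^sub>v v"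
          using M(1) c x \<phi>c[OF x(1)] by (simp add: assoc_mult_mat_vec[of _ "fst B" "fst B" _ "fst A"])
        finally show "M * snd A g *\<^sub>v v = snd B g * M *\<^sub>v v" .
      qed (use M(1) c in auto)
    qed (use d M(1) N(1) MN NM in auto)
  qed
qed

lemma rep_class_eq:
  assumes "affords G V \<alpha> A"
  shows "rep_class G V \<alpha> = vcl G A mrep_zero"
proof -
  have A: "A \<in> mreps G" using assms by (simp add: affords_def)
  have "vcl G B mrep_zero = vcl G A mrep_zero" if "affords G V \<alpha> B" for B
    using that affords_iso[OF that assms] A by (intro vcl_eqI) (auto simp: affords_def simp flip: mclass_eq_iff)
  then have "(\<Union>B\<in>{B. affords G V \<alpha> B}. vcl G B mrep_zero) = vcl G A mrep_zero"
    using assms by (intro UN_const[of A]) blast+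
  then show ?thesis by (simp add: rep_class_def vcl_def)
qed

text \<open>A basis of S is listed as \<open>bs\<close>. Coordinates with respect to it give \<phi>,
  and the coordinates of the images of the basis vectors are the columns of \<rho>. Multiplicativity
  of \<rho> is equivariance of \<phi> at the vectors \<open>\<alpha> h (bs ! j)\<close>.\<close>

lemma gmod_affords:
  fixes S :: "('x \<Rightarrow> complex) set"
  assumes "gmod G S \<alpha>"
  shows "\<exists>A. affords G (fmod S) \<alpha> A"
proof -
  note gD = gmodD[OF assms]
  obtain B0 where B0: "finite B0" "S \<subseteq> fvs.span B0" using gD(2) by auto
  obtain B where B: "B \<subseteq> S" "fvs.independent B" "S \<subseteq> fvs.span B" by (rule fvs.maximal_independent_subset)
  have fin: "finite B" using fvs.independent_span_bound[OF B0(1) B(2)] B(1) B0(2) by auto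
  have SB: "fvs.span B = S" using B gD(1) by (meson fvs.span_minimal subset_antisym)
  obtain bs where bs: "set bs = B" "distinct bs" using fin finite_distinct_list by blast
  define d where "d = length bs"
  have bsB: "bs ! i \<in> B" if "i < d" for i using that bs by (auto simp: d_def)
  have sumB: "(\<Sum>b\<in>B. f b) = (\<Sum>i\<in>{0..<d}. f (bs ! i))" for f :: "('x \<Rightarrow> complex) \<Rightarrow> ('x \<Rightarrow> complex)"
    unfolding bs(1)[symmetric] d_def
    by (simp add: sum.distinct_set_conv_list[OF bs(2)] sum_list_sum_nth)
  let ?r = "fvs.representation B"
  define \<phi> where "\<phi> v = Matrix.vec d (\<lambda>i. ?r v (bs ! i))" for v
  define \<rho> where "\<rho> g = Matrix.mat d d (\<lambda>(i, j). ?r (\<alpha> g (bs ! j)) (bs ! i))" for g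
  have exp: "v = (\<Sum>i\<in>{0..<d}. fscale (?r v (bs ! i)) (bs ! i))" if "v \<in> S" for v
  proof -
    have "(\<Sum>b\<in>B. fscale (?r v b) b) = v"
      by (rule fvs.sum_representation_eq) (use B fin SB that in auto)
    then show ?thesis using sumB[of "\<lambda>b. fscale (?r v b) b"] by simp
  qed
  have rsum: "?r (\<Sum>i\<in>{0..<d}. fscale (c i) (f i)) b = (\<Sum>i\<in>{0..<d}. c i * ?r (f i) b)"
    if "\<And>i. i < d \<Longrightarrow> f i \<in> S" for c b f
    using that B(2) SB by (subst fvs.representation_sum) (auto simp: fvs.subspace_scale[OF gD(1)] fvs.representation_scale)
  have rbs: "?r (bs ! j) (bs ! i) = (if i = j then 1 else 0)" if "i < d" "j < d" for i j
    using fvs.representation_basis[OF B(2) bsB[OF that(2)]] that bs(2) by (auto simp: d_def nth_eq_iff_index_eq)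
  have bsS: "bs ! i \<in> S" if "i < d" for i using bsB[OF that] B by auto
  have surj: "\<exists>v\<in>S. \<phi> v = w" if w: "w \<in> carrier_vec d" for w
  proof
    let ?v = "\<Sum>i\<in>{0..<d}. fscale (w $ i) (bs ! i)"
    show "?v \<in> S" using bsS by (intro fvs.subspace_sum[OF gD(1)] fvs.subspace_scale[OF gD(1)]) auto
    show "\<phi> ?v = w"
    proof (rule eq_vecI)
      fix i assume i: "i < dim_vec w"
      have "\<phi> ?v $ i = (\<Sum>j\<in>{0..<d}. w $ j * (if i = j then 1 else 0))"
        using i w rbs bsS by (simp add: \<phi>_def rsum)
      then show "\<phi> ?v $ i = w $ i" using i w by (simp add: if_distrib cong: if_cong)
    qed (use w in \<open>simp add: \<phi>_def\<close>)
  qed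
  have inj: "inj_on \<phi> S"
  proof (rule inj_onI)
    fix x y assume xy: "x \<in> S" "y \<in> S" "\<phi> x = \<phi> y"
    have "?r x (bs ! i) = ?r y (bs ! i)" if "i < d" for i
      using arg_cong[OF xy(3), of "\<lambda>v. v $ i"] that by (simp add: \<phi>_def)
    then show "x = y" by (subst exp[OF xy(1)], subst exp[OF xy(2)]) simp
  qed
  have eqv: "\<phi> (\<alpha> g v) = \<rho> g *\<^sub>v \<phi> v" if g: "g \<in> carrier G" and v: "v \<in> S" for g v
  proof (rule eq_vecI)
    fix i assume "i < dim_vec (\<rho> g *\<^sub>v \<phi> v)"
    then have i: "i < d" by (simp add: \<rho>_def)
    have "\<alpha> g v = \<alpha> g (\<Sum>j\<in>{0..<d}. fscale (?r v (bs ! j)) (bs ! j))" using exp[OF v] by simp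
    also have "\<dots> = (\<Sum>j\<in>{0..<d}. \<alpha> g (fscale (?r v (bs ! j)) (bs ! j)))"
      by (rule gmod_sum[OF assms g]) (auto intro: fvs.subspace_scale[OF gD(1)] bsS)
    also have "\<dots> = (\<Sum>j\<in>{0..<d}. fscale (?r v (bs ! j)) (\<alpha> g (bs ! j)))"
      using gD(5)[OF g] bsS by (intro sum.cong) auto
    finally have "?r (\<alpha> g v) (bs ! i) = (\<Sum>j\<in>{0..<d}. ?r v (bs ! j) * ?r (\<alpha> g (bs ! j)) (bs ! i))"
      using rsum[of "\<lambda>j. \<alpha> g (bs ! j)"] gD(3)[OF g] bsS by simp
    then show "\<phi> (\<alpha> g v) $ i = (\<rho> g *\<^sub>v \<phi> v) $ i"
      using i by (simp add: \<phi>_def \<rho>_def scalar_prod_def mult.commute)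
  qed (simp add: \<phi>_def \<rho>_def)
  have "(d, \<rho>) \<in> mreps G"
  proof (rule mrepsI)
    show "snd (d, \<rho>) \<one>\<^bsub>G\<^esub> = 1\<^sub>m (fst (d, \<rho>))"
      using gD(6) bsS rbs by (intro eq_matI) (auto simp: \<rho>_def)
    fix g h assume gh: "g \<in> carrier G" "h \<in> carrier G"
    show "snd (d, \<rho>) (g \<otimes>\<^bsub>G\<^esub> h) = snd (d, \<rho>) g * snd (d, \<rho>) h"
    proof (rule eq_matI)
      fix i j assume "i < dim_row (snd (d, \<rho>) g * snd (d, \<rho>) h)" "j < dim_col (snd (d, \<rho>) g * snd (d, \<rho>) h)"
      then have ij: "i < d" "j < d" by (simp_all add: \<rho>_def)
      have "\<phi> (\<alpha> g (\<alpha> h (bs ! j))) $ i = (\<rho> g *\<^sub>v \<phi> (\<alpha> h (bs ! j))) $ i"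
        using eqv[OF gh(1) gD(3)[OF gh(2) bsS[OF ij(2)]]] by simp
      then show "snd (d, \<rho>) (g \<otimes>\<^bsub>G\<^esub> h) $$ (i, j) = (snd (d, \<rho>) g * snd (d, \<rho>) h) $$ (i, j)"
        using ij gD(7)[OF gh bsS[OF ij(2)]] by (simp add: \<phi>_def \<rho>_def scalar_prod_def)
    qed (simp_all add: \<rho>_def)
  qed (simp add: \<rho>_def)
  moreover have "bij_betw \<phi> S (carrier_vec d)"
    unfolding bij_betw_def using inj surj by (auto simp: image_iff Bex_def) (auto simp: \<phi>_def)
  ultimately have "affords G (fmod S) \<alpha> (d, \<rho>)"
    using eqv gD(3) vectorspace_fmod[OF gD(1)] B(2) SB
    by (intro affordsI[where \<phi> = \<phi>])
      (auto simp: \<phi>_def fvs.representation_add fvs.representation_scale)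
  then show ?thesis by blast
qed

lemma rep_class_in:
  assumes "gmod G S \<alpha>"
  shows "rep_class G (fmod S) \<alpha> \<in> carrier (rep_ring G)"
proof -
  obtain A where "affords G (fmod S) \<alpha> A" using gmod_affords[OF assms] by blast
  then show ?thesis using rep_class_eq[of G "fmod S" \<alpha> A] by (auto simp: affords_def)
qed

text \<open>Only the target is known to be a module; V may be any record with operations. The
  concrete modules are compared with spaces of functions through this rule.\<close>

lemma rep_class_transport:
  assumes S: "gmod G S \<beta>" and bij: "bij_betw T (carrier V) S"
    and cl: "\<zero>\<^bsub>V\<^esub> \<in> carrier V" "\<And>x y. x \<in> carrier V \<Longrightarrow> y \<in> carrier V \<Longrightarrow> x \<oplus>\<^bsub>V\<^esub> y \<in> carrier V"
      "\<And>c x. x \<in> carrier V \<Longrightarrow> c \<odot>\<^bsub>V\<^esub> x \<in> carrier V"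
    and hom: "T \<zero>\<^bsub>V\<^esub> = 0" "\<And>x y. x \<in> carrier V \<Longrightarrow> y \<in> carrier V \<Longrightarrow> T (x \<oplus>\<^bsub>V\<^esub> y) = T x + T y"
      "\<And>c x. x \<in> carrier V \<Longrightarrow> T (c \<odot>\<^bsub>V\<^esub> x) = fscale c (T x)"
    and act: "\<And>g v. g \<in> carrier G \<Longrightarrow> v \<in> carrier V \<Longrightarrow> \<alpha> g v \<in> carrier V"
      "\<And>g v. g \<in> carrier G \<Longrightarrow> v \<in> carrier V \<Longrightarrow> T (\<alpha> g v) = \<beta> g (T v)"
  shows "rep_class G V \<alpha> = rep_class G (fmod S) \<beta>"
proof -
  obtain A where A: "affords G (fmod S) \<beta> A" using gmod_affords[OF S] by blast
  have "affords G V \<alpha> A"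
    by (rule affords_transport[OF A, where T = T]) (simp_all add: bij cl hom act)
  from rep_class_eq[OF this] rep_class_eq[OF A] show ?thesis by simp
qed

section \<open>Classes of direct sums\<close>

lemma zero_mat_mult_vec: "v \<in> carrier_vec m \<Longrightarrow> 0\<^sub>m n m *\<^sub>v v = (0\<^sub>v n :: complex Matrix.vec)"
  by (rule eq_vecI) (auto simp: scalar_prod_def)

lemma smult_mat_mult_vec:
  "A \<in> carrier_mat n m \<Longrightarrow> v \<in> carrier_vec m \<Longrightarrow> (c \<cdot>\<^sub>m A) *\<^sub>v v = c \<cdot>\<^sub>v (A *\<^sub>v (v :: complex Matrix.vec))"
  by (rule eq_vecI) (auto simp: scalar_prod_def sum_distrib_left mult_ac)

lemma gmod_sub:
  assumes "gmod G U \<alpha>" "fvs.subspace S" "S \<subseteq> U" "\<And>g v. g \<in> carrier G \<Longrightarrow> v \<in> S \<Longrightarrow> \<alpha> g v \<in> S"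
  shows "gmod G S \<alpha>"
proof (rule gmodI)
  show "\<exists>B. finite B \<and> S \<subseteq> fvs.span B" using gmodD(2)[OF assms(1)] assms(3) by blast
next
  fix v assume "v \<in> S"
  then have v: "v \<in> U" using assms(3) by auto
  show "\<alpha> \<one>\<^bsub>G\<^esub> v = v" by (rule gmodD(6)[OF assms(1) v])
  fix g assume g: "g \<in> carrier G"
  show "\<alpha> g (fscale c v) = fscale c (\<alpha> g v)" for c by (rule gmodD(5)[OF assms(1) g v])
  show "\<alpha> (g \<otimes>\<^bsub>G\<^esub> h) v = \<alpha> g (\<alpha> h v)" if "h \<in> carrier G" for h by (rule gmodD(7)[OF assms(1) g that v])
  show "\<alpha> g (u + v) = \<alpha> g u + \<alpha> g v" if "u \<in> S" for u
    using gmodD(4)[OF assms(1) g _ v] that assms(3) by blast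
qed (use assms in auto)

lemma vcl_zero_add:
  assumes "A \<in> mreps G" "B \<in> mreps G"
  shows "vcl G A mrep_zero \<oplus>\<^bsub>rep_ring G\<^esub> vcl G B mrep_zero = vcl G (mrep_sum A B) mrep_zero"
  using assms by (simp add: vcl_add, intro vcl_eqI) (simp_all add: mclass_simps cadd_zero cadd_ac)

lemma vcl_zero_mult:
  assumes "A \<in> mreps G" "B \<in> mreps G"
  shows "vcl G A mrep_zero \<otimes>\<^bsub>rep_ring G\<^esub> vcl G B mrep_zero = vcl G (mrep_tensor A B) mrep_zero"
  using assms cmul_zero[OF assms(1)] cmul_zero[OF assms(2)] cmul_zero[of mrep_zero G]
  by (simp add: vcl_mult, intro vcl_eqI) (simp_all add: mclass_simps cmul_commute[of G "mclass G A" "mclass G mrep_zero"] cadd_ac)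

text \<open>Each w in S splits uniquely, with \<open>p w\<close> as its part in S1. Appending the
  coordinate vectors of the two parts makes the action block diagonal, which is the form of
  \<open>mrep_sum\<close>.\<close>

lemma rep_class_direct_sum:
  assumes U: "gmod G U \<alpha>" and S1: "gmod G S1 \<alpha>" "S1 \<subseteq> U" and S2: "gmod G S2 \<alpha>" "S2 \<subseteq> U"
    and disj: "S1 \<inter> S2 \<subseteq> {0}" and S: "S = {u + v | u v. u \<in> S1 \<and> v \<in> S2}"
  shows "gmod G S \<alpha>" "S \<subseteq> U"
    "rep_class G (fmod S) \<alpha> = rep_class G (fmod S1) \<alpha> \<oplus>\<^bsub>rep_ring G\<^esub> rep_class G (fmod S2) \<alpha>"
proof -
  have sub: "fvs.subspace S" unfolding S by (rule fvs.subspace_sums[OF gmodD(1)[OF S1(1)] gmodD(1)[OF S2(1)]])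
  show SU: "S \<subseteq> U" unfolding S using S1(2) S2(2) fvs.subspace_add[OF gmodD(1)[OF U]] by blast
  have act: "\<alpha> g (u + v) = \<alpha> g u + \<alpha> g v" if "g \<in> carrier G" "u \<in> S1" "v \<in> S2" for g u v
    using gmodD(4)[OF U that(1)] that S1(2) S2(2) by blast
  show gS: "gmod G S \<alpha>"
  proof (rule gmod_sub[OF U sub SU])
    fix g v assume g: "g \<in> carrier G" and "v \<in> S"
    then obtain a b where "a \<in> S1" "b \<in> S2" "v = a + b" unfolding S by blast
    then show "\<alpha> g v \<in> S" unfolding S using act[OF g] gmodD(3)[OF S1(1) g] gmodD(3)[OF S2(1) g] by blast
  qed
  define p where "p w = (SOME u. u \<in> S1 \<and> w - u \<in> S2)" for w
  have pw: "p w \<in> S1 \<and> w - p w \<in> S2" if w: "w \<in> S" for w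
  proof -
    obtain u v where "u \<in> S1" "v \<in> S2" "w = u + v" using w unfolding S by blast
    then have "u \<in> S1 \<and> w - u \<in> S2" by simp
    then show ?thesis unfolding p_def by (rule someI[where P = "\<lambda>u. u \<in> S1 \<and> w - u \<in> S2"])
  qed
  have inS: "u + v \<in> S" if "u \<in> S1" "v \<in> S2" for u v using that unfolding S by blast
  have puv: "p (u + v) = u" if "u \<in> S1" "v \<in> S2" for u v
  proof -
    note q = pw[OF inS[OF that]]
    have "p (u + v) - u \<in> S1" using q that fvs.subspace_diff[OF gmodD(1)[OF S1(1)]] by blast
    moreover have "p (u + v) - u = v - (u + v - p (u + v))" by simp
    then have "p (u + v) - u \<in> S2" using q that fvs.subspace_diff[OF gmodD(1)[OF S2(1)]] by metis
    ultimately show ?thesis using disj by auto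
  qed
  obtain A where A: "affords G (fmod S1) \<alpha> A" using gmod_affords[OF S1(1)] by blast
  obtain B where B: "affords G (fmod S2) \<alpha> B" using gmod_affords[OF S2(1)] by blast
  obtain \<phi> where h: "A \<in> mreps G" "bij_betw \<phi> S1 (carrier_vec (fst A))"
    "\<And>x y. x \<in> S1 \<Longrightarrow> y \<in> S1 \<Longrightarrow> \<phi> (x + y) = \<phi> x + \<phi> y"
    "\<And>c x. x \<in> S1 \<Longrightarrow> \<phi> (fscale c x) = c \<cdot>\<^sub>v \<phi> x"
    "\<And>g v. g \<in> carrier G \<Longrightarrow> v \<in> S1 \<Longrightarrow> \<phi> (\<alpha> g v) = snd A g *\<^sub>v \<phi> v"
    using affordsE[OF A, unfolded fmod_simps] by metis
  obtain \<psi> where k: "B \<in> mreps G" "bij_betw \<psi> S2 (carrier_vec (fst B))"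
    "\<And>x y. x \<in> S2 \<Longrightarrow> y \<in> S2 \<Longrightarrow> \<psi> (x + y) = \<psi> x + \<psi> y"
    "\<And>c x. x \<in> S2 \<Longrightarrow> \<psi> (fscale c x) = c \<cdot>\<^sub>v \<psi> x"
    "\<And>g v. g \<in> carrier G \<Longrightarrow> v \<in> S2 \<Longrightarrow> \<psi> (\<alpha> g v) = snd B g *\<^sub>v \<psi> v"
    using affordsE[OF B, unfolded fmod_simps] by metis
  have \<phi>c: "x \<in> S1 \<Longrightarrow> \<phi> x \<in> carrier_vec (fst A)" for x using h(2) by (auto simp: bij_betw_def)
  have \<psi>c: "x \<in> S2 \<Longrightarrow> \<psi> x \<in> carrier_vec (fst B)" for x using k(2) by (auto simp: bij_betw_def)
  define \<chi> where "\<chi> w = \<phi> (p w) @\<^sub>v \<psi> (w - p w)" for w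
  have \<chi>: "\<chi> (u + v) = \<phi> u @\<^sub>v \<psi> v" if "u \<in> S1" "v \<in> S2" for u v
    using puv[OF that] by (simp add: \<chi>_def)
  have elim: "\<exists>u\<in>S1. \<exists>v\<in>S2. w = u + v" if "w \<in> S" for w using that unfolding S by blast
  have bij: "bij_betw \<chi> S (carrier_vec (fst A + fst B))"
    unfolding bij_betw_def
  proof (intro conjI inj_onI subset_antisym image_subsetI subsetI)
    fix x y assume "x \<in> S" "y \<in> S" and e: "\<chi> x = \<chi> y"
    then obtain u v u' v' where uv: "u \<in> S1" "v \<in> S2" "x = u + v" "u' \<in> S1" "v' \<in> S2" "y = u' + v'"
      using elim by meson
    then have "\<phi> u = \<phi> u' \<and> \<psi> v = \<psi> v'"
      using e \<phi>c \<psi>c by (simp add: \<chi> append_vec_eq[of _ "fst A"])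
    then have "u = u'" "v = v'" using h(2) k(2) uv by (auto simp: bij_betw_def dest: inj_onD)
    then show "x = y" using uv by simp
  next
    fix x assume "x \<in> S"
    then obtain u v where "u \<in> S1" "v \<in> S2" "x = u + v" using elim by meson
    then show "\<chi> x \<in> carrier_vec (fst A + fst B)" using \<phi>c \<psi>c by (simp add: \<chi>)
  next
    fix z :: "complex Matrix.vec" assume z: "z \<in> carrier_vec (fst A + fst B)"
    have "vec_first z (fst A) \<in> \<phi> ` S1" "vec_last z (fst B) \<in> \<psi> ` S2"
      using h(2) k(2) by (auto simp: bij_betw_def)
    then obtain u v where "u \<in> S1" "v \<in> S2" "vec_first z (fst A) = \<phi> u" "vec_last z (fst B) = \<psi> v" by auto
    then show "z \<in> \<chi> ` S" using z inS \<chi> vec_first_last_append[OF z] by (metis image_eqI)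
  qed
  have "affords G (fmod S) \<alpha> (mrep_sum A B)"
  proof (rule affordsI[where \<phi> = \<chi>])
    show "vectorspace class_ring (fmod S)" by (rule vectorspace_fmod[OF sub])
    show "mrep_sum A B \<in> mreps G" using h k by simp
    fix x assume "x \<in> carrier (fmod S)"
    then obtain u v where uv: "u \<in> S1" "v \<in> S2" "x = u + v" using elim by (metis fmod_simps(1))
    show "\<chi> (c \<odot>\<^bsub>fmod S\<^esub> x) = c \<cdot>\<^sub>v \<chi> x" for c
    proof -
      have "fscale c x = fscale c u + fscale c v" using uv by (simp add: fvs.scale_right_distrib)
      moreover have "fscale c u \<in> S1" "fscale c v \<in> S2"
        using uv fvs.subspace_scale[OF gmodD(1)[OF S1(1)]] fvs.subspace_scale[OF gmodD(1)[OF S2(1)]] by auto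
      ultimately have "\<chi> (fscale c x) = (c \<cdot>\<^sub>v \<phi> u) @\<^sub>v (c \<cdot>\<^sub>v \<psi> v)"
        using \<chi>[of "fscale c u" "fscale c v"] h(4)[OF uv(1)] k(4)[OF uv(2)] by simp
      then show ?thesis unfolding fmod_simps uv(3) \<chi>[OF uv(1,2)] by simp (rule eq_vecI, auto)
    qed
    show "\<chi> (x \<oplus>\<^bsub>fmod S\<^esub> y) = \<chi> x + \<chi> y" if y: "y \<in> carrier (fmod S)" for y
    proof -
      obtain u' v' where uv': "u' \<in> S1" "v' \<in> S2" "y = u' + v'" using elim y by (metis fmod_simps(1))
      have "x + y = (u + u') + (v + v')" using uv uv' by simp
      moreover have "u + u' \<in> S1" "v + v' \<in> S2"
        using uv uv' fvs.subspace_add[OF gmodD(1)[OF S1(1)]] fvs.subspace_add[OF gmodD(1)[OF S2(1)]] by auto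
      ultimately have "\<chi> (x + y) = (\<phi> u + \<phi> u') @\<^sub>v (\<psi> v + \<psi> v')"
        using \<chi>[of "u + u'" "v + v'"] h(3)[OF uv(1) uv'(1)] k(3)[OF uv(2) uv'(2)] by simp
      then show ?thesis
        unfolding fmod_simps uv(3) uv'(3) \<chi>[OF uv(1,2)] \<chi>[OF uv'(1,2)]
        using append_vec_add[OF \<phi>c[OF uv(1)] \<phi>c[OF uv'(1)] \<psi>c[OF uv(2)] \<psi>c[OF uv'(2)]] by simp
    qed
    fix g assume g: "g \<in> carrier G"
    have "\<chi> (\<alpha> g x) = (snd A g *\<^sub>v \<phi> u) @\<^sub>v (snd B g *\<^sub>v \<psi> v)"
      using uv g act[OF g uv(1,2)] gmodD(3)[OF S1(1) g uv(1)] gmodD(3)[OF S2(1) g uv(2)] h(5) k(5)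
      by (simp add: \<chi>)
    moreover have "snd (mrep_sum A B) g *\<^sub>v \<chi> x =
      (snd A g *\<^sub>v \<phi> u + 0\<^sub>m (fst A) (fst B) *\<^sub>v \<psi> v) @\<^sub>v (0\<^sub>m (fst B) (fst A) *\<^sub>v \<phi> u + snd B g *\<^sub>v \<psi> v)"
      using uv mrepsD(1)[OF h(1) g] mrepsD(1)[OF k(1) g] \<phi>c \<psi>c
      by (simp only: mrep_sum_simps \<chi>[OF uv(1,2)] uv(3))
        (rule four_block_mat_mult_vec[of _ "fst A" "fst A" _ "fst B" _ "fst B"]; simp)
    ultimately show "\<chi> (\<alpha> g x) = snd (mrep_sum A B) g *\<^sub>v \<chi> x"
      using uv \<phi>c \<psi>c mrepsD(1)[OF h(1) g] mrepsD(1)[OF k(1) g]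
      by (simp add: zero_mat_mult_vec mult_mat_vec_carrier[of _ "fst A" "fst A"] mult_mat_vec_carrier[of _ "fst B" "fst B"])
    show "\<alpha> g x \<in> carrier (fmod S)" using gmodD(3)[OF gS g] \<open>x \<in> carrier (fmod S)\<close> by simp
  qed (use bij in \<open>simp add: mrep_sum_simps\<close>)
  then show "rep_class G (fmod S) \<alpha> = rep_class G (fmod S1) \<alpha> \<oplus>\<^bsub>rep_ring G\<^esub> rep_class G (fmod S2) \<alpha>"
    using h(1) k(1) by (simp add: rep_class_eq[OF A] rep_class_eq[OF B] rep_class_eq vcl_zero_add)
qed

lemma rep_class_zero:
  assumes "gmod G {0} \<alpha>"
  shows "rep_class G (fmod {0}) \<alpha> = \<zero>\<^bsub>rep_ring G\<^esub>"
proof -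
  have "affords G (fmod {0}) \<alpha> mrep_zero"
  proof (rule affordsI[where \<phi> = "\<lambda>_. 0\<^sub>v 0"])
    show "bij_betw (\<lambda>_. 0\<^sub>v 0) (carrier (fmod {0})) (carrier_vec (fst mrep_zero))"
      by (auto simp: bij_betw_def mrep_zero_def)
    show "\<alpha> g v \<in> carrier (fmod {0})" if "g \<in> carrier G" "v \<in> carrier (fmod {0})" for g v
      using gmodD(3)[OF assms] that by simp
    show "0\<^sub>v 0 = snd mrep_zero g *\<^sub>v 0\<^sub>v 0" for g by (rule eq_vecI) (simp_all add: mrep_zero_def)
  qed (use gmodD(1)[OF assms] in \<open>auto intro: vectorspace_fmod\<close>)
  then show ?thesis by (simp add: rep_class_eq rep_ring_zero)
qed

definition ssum :: "'i set \<Rightarrow> ('i \<Rightarrow> ('x \<Rightarrow> complex) set) \<Rightarrow> ('x \<Rightarrow> complex) set" where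
  "ssum K S = {v. \<exists>f. (\<forall>i\<in>K. f i \<in> S i) \<and> v = (\<Sum>i\<in>K. f i)}"

definition sindep :: "'i set \<Rightarrow> ('i \<Rightarrow> ('x \<Rightarrow> complex) set) \<Rightarrow> bool" where
  "sindep K S \<longleftrightarrow> (\<forall>f. (\<forall>i\<in>K. f i \<in> S i) \<and> (\<Sum>i\<in>K. f i) = 0 \<longrightarrow> (\<forall>i\<in>K. f i = 0))"

lemma ssum_insert:
  assumes "finite K" "x \<notin> K"
  shows "ssum (insert x K) S = {u + v | u v. u \<in> S x \<and> v \<in> ssum K S}"
proof (intro subset_antisym subsetI)
  fix w assume "w \<in> ssum (insert x K) S"
  then obtain f where f: "\<forall>i\<in>insert x K. f i \<in> S i" "w = (\<Sum>i\<in>insert x K. f i)"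
    unfolding ssum_def by blast
  then have "w = f x + (\<Sum>i\<in>K. f i)" using sum.insert[OF assms, of f] by simp
  moreover have "(\<Sum>i\<in>K. f i) \<in> ssum K S" using f unfolding ssum_def by blast
  ultimately show "w \<in> {u + v | u v. u \<in> S x \<and> v \<in> ssum K S}" using f(1) by blast
next
  fix w assume "w \<in> {u + v | u v. u \<in> S x \<and> v \<in> ssum K S}"
  then obtain u f where f: "u \<in> S x" "\<forall>i\<in>K. f i \<in> S i" "w = u + (\<Sum>i\<in>K. f i)"
    unfolding ssum_def by blast
  let ?f = "f(x := u)"
  have "(\<Sum>i\<in>K. ?f i) = (\<Sum>i\<in>K. f i)" using assms(2) by (intro sum.cong) auto
  then have "w = (\<Sum>i\<in>insert x K. ?f i)" using f(3) sum.insert[OF assms, of ?f] by simp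
  moreover have "\<forall>i\<in>insert x K. ?f i \<in> S i" using f assms(2) by auto
  ultimately show "w \<in> ssum (insert x K) S" unfolding ssum_def by blast
qed

text \<open>Induction over K. Independence forces the new summand to meet the sum of the others in
  0: a common vector v, entered with the sign -v at x, completes a family with sum zero.\<close>

lemma rep_class_ssum:
  assumes U: "gmod G U \<alpha>" and fin: "finite K" and S: "\<And>i. i \<in> K \<Longrightarrow> gmod G (S i) \<alpha> \<and> S i \<subseteq> U"
    and ind: "sindep K S"
  shows "gmod G (ssum K S) \<alpha> \<and> ssum K S \<subseteq> U \<and>
    rep_class G (fmod (ssum K S)) \<alpha> = finsum (rep_ring G) (\<lambda>i. rep_class G (fmod (S i)) \<alpha>) K"
  using fin S ind
proof (induction K rule: finite_induct)
  case empty
  have e: "ssum {} S = {0}" by (auto simp: ssum_def)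
  interpret R: cring "rep_ring G" by (rule cring_rep_ring)
  have "\<alpha> g 0 = 0" if "g \<in> carrier G" for g
    using gmodD(5)[OF U that fvs.subspace_0[OF gmodD(1)[OF U]], of 0] by simp
  then have "gmod G {0} \<alpha>"
    using fvs.subspace_0[OF gmodD(1)[OF U]] by (intro gmod_sub[OF U]) auto
  then show ?case using rep_class_zero e fvs.subspace_0[OF gmodD(1)[OF U]] by simp
next
  case (insert x K)
  interpret R: cring "rep_ring G" by (rule cring_rep_ring)
  have 0: "0 \<in> S i" if "i \<in> insert x K" for i using insert.prems(1)[OF that] fvs.subspace_0 gmodD(1) by blast
  have indK: "sindep K S"
    unfolding sindep_def
  proof (intro allI impI)
    fix f assume f: "(\<forall>i\<in>K. f i \<in> S i) \<and> (\<Sum>i\<in>K. f i) = 0"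
    let ?f = "f(x := 0)"
    have "(\<Sum>i\<in>K. ?f i) = (\<Sum>i\<in>K. f i)" using insert.hyps(2) by (intro sum.cong) auto
    then have "(\<Sum>i\<in>insert x K. ?f i) = 0" using f sum.insert[OF insert.hyps, of ?f] by simp
    moreover have "\<forall>i\<in>insert x K. ?f i \<in> S i" using f 0 by auto
    ultimately have "\<forall>i\<in>insert x K. ?f i = 0" using insert.prems(2) unfolding sindep_def by blast
    then show "\<forall>i\<in>K. f i = 0" using insert.hyps(2) by (metis fun_upd_other insertCI)
  qed
  have IH: "gmod G (ssum K S) \<alpha>" "ssum K S \<subseteq> U"
    "rep_class G (fmod (ssum K S)) \<alpha> = finsum (rep_ring G) (\<lambda>i. rep_class G (fmod (S i)) \<alpha>) K"
    using insert.IH[OF _ indK] insert.prems(1) by auto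
  have disj: "S x \<inter> ssum K S \<subseteq> {0}"
  proof
    fix v assume v: "v \<in> S x \<inter> ssum K S"
    then obtain f where f: "\<forall>i\<in>K. f i \<in> S i" "v = (\<Sum>i\<in>K. f i)" unfolding ssum_def by blast
    let ?f = "f(x := - v)"
    have "(\<Sum>i\<in>K. ?f i) = v" unfolding f(2) using insert.hyps(2) by (intro sum.cong) auto
    then have "(\<Sum>i\<in>insert x K. ?f i) = 0" using sum.insert[OF insert.hyps, of ?f] by simp
    moreover have "\<forall>i\<in>insert x K. ?f i \<in> S i"
      using f v insert.prems(1)[of x] fvs.subspace_neg[OF gmodD(1), of G "S x" \<alpha>] by auto
    ultimately have "?f x = 0" using insert.prems(2) unfolding sindep_def by blast
    then show "v \<in> {0}" by simp
  qed
  have x: "gmod G (S x) \<alpha>" "S x \<subseteq> U" using insert.prems(1) by auto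
  note ds = rep_class_direct_sum[OF U x IH(1,2) disj ssum_insert[OF insert.hyps]]
  have "finsum (rep_ring G) (\<lambda>i. rep_class G (fmod (S i)) \<alpha>) (insert x K) =
    rep_class G (fmod (S x)) \<alpha> \<oplus>\<^bsub>rep_ring G\<^esub> finsum (rep_ring G) (\<lambda>i. rep_class G (fmod (S i)) \<alpha>) K"
    using insert.hyps insert.prems(1) by (intro R.finsum_insert) (auto intro!: rep_class_in)
  then show ?case using ds IH(3) by simp
qed

text \<open>Tensoring with a one-dimensional representation keeps the space and multiplies each
  matrix by the scalar \<open>\<chi> g\<close>. A product with the class of a character is therefore
  computed by rescaling the action.\<close>

lemma rep_class_twist:
  assumes S: "gmod G S \<alpha>" and one: "\<chi> \<one>\<^bsub>G\<^esub> = 1"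
    and hom: "\<And>g h. g \<in> carrier G \<Longrightarrow> h \<in> carrier G \<Longrightarrow> \<chi> (g \<otimes>\<^bsub>G\<^esub> h) = \<chi> g * \<chi> h"
  shows "gmod G S (\<lambda>g v. fscale (\<chi> g) (\<alpha> g v))"
    and "rep_class G line_module (\<lambda>g z. \<chi> g * z) \<in> carrier (rep_ring G)"
    and "rep_class G (fmod S) (\<lambda>g v. fscale (\<chi> g) (\<alpha> g v)) =
      rep_class G (fmod S) \<alpha> \<otimes>\<^bsub>rep_ring G\<^esub> rep_class G line_module (\<lambda>g z. \<chi> g * z)"
proof -
  note gD = gmodD[OF S]
  show gm: "gmod G S (\<lambda>g v. fscale (\<chi> g) (\<alpha> g v))"
  proof (rule gmodI)
    show "fscale (\<chi> g) (\<alpha> g v) \<in> S" if "g \<in> carrier G" "v \<in> S" for g v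
      using fvs.subspace_scale[OF gD(1) gD(3)[OF that]] .
  qed (use gD one hom in \<open>auto simp: fvs.scale_right_distrib mult_ac\<close>)
  define X :: "'a mrep" where "X = (1, \<lambda>g. Matrix.mat 1 1 (\<lambda>_. \<chi> g))"
  have X: "X \<in> mreps G"
    by (rule mrepsI) (auto simp: X_def one hom scalar_prod_def intro!: eq_matI)
  have vsl: "vectorspace class_ring line_module"
    by (rule vectorspace_transport[OF vec_vs[where 'a = complex, of 1], where T = "\<lambda>z. Matrix.vec 1 (\<lambda>_. z)"])
      (auto simp: line_module_def module_vec_simps inj_on_def vec_eq_iff)
  have lX: "affords G line_module (\<lambda>g z. \<chi> g * z) X"
  proof (rule affordsI[OF X vsl, where \<phi> = "\<lambda>z. Matrix.vec 1 (\<lambda>_. z)"])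
    show "bij_betw (\<lambda>z. Matrix.vec 1 (\<lambda>_. z)) (carrier line_module) (carrier_vec (fst X))"
      by (rule bij_betw_byWitness[where f' = "\<lambda>v. v $ 0"]) (auto simp: line_module_def X_def)
  qed (auto simp: line_module_def X_def scalar_prod_def intro!: eq_vecI)
  obtain A where A: "affords G (fmod S) \<alpha> A" using gmod_affords[OF S] by blast
  obtain \<phi> where h: "A \<in> mreps G" "bij_betw \<phi> S (carrier_vec (fst A))"
    "\<And>x y. x \<in> S \<Longrightarrow> y \<in> S \<Longrightarrow> \<phi> (x + y) = \<phi> x + \<phi> y"
    "\<And>c x. x \<in> S \<Longrightarrow> \<phi> (fscale c x) = c \<cdot>\<^sub>v \<phi> x"
    "\<And>g v. g \<in> carrier G \<Longrightarrow> v \<in> S \<Longrightarrow> \<phi> (\<alpha> g v) = snd A g *\<^sub>v \<phi> v"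
    using affordsE[OF A, unfolded fmod_simps] by metis
  have "affords G (fmod S) (\<lambda>g v. fscale (\<chi> g) (\<alpha> g v)) (mrep_tensor A X)"
  proof (rule affordsI[where \<phi> = \<phi>])
    show "mrep_tensor A X \<in> mreps G" using h X by simp
    show "vectorspace class_ring (fmod S)" by (rule vectorspace_fmod[OF gD(1)])
    fix g v assume g: "g \<in> carrier G" and v: "v \<in> carrier (fmod S)"
    then show "fscale (\<chi> g) (\<alpha> g v) \<in> carrier (fmod S)" using gmodD(3)[OF gm g] by simp
    have c: "\<phi> v \<in> carrier_vec (fst A)" using h(2) v by (auto simp: bij_betw_def)
    have "snd (mrep_tensor A X) g = \<chi> g \<cdot>\<^sub>m snd A g"
      using mrepsD(1)[OF h(1) g] by (intro eq_matI) (auto simp: mrep_tensor_simps kron_def X_def)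
    then show "\<phi> (fscale (\<chi> g) (\<alpha> g v)) = snd (mrep_tensor A X) g *\<^sub>v \<phi> v"
      using h(4,5) g v gD(3)[OF g] mrepsD(1)[OF h(1) g] c
      by (auto simp: smult_mat_mult_vec[of _ "fst A" "fst A"] intro!: eq_vecI)
  qed (use h in \<open>auto simp: mrep_tensor_simps X_def\<close>)
  from rep_class_eq[OF this] rep_class_eq[OF A] rep_class_eq[OF lX] vcl_zero_mult[OF h(1) X] X
  show "rep_class G line_module (\<lambda>g z. \<chi> g * z) \<in> carrier (rep_ring G)"
    "rep_class G (fmod S) (\<lambda>g v. fscale (\<chi> g) (\<alpha> g v)) =
      rep_class G (fmod S) \<alpha> \<otimes>\<^bsub>rep_ring G\<^esub> rep_class G line_module (\<lambda>g z. \<chi> g * z)"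
    by simp_all
qed

text \<open>The image of a basis is independent and has the same cardinality as the basis, so by the
  exchange bound it spans.\<close>

lemma inj_endo_surj:
  fixes D :: "('x \<Rightarrow> complex) set"
  assumes D: "fvs.subspace D" "finite B0" "D \<subseteq> fvs.span B0"
    and N: "Vector_Spaces.linear fscale fscale N" "N ` D \<subseteq> D" "inj_on N D"
  shows "N ` D = D"
proof -
  obtain B where B: "B \<subseteq> D" "fvs.independent B" "D \<subseteq> fvs.span B" by (rule fvs.maximal_independent_subset)
  have SB: "fvs.span B = D" using B D(1) by (meson fvs.span_minimal subset_antisym)
  have fin: "finite B" using fvs.independent_span_bound[OF D(2) B(2)] B(1) D(3) by auto
  have i: "fvs.independent (N ` B)"
    by (rule fvp.linear_independent_injective_image[OF N(1) B(2)]) (use N(3) SB in simp)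
  have sub: "N ` B \<subseteq> fvs.span B" using B(1) N(2) SB by auto
  have card: "card (N ` B) = card B" using N(3) B(1) by (meson card_image inj_on_subset)
  obtain t where t: "card t = card B" "finite t" "N ` B \<subseteq> t" "B \<subseteq> fvs.span t"
  proof -
    have "B \<subseteq> fvs.span (N ` B)"
    proof (rule ccontr)
      assume "\<not> B \<subseteq> fvs.span (N ` B)"
      then obtain b where b: "b \<in> B" "b \<notin> fvs.span (N ` B)" by blast
      then have "fvs.independent (insert b (N ` B))" using i by (simp add: fvs.independent_insert)
      moreover have "insert b (N ` B) \<subseteq> fvs.span B" using sub b fvs.span_base by auto
      ultimately have "card (insert b (N ` B)) \<le> card B" using fvs.independent_span_bound[OF fin] by blast
      moreover have "b \<notin> N ` B" using b(2) fvs.span_base by blast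
      ultimately show False using card fin by simp
    qed
    then show ?thesis using that[of "N ` B"] card fin by auto
  qed
  have "t = N ` B" using t card by (metis card_subset_eq)
  then have "D \<subseteq> fvs.span (N ` B)" using t(4) SB fvs.span_minimal[OF t(4) fvs.subspace_span] by simp
  also have "fvs.span (N ` B) = N ` fvs.span B"
    by (rule fvp.linear_span_image[OF N(1)])
  finally show ?thesis using N(2) SB by auto
qed

section \<open>Young subgroups and the lexicographic order\<close>

text \<open>The stabilizer of a chain of prefixes. For I inside {1..n - 1} it is the Young subgroup,
  but this form treats one cut at a time: enlarging I shrinks the group, and the transposition of i
  and i + 1 belongs to it exactly if i is not a cut.\<close>

definition yg :: "nat \<Rightarrow> nat set \<Rightarrow> (nat \<Rightarrow> nat) set" where
  "yg n I = {u. u permutes {1..n} \<and> (\<forall>i\<in>I. u ` {1..i} = {1..i})}"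

lemma permutes_image_prefixI:
  assumes "u permutes {1..n}" "i \<le> n" "\<And>k. k \<in> {1..i} \<Longrightarrow> u k \<in> {1..i}"
  shows "u ` {1..i} = {1..(i::nat)}"
proof (rule card_subset_eq)
  show "card (u ` {1..i}) = card {1..i}"
    using permutes_inj[OF assms(1)] by (intro card_image) (auto intro: inj_on_subset)
qed (use assms(3) in auto)

lemma young_subgroup_eq_yg:
  assumes I: "I \<subseteq> {1..n - 1}"
  shows "young_subgroup n I = yg n I"
proof (intro subset_antisym subsetI)
  fix u assume "u \<in> young_subgroup n I"
  then have u: "u permutes {1..n}" "\<And>B. B \<in> young_blocks n I \<Longrightarrow> u ` B = B"
    by (auto simp: young_subgroup_def sym_group_carrier)
  have finI: "finite I" using I finite_subset by blast
  have "u ` {1..i} = {1..i}" if i: "i \<in> I" for i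
  proof (rule permutes_image_prefixI[OF u(1)])
    show "i \<le> n" using subsetD[OF I i] by (metis atLeastAtMost_iff diff_le_self le_trans)
    fix k assume k: "k \<in> {1..i}"
    \<comment> \<open>The nearest cuts on either side of k, so that {a<..b} is the block of k. It
      ends at or before i, because i is itself a cut at or after k.\<close>
    define a where "a = Max {x \<in> insert 0 I. x < k}"
    define b where "b = Min {x \<in> insert n I. k \<le> x}"
    have a: "a \<in> {x \<in> insert 0 I. x < k}" unfolding a_def using finI k by (intro Max_in) auto
    have b: "b \<in> {x \<in> insert n I. k \<le> x}" unfolding b_def using finI k i by (intro Min_in) auto
    have bi: "b \<le> i" unfolding b_def using finI k i by (intro Min_le) auto
    have "x \<le> a" if "x \<in> I" "x < k" for x unfolding a_def using finI that by (intro Max_ge) auto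
    moreover have "b \<le> x" if "x \<in> I" "k \<le> x" for x unfolding b_def using finI that by (intro Min_le) auto
    ultimately have "I \<inter> {a<..<b} = {}" by (meson disjoint_iff greaterThanLessThan_iff leD not_le)
    then have "{a<..b} \<in> young_blocks n I" using a b unfolding young_blocks_def by fastforce
    then have "u k \<in> {a<..b}" using u(2)[of "{a<..b}"] a b by auto
    then show "u k \<in> {1..i}" using bi by auto
  qed
  then show "u \<in> yg n I" using u by (simp add: yg_def)
next
  fix u assume "u \<in> yg n I"
  then have u: "u permutes {1..n}" "\<And>i. i \<in> I \<Longrightarrow> u ` {1..i} = {1..i}" by (auto simp: yg_def)
  have "u ` B = B" if B: "B \<in> young_blocks n I" for B
  proof -
    obtain a b where ab: "B = {a<..b}" "a \<in> insert 0 I" "b \<in> insert n I"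
      using B by (auto simp: young_blocks_def)
    have "u ` {1..a} = {1..a}" "u ` {1..b} = {1..b}"
      using ab(2,3) u permutes_image[OF u(1)] by auto
    moreover have "B = {1..b} - {1..a}" using ab(1) by auto
    ultimately show ?thesis using image_set_diff[OF permutes_inj[OF u(1)], of "{1..b}" "{1..a}"] by simp
  qed
  then show "u \<in> young_subgroup n I" using u by (simp add: young_subgroup_def sym_group_carrier)
qed

lemma ygD: "u \<in> yg n I \<Longrightarrow> u permutes {1..n}"
  by (simp add: yg_def)

lemma finite_perms [simp]: "finite {p. p permutes {1..n::nat}}"
  by (rule finite_permutations) simp

lemma finite_perms_Suc [simp]: "finite {p. p permutes {Suc 0..n}}"
  using finite_perms[of n] by simp

lemma finite_yg [simp]: "finite (yg n I)"
  by (rule finite_subset[OF _ finite_perms[of n]]) (auto simp: yg_def)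

lemma id_in_yg [simp]: "id \<in> yg n I"
  by (simp add: yg_def permutes_id)

lemma comp_in_yg: "u \<in> yg n I \<Longrightarrow> v \<in> yg n I \<Longrightarrow> u \<circ> v \<in> yg n I"
  unfolding yg_def mem_Collect_eq image_comp[symmetric] by (simp add: permutes_compose)

lemma inv_in_yg:
  assumes "u \<in> yg n I"
  shows "inv' u \<in> yg n I"
proof -
  have u: "u permutes {1..n}" by (rule ygD[OF assms])
  have "inv' u ` {1..i} = {1..i}" if "i \<in> I" for i
    using assms that image_inv_f_f[OF permutes_inj[OF u], of "{1..i}"] by (simp add: yg_def)
  then show ?thesis using permutes_inv[OF u] by (simp add: yg_def)
qed

lemma yg_antimono: "I \<subseteq> J \<Longrightarrow> yg n J \<subseteq> yg n I"
  by (auto simp: yg_def)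

lemma transpose_in_yg:
  assumes "i \<in> {1..n - 1}" "i \<notin> I"
  shows "Transposition.transpose i (i + 1) \<in> yg n I"
proof -
  have p: "Transposition.transpose i (i + 1) permutes {1..n}" using assms(1) by (intro permutes_swap_id) auto
  have "Transposition.transpose i (i + 1) ` {1..j} = {1..j}" if "j \<in> I" for j
  proof (cases "i < j")
    case True
    then show ?thesis using assms(1) by (intro transpose_image_eq) auto
  next
    case False
    then have "j < i" using assms(2) that by (metis linorder_neqE_nat)
    then show ?thesis by (intro transpose_image_eq) auto
  qed
  then show ?thesis using p by (simp add: yg_def)
qed

text \<open>All natural numbers serve as positions; permutations of {1..n} agree at 0 and above n,
  so only 1, ..., n can decide. The order plays the part of the length function in picking extreme
  elements of cosets.\<close>

definition lexlt :: "(nat \<Rightarrow> nat) \<Rightarrow> (nat \<Rightarrow> nat) \<Rightarrow> bool" where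
  "lexlt w w' \<longleftrightarrow> (\<exists>p. (\<forall>j<p. w j = w' j) \<and> w p < w' p)"

lemma lexlt_irrefl: "\<not> lexlt w w"
  by (simp add: lexlt_def)

lemma lexlt_trans:
  assumes "lexlt u v" "lexlt v w"
  shows "lexlt u w"
proof -
  obtain p q where p: "\<forall>j<p. u j = v j" "u p < v p" and q: "\<forall>j<q. v j = w j" "v q < w q"
    using assms by (auto simp: lexlt_def)
  have "(\<forall>j<min p q. u j = w j) \<and> u (min p q) < w (min p q)"
    using p q by (cases p q rule: linorder_cases) (auto simp: min_def)
  then show ?thesis unfolding lexlt_def by blast
qed

text \<open>Everything below p is fixed, so injectivity leaves only larger values for
  \<open>u p\<close>. A cut i with p <= i < u p would give a prefix that is preserved by u and
  contains p but not \<open>u p\<close>.\<close>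

lemma yg_first_moved:
  assumes u: "u \<in> yg n I" "u \<noteq> id"
  obtains p where "\<And>j. j < p \<Longrightarrow> u j = j" "p < u p" "u p \<le> n" "1 \<le> p" "\<And>i. p \<le> i \<Longrightarrow> i < u p \<Longrightarrow> i \<notin> I"
proof -
  have perm: "u permutes {1..n}" by (rule ygD[OF u(1)])
  define p where "p = (LEAST p. u p \<noteq> p)"
  obtain q where "u q \<noteq> q" using u(2) by (auto simp: fun_eq_iff)
  then have p: "u p \<noteq> p" unfolding p_def by (rule LeastI)
  have less: "u j = j" if "j < p" for j using that not_less_Least unfolding p_def by blast
  have pin: "p \<in> {1..n}" using p perm by (meson permutes_not_in)
  then have up: "u p \<in> {1..n}" using permutes_in_image[OF perm, of p] by blast
  have gt: "p < u p"
  proof (rule ccontr)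
    assume "\<not> p < u p"
    then have "u (u p) = u p" using p by (intro less) simp
    then show False using p permutes_inj[OF perm] by (metis injD)
  qed
  have "i \<notin> I" if "p \<le> i" "i < u p" for i
  proof
    assume "i \<in> I"
    then have "u ` {1..i} = {1..i}" using u(1) by (simp add: yg_def)
    moreover have "u p \<in> u ` {1..i}" using that pin by auto
    ultimately show False using that by auto
  qed
  then show ?thesis using that[of p] less gt up pin by auto
qed

text \<open>At the first moved position p the value grows from \<open>w p\<close> to
  \<open>w (u p)\<close>, since p and \<open>u p\<close> lie in one block and w increases along it.
  So w is the strict minimum of its coset; descents give the maximum in the same way.\<close>

lemma lexlt_right_mult_asc:
  assumes u: "u \<in> yg n I" "u \<noteq> id" and asc: "\<And>i. i \<in> {1..n - 1} \<Longrightarrow> i \<notin> I \<Longrightarrow> w i < w (i + 1)"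
  shows "lexlt w (w \<circ> u)"
  using u
proof (rule yg_first_moved)
  fix p assume p: "\<And>j. j < p \<Longrightarrow> u j = j" "p < u p" "u p \<le> n" "1 \<le> p" "\<And>i. p \<le> i \<Longrightarrow> i < u p \<Longrightarrow> i \<notin> I"
  have "w p < w (p + Suc k)" if "p + Suc k \<le> u p" for k
    using that
  proof (induction k)
    case 0
    have "w p < w (p + 1)" by (rule asc) (use p in auto)
    then show ?case by simp
  next
    case (Suc k)
    then have "w (p + Suc k) < w (p + Suc k + 1)" using p by (intro asc) auto
    then show ?case using Suc by auto
  qed
  from this[of "u p - p - 1"] have "w p < w (u p)" using p(2) by simp
  then show ?thesis using p(1) by (auto simp: lexlt_def intro!: exI[of _ p])
qed

lemma lexlt_right_mult_desc:
  assumes u: "u \<in> yg n I" "u \<noteq> id" and desc: "\<And>i. i \<in> {1..n - 1} \<Longrightarrow> i \<notin> I \<Longrightarrow> w (i + 1) < w i"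
  shows "lexlt (w \<circ> u) w"
  using u
proof (rule yg_first_moved)
  fix p assume p: "\<And>j. j < p \<Longrightarrow> u j = j" "p < u p" "u p \<le> n" "1 \<le> p" "\<And>i. p \<le> i \<Longrightarrow> i < u p \<Longrightarrow> i \<notin> I"
  have "w (p + Suc k) < w p" if "p + Suc k \<le> u p" for k
    using that
  proof (induction k)
    case 0
    have "w (p + 1) < w p" by (rule desc) (use p in auto)
    then show ?case by simp
  next
    case (Suc k)
    then have "w (p + Suc k + 1) < w (p + Suc k)" using p by (intro desc) auto
    then show ?case using Suc by auto
  qed
  from this[of "u p - p - 1"] have "w (u p) < w p" using p(2) by simp
  then show ?thesis using p(1) by (auto simp: lexlt_def intro!: exI[of _ p])
qed

text \<open>An element of a Young subgroup that ascends inside every block is trivial, so adjacent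
  transpositions generate.\<close>

lemma yg_induct:
  assumes "u \<in> yg n I" and "P id"
    and step: "\<And>v i. v \<in> yg n I \<Longrightarrow> i \<in> {1..n - 1} \<Longrightarrow> i \<notin> I \<Longrightarrow> P v \<Longrightarrow> P (v \<circ> Transposition.transpose i (i + 1))"
  shows "P u"
proof (rule ccontr)
  assume "\<not> P u"
  define A where "A = {v \<in> yg n I. \<not> P v}"
  have "\<exists>m\<in>A. \<forall>x\<in>A. x \<noteq> m \<longrightarrow> \<not> lexlt x m"
  proof (rule Finite_Set.bex_min_element)
    show "finite A" by (simp add: A_def)
    show "asymp_on A lexlt" using lexlt_irrefl lexlt_trans by (blast intro: asymp_onI)
    show "transp_on A lexlt" using lexlt_trans by (blast intro: transp_onI)
    show "A \<noteq> {}" using \<open>\<not> P u\<close> assms(1) by (auto simp: A_def)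
  qed
  then obtain m where m0: "m \<in> A" "\<And>x. x \<in> A \<Longrightarrow> x \<noteq> m \<Longrightarrow> \<not> lexlt x m" by blast
  then have m: "m \<in> yg n I" "\<not> P m" "\<And>x. x \<in> yg n I \<Longrightarrow> \<not> P x \<Longrightarrow> \<not> lexlt x m"
    using lexlt_irrefl[of m] by (auto simp: A_def)
  have perm: "m permutes {1..n}" by (rule ygD[OF m(1)])
  have asc: "m i < m (i + 1)" if i: "i \<in> {1..n - 1}" "i \<notin> I" for i
  proof (rule ccontr)
    assume "\<not> m i < m (i + 1)"
    moreover have "m i \<noteq> m (i + 1)" using permutes_inj[OF perm] by (metis injD n_not_Suc_n Suc_eq_plus1)
    ultimately have lt: "m (i + 1) < m i" by simp
    have "lexlt (m \<circ> Transposition.transpose i (i + 1)) m"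
      unfolding lexlt_def using lt by (intro exI[of _ i]) (auto simp: Transposition.transpose_def)
    then have "P (m \<circ> Transposition.transpose i (i + 1))" using m(3) comp_in_yg[OF m(1) transpose_in_yg[OF i]] by blast
    from step[OF comp_in_yg[OF m(1) transpose_in_yg[OF i]] i this] m(2) show False
      by (simp add: comp_assoc)
  qed
  have "m \<noteq> id" using m(2) assms(2) by auto
  then have "inv' m \<noteq> id" using perm by (metis inv_inv_eq inv_id permutes_bij)
  \<comment> \<open>Now m ascends inside every block. Multiplication by its inverse gives that m
    precedes \<open>id\<close>, whereas \<open>id\<close>, which ascends everywhere, precedes its
    multiple m.\<close>
  from lexlt_right_mult_asc[OF inv_in_yg[OF m(1)] this, of m] asc have "lexlt m id"
    using permutes_inv_o(1)[OF perm] by simp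
  moreover have "lexlt id (id \<circ> m)"
    by (rule lexlt_right_mult_asc[OF m(1) \<open>m \<noteq> id\<close>]) auto
  ultimately show False using lexlt_trans lexlt_irrefl by fastforce
qed

section \<open>Functions on the symmetric group\<close>

lemma sum_apply_fun: "(\<Sum>i\<in>A. f i) x = (\<Sum>i\<in>A. f i x :: complex)"
  by (induction A rule: infinite_finite_induct) auto

definition supp_fun :: "'x set \<Rightarrow> ('x \<Rightarrow> complex) set" where
  "supp_fun X = {f. \<forall>x. x \<notin> X \<longrightarrow> f x = 0}"

lemma supp_funD: "f \<in> supp_fun X \<Longrightarrow> x \<notin> X \<Longrightarrow> f x = 0"
  by (simp add: supp_fun_def)

lemma subspace_supp_fun: "fvs.subspace (supp_fun X)"
  by (rule fvs.subspaceI) (auto simp: supp_fun_def)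

lemma supp_fun_finite_span:
  assumes "finite X"
  shows "\<exists>B. finite B \<and> supp_fun X \<subseteq> fvs.span B"
proof (intro exI conjI subsetI)
  let ?d = "\<lambda>w. (\<lambda>x. if x = w then 1 else 0) :: 'a \<Rightarrow> complex"
  show "finite (?d ` X)" by (rule finite_imageI[OF assms])
  fix \<phi> assume "\<phi> \<in> supp_fun X"
  have "\<phi> = (\<Sum>w\<in>X. fscale (\<phi> w) (?d w))"
  proof
    fix x
    have "(\<Sum>w\<in>X. fscale (\<phi> w) (?d w)) x = (\<Sum>w\<in>X. if x = w then \<phi> w else 0)"
      by (simp add: sum_apply_fun fscale_def if_distrib cong: if_cong)
    also have "\<dots> = \<phi> x" using \<open>\<phi> \<in> supp_fun X\<close> assms by (auto simp: supp_fun_def)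
    finally show "\<phi> x = (\<Sum>w\<in>X. fscale (\<phi> w) (?d w)) x" by simp
  qed
  also have "\<dots> \<in> fvs.span (?d ` X)"
    by (intro fvs.span_sum fvs.span_scale fvs.span_base) auto
  finally show "\<phi> \<in> fvs.span (?d ` X)" .
qed

text \<open>Extension by zero, in place of an unspecified value off the group, makes this a subspace
  of a full function space, where equality of elements is plain equality.\<close>

definition FS :: "nat \<Rightarrow> ((nat \<Rightarrow> nat) \<Rightarrow> complex) set" where
  "FS n = {\<phi>. \<forall>w. \<not> w permutes {1..n} \<longrightarrow> \<phi> w = 0}"

definition ltr :: "(nat \<Rightarrow> nat) \<Rightarrow> ((nat \<Rightarrow> nat) \<Rightarrow> complex) \<Rightarrow> (nat \<Rightarrow> nat) \<Rightarrow> complex" where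
  "ltr \<sigma> \<phi> = (\<lambda>w. \<phi> (inv' \<sigma> \<circ> w))"

text \<open>An averaging operator acting from the right. It commutes with left translation
  (\<open>rop_ltr\<close>), so images of submodules are submodules. Symmetrizers and
  antisymmetrizers are the cases of the trivial and the sign character.\<close>

definition rop :: "(nat \<Rightarrow> nat) set \<Rightarrow> ((nat \<Rightarrow> nat) \<Rightarrow> complex) \<Rightarrow> ((nat \<Rightarrow> nat) \<Rightarrow> complex) \<Rightarrow> (nat \<Rightarrow> nat) \<Rightarrow> complex"
  where "rop H \<chi> \<phi> = (\<lambda>w. \<Sum>u\<in>H. \<chi> u * \<phi> (w \<circ> u))"

definition FI :: "nat \<Rightarrow> nat set \<Rightarrow> ((nat \<Rightarrow> nat) \<Rightarrow> complex) set" where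
  "FI n I = {\<phi> \<in> FS n. \<forall>w. \<forall>u\<in>yg n I. \<phi> (w \<circ> u) = \<phi> w}"

abbreviation Sg :: "nat \<Rightarrow> nat set \<Rightarrow> ((nat \<Rightarrow> nat) \<Rightarrow> complex) \<Rightarrow> (nat \<Rightarrow> nat) \<Rightarrow> complex" where
  "Sg n I \<equiv> rop (yg n I) (\<lambda>_. 1)"

text \<open>The group is cut at the complement of I, hence generated by the transpositions of i and
  i + 1 with i in I. The group of \<open>Sg n I\<close> is generated by the remaining ones.\<close>

abbreviation An :: "nat \<Rightarrow> nat set \<Rightarrow> ((nat \<Rightarrow> nat) \<Rightarrow> complex) \<Rightarrow> (nat \<Rightarrow> nat) \<Rightarrow> complex" where
  "An n I \<equiv> rop (yg n ({1..n - 1} - I)) (\<lambda>u. of_int (sign u))"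

lemma permutes_comp_iff:
  assumes "u permutes S"
  shows "w \<circ> u permutes S \<longleftrightarrow> w permutes S" "u \<circ> w permutes S \<longleftrightarrow> w permutes S"
proof -
  have "w = (w \<circ> u) \<circ> inv' u" "w = inv' u \<circ> (u \<circ> w)"
    using permutes_inv_o[OF assms] by (simp_all add: comp_assoc[symmetric]) (simp add: comp_assoc)
  then show "w \<circ> u permutes S \<longleftrightarrow> w permutes S" "u \<circ> w permutes S \<longleftrightarrow> w permutes S"
    using assms permutes_compose permutes_inv by metis+
qed

lemma subspace_FS: "fvs.subspace (FS n)"
  by (rule fvs.subspaceI) (auto simp: FS_def)

lemma subspace_FI: "fvs.subspace (FI n I)"
  by (rule fvs.subspaceI) (auto simp: FI_def FS_def)

lemma FI_subset_FS: "FI n I \<subseteq> FS n"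
  by (auto simp: FI_def)

lemma FI_mono: "I \<subseteq> J \<Longrightarrow> FI n I \<subseteq> FI n J"
  using yg_antimono[of I J n] unfolding FI_def by blast

lemma FS_finite_span: "\<exists>B. finite B \<and> FS n \<subseteq> fvs.span B"
  using supp_fun_finite_span[OF finite_perms] unfolding FS_def supp_fun_def by simp

lemma gmod_FS: "gmod (sym_group n) (FS n) ltr"
proof (rule gmodI[OF subspace_FS FS_finite_span])
  fix g h \<phi> assume g: "g \<in> carrier (sym_group n)" and h: "h \<in> carrier (sym_group n)"
  have "inv' (g \<circ> h) = inv' h \<circ> inv' g"
    using g h by (intro o_inv_distrib) (auto simp: sym_group_carrier permutes_bij)
  then show "ltr (g \<otimes>\<^bsub>sym_group n\<^esub> h) \<phi> = ltr g (ltr h \<phi>)"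
    by (simp add: ltr_def sym_group_mult comp_assoc)
next
  fix g \<phi> assume "g \<in> carrier (sym_group n)" "\<phi> \<in> FS n"
  then show "ltr g \<phi> \<in> FS n"
    using permutes_comp_iff(2)[OF permutes_inv] by (auto simp: FS_def ltr_def sym_group_carrier)
qed (auto simp: ltr_def sym_group_one fun_eq_iff)

lemma ltr_FI: "\<phi> \<in> FI n I \<Longrightarrow> g \<in> carrier (sym_group n) \<Longrightarrow> ltr g \<phi> \<in> FI n I"
  using gmodD(3)[OF gmod_FS, of g n \<phi>] by (auto simp: FI_def ltr_def comp_assoc[symmetric])

section \<open>Averaging operators and the invariant Hermitian form\<close>

lemma linear_rop: "Vector_Spaces.linear fscale fscale (rop H \<chi>)"
  by unfold_locales (auto simp: rop_def fun_eq_iff algebra_simps sum.distrib sum_distrib_left)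

lemma rop_ltr: "rop H \<chi> (ltr g \<phi>) = ltr g (rop H \<chi> \<phi>)"
  by (simp add: rop_def ltr_def comp_assoc)

text \<open>A group together with a real character of square 1. These properties make
  \<open>rop H \<chi>\<close> self-adjoint and idempotent up to the factor \<open>card H\<close>,
  for the trivial and the sign character alike.\<close>

definition rchar :: "nat \<Rightarrow> (nat \<Rightarrow> nat) set \<Rightarrow> ((nat \<Rightarrow> nat) \<Rightarrow> complex) \<Rightarrow> bool" where
  "rchar n H \<chi> \<longleftrightarrow> (\<forall>u\<in>H. u permutes {1..n}) \<and> id \<in> H \<and> (\<forall>u\<in>H. \<forall>v\<in>H. u \<circ> v \<in> H) \<and> (\<forall>u\<in>H. inv' u \<in> H) \<and>
     (\<forall>u\<in>H. \<forall>v\<in>H. \<chi> (u \<circ> v) = \<chi> u * \<chi> v) \<and> (\<forall>u\<in>H. \<chi> u * \<chi> u = 1) \<and> (\<forall>u\<in>H. cnj (\<chi> u) = \<chi> u)"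

lemma rcharD:
  assumes "rchar n H \<chi>"
  shows "\<And>u. u \<in> H \<Longrightarrow> u permutes {1..n}" "id \<in> H" "\<And>u v. u \<in> H \<Longrightarrow> v \<in> H \<Longrightarrow> u \<circ> v \<in> H"
    "\<And>u. u \<in> H \<Longrightarrow> inv' u \<in> H" "\<And>u v. u \<in> H \<Longrightarrow> v \<in> H \<Longrightarrow> \<chi> (u \<circ> v) = \<chi> u * \<chi> v"
    "\<And>u. u \<in> H \<Longrightarrow> \<chi> u * \<chi> u = 1" "\<And>u. u \<in> H \<Longrightarrow> cnj (\<chi> u) = \<chi> u"
  using assms by (simp_all add: rchar_def)

lemma rchar_one: "rchar n (yg n I) (\<lambda>_. 1)"
  by (auto simp: rchar_def comp_in_yg inv_in_yg dest: ygD)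

lemma permutes_permutation: "u permutes {1..n::nat} \<Longrightarrow> permutation u"
  by (auto simp: permutation_permutes)

lemma sign_comp_yg: "u \<in> yg n I \<Longrightarrow> v \<in> yg n I \<Longrightarrow> sign (u \<circ> v) = sign u * sign v"
  by (rule sign_compose) (auto intro: permutes_permutation ygD)

lemma rchar_sign: "rchar n (yg n I) (\<lambda>u. of_int (sign u))"
  by (auto simp: rchar_def comp_in_yg inv_in_yg sign_comp_yg sign_idempotent simp flip: of_int_mult dest: ygD)

lemma rchar_finite: "rchar n H \<chi> \<Longrightarrow> finite H"
  by (rule finite_subset[OF _ finite_perms[of n]]) (auto simp: rchar_def)

lemma rop_FS:
  assumes "rchar n H \<chi>" "\<phi> \<in> FS n"
  shows "rop H \<chi> \<phi> \<in> FS n"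
proof -
  have "\<phi> (w \<circ> u) = 0" if "\<not> w permutes {1..n}" "u \<in> H" for w u
    using that permutes_comp_iff(1)[OF rcharD(1)[OF assms(1) that(2)], of w] assms(2) unfolding FS_def by blast
  then show ?thesis by (simp add: FS_def rop_def)
qed

lemma rchar_reindex_left:
  assumes "rchar n H \<chi>" "s \<in> H"
  shows "bij_betw (\<lambda>u. s \<circ> u) H H"
  by (rule bij_betw_byWitness[where f' = "\<lambda>u. inv' s \<circ> u"])
    (use assms in \<open>auto simp: comp_assoc[symmetric] permutes_inv_o[OF rcharD(1)[OF assms]] rcharD(3,4)[OF assms(1)]\<close>)

lemma rchar_reindex_right:
  assumes "rchar n H \<chi>" "s \<in> H"
  shows "bij_betw (\<lambda>u. u \<circ> s) H H"
  by (rule bij_betw_byWitness[where f' = "\<lambda>u. u \<circ> inv' s"])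
    (use assms in \<open>auto simp: comp_assoc permutes_inv_o[OF rcharD(1)[OF assms]] rcharD(3,4)[OF assms(1)]\<close>)

lemma rchar_reindex_inv:
  assumes "rchar n H \<chi>"
  shows "bij_betw inv' H H"
  by (rule bij_betw_byWitness[where f' = inv'])
    (use assms in \<open>auto simp: inv_inv_eq permutes_bij[OF rcharD(1)[OF assms]] rcharD(4)[OF assms]\<close>)

lemma rop_shift:
  assumes H: "rchar n H \<chi>" and s: "s \<in> H"
  shows "rop H \<chi> \<phi> (w \<circ> s) = \<chi> s * rop H \<chi> \<phi> w"
proof -
  have "rop H \<chi> \<phi> w = (\<Sum>u\<in>H. \<chi> (s \<circ> u) * \<phi> (w \<circ> (s \<circ> u)))"
    unfolding rop_def using rchar_reindex_left[OF H s] by (intro sum.reindex_bij_betw[symmetric])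
  also have "\<dots> = (\<Sum>u\<in>H. \<chi> s * (\<chi> u * \<phi> (w \<circ> s \<circ> u)))"
    using H s by (intro sum.cong) (auto simp: rchar_def comp_assoc)
  also have "\<dots> = \<chi> s * rop H \<chi> \<phi> (w \<circ> s)" by (simp add: rop_def sum_distrib_left)
  finally show ?thesis using H s by (simp add: rchar_def mult.assoc[symmetric])
qed

lemma rop_rop:
  assumes H: "rchar n H \<chi>"
  shows "rop H \<chi> (rop H \<chi> \<phi>) = fscale (of_nat (card H)) (rop H \<chi> \<phi>)"
proof
  fix w
  have "rop H \<chi> (rop H \<chi> \<phi>) w = (\<Sum>u\<in>H. \<chi> u * \<chi> u * rop H \<chi> \<phi> w)"
    unfolding rop_def[of H \<chi> "rop H \<chi> \<phi>"] using rop_shift[OF H] by (intro sum.cong) (auto simp: mult.assoc)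
  also have "\<dots> = (\<Sum>u\<in>H. rop H \<chi> \<phi> w)" using H by (intro sum.cong) (auto simp: rchar_def)
  finally show "rop H \<chi> (rop H \<chi> \<phi>) w = fscale (of_nat (card H)) (rop H \<chi> \<phi>) w" by simp
qed

lemma rchar_card: "rchar n H \<chi> \<Longrightarrow> (of_nat (card H) :: complex) \<noteq> 0"
  using rchar_finite[of n H \<chi>] rcharD(2)[of n H \<chi>] by auto

lemma Sg_in_FI: "\<phi> \<in> FS n \<Longrightarrow> Sg n I \<phi> \<in> FI n I"
  using rop_FS[OF rchar_one] rop_shift[OF rchar_one] unfolding FI_def by simp

lemma Sg_FI: "\<phi> \<in> FI n I \<Longrightarrow> Sg n I \<phi> = fscale (of_nat (card (yg n I))) \<phi>"
  by (auto simp: FI_def rop_def fun_eq_iff)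

text \<open>The transposition of i and i + 1 lies in both groups: it leaves \<phi> unchanged from
  the right but changes the sign in the alternating sum, which is thus its own negative.\<close>

lemma An_kills:
  assumes \<phi>: "\<phi> \<in> FI n J" and i: "i \<in> {1..n - 1}" "i \<in> I" "i \<notin> J"
  shows "An n I \<phi> = 0"
proof
  fix w
  let ?s = "Transposition.transpose i (i + 1)" and ?H = "yg n ({1..n - 1} - I)"
  have s: "?s \<in> ?H" "?s \<in> yg n J" using transpose_in_yg i by auto
  have sg: "sign (u \<circ> ?s) = - sign u" if "u \<in> ?H" for u
    using that sign_compose[of u ?s] by (simp add: permutes_permutation[OF ygD] sign_swap_id permutation_swap_id)
  have "An n I \<phi> w = (\<Sum>u\<in>?H. of_int (sign (u \<circ> ?s)) * \<phi> (w \<circ> (u \<circ> ?s)))"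
    unfolding rop_def using rchar_reindex_right[OF rchar_sign s(1)] by (intro sum.reindex_bij_betw[symmetric])
  also have "\<dots> = (\<Sum>u\<in>?H. - (of_int (sign u) * \<phi> (w \<circ> u)))"
    using sg \<phi> s(2) by (intro sum.cong) (auto simp: FI_def comp_assoc[symmetric])
  also have "\<dots> = - An n I \<phi> w" by (simp add: rop_def sum_negf)
  finally show "An n I \<phi> w = 0 w" by simp
qed

definition ip :: "nat \<Rightarrow> ((nat \<Rightarrow> nat) \<Rightarrow> complex) \<Rightarrow> ((nat \<Rightarrow> nat) \<Rightarrow> complex) \<Rightarrow> complex" where
  "ip n \<phi> \<psi> = (\<Sum>w\<in>{p. p permutes {1..n}}. \<phi> w * cnj (\<psi> w))"

lemma ip_zero [simp]: "ip n 0 \<psi> = 0" "ip n \<phi> 0 = 0"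
  by (simp_all add: ip_def)

lemma ip_scale: "ip n (fscale c \<phi>) \<psi> = c * ip n \<phi> \<psi>" "ip n \<phi> (fscale c \<psi>) = cnj c * ip n \<phi> \<psi>"
  by (simp_all add: ip_def sum_distrib_left mult_ac)

lemma ip_self_zero:
  assumes "\<phi> \<in> FS n" "ip n \<phi> \<phi> = 0"
  shows "\<phi> = 0"
proof
  fix w
  have "ip n \<phi> \<phi> = of_real (\<Sum>w\<in>{p. p permutes {1..n}}. (norm (\<phi> w))\<^sup>2)"
    unfolding ip_def of_real_sum
    by (intro sum.cong refl) (simp only: complex_norm_square[symmetric])
  then have "(\<Sum>w\<in>{p. p permutes {1..n}}. (norm (\<phi> w))\<^sup>2) = 0"
    using assms(2) of_real_eq_0_iff by metis
  then have "\<forall>w\<in>{p. p permutes {1..n}}. (norm (\<phi> w))\<^sup>2 = 0" by (subst (asm) sum_nonneg_eq_0_iff) auto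
  then show "\<phi> w = 0 w" using assms(1) by (cases "w permutes {1..n}") (auto simp: FS_def)
qed

text \<open>Shifting w by the inverse of u moves the translation to the other argument. Replacing u
  by its inverse restores the shape of the operator, because \<chi> is real and takes the same value
  at u and at its inverse.\<close>

lemma ip_rop:
  assumes H: "rchar n H \<chi>"
  shows "ip n (rop H \<chi> \<phi>) \<psi> = ip n \<phi> (rop H \<chi> \<psi>)"
proof -
  let ?P = "{p. p permutes {1..n}}"
  have "ip n (rop H \<chi> \<phi>) \<psi> = (\<Sum>u\<in>H. \<Sum>w\<in>?P. \<chi> u * \<phi> (w \<circ> u) * cnj (\<psi> w))"
    unfolding ip_def rop_def sum_distrib_right by (rule sum.swap)
  also have "\<dots> = (\<Sum>u\<in>H. \<Sum>w\<in>?P. \<chi> u * \<phi> w * cnj (\<psi> (w \<circ> inv' u)))"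
  proof (rule sum.cong[OF refl])
    fix u assume "u \<in> H"
    then have u: "u permutes {1..n}" using H by (auto simp: rchar_def)
    have "bij_betw (\<lambda>w. w \<circ> inv' u) ?P ?P"
      by (rule bij_betw_byWitness[where f' = "\<lambda>w. w \<circ> u"])
        (use u permutes_inv[OF u] in \<open>auto simp: comp_assoc permutes_inv_o permutes_compose\<close>)
    from sum.reindex_bij_betw[OF this, of "\<lambda>w. \<chi> u * \<phi> (w \<circ> u) * cnj (\<psi> w)"]
    show "(\<Sum>w\<in>?P. \<chi> u * \<phi> (w \<circ> u) * cnj (\<psi> w)) = (\<Sum>w\<in>?P. \<chi> u * \<phi> w * cnj (\<psi> (w \<circ> inv' u)))"
      using u by (simp add: comp_assoc permutes_inv_o)
  qed
  also have "\<dots> = (\<Sum>u\<in>H. \<Sum>w\<in>?P. \<chi> u * \<phi> w * cnj (\<psi> (w \<circ> u)))"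
  proof -
    have "\<chi> (inv' u) = \<chi> u" if "u \<in> H" for u
    proof -
      have 1: "\<chi> id = 1" using rcharD(5)[OF H rcharD(2)[OF H] rcharD(2)[OF H]] rcharD(6)[OF H rcharD(2)[OF H]] by simp
      have "\<chi> u * \<chi> (inv' u) = 1"
        using rcharD(5)[OF H that rcharD(4)[OF H that]] permutes_inv_o(1)[OF rcharD(1)[OF H that]] 1 by simp
      then have "\<chi> u * (\<chi> u * \<chi> (inv' u)) = \<chi> u" by simp
      then show ?thesis using rcharD(6)[OF H that] by (simp add: mult.assoc[symmetric])
    qed
    then have "(\<Sum>u\<in>H. \<Sum>w\<in>?P. \<chi> u * \<phi> w * cnj (\<psi> (w \<circ> inv' u))) =
      (\<Sum>u\<in>H. \<Sum>w\<in>?P. \<chi> (inv' u) * \<phi> w * cnj (\<psi> (w \<circ> inv' u)))"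
      by (intro sum.cong) auto
    then show ?thesis using sum.reindex_bij_betw[OF rchar_reindex_inv[OF H],
        of "\<lambda>u. \<Sum>w\<in>?P. \<chi> u * \<phi> w * cnj (\<psi> (w \<circ> u))"] by simp
  qed
  also have "\<dots> = (\<Sum>w\<in>?P. \<Sum>u\<in>H. \<phi> w * (\<chi> u * cnj (\<psi> (w \<circ> u))))"
    by (subst sum.swap) (simp add: mult_ac)
  also have "\<dots> = ip n \<phi> (rop H \<chi> \<psi>)"
    unfolding ip_def rop_def using H by (intro sum.cong) (auto simp: sum_distrib_left rchar_def)
  finally show ?thesis .
qed

section \<open>Decomposition of the permutation modules\<close>

definition EJ :: "nat \<Rightarrow> nat set \<Rightarrow> ((nat \<Rightarrow> nat) \<Rightarrow> complex) set" where
  "EJ n J = (\<lambda>\<phi>. Sg n J (An n J \<phi>)) ` FS n"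

text \<open>A model, inside \<open>FS n\<close>, of the quotient of \<open>FI n J\<close> by the sum
  of the \<open>FI n (J - {i})\<close> with i in J: by \<open>An_kills\<close> and
  \<open>An_kernel\<close> that sum is the kernel of \<open>An n J\<close> on \<open>FI n J\<close>,
  for J inside {1..n - 1}.\<close>

definition DJ :: "nat \<Rightarrow> nat set \<Rightarrow> ((nat \<Rightarrow> nat) \<Rightarrow> complex) set" where
  "DJ n J = An n J ` FI n J"

lemma linear_rop_add: "rop H \<chi> (\<phi> + \<psi>) = rop H \<chi> \<phi> + rop H \<chi> \<psi>"
  and linear_rop_diff: "rop H \<chi> (\<phi> - \<psi>) = rop H \<chi> \<phi> - rop H \<chi> \<psi>"
  and linear_rop_scale: "rop H \<chi> (fscale c \<phi>) = fscale c (rop H \<chi> \<phi>)"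
  and linear_rop_zero: "rop H \<chi> 0 = 0"
  using fvp.linear_add[OF linear_rop, of H \<chi> \<phi> \<psi>] fvp.linear_diff[OF linear_rop, of H \<chi> \<phi> \<psi>]
    fvp.linear_scale[OF linear_rop, of H \<chi> c \<phi>] fvp.linear_0[OF linear_rop, of H \<chi>] by simp_all

lemma linear_rop_sum: "rop H \<chi> (\<Sum>i\<in>A. f i) = (\<Sum>i\<in>A. rop H \<chi> (f i))"
  using fvp.linear_sum[OF linear_rop, of H \<chi> f A] by simp

lemma subspace_rop_image: "fvs.subspace S \<Longrightarrow> fvs.subspace (rop H \<chi> ` S)"
  by (rule fvp.linear_subspace_image[OF linear_rop])

lemma subspace_EJ: "fvs.subspace (EJ n J)"
  unfolding EJ_def using subspace_rop_image[OF subspace_rop_image[OF subspace_FS]] by (simp add: image_image)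

lemma subspace_DJ: "fvs.subspace (DJ n J)"
  unfolding DJ_def by (rule subspace_rop_image[OF subspace_FI])

lemma EJ_subset_FI: "EJ n J \<subseteq> FI n J"
  unfolding EJ_def using Sg_in_FI rop_FS[OF rchar_sign] by blast

lemma DJ_subset_FS: "DJ n J \<subseteq> FS n"
  unfolding DJ_def using rop_FS[OF rchar_sign] FI_subset_FS by blast

lemma gmod_FI: "gmod (sym_group n) (FI n I) ltr"
  by (rule gmod_sub[OF gmod_FS subspace_FI FI_subset_FS ltr_FI])

lemma gmod_EJ: "gmod (sym_group n) (EJ n J) ltr"
proof (rule gmod_sub[OF gmod_FS subspace_EJ])
  show "EJ n J \<subseteq> FS n" using EJ_subset_FI FI_subset_FS by blast
  fix g \<phi> assume "g \<in> carrier (sym_group n)" "\<phi> \<in> EJ n J"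
  then show "ltr g \<phi> \<in> EJ n J"
    unfolding EJ_def using gmodD(3)[OF gmod_FS] by (auto simp: rop_ltr[symmetric])
qed

lemma gmod_DJ: "gmod (sym_group n) (DJ n J) ltr"
proof (rule gmod_sub[OF gmod_FS subspace_DJ DJ_subset_FS])
  fix g \<phi> assume "g \<in> carrier (sym_group n)" "\<phi> \<in> DJ n J"
  then show "ltr g \<phi> \<in> DJ n J"
    unfolding DJ_def using ltr_FI by (auto simp: rop_ltr[symmetric])
qed

lemma ssumI: "(\<And>i. i \<in> K \<Longrightarrow> f i \<in> S i) \<Longrightarrow> (\<Sum>i\<in>K. f i) \<in> ssum K S"
  unfolding ssum_def by blast

lemma ssum_subspace:
  assumes "\<And>i. i \<in> K \<Longrightarrow> fvs.subspace (S i)"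
  shows "fvs.subspace (ssum K S)"
proof (rule fvs.subspaceI)
  show "0 \<in> ssum K S" using ssumI[of K "\<lambda>_. 0" S] fvs.subspace_0[OF assms] by simp
  fix x y assume "x \<in> ssum K S" "y \<in> ssum K S"
  then obtain f g where f: "\<forall>i\<in>K. f i \<in> S i" "x = (\<Sum>i\<in>K. f i)" and g: "\<forall>i\<in>K. g i \<in> S i" "y = (\<Sum>i\<in>K. g i)"
    unfolding ssum_def by blast
  have "(\<Sum>i\<in>K. f i + g i) \<in> ssum K S" by (rule ssumI) (use f g fvs.subspace_add[OF assms] in blast)
  then show "x + y \<in> ssum K S" unfolding f(2) g(2) sum.distrib .
next
  fix c x assume "x \<in> ssum K S"
  then obtain f where f: "\<forall>i\<in>K. f i \<in> S i" "x = (\<Sum>i\<in>K. f i)" unfolding ssum_def by blast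
  have "(\<Sum>i\<in>K. fscale c (f i)) \<in> ssum K S" by (rule ssumI) (use f fvs.subspace_scale[OF assms] in blast)
  then show "fscale c x \<in> ssum K S" unfolding f(2) fvs.scale_sum_right .
qed

lemma ssum_mono:
  assumes "finite L" "K \<subseteq> L" "\<And>i. i \<in> L \<Longrightarrow> fvs.subspace (S i)"
  shows "ssum K S \<subseteq> ssum L S"
proof
  fix x assume "x \<in> ssum K S"
  then obtain f where f: "\<forall>i\<in>K. f i \<in> S i" "x = (\<Sum>i\<in>K. f i)" unfolding ssum_def by blast
  have "(\<Sum>i\<in>L. if i \<in> K then f i else 0) \<in> ssum L S"
    by (rule ssumI) (use f fvs.subspace_0[OF assms(3)] in auto)
  moreover have "(\<Sum>i\<in>L. if i \<in> K then f i else 0) = x"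
    unfolding f(2) using assms(1,2) by (intro sum.mono_neutral_cong_right) auto
  ultimately show "x \<in> ssum L S" by simp
qed

lemma ssum_single:
  assumes "finite K" "i \<in> K" "v \<in> S i" "\<And>i. i \<in> K \<Longrightarrow> fvs.subspace (S i)"
  shows "v \<in> ssum K S"
proof -
  have "v \<in> ssum {i} S" using ssumI[of "{i}" "\<lambda>_. v" S] assms(3) by simp
  then show ?thesis using ssum_mono[of K "{i}" S] assms by blast
qed

lemma ssum_subset:
  assumes "fvs.subspace V" "\<And>i. i \<in> K \<Longrightarrow> S i \<subseteq> V"
  shows "ssum K S \<subseteq> V"
proof
  fix x assume "x \<in> ssum K S"
  then obtain f where f: "\<forall>i\<in>K. f i \<in> S i" "x = (\<Sum>i\<in>K. f i)" unfolding ssum_def by blast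
  show "x \<in> V" unfolding f(2) by (rule fvs.subspace_sum[OF assms(1)]) (use f(1) assms(2) in blast)
qed

text \<open>Straightening: a lexicographically minimal \<open>w\<close> in the support of \<open>\<phi>\<close> ascends outside \<open>I\<close>.
  If it ascends at some \<open>i \<in> I\<close>, a multiple of the indicator function of a coset is split off;
  otherwise \<open>w\<close> descends exactly at \<open>I\<close> and the antisymmetrization of \<open>\<phi>\<close> takes the value
  \<open>\<phi> w\<close> at \<open>w\<close>.\<close>

lemma An_kernel:
  assumes I: "I \<subseteq> {1..n - 1}" and "\<phi> \<in> FI n I" "An n I \<phi> = 0"
  shows "\<phi> \<in> ssum I (\<lambda>i. FI n (I - {i}))"
  using assms(2,3)
proof (induction "card {x. x permutes {1..n} \<and> (\<exists>w. \<phi> w \<noteq> 0 \<and> (w = x \<or> lexlt w x))}" arbitrary: \<phi> rule: less_induct)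
  case less
  \<comment> \<open>The induction measure is the size of the upward closure of the support in the
    lexicographic order. Splitting off a coset whose minimum is the minimal support element w adds
    nothing to this set and removes w from it.\<close>
  define U where "U \<phi> = {x. x permutes {1..n} \<and> (\<exists>w. \<phi> w \<noteq> 0 \<and> (w = x \<or> lexlt w x))}" for \<phi> :: "(nat \<Rightarrow> nat) \<Rightarrow> complex"
  have finI: "finite I" using I finite_subset by blast
  have sub: "fvs.subspace (ssum I (\<lambda>i. FI n (I - {i})))" by (rule ssum_subspace) (rule subspace_FI)
  have inFS: "\<phi> \<in> FS n" using less.prems(1) FI_subset_FS by blast
  show ?case
  proof (cases "\<phi> = 0")
    case True
    then show ?thesis using fvs.subspace_0[OF sub] by simp
  next
    case False
    define A where "A = {w. \<phi> w \<noteq> 0}"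
    have Aperm: "A \<subseteq> {p. p permutes {1..n}}" using inFS unfolding A_def FS_def by blast
    have "\<exists>m\<in>A. \<forall>x\<in>A. x \<noteq> m \<longrightarrow> \<not> lexlt x m"
    proof (rule Finite_Set.bex_min_element)
      show "finite A" using Aperm finite_perms finite_subset by blast
      show "asymp_on A lexlt" using lexlt_irrefl lexlt_trans by (blast intro: asymp_onI)
      show "transp_on A lexlt" using lexlt_trans by (blast intro: transp_onI)
      show "A \<noteq> {}" using False by (auto simp: A_def fun_eq_iff)
    qed
    then obtain w where w: "\<phi> w \<noteq> 0" and wmin: "\<And>x. lexlt x w \<Longrightarrow> \<phi> x = 0"
      unfolding A_def using lexlt_irrefl by fastforce
    have wp: "w permutes {1..n}" using w Aperm by (auto simp: A_def)
    have neq: "w i \<noteq> w (i + 1)" for i using permutes_inj[OF wp] by (metis injD n_not_Suc_n Suc_eq_plus1)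
    have asc: "w i < w (i + 1)" if i: "i \<in> {1..n - 1}" "i \<notin> I" for i
    proof (rule ccontr)
      assume "\<not> w i < w (i + 1)"
      then have lt: "w (i + 1) < w i" using neq[of i] by simp
      have "lexlt (w \<circ> Transposition.transpose i (i + 1)) w"
        unfolding lexlt_def using lt by (intro exI[of _ i]) (auto simp: Transposition.transpose_def)
      then have "\<phi> (w \<circ> Transposition.transpose i (i + 1)) = 0" by (rule wmin)
      then show False using less.prems(1) transpose_in_yg[OF i] w by (auto simp: FI_def)
    qed
    show ?thesis
    proof (cases "\<exists>i\<in>I. w i < w (i + 1)")
      case True
      then obtain i where i: "i \<in> I" "w i < w (i + 1)" by blast
      define J where "J = I - {i}"
      define C where "C = (\<lambda>u. w \<circ> u) ` yg n J"
      define \<psi> where "\<psi> = (\<lambda>x. if x \<in> C then \<phi> w else 0)"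
      have Cperm: "x permutes {1..n}" if "x \<in> C" for x
        using that wp ygD permutes_compose unfolding C_def by blast
      have wC: "w \<in> C" unfolding C_def by (rule image_eqI[where x = id]) auto
      have Cinv: "x \<circ> u \<in> C \<longleftrightarrow> x \<in> C" if u: "u \<in> yg n J" for x u
      proof -
        have 1: "y \<circ> v \<in> C" if "y \<in> C" "v \<in> yg n J" for y v
          using that comp_in_yg unfolding C_def by (auto simp: comp_assoc)
        have "x = (x \<circ> u) \<circ> inv' u" using permutes_inv_o(1)[OF ygD[OF u]] by (simp add: comp_assoc)
        then show ?thesis using 1[OF _ u] 1[OF _ inv_in_yg[OF u]] by metis
      qed
      have \<psi>: "\<psi> \<in> FI n J" unfolding FI_def FS_def \<psi>_def using Cperm Cinv by auto
      have JI: "J \<subseteq> I" by (auto simp: J_def)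
      have An\<psi>: "An n I \<psi> = 0"
        by (rule An_kills[OF \<psi>, of i]) (use i I in \<open>auto simp: J_def\<close>)
      have "C \<subseteq> {x. x = w \<or> lexlt w x}"
      proof
        fix x assume "x \<in> C"
        then obtain u where u: "u \<in> yg n J" "x = w \<circ> u" unfolding C_def by blast
        show "x \<in> {x. x = w \<or> lexlt w x}"
        proof (cases "u = id")
          case True
          then show ?thesis using u by simp
        next
          case False
          have "lexlt w (w \<circ> u)"
            by (rule lexlt_right_mult_asc[OF u(1) False]) (use asc i in \<open>auto simp: J_def\<close>)
          then show ?thesis using u by simp
        qed
      qed
      then have supp: "\<phi> y \<noteq> 0 \<or> y = w \<or> lexlt w y" if "(\<phi> - \<psi>) y \<noteq> 0" for y
        using that by (auto simp: \<psi>_def split: if_splits)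
      have zero: "(\<phi> - \<psi>) w = 0" using wC by (simp add: \<psi>_def)
      have "U (\<phi> - \<psi>) \<subseteq> U \<phi>"
      proof
        fix x assume "x \<in> U (\<phi> - \<psi>)"
        then obtain y where x: "x permutes {1..n}" and y: "(\<phi> - \<psi>) y \<noteq> 0" "y = x \<or> lexlt y x"
          unfolding U_def by blast
        have "\<exists>z. \<phi> z \<noteq> 0 \<and> (z = x \<or> lexlt z x)"
          using supp[OF y(1)] y(2) w lexlt_trans by blast
        then show "x \<in> U \<phi>" using x unfolding U_def by blast
      qed
      moreover have "w \<in> U \<phi>" unfolding U_def using w wp by blast
      moreover have "w \<notin> U (\<phi> - \<psi>)"
      proof
        assume "w \<in> U (\<phi> - \<psi>)"
        then obtain y where y: "(\<phi> - \<psi>) y \<noteq> 0" "y = w \<or> lexlt y w" unfolding U_def by blast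
        then have "lexlt y w" "y \<noteq> w" using zero by auto
        then show False using supp[OF y(1)] wmin lexlt_trans lexlt_irrefl by blast
      qed
      moreover have "finite (U \<phi>)" unfolding U_def by (rule finite_subset[OF _ finite_perms[of n]]) auto
      ultimately have "card (U (\<phi> - \<psi>)) < card (U \<phi>)" by (metis psubsetI psubset_card_mono)
      moreover have "\<phi> - \<psi> \<in> FI n I"
        using less.prems(1) \<psi> FI_mono[OF JI] fvs.subspace_diff[OF subspace_FI] by blast
      moreover have "An n I (\<phi> - \<psi>) = 0" using less.prems(2) An\<psi> by (simp add: linear_rop_diff)
      ultimately have "\<phi> - \<psi> \<in> ssum I (\<lambda>i. FI n (I - {i}))" using less.hyps unfolding U_def by blast
      moreover have "\<psi> \<in> ssum I (\<lambda>i. FI n (I - {i}))"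
        by (rule ssum_single[OF finI i(1)]) (use \<psi> subspace_FI in \<open>auto simp: J_def\<close>)
      ultimately have "(\<phi> - \<psi>) + \<psi> \<in> ssum I (\<lambda>i. FI n (I - {i}))" using fvs.subspace_add[OF sub] by blast
      then show ?thesis by simp
    next
      case no: False
      let ?H = "yg n ({1..n - 1} - I)"
      have "An n I \<phi> w = (\<Sum>u\<in>?H. if u = id then \<phi> w else 0)"
        unfolding rop_def
      proof (rule sum.cong[OF refl])
        fix u assume u: "u \<in> ?H"
        show "of_int (sign u) * \<phi> (w \<circ> u) = (if u = id then \<phi> w else 0)"
        proof (cases "u = id")
          case False
          have "lexlt (w \<circ> u) w"
            by (rule lexlt_right_mult_desc[OF u False]) (use no neq in \<open>auto simp: nat_neq_iff\<close>)
          then show ?thesis using wmin False by simp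
        qed simp
      qed
      then have "An n I \<phi> w = \<phi> w" by simp
      then show ?thesis using w less.prems(2) by simp
    qed
  qed
qed

section \<open>Interaction of symmetrization and antisymmetrization\<close>

lemma An_An: "An n J (An n J \<phi>) = fscale (of_nat (card (yg n ({1..n - 1} - J)))) (An n J \<phi>)"
  by (rule rop_rop[OF rchar_sign])

lemma Sg_Sg: "Sg n J (Sg n J \<phi>) = fscale (of_nat (card (yg n J))) (Sg n J \<phi>)"
  by (rule rop_rop[OF rchar_one])

text \<open>Both operators are self-adjoint and idempotent up to a positive factor.\<close>

lemma Sg_An_eq_zero:
  assumes "\<phi> \<in> FS n" "An n J (Sg n J (An n J \<phi>)) = 0"
  shows "Sg n J (An n J \<phi>) = 0"
proof (rule ip_self_zero)
  show "Sg n J (An n J \<phi>) \<in> FS n" using assms(1) rop_FS[OF rchar_one] rop_FS[OF rchar_sign] by blast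
  have "ip n (An n J \<phi>) (Sg n J (An n J \<phi>)) = ip n \<phi> (An n J (Sg n J (An n J \<phi>)))"
    by (rule ip_rop[OF rchar_sign])
  then have "ip n (An n J \<phi>) (Sg n J (An n J \<phi>)) = 0" using assms(2) by simp
  moreover have "ip n (Sg n J (An n J \<phi>)) (Sg n J (An n J \<phi>)) = ip n (An n J \<phi>) (Sg n J (Sg n J (An n J \<phi>)))"
    by (rule ip_rop[OF rchar_one])
  ultimately show "ip n (Sg n J (An n J \<phi>)) (Sg n J (An n J \<phi>)) = 0"
    by (simp only: Sg_Sg ip_scale mult_zero_right)
qed

text \<open>Invariance lets \<psi> be replaced, up to a factor, by its symmetrization. Moving both
  operators across the form leaves \<open>Sg n J (An n J ?d)\<close>, which is a multiple of
  \<open>Sg n J (An n J \<psi>)\<close> because \<open>?d\<close> is already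
  antisymmetrized.\<close>

lemma An_Sg_eq_zero:
  assumes "\<psi> \<in> FI n J" "Sg n J (An n J \<psi>) = 0"
  shows "An n J \<psi> = 0"
proof (rule ip_self_zero)
  let ?d = "An n J \<psi>" and ?c = "of_nat (card (yg n J)) :: complex"
  show "?d \<in> FS n" using assms(1) rop_FS[OF rchar_sign] FI_subset_FS by blast
  have "?c * ip n ?d ?d = ip n (fscale ?c ?d) ?d" by (simp add: ip_scale)
  also have "\<dots> = ip n (An n J (Sg n J \<psi>)) ?d" using Sg_FI[OF assms(1)] by (simp add: linear_rop_scale)
  also have "\<dots> = ip n (Sg n J \<psi>) (An n J ?d)" by (rule ip_rop[OF rchar_sign])
  also have "\<dots> = ip n \<psi> (Sg n J (An n J ?d))" by (rule ip_rop[OF rchar_one])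
  also have "Sg n J (An n J ?d) = 0"
    by (simp only: An_An linear_rop_scale assms(2) fvs.scale_zero_right)
  finally have "?c * ip n ?d ?d = 0" by (simp only: ip_zero)
  then show "ip n ?d ?d = 0" using rchar_card[OF rchar_one, of n J] by (simp only: mult_eq_0_iff) blast
qed

text \<open>On \<open>DJ n J\<close> the map \<open>?N\<close> is injective by the two preceding
  lemmas, hence onto by finite dimension. Since \<open>Sg n J\<close> sends \<open>DJ n J\<close>
  into \<open>EJ n J\<close>, every antisymmetrization of an element of \<open>FI n J\<close> is
  also one of an element of \<open>EJ n J\<close>.\<close>

lemma An_FI_subset: "An n J ` FI n J \<subseteq> An n J ` EJ n J"
proof -
  let ?D = "DJ n J" and ?N = "\<lambda>\<phi>. An n J (Sg n J \<phi>)"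
  obtain B where B: "finite B" "FS n \<subseteq> fvs.span B" using FS_finite_span by blast
  have lin: "Vector_Spaces.linear fscale fscale ?N"
    using Vector_Spaces.linear_compose[OF linear_rop linear_rop] by (simp add: comp_def)
  have "?N ` ?D \<subseteq> ?D" unfolding DJ_def
    using Sg_in_FI rop_FS[OF rchar_sign] FI_subset_FS by blast
  moreover have "inj_on ?N ?D"
  proof (rule inj_onI)
    fix x y assume xy: "x \<in> ?D" "y \<in> ?D" "?N x = ?N y"
    then obtain z where z: "z \<in> FI n J" "x - y = An n J z"
      using fvs.subspace_diff[OF subspace_DJ] unfolding DJ_def by blast
    have "?N (x - y) = 0" using xy(3) by (simp add: linear_rop_diff)
    then have "Sg n J (An n J z) = 0" using Sg_An_eq_zero[of z n J] z FI_subset_FS by auto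
    then have "An n J z = 0" by (rule An_Sg_eq_zero[OF z(1)])
    then show "x = y" using z(2) by simp
  qed
  ultimately have "?N ` ?D = ?D"
    using inj_endo_surj[OF subspace_DJ B(1) _ lin] B(2) DJ_subset_FS by blast
  moreover have "Sg n J ` ?D \<subseteq> EJ n J" unfolding DJ_def EJ_def using FI_subset_FS by blast
  ultimately show ?thesis unfolding DJ_def by blast
qed

text \<open>Triangularity with respect to inclusion. For an inclusion-maximal J with nonzero term,
  \<open>An n J\<close> kills the term of every K that does not contain J, and the terms of larger K
  vanish. This leaves \<open>An n J (f J) = 0\<close>, where \<open>f J\<close> has the form
  required by \<open>Sg_An_eq_zero\<close>.\<close>

lemma sindep_EJ: "sindep (Pow {1..n - 1}) (EJ n)"
  unfolding sindep_def
proof (intro allI impI)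
  fix f assume f: "(\<forall>J\<in>Pow {1..n - 1}. f J \<in> EJ n J) \<and> (\<Sum>J\<in>Pow {1..n - 1}. f J) = 0"
  show "\<forall>J\<in>Pow {1..n - 1}. f J = 0"
  proof (rule ccontr)
    assume "\<not> ?thesis"
    then have "{J \<in> Pow {1..n - 1}. f J \<noteq> 0} \<noteq> {}" by blast
    moreover define A where "A = {J \<in> Pow {1..n - 1}. f J \<noteq> 0}"
    ultimately have ne: "A \<noteq> {}" by simp
    have fin: "finite A" by (simp add: A_def)
    obtain J where J': "J \<in> A" and Jmax': "\<forall>K\<in>A. J \<le> K \<longrightarrow> J = K" using finite_has_maximal[OF fin ne] by blast
    have J: "J \<in> Pow {1..n - 1}" "f J \<noteq> 0" using J' by (simp_all add: A_def)
    have Jmax: "f K = 0" if "K \<in> Pow {1..n - 1}" "J \<subseteq> K" "K \<noteq> J" for K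
      using Jmax' that unfolding A_def by blast
    have "0 = An n J (\<Sum>K\<in>Pow {1..n - 1}. f K)" using f by (simp only: linear_rop_zero)
    also have "\<dots> = (\<Sum>K\<in>Pow {1..n - 1}. An n J (f K))" by (rule linear_rop_sum)
    also have "\<dots> = (\<Sum>K\<in>{J}. An n J (f K))"
    proof (rule sum.mono_neutral_right)
      show "\<forall>K\<in>Pow {1..n - 1} - {J}. An n J (f K) = 0"
      proof
        fix K assume K: "K \<in> Pow {1..n - 1} - {J}"
        show "An n J (f K) = 0"
        proof (cases "J \<subseteq> K")
          case True
          then have "f K = 0" using Jmax[of K] K by blast
          then show ?thesis by (simp only: linear_rop_zero)
        next
          case False
          then obtain i where "i \<in> J" "i \<notin> K" by blast
          moreover have "f K \<in> FI n K" using f K EJ_subset_FI by blast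
          ultimately show ?thesis using An_kills[of "f K" n K i J] J by blast
        qed
      qed
    qed (use J in auto)
    finally have "An n J (f J) = 0" by simp
    moreover have "f J \<in> EJ n J" using f J by blast
    then obtain \<phi> where "\<phi> \<in> FS n" "f J = Sg n J (An n J \<phi>)" unfolding EJ_def by blast
    ultimately have "f J = 0" using Sg_An_eq_zero[of \<phi> n J] by simp
    then show False using J by blast
  qed
qed

text \<open>Induction on \<open>card I\<close>. An element of \<open>FI n I\<close> is corrected by
  an element of \<open>EJ n I\<close> with the same antisymmetrization; the difference lies in the
  kernel of \<open>An n I\<close>, which is a sum over smaller index sets.\<close>

lemma FI_eq_ssum_EJ:
  assumes "I \<subseteq> {1..n - 1}"
  shows "FI n I = ssum (Pow I) (EJ n)"
proof
  show "ssum (Pow I) (EJ n) \<subseteq> FI n I"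
    by (rule ssum_subset[OF subspace_FI]) (use EJ_subset_FI FI_mono in blast)
  have "finite I" using assms finite_subset by blast
  then show "FI n I \<subseteq> ssum (Pow I) (EJ n)" using assms
  proof (induction "card I" arbitrary: I rule: less_induct)
    case less
    have subE: "fvs.subspace (ssum (Pow I) (EJ n))" by (rule ssum_subspace) (rule subspace_EJ)
    show ?case
    proof
      fix \<phi> assume \<phi>: "\<phi> \<in> FI n I"
      then obtain \<epsilon> where \<epsilon>: "\<epsilon> \<in> EJ n I" "An n I \<phi> = An n I \<epsilon>" using An_FI_subset by blast
      have "\<phi> - \<epsilon> \<in> FI n I" using \<phi> \<epsilon> EJ_subset_FI fvs.subspace_diff[OF subspace_FI] by blast
      moreover have "An n I (\<phi> - \<epsilon>) = 0" using \<epsilon>(2) by (simp add: linear_rop_diff)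
      ultimately have "\<phi> - \<epsilon> \<in> ssum I (\<lambda>i. FI n (I - {i}))" by (rule An_kernel[OF less.prems(2)])
      moreover have "ssum I (\<lambda>i. FI n (I - {i})) \<subseteq> ssum (Pow I) (EJ n)"
      proof (rule ssum_subset[OF subE])
        fix i assume i: "i \<in> I"
        have "FI n (I - {i}) \<subseteq> ssum (Pow (I - {i})) (EJ n)"
          by (rule less.hyps[OF card_Diff1_less]) (use i less.prems in auto)
        also have "\<dots> \<subseteq> ssum (Pow I) (EJ n)"
          by (rule ssum_mono) (use less.prems subspace_EJ in auto)
        finally show "FI n (I - {i}) \<subseteq> ssum (Pow I) (EJ n)" .
      qed
      moreover have "\<epsilon> \<in> ssum (Pow I) (EJ n)"
        by (rule ssum_single[of _ I]) (use less.prems subspace_EJ \<epsilon> in auto)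
      ultimately have "(\<phi> - \<epsilon>) + \<epsilon> \<in> ssum (Pow I) (EJ n)" using fvs.subspace_add[OF subE] by blast
      then show "\<phi> \<in> ssum (Pow I) (EJ n)" by simp
    qed
  qed
qed

lemma sindep_subset:
  assumes "sindep L S" "finite L" "K \<subseteq> L" "\<And>i. i \<in> L \<Longrightarrow> 0 \<in> S i"
  shows "sindep K S"
  unfolding sindep_def
proof (intro allI impI)
  fix f assume f: "(\<forall>i\<in>K. f i \<in> S i) \<and> (\<Sum>i\<in>K. f i) = 0"
  let ?f = "\<lambda>i. if i \<in> K then f i else 0"
  have "(\<Sum>i\<in>L. ?f i) = (\<Sum>i\<in>K. f i)"
    using assms(2,3) by (intro sum.mono_neutral_cong_right) auto
  then have "(\<Sum>i\<in>L. ?f i) = 0" using f by (simp only:)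
  moreover have "\<forall>i\<in>L. ?f i \<in> S i" using f assms(4) by auto
  ultimately have *: "\<forall>i\<in>L. ?f i = 0" using assms(1)[unfolded sindep_def, THEN spec, of ?f, THEN mp] by blast
  show "\<forall>i\<in>K. f i = 0"
  proof
    fix i assume "i \<in> K"
    then show "f i = 0" using bspec[OF *, of i] assms(3) by auto
  qed
qed

section \<open>Classes of the summands and the twist by the sign\<close>

definition eclass :: "nat \<Rightarrow> nat set \<Rightarrow> ((nat \<Rightarrow> nat) mrep \<times> (nat \<Rightarrow> nat) mrep) set" where
  "eclass n J = rep_class (sym_group n) (fmod (EJ n J)) ltr"

lemma eclass_in: "eclass n J \<in> carrier (RS n)"
  unfolding eclass_def RS_def by (rule rep_class_in[OF gmod_EJ])

lemma rep_class_FI: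
  assumes "I \<subseteq> {1..n - 1}"
  shows "rep_class (sym_group n) (fmod (FI n I)) ltr = finsum (RS n) (eclass n) (Pow I)"
proof -
  have fin: "finite (Pow I)" using assms finite_subset by auto
  have "sindep (Pow I) (EJ n)"
    by (rule sindep_subset[OF sindep_EJ]) (use assms fvs.subspace_0[OF subspace_EJ] in auto)
  then have "rep_class (sym_group n) (fmod (ssum (Pow I) (EJ n))) ltr =
    finsum (rep_ring (sym_group n)) (\<lambda>i. rep_class (sym_group n) (fmod (EJ n i)) ltr) (Pow I)"
    using rep_class_ssum[OF gmod_FS fin, where S = "EJ n"] gmod_EJ EJ_subset_FI FI_subset_FS by blast
  then show ?thesis unfolding FI_eq_ssum_EJ[OF assms] RS_def eclass_def .
qed

definition tw :: "((nat \<Rightarrow> nat) \<Rightarrow> complex) \<Rightarrow> (nat \<Rightarrow> nat) \<Rightarrow> complex" where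
  "tw \<phi> = (\<lambda>w. of_int (sign w) * \<phi> w)"

lemma tw_tw: "tw (tw \<phi>) = \<phi>"
proof
  fix w :: "nat \<Rightarrow> nat"
  have "of_int (sign w) * (of_int (sign w) * \<phi> w) = of_int (sign w * sign w) * \<phi> w"
    by (simp only: of_int_mult mult.assoc)
  then show "tw (tw \<phi>) w = \<phi> w" by (simp add: tw_def)
qed

lemma tw_add: "tw (\<phi> + \<psi>) = tw \<phi> + tw \<psi>"
  and tw_scale: "tw (fscale c \<phi>) = fscale c (tw \<phi>)"
  and tw_zero: "tw 0 = 0"
  by (auto simp: tw_def fun_eq_iff algebra_simps)

lemma tw_sum: "tw (\<Sum>i\<in>A. f i) = (\<Sum>i\<in>A. tw (f i))"
proof (induction A rule: infinite_finite_induct)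
  case (insert x F)
  then show ?case by (simp only: sum.insert[OF insert.hyps(1,2)] tw_add)
qed (simp_all only: sum.infinite sum.empty tw_zero not_False_eq_True)

lemma tw_FS: "\<phi> \<in> FS n \<Longrightarrow> tw \<phi> \<in> FS n"
  by (simp add: tw_def FS_def)

lemma sign_comp_permutes: "u permutes {1..n::nat} \<Longrightarrow> v permutes {1..n} \<Longrightarrow> sign (u \<circ> v) = sign u * sign v"
  by (rule sign_compose) (auto intro: permutes_permutation)

lemma tw_rop:
  assumes "rchar n H \<chi>" "\<phi> \<in> FS n" and \<chi>': "\<And>u. u \<in> H \<Longrightarrow> \<chi>' u = of_int (sign u) * \<chi> u"
  shows "tw (rop H \<chi> \<phi>) = rop H \<chi>' (tw \<phi>)"
proof
  fix w
  show "tw (rop H \<chi> \<phi>) w = rop H \<chi>' (tw \<phi>) w"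
  proof (cases "w permutes {1..n}")
    case True
    have "of_int (sign w) * (\<chi> u * \<phi> (w \<circ> u)) = \<chi>' u * (of_int (sign (w \<circ> u)) * \<phi> (w \<circ> u))" if u: "u \<in> H" for u
    proof -
      have ss: "of_int (sign u) * of_int (sign u) = (1 :: complex)" by (simp flip: of_int_mult)
      have "\<chi>' u * (of_int (sign (w \<circ> u)) * \<phi> (w \<circ> u)) =
        (of_int (sign u) * of_int (sign u)) * (of_int (sign w) * (\<chi> u * \<phi> (w \<circ> u)))"
        by (simp only: sign_comp_permutes[OF True rcharD(1)[OF assms(1) u]] \<chi>'[OF u] of_int_mult mult_ac)
      then show ?thesis unfolding ss mult_1_left by (rule sym)
    qed
    then show ?thesis unfolding tw_def rop_def sum_distrib_left by (intro sum.cong) auto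
  next
    case False
    then have "rop H \<chi> \<phi> w = 0" using rop_FS[OF assms(1,2)] by (auto simp: FS_def)
    moreover have "tw \<phi> (w \<circ> u) = 0" if "u \<in> H" for u
      using False permutes_comp_iff(1)[OF rcharD(1)[OF assms(1) that], of w] tw_FS[OF assms(2)] unfolding FS_def by blast
    ultimately show ?thesis by (simp add: tw_def[of "rop H \<chi> \<phi>"] rop_def[of H \<chi>'])
  qed
qed

text \<open>On \<open>FI n I\<close> the symmetrizer multiplies by the order of the group, which is
  invertible in the complex numbers.\<close>

lemma FI_eq_Sg_image: "FI n I = Sg n I ` FS n"
proof
  show "Sg n I ` FS n \<subseteq> FI n I" using Sg_in_FI by blast
  show "FI n I \<subseteq> Sg n I ` FS n"
  proof
    fix \<phi> assume \<phi>: "\<phi> \<in> FI n I"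
    let ?c = "of_nat (card (yg n I)) :: complex"
    have "Sg n I (fscale (1 / ?c) \<phi>) = fscale (1 / ?c) (fscale ?c \<phi>)"
      by (simp only: linear_rop_scale Sg_FI[OF \<phi>])
    also have "\<dots> = \<phi>" using rchar_card[OF rchar_one, of n I] by (simp add: fun_eq_iff)
    finally have "Sg n I (fscale (1 / ?c) \<phi>) = \<phi>" .
    moreover have "fscale (1 / ?c) \<phi> \<in> FS n" using \<phi> FI_subset_FS fvs.subspace_scale[OF subspace_FS] by blast
    ultimately show "\<phi> \<in> Sg n I ` FS n" by force
  qed
qed

text \<open>Multiplication by the sign exchanges the trivial and the sign character in
  \<open>rop\<close> and keeps the group. The group of \<open>An n I\<close> is that of
  \<open>Sg\<close> at the complement of I, and the group of \<open>Sg n I\<close> is that of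
  \<open>An\<close> at the complement.\<close>

lemma tw_An_Sg:
  assumes "I \<subseteq> {1..n - 1}" "\<phi> \<in> FS n"
  shows "tw (An n I (Sg n I \<phi>)) = Sg n ({1..n - 1} - I) (An n ({1..n - 1} - I) (tw \<phi>))"
proof -
  have II: "{1..n - 1} - ({1..n - 1} - I) = I" using assms(1) by blast
  have "tw (An n I (Sg n I \<phi>)) = Sg n ({1..n - 1} - I) (tw (Sg n I \<phi>))"
  proof (rule tw_rop[OF rchar_sign rop_FS[OF rchar_one assms(2)]])
    show "1 = of_int (sign u) * (of_int (sign u) :: complex)" for u :: "nat \<Rightarrow> nat"
      by (simp flip: of_int_mult)
  qed
  also have "tw (Sg n I \<phi>) = rop (yg n I) (\<lambda>u. of_int (sign u)) (tw \<phi>)"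
    by (rule tw_rop[OF rchar_one assms(2)]) simp
  finally show ?thesis unfolding II .
qed

lemma tw_DJ:
  assumes "I \<subseteq> {1..n - 1}"
  shows "tw ` DJ n I = EJ n ({1..n - 1} - I)"
proof -
  have "tw ` DJ n I = (\<lambda>\<phi>. tw (An n I (Sg n I \<phi>))) ` FS n"
    unfolding DJ_def FI_eq_Sg_image by (simp only: image_image)
  also have "\<dots> = (\<lambda>\<phi>. Sg n ({1..n - 1} - I) (An n ({1..n - 1} - I) \<phi>)) ` tw ` FS n"
    unfolding image_image by (intro image_cong refl tw_An_Sg assms)
  also have "tw ` FS n = FS n" using tw_FS tw_tw by (metis (no_types, opaque_lifting) image_eqI image_subsetI subsetI subset_antisym)
  finally show ?thesis unfolding EJ_def .
qed

text \<open>Transferred from \<open>sindep_EJ\<close>: multiplication by the sign carries this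
  family to that one, reindexed by complements.\<close>

lemma sindep_DJ: "sindep (Pow {1..n - 1}) (DJ n)"
  unfolding sindep_def
proof (intro allI impI)
  let ?c = "\<lambda>J. {1..n - 1} - J"
  fix f assume f: "(\<forall>J\<in>Pow {1..n - 1}. f J \<in> DJ n J) \<and> (\<Sum>J\<in>Pow {1..n - 1}. f J) = 0"
  have bij: "bij_betw ?c (Pow {1..n - 1}) (Pow {1..n - 1})"
    by (rule bij_betw_byWitness[where f' = ?c]) auto
  have cc: "?c (?c J) = J" if "J \<in> Pow {1..n - 1}" for J using that by blast
  let ?g = "\<lambda>J. tw (f (?c J))"
  have "(\<Sum>J\<in>Pow {1..n - 1}. ?g J) = (\<Sum>J\<in>Pow {1..n - 1}. tw (f J))"
    by (rule sum.reindex_bij_betw[OF bij, of "\<lambda>J. tw (f J)"])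
  also have "\<dots> = 0" using f by (simp only: tw_sum[symmetric] tw_zero)
  finally have "(\<Sum>J\<in>Pow {1..n - 1}. ?g J) = 0" .
  moreover have "\<forall>J\<in>Pow {1..n - 1}. ?g J \<in> EJ n J"
  proof
    fix J assume J: "J \<in> Pow {1..n - 1}"
    have "f (?c J) \<in> DJ n (?c J)" using f by blast
    then have "?g J \<in> EJ n (?c (?c J))" using tw_DJ[of "?c J" n] by blast
    then show "?g J \<in> EJ n J" using cc[OF J] by simp
  qed
  ultimately have *: "\<forall>J\<in>Pow {1..n - 1}. ?g J = 0"
    using sindep_EJ[of n, unfolded sindep_def, THEN spec, of ?g, THEN mp] by blast
  show "\<forall>J\<in>Pow {1..n - 1}. f J = 0"
  proof
    fix J assume J: "J \<in> Pow {1..n - 1}"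
    have "?c J \<in> Pow {1..n - 1}" by blast
    then have "tw (f J) = 0" using bspec[OF *, of "?c J"] by (simp only: cc[OF J])
    then show "f J = 0" using tw_tw[of "f J"] tw_zero by metis
  qed
qed

text \<open>Multiplication by the sign intertwines the sign-twisted left translation with the plain
  one, as the sign of the inverse of g times w is the product of the signs of g and w.\<close>

lemma rep_class_DJ_twist:
  assumes I: "I \<subseteq> {1..n - 1}"
  shows "rep_class (sym_group n) (fmod (DJ n I)) ltr \<otimes>\<^bsub>RS n\<^esub> alt_class n = eclass n ({1..n - 1} - I)"
proof -
  let ?\<chi> = "\<lambda>g. of_int (sign g) :: complex"
  have one: "?\<chi> \<one>\<^bsub>sym_group n\<^esub> = 1" by (simp add: sym_group_one)
  have hom: "?\<chi> (g \<otimes>\<^bsub>sym_group n\<^esub> h) = ?\<chi> g * ?\<chi> h" if "g \<in> carrier (sym_group n)" "h \<in> carrier (sym_group n)" for g h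
    using sign_comp_permutes[of g n h] that by (simp add: sym_group_carrier sym_group_mult)
  note t = rep_class_twist[where \<chi> = "?\<chi>", OF gmod_DJ one hom]
  have alt: "alt_class n = rep_class (sym_group n) line_module (\<lambda>g z. ?\<chi> g * z)"
    unfolding alt_class_def by (simp add: sign_action_def[abs_def])
  have "rep_class (sym_group n) (fmod (DJ n I)) (\<lambda>g v. fscale (?\<chi> g) (ltr g v)) = eclass n ({1..n - 1} - I)"
    unfolding eclass_def
  proof (rule rep_class_transport[OF gmod_EJ, where T = tw])
    have "inj_on tw (DJ n I)" by (rule inj_onI) (metis tw_tw)
    then show "bij_betw tw (carrier (fmod (DJ n I))) (EJ n ({1..n - 1} - I))"
      using tw_DJ[OF I] by (simp add: bij_betw_def)
    fix g v assume g: "g \<in> carrier (sym_group n)" and v: "v \<in> carrier (fmod (DJ n I))"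
    show "fscale (?\<chi> g) (ltr g v) \<in> carrier (fmod (DJ n I))"
      using fvs.subspace_scale[OF subspace_DJ gmodD(3)[OF gmod_DJ g]] v by simp
    have gp: "g permutes {1..n}" using g by (simp add: sym_group_carrier)
    show "tw (fscale (?\<chi> g) (ltr g v)) = ltr g (tw v)"
    proof
      fix w
      show "tw (fscale (?\<chi> g) (ltr g v)) w = ltr g (tw v) w"
      proof (cases "w permutes {1..n}")
        case True
        have "sign (inv' g \<circ> w) = sign g * sign w"
          using sign_comp_permutes[OF permutes_inv[OF gp] True] sign_inverse[OF permutes_permutation[OF gp]] by simp
        then show ?thesis by (simp add: tw_def ltr_def)
      next
        case False
        have "v \<in> FS n" using v DJ_subset_FS by auto
        then have "v (inv' g \<circ> w) = 0"
          using False permutes_comp_iff(2)[OF permutes_inv[OF gp], of w] unfolding FS_def by blast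
        then show ?thesis by (simp add: tw_def ltr_def)
      qed
    qed
  qed (auto simp: fvs.subspace_0[OF subspace_DJ] fvs.subspace_add[OF subspace_DJ]
      fvs.subspace_scale[OF subspace_DJ] tw_zero tw_add tw_scale)
  then show ?thesis using t(3) unfolding alt RS_def by simp
qed

lemma alt_class_in: "alt_class n \<in> carrier (RS n)"
proof -
  let ?\<chi> = "\<lambda>g. of_int (sign g) :: complex"
  have one: "?\<chi> \<one>\<^bsub>sym_group n\<^esub> = 1" by (simp add: sym_group_one)
  have hom: "?\<chi> (g \<otimes>\<^bsub>sym_group n\<^esub> h) = ?\<chi> g * ?\<chi> h" if "g \<in> carrier (sym_group n)" "h \<in> carrier (sym_group n)" for g h
    using sign_comp_permutes[of g n h] that by (simp add: sym_group_carrier sym_group_mult)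
  from rep_class_twist(2)[where \<chi> = "?\<chi>", OF gmod_DJ one hom] show ?thesis
    unfolding alt_class_def RS_def by (simp add: sign_action_def[abs_def])
qed

text \<open>The induced module consists of left-invariant functions; inversion turns them into
  right-invariant ones.\<close>

lemma ind_class_eq:
  assumes I: "I \<subseteq> {1..n - 1}"
  shows "ind_class n I = finsum (RS n) (eclass n) (Pow I)"
proof -
  let ?V = "ind_module (sym_group n) (young_subgroup n I) line_module trivial_action"
  define T where "T f = (\<lambda>w. if w permutes {1..n} then f (inv' w) else 0)" for f :: "(nat \<Rightarrow> nat) \<Rightarrow> complex"
  have V: "carrier ?V = {f \<in> carrier (sym_group n) \<rightarrow>\<^sub>E UNIV. \<forall>h\<in>yg n I. \<forall>g\<in>carrier (sym_group n). f (h \<circ> g) = f g}"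
    by (simp add: ind_module_def line_module_def young_subgroup_eq_yg[OF I] sym_group_mult trivial_action_def)
  have V': "\<zero>\<^bsub>?V\<^esub> = (\<lambda>g\<in>carrier (sym_group n). 0)" "f \<oplus>\<^bsub>?V\<^esub> f' = (\<lambda>g\<in>carrier (sym_group n). f g + f' g)"
    "c \<odot>\<^bsub>?V\<^esub> f = (\<lambda>g\<in>carrier (sym_group n). c * f g)" for f f' c
    by (simp_all add: ind_module_def line_module_def)
  have comp: "h \<circ> g permutes {1..n}" if "h \<in> yg n I" "g permutes {1..n}" for h g
    using that ygD permutes_compose by blast
  have "ind_class n I = rep_class (sym_group n) (fmod (FI n I)) ltr"
    unfolding ind_class_def
  proof (rule rep_class_transport[OF gmod_FI, where T = T])
    show "bij_betw T (carrier ?V) (FI n I)"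
    proof (rule bij_betw_byWitness[where f' = "\<lambda>\<phi>. \<lambda>g\<in>carrier (sym_group n). \<phi> (inv' g)"])
      show "\<forall>f\<in>carrier ?V. (\<lambda>g\<in>carrier (sym_group n). T f (inv' g)) = f"
        unfolding V by (auto simp: T_def sym_group_carrier permutes_inv inv_inv_eq permutes_bij PiE_def extensional_def fun_eq_iff)
      show "\<forall>\<phi>\<in>FI n I. T (\<lambda>g\<in>carrier (sym_group n). \<phi> (inv' g)) = \<phi>"
        by (auto simp: T_def sym_group_carrier permutes_inv inv_inv_eq permutes_bij FI_def FS_def fun_eq_iff)
      show "T ` carrier ?V \<subseteq> FI n I"
      proof
        fix \<phi> assume "\<phi> \<in> T ` carrier ?V"
        then obtain f where f: "f \<in> carrier ?V" "\<phi> = T f" by blast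
        have "\<phi> (w \<circ> u) = \<phi> w" if u: "u \<in> yg n I" for w u
        proof (cases "w permutes {1..n}")
          case True
          have "inv' (w \<circ> u) = inv' u \<circ> inv' w"
            using permutes_bij[OF True] permutes_bij[OF ygD[OF u]] by (rule o_inv_distrib)
          moreover have "f (inv' u \<circ> inv' w) = f (inv' w)"
            using f(1) inv_in_yg[OF u] permutes_inv[OF True] unfolding V by (simp add: sym_group_carrier)
          ultimately show ?thesis using True permutes_comp_iff(1)[OF ygD[OF u], of w] by (simp add: f(2) T_def)
        next
          case False
          then show ?thesis using permutes_comp_iff(1)[OF ygD[OF u], of w] by (simp add: f(2) T_def)
        qed
        then show "\<phi> \<in> FI n I" by (simp add: FI_def FS_def f(2) T_def)
      qed
      show "(\<lambda>\<phi>. \<lambda>g\<in>carrier (sym_group n). \<phi> (inv' g)) ` FI n I \<subseteq> carrier ?V"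
      proof
        fix f assume "f \<in> (\<lambda>\<phi>. \<lambda>g\<in>carrier (sym_group n). \<phi> (inv' g)) ` FI n I"
        then obtain \<phi> where \<phi>: "\<phi> \<in> FI n I" "f = (\<lambda>g\<in>carrier (sym_group n). \<phi> (inv' g))" by blast
        have "f (h \<circ> g) = f g" if h: "h \<in> yg n I" and g: "g permutes {1..n}" for h g
        proof -
          have "inv' (h \<circ> g) = inv' g \<circ> inv' h"
            using permutes_bij[OF ygD[OF h]] permutes_bij[OF g] by (rule o_inv_distrib)
          then show ?thesis using \<phi> inv_in_yg[OF h] comp[OF h g] g by (simp add: sym_group_carrier FI_def)
        qed
        then show "f \<in> carrier ?V" unfolding V by (simp add: sym_group_carrier \<phi>(2))
      qed
    qed
    fix g f assume g: "g \<in> carrier (sym_group n)" and f: "f \<in> carrier ?V"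
    have gp: "g permutes {1..n}" using g by (simp add: sym_group_carrier)
    have xg: "x \<circ> g permutes {1..n}" if "x permutes {1..n}" for x using that gp permutes_compose by blast
    show "ind_action (sym_group n) g f \<in> carrier ?V"
      using f xg comp unfolding V ind_action_def by (auto simp: sym_group_carrier sym_group_mult comp_assoc)
    show "T (ind_action (sym_group n) g f) = ltr g (T f)"
    proof
      fix w
      show "T (ind_action (sym_group n) g f) w = ltr g (T f) w"
      proof (cases "w permutes {1..n}")
        case True
        have "inv' (inv' g \<circ> w) = inv' w \<circ> g"
          using o_inv_distrib[OF permutes_bij[OF permutes_inv[OF gp]] permutes_bij[OF True]] inv_inv_eq[OF permutes_bij[OF gp]] by simp
        then show ?thesis using True permutes_inv[OF True] permutes_comp_iff(2)[OF permutes_inv[OF gp], of w]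
          by (simp add: T_def ltr_def ind_action_def sym_group_carrier sym_group_mult)
      next
        case False
        then show ?thesis using permutes_comp_iff(2)[OF permutes_inv[OF gp], of w] by (simp add: T_def ltr_def)
      qed
    qed
  qed (auto simp: V' V T_def fun_eq_iff sym_group_carrier permutes_inv comp comp[unfolded One_nat_def])
  then show ?thesis using rep_class_FI[OF I] by simp
qed

section \<open>Substitution in polynomials\<close>

lemma poly_mapping_sum_single: "p = (\<Sum>m\<in>Poly_Mapping.keys p. Poly_Mapping.single m (Poly_Mapping.lookup p m))"
proof (rule poly_mapping_eqI)
  fix k
  have "Poly_Mapping.lookup (\<Sum>m\<in>Poly_Mapping.keys p. Poly_Mapping.single m (Poly_Mapping.lookup p m)) k =
    (\<Sum>m\<in>Poly_Mapping.keys p. if m = k then Poly_Mapping.lookup p m else 0)"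
    by (simp add: lookup_sum lookup_single when_def)
  also have "\<dots> = Poly_Mapping.lookup p k" by (simp add: in_keys_iff)
  finally show "Poly_Mapping.lookup p k =
    Poly_Mapping.lookup (\<Sum>m\<in>Poly_Mapping.keys p. Poly_Mapping.single m (Poly_Mapping.lookup p m)) k" by simp
qed

lemma lookup_single_mult:
  fixes p :: cpoly
  shows "Poly_Mapping.lookup (Poly_Mapping.single a c * p) (a + b) = c * Poly_Mapping.lookup p b"
    and "(\<And>b. m \<noteq> a + b) \<Longrightarrow> Poly_Mapping.lookup (Poly_Mapping.single a c * p) m = 0"
proof -
  have e: "Poly_Mapping.single a c * p =
    (\<Sum>m\<in>Poly_Mapping.keys p. Poly_Mapping.single (a + m) (c * Poly_Mapping.lookup p m))"
    by (subst (1) poly_mapping_sum_single[of p]) (simp add: sum_distrib_left mult_single)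
  have "Poly_Mapping.lookup (Poly_Mapping.single a c * p) (a + b) =
    (\<Sum>m\<in>Poly_Mapping.keys p. if m = b then c * Poly_Mapping.lookup p m else 0)"
    unfolding e by (simp add: lookup_sum lookup_single when_def)
  then show "Poly_Mapping.lookup (Poly_Mapping.single a c * p) (a + b) = c * Poly_Mapping.lookup p b"
    by (simp add: in_keys_iff)
  show "Poly_Mapping.lookup (Poly_Mapping.single a c * p) m = 0" if "\<And>b. m \<noteq> a + b"
    unfolding e using that by (auto simp: lookup_sum lookup_single when_def intro!: sum.neutral) metis
qed

lemma const_poly_simps:
  "const_poly 0 = 0" "const_poly 1 = 1" "const_poly (a + b) = const_poly a + const_poly b"
  "const_poly (a * b) = const_poly a * const_poly b" "const_poly (a - b) = const_poly a - const_poly b"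
  by (simp_all add: const_poly_def single_add single_diff mult_single)

lemma const_poly_sum: "const_poly (\<Sum>i\<in>A. f i) = (\<Sum>i\<in>A. const_poly (f i))"
  by (induction A rule: infinite_finite_induct) (simp_all add: const_poly_simps)

definition monom_val :: "(nat \<Rightarrow> cpoly) \<Rightarrow> (nat \<Rightarrow>\<^sub>0 nat) \<Rightarrow> cpoly" where
  "monom_val \<theta> m = (\<Prod>i\<in>Poly_Mapping.keys m. \<theta> i ^ Poly_Mapping.lookup m i)"

text \<open>The algebra endomorphism that sends the i-th variable to \<open>\<theta> i\<close>; the
  homomorphism laws are proved below from this expansion into monomials.\<close>

definition psubst :: "(nat \<Rightarrow> cpoly) \<Rightarrow> cpoly \<Rightarrow> cpoly" where
  "psubst \<theta> p = (\<Sum>m\<in>Poly_Mapping.keys p. const_poly (Poly_Mapping.lookup p m) * monom_val \<theta> m)"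

lemma monom_val_superset:
  assumes "finite A" "Poly_Mapping.keys m \<subseteq> A"
  shows "monom_val \<theta> m = (\<Prod>i\<in>A. \<theta> i ^ Poly_Mapping.lookup m i)"
  unfolding monom_val_def using assms by (intro prod.mono_neutral_left) (auto simp: in_keys_iff)

lemma monom_val_add: "monom_val \<theta> (m + m') = monom_val \<theta> m * monom_val \<theta> m'"
proof -
  let ?A = "Poly_Mapping.keys m \<union> Poly_Mapping.keys m'"
  have "monom_val \<theta> (m + m') = (\<Prod>i\<in>?A. \<theta> i ^ Poly_Mapping.lookup (m + m') i)"
    by (rule monom_val_superset) (use Poly_Mapping.keys_add[of m m'] in auto)
  also have "\<dots> = (\<Prod>i\<in>?A. \<theta> i ^ Poly_Mapping.lookup m i) * (\<Prod>i\<in>?A. \<theta> i ^ Poly_Mapping.lookup m' i)"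
    by (simp add: lookup_add power_add prod.distrib)
  also have "\<dots> = monom_val \<theta> m * monom_val \<theta> m'"
    by (simp add: monom_val_superset[of ?A])
  finally show ?thesis .
qed

lemma monom_val_zero [simp]: "monom_val \<theta> 0 = 1"
  by (simp add: monom_val_def)

lemma monom_val_single: "monom_val \<theta> (Poly_Mapping.single i 1) = \<theta> i"
  by (simp add: monom_val_def)

lemma psubst_superset:
  assumes "finite A" "Poly_Mapping.keys p \<subseteq> A"
  shows "psubst \<theta> p = (\<Sum>m\<in>A. const_poly (Poly_Mapping.lookup p m) * monom_val \<theta> m)"
  unfolding psubst_def using assms by (intro sum.mono_neutral_left) (auto simp: in_keys_iff const_poly_simps)

lemma psubst_add: "psubst \<theta> (p + q) = psubst \<theta> p + psubst \<theta> q"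
proof -
  let ?A = "Poly_Mapping.keys p \<union> Poly_Mapping.keys q"
  have "psubst \<theta> (p + q) = (\<Sum>m\<in>?A. const_poly (Poly_Mapping.lookup (p + q) m) * monom_val \<theta> m)"
    by (rule psubst_superset) (use Poly_Mapping.keys_add[of p q] in auto)
  also have "\<dots> = (\<Sum>m\<in>?A. const_poly (Poly_Mapping.lookup p m) * monom_val \<theta> m) +
      (\<Sum>m\<in>?A. const_poly (Poly_Mapping.lookup q m) * monom_val \<theta> m)"
    by (simp add: lookup_add const_poly_simps distrib_right sum.distrib)
  also have "\<dots> = psubst \<theta> p + psubst \<theta> q" by (simp add: psubst_superset[of ?A])
  finally show ?thesis .
qed

lemma psubst_zero [simp]: "psubst \<theta> 0 = 0"
  by (simp add: psubst_def)

lemma psubst_sum: "psubst \<theta> (\<Sum>i\<in>A. f i) = (\<Sum>i\<in>A. psubst \<theta> (f i))"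
  by (induction A rule: infinite_finite_induct) (simp_all add: psubst_add)

lemma psubst_single: "psubst \<theta> (Poly_Mapping.single m c) = const_poly c * monom_val \<theta> m"
  by (cases "c = 0") (simp_all add: psubst_def const_poly_simps)

lemma psubst_const: "psubst \<theta> (const_poly c) = const_poly c"
  using psubst_single[of \<theta> 0 c] by (simp add: const_poly_def)

lemma psubst_tvar: "psubst \<theta> (tvar i) = \<theta> i"
  using psubst_single[of \<theta> "Poly_Mapping.single i 1" 1] by (simp only: tvar_def monom_val_single const_poly_simps mult_1_left)

lemma psubst_mult: "psubst \<theta> (p * q) = psubst \<theta> p * psubst \<theta> q"
proof -
  let ?s = "Poly_Mapping.single" and ?l = "Poly_Mapping.lookup" and ?k = "Poly_Mapping.keys"
  have "p * q = (\<Sum>m\<in>?k p. ?s m (?l p m)) * (\<Sum>m'\<in>?k q. ?s m' (?l q m'))"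
    using poly_mapping_sum_single[of p] poly_mapping_sum_single[of q] by simp
  also have "\<dots> = (\<Sum>m\<in>?k p. \<Sum>m'\<in>?k q. ?s (m + m') (?l p m * ?l q m'))"
    by (simp add: sum_product mult_single)
  finally have "psubst \<theta> (p * q) = (\<Sum>m\<in>?k p. \<Sum>m'\<in>?k q. psubst \<theta> (?s (m + m') (?l p m * ?l q m')))"
    by (simp add: psubst_sum)
  also have "\<dots> = (\<Sum>m\<in>?k p. \<Sum>m'\<in>?k q. (const_poly (?l p m) * monom_val \<theta> m) * (const_poly (?l q m') * monom_val \<theta> m'))"
    by (simp add: psubst_single monom_val_add const_poly_simps mult_ac)
  also have "\<dots> = psubst \<theta> p * psubst \<theta> q" by (simp add: psubst_def sum_product)
  finally show ?thesis .
qed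

lemma psubst_uminus: "psubst \<theta> (- p) = - psubst \<theta> p"
  using psubst_add[of \<theta> p "- p"] by (simp add: eq_neg_iff_add_eq_0 add.commute)

lemma psubst_diff: "psubst \<theta> (p - q) = psubst \<theta> p - psubst \<theta> q"
  using psubst_add[of \<theta> p "- q"] by (simp add: psubst_uminus)

lemma psubst_one: "psubst \<theta> 1 = 1"
  using psubst_const[of \<theta> 1] by (simp add: const_poly_simps)

lemma psubst_power: "psubst \<theta> (p ^ k) = psubst \<theta> p ^ k"
  by (induction k) (simp_all add: psubst_one psubst_mult)

lemma psubst_prod: "psubst \<theta> (\<Prod>i\<in>A. f i) = (\<Prod>i\<in>A. psubst \<theta> (f i))"
  by (induction A rule: infinite_finite_induct) (simp_all add: psubst_one psubst_mult)

lemma psubst_monom_val: "psubst \<theta> (monom_val \<eta> m) = monom_val (\<lambda>i. psubst \<theta> (\<eta> i)) m"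
  by (simp add: monom_val_def psubst_prod psubst_power)

lemma psubst_psubst: "psubst \<theta> (psubst \<eta> p) = psubst (\<lambda>i. psubst \<theta> (\<eta> i)) p"
  by (simp add: psubst_def[of \<eta>] psubst_def[of "\<lambda>i. psubst \<theta> (\<eta> i)"] psubst_sum psubst_mult psubst_const psubst_monom_val)

lemma tvar_power: "tvar i ^ k = Poly_Mapping.single (Poly_Mapping.single i k) 1"
  by (induction k) (simp_all add: tvar_def mult_single single_add[symmetric])

lemma prod_single: "(\<Prod>i\<in>A. Poly_Mapping.single (f i) 1 :: cpoly) = Poly_Mapping.single (\<Sum>i\<in>A. f i) 1"
  by (induction A rule: infinite_finite_induct) (simp_all add: mult_single)

lemma monom_val_tvar: "monom_val tvar m = Poly_Mapping.single m 1"
  using poly_mapping_sum_single[of m] by (simp add: monom_val_def tvar_power prod_single)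

lemma psubst_tvar_id: "psubst tvar p = p"
  using poly_mapping_sum_single[of p] by (simp add: psubst_def monom_val_tvar const_poly_def mult_single)

lemma psubst_cong:
  assumes "p \<in> polys n" "\<And>i. i \<in> {1..n} \<Longrightarrow> \<theta> i = \<eta> i"
  shows "psubst \<theta> p = psubst \<eta> p"
  unfolding psubst_def
proof (rule sum.cong[OF refl])
  fix m assume "m \<in> Poly_Mapping.keys p"
  then have "Poly_Mapping.keys m \<subseteq> {1..n}" using assms(1) by (auto simp: polys_def)
  then have "monom_val \<theta> m = monom_val \<eta> m" unfolding monom_val_def using assms(2) by (intro prod.cong) auto
  then show "const_poly (Poly_Mapping.lookup p m) * monom_val \<theta> m = const_poly (Poly_Mapping.lookup p m) * monom_val \<eta> m"
    by simp
qed

section \<open>Closure of the polynomial ring in n variables, and degrees\<close>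

lemma polys_add: "p \<in> polys n \<Longrightarrow> q \<in> polys n \<Longrightarrow> p + q \<in> polys n"
  using Poly_Mapping.keys_add[of p q] unfolding polys_def by blast

lemma polys_uminus: "p \<in> polys n \<Longrightarrow> - p \<in> polys n"
  unfolding polys_def by (simp add: in_keys_iff)

lemma polys_diff: "p \<in> polys n \<Longrightarrow> q \<in> polys n \<Longrightarrow> p - q \<in> polys n"
  using polys_add[OF _ polys_uminus, of p n q] by simp

lemma polys_mult:
  assumes "p \<in> polys n" "q \<in> polys n"
  shows "p * q \<in> polys n"
  unfolding polys_def
proof (intro CollectI ballI)
  fix m assume "m \<in> Poly_Mapping.keys (p * q)"
  then obtain a b where "m = a + b" "a \<in> Poly_Mapping.keys p" "b \<in> Poly_Mapping.keys q"
    using Poly_Mapping.keys_mult[of p q] by blast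
  then show "Poly_Mapping.keys m \<subseteq> {1..n}"
    using assms Poly_Mapping.keys_add[of a b] unfolding polys_def by blast
qed

lemma polys_const [simp]: "const_poly c \<in> polys n"
  by (auto simp: polys_def const_poly_def)

lemma polys_0_1 [simp]: "0 \<in> polys n" "1 \<in> polys n"
  by (simp_all add: polys_def)

lemma polys_tvar: "i \<in> {1..n} \<Longrightarrow> tvar i \<in> polys n"
  by (simp add: polys_def tvar_def)

lemma polys_sum: "(\<And>i. i \<in> A \<Longrightarrow> f i \<in> polys n) \<Longrightarrow> (\<Sum>i\<in>A. f i) \<in> polys n"
  by (induction A rule: infinite_finite_induct) (simp_all add: polys_add)

lemma polys_power: "p \<in> polys n \<Longrightarrow> p ^ k \<in> polys n"
  by (induction k) (simp_all add: polys_mult)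

lemma polys_prod: "(\<And>i. i \<in> A \<Longrightarrow> f i \<in> polys n) \<Longrightarrow> (\<Prod>i\<in>A. f i) \<in> polys n"
  by (induction A rule: infinite_finite_induct) (simp_all add: polys_mult)

lemma polys_monom_val:
  "Poly_Mapping.keys m \<subseteq> {1..n} \<Longrightarrow> (\<And>i. i \<in> {1..n} \<Longrightarrow> \<theta> i \<in> polys n) \<Longrightarrow> monom_val \<theta> m \<in> polys n"
  unfolding monom_val_def by (intro polys_prod polys_power) blast

lemma polys_psubst: "p \<in> polys n \<Longrightarrow> (\<And>i. i \<in> {1..n} \<Longrightarrow> \<theta> i \<in> polys n) \<Longrightarrow> psubst \<theta> p \<in> polys n"
  unfolding psubst_def by (intro polys_sum polys_mult polys_const polys_monom_val) (auto simp: polys_def)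

definition mdeg :: "(nat \<Rightarrow>\<^sub>0 nat) \<Rightarrow> nat" where
  "mdeg m = (\<Sum>i\<in>Poly_Mapping.keys m. Poly_Mapping.lookup m i)"

lemma homogeneous_mdeg: "homogeneous k p \<longleftrightarrow> (\<forall>m\<in>Poly_Mapping.keys p. mdeg m = k)"
  by (simp add: homogeneous_def mdeg_def)

lemma mdeg_superset: "finite A \<Longrightarrow> Poly_Mapping.keys m \<subseteq> A \<Longrightarrow> mdeg m = (\<Sum>i\<in>A. Poly_Mapping.lookup m i)"
  unfolding mdeg_def by (intro sum.mono_neutral_left) (auto simp: in_keys_iff)

lemma mdeg_add: "mdeg (a + b) = mdeg a + mdeg b"
proof -
  let ?A = "Poly_Mapping.keys a \<union> Poly_Mapping.keys b"
  have "mdeg (a + b) = (\<Sum>i\<in>?A. Poly_Mapping.lookup (a + b) i)"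
    by (rule mdeg_superset) (use Poly_Mapping.keys_add[of a b] in auto)
  also have "\<dots> = mdeg a + mdeg b" by (simp add: lookup_add sum.distrib mdeg_superset[of ?A])
  finally show ?thesis .
qed

lemma homogeneous_add: "homogeneous k p \<Longrightarrow> homogeneous k q \<Longrightarrow> homogeneous k (p + q)"
  using Poly_Mapping.keys_add[of p q] unfolding homogeneous_def by blast

lemma homogeneous_uminus: "homogeneous k p \<Longrightarrow> homogeneous k (- p)"
  unfolding homogeneous_def by (simp add: in_keys_iff)

lemma homogeneous_diff: "homogeneous k p \<Longrightarrow> homogeneous k q \<Longrightarrow> homogeneous k (p - q)"
  using homogeneous_add[OF _ homogeneous_uminus, of k p q] by simp

lemma homogeneous_zero [simp]: "homogeneous k 0"
  by (simp add: homogeneous_def)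

lemma homogeneous_sum: "(\<And>i. i \<in> A \<Longrightarrow> homogeneous k (f i)) \<Longrightarrow> homogeneous k (\<Sum>i\<in>A. f i)"
  by (induction A rule: infinite_finite_induct) (simp_all add: homogeneous_add)

lemma homogeneous_mult:
  assumes "homogeneous k p" "homogeneous l q"
  shows "homogeneous (k + l) (p * q)"
  unfolding homogeneous_mdeg
proof
  fix m assume "m \<in> Poly_Mapping.keys (p * q)"
  then obtain a b where "m = a + b" "a \<in> Poly_Mapping.keys p" "b \<in> Poly_Mapping.keys q"
    using Poly_Mapping.keys_mult[of p q] by blast
  then show "mdeg m = k + l" using assms unfolding homogeneous_mdeg by (simp add: mdeg_add)
qed

lemma homogeneous_const: "homogeneous 0 (const_poly c)"
  by (simp add: homogeneous_mdeg const_poly_def mdeg_def)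

lemma homogeneous_tvar: "homogeneous 1 (tvar i)"
  by (simp add: homogeneous_mdeg tvar_def mdeg_def)

lemma homogeneous_power: "homogeneous k p \<Longrightarrow> homogeneous (l * k) (p ^ l)"
proof (induction l)
  case 0
  then show ?case using homogeneous_const[of 1] by (simp add: const_poly_simps)
next
  case (Suc l)
  then show ?case using homogeneous_mult[of k p "l * k" "p ^ l"] by simp
qed

lemma homogeneous_prod:
  "finite A \<Longrightarrow> (\<And>i. i \<in> A \<Longrightarrow> homogeneous (d i) (f i)) \<Longrightarrow> homogeneous (\<Sum>i\<in>A. d i) (\<Prod>i\<in>A. f i)"
proof (induction A rule: finite_induct)
  case empty
  then show ?case using homogeneous_const[of 1] by (simp add: const_poly_simps)
next
  case (insert x F)
  then show ?case using homogeneous_mult[of "d x" "f x"] by simp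
qed

lemma homogeneous_monom_val:
  assumes "\<And>i. i \<in> Poly_Mapping.keys m \<Longrightarrow> homogeneous 1 (\<theta> i)"
  shows "homogeneous (mdeg m) (monom_val \<theta> m)"
  unfolding mdeg_def monom_val_def
proof (rule homogeneous_prod)
  fix i assume "i \<in> Poly_Mapping.keys m"
  from homogeneous_power[OF assms[OF this], of "Poly_Mapping.lookup m i"]
  show "homogeneous (Poly_Mapping.lookup m i) (\<theta> i ^ Poly_Mapping.lookup m i)" by simp
qed simp

lemma homogeneous_psubst:
  assumes "p \<in> polys n" "homogeneous k p" "\<And>i. i \<in> {1..n} \<Longrightarrow> homogeneous 1 (\<theta> i)"
  shows "homogeneous k (psubst \<theta> p)"
  unfolding psubst_def
proof (rule homogeneous_sum)
  fix m assume m: "m \<in> Poly_Mapping.keys p"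
  have "homogeneous (mdeg m) (monom_val \<theta> m)"
  proof (rule homogeneous_monom_val)
    fix i assume "i \<in> Poly_Mapping.keys m"
    then have "i \<in> {1..n}" using m assms(1) unfolding polys_def by blast
    then show "homogeneous 1 (\<theta> i)" by (rule assms(3))
  qed
  from homogeneous_mult[OF homogeneous_const this] m assms(2)
  show "homogeneous k (const_poly (Poly_Mapping.lookup p m) * monom_val \<theta> m)" by (simp add: homogeneous_mdeg)
qed

text \<open>The linear change of variables \<open>t\<^sub>i = x\<^sub>i + \<dots> + x\<^sub>n\<close>, with inverse \<open>x\<^sub>i = t\<^sub>i - t\<^bsub>i+1\<^esub>\<close> for
  \<open>i < n\<close> and \<open>x\<^sub>n = t\<^sub>n\<close>. In the new variables the congruences become divisibility by \<open>x\<^sub>i\<close>, which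
  is visible on monomials.\<close>

definition sums_subst :: "nat \<Rightarrow> nat \<Rightarrow> cpoly" where
  "sums_subst n i = (\<Sum>j\<in>{i..n}. tvar j)"

definition diffs_subst :: "nat \<Rightarrow> nat \<Rightarrow> cpoly" where
  "diffs_subst n i = (if i = n then tvar n else tvar i - tvar (i + 1))"

text \<open>A telescoping sum, summed from n downwards; the exceptional form of
  \<open>diffs_subst\<close> at n supplies its last term.\<close>

lemma psubst_diffs_sums: "i \<in> {1..n} \<Longrightarrow> psubst (diffs_subst n) (sums_subst n i) = tvar i"
proof -
  have "(\<Sum>j\<in>{i..n}. diffs_subst n j) = tvar i" if "i \<le> n"
    using that
  proof (induction i rule: inc_induct)
    case base
    then show ?case by (simp add: diffs_subst_def)
  next
    case (step k)
    then have "(\<Sum>j\<in>{k..n}. diffs_subst n j) = diffs_subst n k + (\<Sum>j\<in>{Suc k..n}. diffs_subst n j)"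
      by (simp add: sum.atLeast_Suc_atMost)
    then show ?case using step by (simp add: diffs_subst_def)
  qed
  then show "i \<in> {1..n} \<Longrightarrow> psubst (diffs_subst n) (sums_subst n i) = tvar i"
    by (simp add: sums_subst_def psubst_sum psubst_tvar)
qed

lemma psubst_diffs_sums_id: "p \<in> polys n \<Longrightarrow> psubst (diffs_subst n) (psubst (sums_subst n) p) = p"
  using psubst_cong[of p n "\<lambda>i. psubst (diffs_subst n) (sums_subst n i)" tvar] psubst_diffs_sums
  by (simp add: psubst_psubst psubst_tvar_id)

lemma psubst_sums_diffs: "i \<in> {1..n} \<Longrightarrow> psubst (sums_subst n) (diffs_subst n i) = tvar i"
  by (auto simp: diffs_subst_def psubst_tvar psubst_diff sums_subst_def sum.atLeast_Suc_atMost)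

lemma sums_subst_polys: "i \<in> {1..n} \<Longrightarrow> sums_subst n i \<in> polys n"
  unfolding sums_subst_def by (intro polys_sum polys_tvar) auto

lemma diffs_subst_polys: "i \<in> {1..n} \<Longrightarrow> diffs_subst n i \<in> polys n"
  unfolding diffs_subst_def by (auto intro!: polys_diff polys_tvar)

lemma sums_subst_homogeneous: "homogeneous 1 (sums_subst n i)"
  unfolding sums_subst_def by (intro homogeneous_sum homogeneous_tvar)

lemma diffs_subst_homogeneous: "homogeneous 1 (diffs_subst n i)"
  unfolding diffs_subst_def using homogeneous_diff[OF homogeneous_tvar homogeneous_tvar] homogeneous_tvar by simp

section \<open>The cohomology of the twin\<close>

text \<open>Membership in \<open>HT\<close> for the path function, stated on bare functions: values
  off the group are ignored. The modulus is written as the linear form that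
  \<open>psubst (sums_subst n)\<close> turns into a single variable.\<close>

definition HTp :: "nat \<Rightarrow> ((nat \<Rightarrow> nat) \<Rightarrow> cpoly) \<Rightarrow> bool" where
  "HTp n f \<longleftrightarrow> (\<forall>w. w permutes {1..n} \<longrightarrow> f w \<in> polys n) \<and>
     (\<forall>w j. w permutes {1..n} \<longrightarrow> j \<in> {1..n - 1} \<longrightarrow>
        (\<exists>p\<in>polys n. f (w \<circ> Transposition.transpose j (j + 1)) - f w = diffs_subst n j * p))"

definition tHTp :: "nat \<Rightarrow> ((nat \<Rightarrow> nat) \<Rightarrow> cpoly) \<Rightarrow> bool" where
  "tHTp n g \<longleftrightarrow> (\<exists>f. (\<forall>i\<in>{1..n}. HTp n (f i)) \<and>
     (\<forall>w. w permutes {1..n} \<longrightarrow> g w = (\<Sum>i\<in>{1..n}. tvar i * f i w)))"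

definition path_hess :: "nat \<Rightarrow> (nat \<Rightarrow> nat) \<Rightarrow> bool" where
  "path_hess n h \<longleftrightarrow> n \<ge> 1 \<and> (\<forall>j\<in>{1..n - 1}. h j = j + 1) \<and> h n = n"

lemma transpose_perm: "(j :: nat) \<in> {1..n - 1} \<Longrightarrow> Transposition.transpose j (j + 1) permutes {1..n}"
  using ygD[OF transpose_in_yg[of j n "{}"]] by simp

lemma comp_transpose_perm:
  "w permutes {1..n::nat} \<Longrightarrow> j \<in> {1..n - 1} \<Longrightarrow> w \<circ> Transposition.transpose j (j + 1) permutes {1..n}"
  by (rule permutes_compose[OF transpose_perm])

text \<open>For h(j) = j + 1 the pairs j < i <= h(j) are the pairs of neighbours, and j = n admits
  none. The modulus changes sign between the two descriptions, which the cofactor absorbs.\<close>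

lemma HT_carrier:
  assumes h: "path_hess n h"
  shows "f \<in> carrier (HT n h) \<longleftrightarrow> f \<in> extensional (carrier (sym_group n)) \<and> HTp n f"
proof -
  let ?P = "\<lambda>w i j. \<exists>p\<in>polys n. f (w \<circ> Transposition.transpose i j) - f w = (tvar i - tvar j) * p"
  let ?Q = "\<lambda>w j. \<exists>p\<in>polys n. f (w \<circ> Transposition.transpose j (j + 1)) - f w = diffs_subst n j * p"
  have hj: "(j \<in> {1..n} \<and> i \<in> {1..n} \<and> j < i \<and> i \<le> h j) \<longleftrightarrow> (j \<in> {1..n - 1} \<and> i = j + 1)" for i j
  proof
    assume a: "j \<in> {1..n} \<and> i \<in> {1..n} \<and> j < i \<and> i \<le> h j"
    have "j \<noteq> n" using a h by (auto simp: path_hess_def)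
    then have j: "j \<in> {1..n - 1}" using a by auto
    then have "h j = j + 1" using h unfolding path_hess_def by blast
    then show "j \<in> {1..n - 1} \<and> i = j + 1" using a j by auto
  next
    assume a: "j \<in> {1..n - 1} \<and> i = j + 1"
    then have "h j = j + 1" using h unfolding path_hess_def by blast
    then show "j \<in> {1..n} \<and> i \<in> {1..n} \<and> j < i \<and> i \<le> h j" using a by auto
  qed
  have PQ: "?P w (j + 1) j \<longleftrightarrow> ?Q w j" if "j \<in> {1..n - 1}" for w j
  proof -
    have d: "diffs_subst n j = - (tvar (j + 1) - tvar j)" using that by (auto simp: diffs_subst_def)
    have t: "Transposition.transpose (j + 1) j = Transposition.transpose j (j + 1)" by (rule transpose_commute)
    show ?thesis unfolding t d
    proof (intro iffI; elim bexE)
      fix p assume "p \<in> polys n" "f (w \<circ> Transposition.transpose j (j + 1)) - f w = (tvar (j + 1) - tvar j) * p"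
      then show "\<exists>p\<in>polys n. f (w \<circ> Transposition.transpose j (j + 1)) - f w = - (tvar (j + 1) - tvar j) * p"
        by (intro bexI[of _ "- p"]) (simp_all add: polys_uminus left_diff_distrib)
    next
      fix p assume "p \<in> polys n" "f (w \<circ> Transposition.transpose j (j + 1)) - f w = - (tvar (j + 1) - tvar j) * p"
      then show "\<exists>p\<in>polys n. f (w \<circ> Transposition.transpose j (j + 1)) - f w = (tvar (j + 1) - tvar j) * p"
        by (intro bexI[of _ "- p"]) (simp_all add: polys_uminus left_diff_distrib)
    qed
  qed
  have "f \<in> carrier (HT n h) \<longleftrightarrow> f \<in> carrier (sym_group n) \<rightarrow>\<^sub>E polys n \<and>
    (\<forall>w\<in>carrier (sym_group n). \<forall>i j. (j \<in> {1..n} \<and> i \<in> {1..n} \<and> j < i \<and> i \<le> h j) \<longrightarrow> ?P w i j)"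
    unfolding HT_def by auto
  also have "\<dots> \<longleftrightarrow> f \<in> carrier (sym_group n) \<rightarrow>\<^sub>E polys n \<and>
    (\<forall>w\<in>carrier (sym_group n). \<forall>j\<in>{1..n - 1}. ?P w (j + 1) j)"
    unfolding hj by blast
  also have "\<dots> \<longleftrightarrow> f \<in> carrier (sym_group n) \<rightarrow>\<^sub>E polys n \<and>
    (\<forall>w\<in>carrier (sym_group n). \<forall>j\<in>{1..n - 1}. ?Q w j)"
    using PQ by (metis (no_types, lifting))
  also have "\<dots> \<longleftrightarrow> f \<in> extensional (carrier (sym_group n)) \<and> HTp n f"
    unfolding HTp_def PiE_def Pi_def sym_group_carrier[of _ n, symmetric] by blast
  finally show ?thesis .
qed

section \<open>Closure properties of the equivariant cohomology and of its multiples by the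
  variables\<close>

lemma HTp_cong:
  assumes "\<And>w. w permutes {1..n} \<Longrightarrow> f w = g w"
  shows "HTp n f \<longleftrightarrow> HTp n g"
  unfolding HTp_def using assms comp_transpose_perm[of _ n] by (metis (no_types, lifting))

lemma HTpD: "HTp n f \<Longrightarrow> w permutes {1..n} \<Longrightarrow> f w \<in> polys n"
  by (simp add: HTp_def)

lemma HTp_add:
  assumes "HTp n f" "HTp n g"
  shows "HTp n (\<lambda>w. f w + g w)"
  unfolding HTp_def
proof (intro conjI allI impI)
  fix w j assume w: "w permutes {1..n}" "j \<in> {1..n - 1}"
  let ?s = "w \<circ> Transposition.transpose j (j + 1)"
  obtain p q where "p \<in> polys n" "q \<in> polys n" "f ?s - f w = diffs_subst n j * p" "g ?s - g w = diffs_subst n j * q"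
    using assms w unfolding HTp_def by blast
  then show "\<exists>r\<in>polys n. f ?s + g ?s - (f w + g w) = diffs_subst n j * r"
    by (intro bexI[of _ "p + q"]) (simp_all add: polys_add distrib_left add_diff_add)
qed (use assms in \<open>auto simp: HTp_def polys_add\<close>)

lemma HTp_mult:
  assumes "c \<in> polys n" "HTp n f"
  shows "HTp n (\<lambda>w. c * f w)"
  unfolding HTp_def
proof (intro conjI allI impI)
  fix w j assume w: "w permutes {1..n}" "j \<in> {1..n - 1}"
  let ?s = "w \<circ> Transposition.transpose j (j + 1)"
  obtain p where "p \<in> polys n" "f ?s - f w = diffs_subst n j * p"
    using assms w unfolding HTp_def by blast
  then show "\<exists>r\<in>polys n. c * f ?s - c * f w = diffs_subst n j * r"
    using assms(1) by (intro bexI[of _ "c * p"]) (simp_all add: polys_mult mult.left_commute flip: right_diff_distrib)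
qed (use assms in \<open>auto simp: HTp_def polys_mult\<close>)

lemma HTp_zero: "HTp n (\<lambda>w. 0)"
  by (auto simp: HTp_def intro!: bexI[of _ 0])

lemma HTp_sum: "(\<And>i. i \<in> A \<Longrightarrow> HTp n (f i)) \<Longrightarrow> HTp n (\<lambda>w. \<Sum>i\<in>A. f i w)"
  by (induction A rule: infinite_finite_induct) (simp_all add: HTp_zero HTp_add)

lemma tHTp_cong:
  assumes "\<And>w. w permutes {1..n} \<Longrightarrow> f w = g w"
  shows "tHTp n f \<longleftrightarrow> tHTp n g"
  unfolding tHTp_def using assms by auto

lemma tHTp_add:
  assumes "tHTp n f" "tHTp n g"
  shows "tHTp n (\<lambda>w. f w + g w)"
proof -
  obtain a where a: "\<And>i. i \<in> {1..n} \<Longrightarrow> HTp n (a i)" "\<And>w. w permutes {1..n} \<Longrightarrow> f w = (\<Sum>i\<in>{1..n}. tvar i * a i w)"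
    using assms(1) unfolding tHTp_def by blast
  obtain b where b: "\<And>i. i \<in> {1..n} \<Longrightarrow> HTp n (b i)" "\<And>w. w permutes {1..n} \<Longrightarrow> g w = (\<Sum>i\<in>{1..n}. tvar i * b i w)"
    using assms(2) unfolding tHTp_def by blast
  show ?thesis unfolding tHTp_def
    by (intro exI[of _ "\<lambda>i w. a i w + b i w"] conjI ballI allI impI)
      (simp_all add: HTp_add a(1) b(1), simp add: a(2) b(2) distrib_left sum.distrib)
qed

lemma tHTp_mult:
  assumes "c \<in> polys n" "tHTp n f"
  shows "tHTp n (\<lambda>w. c * f w)"
proof -
  obtain a where a: "\<And>i. i \<in> {1..n} \<Longrightarrow> HTp n (a i)" "\<And>w. w permutes {1..n} \<Longrightarrow> f w = (\<Sum>i\<in>{1..n}. tvar i * a i w)"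
    using assms(2) unfolding tHTp_def by blast
  show ?thesis unfolding tHTp_def
    by (intro exI[of _ "\<lambda>i w. c * a i w"] conjI ballI allI impI)
      (simp_all add: HTp_mult assms(1) a(1), simp add: a(2) sum_distrib_left mult.left_commute)
qed

lemma tHTp_zero: "tHTp n (\<lambda>w. 0)"
  unfolding tHTp_def by (intro exI[of _ "\<lambda>i w. 0"]) (simp add: HTp_zero)

lemma tHTp_sum: "(\<And>i. i \<in> A \<Longrightarrow> tHTp n (f i)) \<Longrightarrow> tHTp n (\<lambda>w. \<Sum>i\<in>A. f i w)"
  by (induction A rule: infinite_finite_induct) (simp_all add: tHTp_zero tHTp_add)

lemma tHTp_HTp:
  assumes "tHTp n g"
  shows "HTp n g"
proof -
  obtain a where a: "\<And>i. i \<in> {1..n} \<Longrightarrow> HTp n (a i)" "\<And>w. w permutes {1..n} \<Longrightarrow> g w = (\<Sum>i\<in>{1..n}. tvar i * a i w)"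
    using assms unfolding tHTp_def by blast
  have "HTp n (\<lambda>w. \<Sum>i\<in>{1..n}. tvar i * a i w)"
    by (intro HTp_sum HTp_mult polys_tvar a(1))
  then show ?thesis using HTp_cong[of n g "\<lambda>w. \<Sum>i\<in>{1..n}. tvar i * a i w"] a(2) by blast
qed

lemma tHTp_tvar:
  assumes "i \<in> {1..n}" "HTp n f"
  shows "tHTp n (\<lambda>w. tvar i * f w)"
  unfolding tHTp_def
proof (intro exI[of _ "\<lambda>j w. if j = i then f w else 0"] conjI ballI allI impI)
  show "HTp n (\<lambda>w. if j = i then f w else 0)" for j
    using assms(2) HTp_zero by (cases "j = i") simp_all
  show "tvar i * f w = (\<Sum>j\<in>{1..n}. tvar j * (if j = i then f w else 0))" for w
    using assms(1) by (simp add: if_distrib cong: if_cong)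
qed

lemma tHTp_diffs:
  assumes i: "i \<in> {1..n}" and f: "HTp n f"
  shows "tHTp n (\<lambda>w. diffs_subst n i * f w)"
proof (cases "i = n")
  case True
  then show ?thesis using tHTp_tvar[OF i f] by (simp add: diffs_subst_def)
next
  case False
  then have i': "i + 1 \<in> {1..n}" using i by simp
  have "tHTp n (\<lambda>w. tvar i * f w + (- 1) * (tvar (i + 1) * f w))"
    using tHTp_add[OF tHTp_tvar[OF i f] tHTp_mult[OF _ tHTp_tvar[OF i' f], of "- 1"]] polys_uminus[of 1 n] by simp
  then show ?thesis using False by (simp add: diffs_subst_def left_diff_distrib)
qed

lemma HT_simps:
  "\<zero>\<^bsub>HT n h\<^esub> = (\<lambda>w\<in>carrier (sym_group n). 0)"
  "f \<oplus>\<^bsub>HT n h\<^esub> g = (\<lambda>w\<in>carrier (sym_group n). f w + g w)"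
  "c \<odot>\<^bsub>HT n h\<^esub> f = (\<lambda>w\<in>carrier (sym_group n). const_poly c * f w)"
  by (simp_all add: HT_def)

lemma restrict_HT:
  assumes "path_hess n h"
  shows "restrict f (carrier (sym_group n)) \<in> carrier (HT n h) \<longleftrightarrow> HTp n f"
  using HTp_cong[of n "restrict f (carrier (sym_group n))" f]
  by (simp add: HT_carrier[OF assms] sym_group_carrier)

lemma tHT_mem:
  assumes h: "path_hess n h"
  shows "g \<in> tHT n h \<longleftrightarrow> g \<in> extensional (carrier (sym_group n)) \<and> tHTp n g"
proof
  assume "g \<in> tHT n h"
  then obtain f where f: "\<forall>i\<in>{1..n}. f i \<in> carrier (HT n h)"
    "g = (\<lambda>w\<in>carrier (sym_group n). \<Sum>i\<in>{1..n}. tvar i * f i w)"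
    unfolding tHT_def by blast
  then show "g \<in> extensional (carrier (sym_group n)) \<and> tHTp n g"
    unfolding tHTp_def HT_carrier[OF h] by (auto simp: sym_group_carrier intro!: exI[of _ f])
next
  assume "g \<in> extensional (carrier (sym_group n)) \<and> tHTp n g"
  then obtain f where g: "g \<in> extensional (carrier (sym_group n))" and f: "\<And>i. i \<in> {1..n} \<Longrightarrow> HTp n (f i)"
    "\<And>w. w permutes {1..n} \<Longrightarrow> g w = (\<Sum>i\<in>{1..n}. tvar i * f i w)" unfolding tHTp_def by blast
  let ?f = "\<lambda>i. restrict (f i) (carrier (sym_group n))"
  have e1: "g = (\<lambda>w\<in>carrier (sym_group n). \<Sum>i\<in>{1..n}. tvar i * ?f i w)"
    by (rule extensionalityI[OF g restrict_extensional]) (simp add: f(2) sym_group_carrier)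
  have e2: "\<forall>i\<in>{1..n}. ?f i \<in> carrier (HT n h)" using f(1) unfolding restrict_HT[OF h] by blast
  show "g \<in> tHT n h"
    unfolding tHT_def by (rule CollectI, rule exI[of _ ?f], rule conjI, rule e1, rule e2)
qed

text \<open>The coefficient of the monomial m in the new variables, as an element of
  \<open>FS n\<close>. Divisibility conditions on the values of f become invariance conditions on
  these complex functions.\<close>

definition coef_fun :: "nat \<Rightarrow> (nat \<Rightarrow>\<^sub>0 nat) \<Rightarrow> ((nat \<Rightarrow> nat) \<Rightarrow> cpoly) \<Rightarrow> (nat \<Rightarrow> nat) \<Rightarrow> complex" where
  "coef_fun n m f = (\<lambda>w. if w permutes {1..n} then Poly_Mapping.lookup (psubst (sums_subst n) (f w)) m else 0)"

lemma coef_fun_add: "coef_fun n m (\<lambda>w. f w + g w) = coef_fun n m f + coef_fun n m g"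
  by (simp add: coef_fun_def fun_eq_iff psubst_add lookup_add)

lemma lookup_const_mult: "Poly_Mapping.lookup (const_poly c * p) m = c * Poly_Mapping.lookup p m"
  using lookup_single_mult(1)[of 0 c p m] by (simp add: const_poly_def)

lemma coef_fun_const_mult: "coef_fun n m (\<lambda>w. const_poly c * f w) = fscale c (coef_fun n m f)"
  by (rule ext) (simp add: coef_fun_def psubst_mult psubst_const lookup_const_mult)

lemma lookup_tvar_mult:
  "Poly_Mapping.lookup m i = 0 \<Longrightarrow> Poly_Mapping.lookup (tvar i * p) m = 0"
  "Poly_Mapping.lookup (tvar i * p) (Poly_Mapping.single i 1 + m) = Poly_Mapping.lookup p m"
proof -
  show "Poly_Mapping.lookup (tvar i * p) (Poly_Mapping.single i 1 + m) = Poly_Mapping.lookup p m"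
    unfolding tvar_def using lookup_single_mult(1)[of "Poly_Mapping.single i 1" 1 p m] by simp
  show "Poly_Mapping.lookup (tvar i * p) m = 0" if "Poly_Mapping.lookup m i = 0"
    unfolding tvar_def
  proof (rule lookup_single_mult(2))
    show "m \<noteq> Poly_Mapping.single i 1 + b" for b using that by (auto simp: lookup_add lookup_single)
  qed
qed

text \<open>The values of f at w and at w times an adjacent transposition differ by a multiple of
  the variable x_i, so coefficients at monomials without x_i agree; such transpositions generate the
  Young subgroup. The variable x_n belongs to no congruence, whence the intersection with {1..n -
  1}.\<close>

lemma coef_fun_FI:
  assumes f: "HTp n f"
  shows "coef_fun n m f \<in> FI n (Poly_Mapping.keys m \<inter> {1..n - 1})"
proof -
  let ?I = "Poly_Mapping.keys m \<inter> {1..n - 1}"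
  have step: "coef_fun n m f (w \<circ> Transposition.transpose i (i + 1)) = coef_fun n m f w"
    if w: "w permutes {1..n}" and i: "i \<in> {1..n - 1}" "i \<notin> ?I" for w i
  proof -
    let ?s = "w \<circ> Transposition.transpose i (i + 1)"
    obtain p where p: "f ?s - f w = diffs_subst n i * p" using f w i unfolding HTp_def by blast
    have "i \<in> {1..n}" using i by auto
    then have "psubst (sums_subst n) (f ?s) - psubst (sums_subst n) (f w) = tvar i * psubst (sums_subst n) p"
      using p psubst_sums_diffs[of i n] by (simp flip: psubst_diff add: psubst_mult)
    moreover have "Poly_Mapping.lookup m i = 0" using i by (simp add: in_keys_iff)
    ultimately have "Poly_Mapping.lookup (psubst (sums_subst n) (f ?s) - psubst (sums_subst n) (f w)) m = 0"
      by (simp add: lookup_tvar_mult(1))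
    then show ?thesis using w comp_transpose_perm[OF w i(1)] by (simp add: coef_fun_def lookup_minus)
  qed
  have "coef_fun n m f (w \<circ> u) = coef_fun n m f w" if u: "u \<in> yg n ?I" for w u
  proof (cases "w permutes {1..n}")
    case True
    show ?thesis
      using u
    proof (rule yg_induct)
      fix v i assume v: "v \<in> yg n ?I" "i \<in> {1..n - 1}" "i \<notin> ?I" "coef_fun n m f (w \<circ> v) = coef_fun n m f w"
      have "w \<circ> v permutes {1..n}" using True ygD[OF v(1)] permutes_compose by blast
      from step[OF this v(2,3)] v(4)
      show "coef_fun n m f (w \<circ> (v \<circ> Transposition.transpose i (i + 1))) = coef_fun n m f w"
        by (simp add: comp_assoc)
    qed simp
  next
    case False
    then show ?thesis using permutes_comp_iff(1)[OF ygD[OF u], of w] by (simp add: coef_fun_def)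
  qed
  then show ?thesis by (simp add: FI_def FS_def coef_fun_def)
qed

text \<open>The converse of \<open>coef_fun_FI\<close> for a single monomial: the congruence modulo
  x_j holds either because x_j divides the monomial or because \<phi> does not change.\<close>

lemma HTp_monom:
  assumes \<phi>: "\<phi> \<in> FI n (Poly_Mapping.keys m \<inter> {1..n - 1})" and m: "Poly_Mapping.keys m \<subseteq> {1..n}"
  shows "HTp n (\<lambda>w. const_poly (\<phi> w) * monom_val (diffs_subst n) m)"
  unfolding HTp_def
proof (intro conjI allI impI)
  have pm: "monom_val (diffs_subst n) k \<in> polys n" if "Poly_Mapping.keys k \<subseteq> {1..n}" for k
    using that by (intro polys_monom_val diffs_subst_polys)
  show "const_poly (\<phi> w) * monom_val (diffs_subst n) m \<in> polys n" for w
    by (intro polys_mult polys_const pm m)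
  fix w j assume w: "w permutes {1..n}" and j: "j \<in> {1..n - 1}"
  let ?s = "w \<circ> Transposition.transpose j (j + 1)"
  show "\<exists>p\<in>polys n. const_poly (\<phi> ?s) * monom_val (diffs_subst n) m - const_poly (\<phi> w) * monom_val (diffs_subst n) m =
    diffs_subst n j * p"
  proof (cases "j \<in> Poly_Mapping.keys m")
    case True
    define m' where "m' = m - Poly_Mapping.single j 1"
    have mm: "m = Poly_Mapping.single j 1 + m'"
      using True by (intro poly_mapping_eqI) (auto simp: m'_def lookup_add lookup_minus lookup_single when_def in_keys_iff)
    have "Poly_Mapping.keys m' \<subseteq> Poly_Mapping.keys m"
      by (auto simp: m'_def in_keys_iff lookup_minus)
    then have "const_poly (\<phi> ?s - \<phi> w) * monom_val (diffs_subst n) m' \<in> polys n"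
      using m by (intro polys_mult polys_const pm) blast
    moreover have "monom_val (diffs_subst n) m = diffs_subst n j * monom_val (diffs_subst n) m'"
      by (subst mm) (simp only: monom_val_add monom_val_single)
    ultimately show ?thesis
      by (intro bexI[of _ "const_poly (\<phi> ?s - \<phi> w) * monom_val (diffs_subst n) m'"])
        (simp_all add: const_poly_simps algebra_simps)
  next
    case False
    then have "Transposition.transpose j (j + 1) \<in> yg n (Poly_Mapping.keys m \<inter> {1..n - 1})"
      using transpose_in_yg[OF j] by blast
    then have "\<phi> ?s = \<phi> w" using \<phi> by (simp add: FI_def)
    then show ?thesis by (intro bexI[of _ 0]) simp_all
  qed
qed

section \<open>Squarefree monomials and their antisymmetrized coefficients\<close>

definition expo :: "nat set \<Rightarrow> (nat \<Rightarrow>\<^sub>0 nat)" where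
  "expo I = (\<Sum>i\<in>I. Poly_Mapping.single i 1)"

lemma lookup_expo: "finite I \<Longrightarrow> Poly_Mapping.lookup (expo I) j = (if j \<in> I then 1 else 0)"
  by (simp add: expo_def lookup_sum lookup_single when_def)

lemma keys_expo: "finite I \<Longrightarrow> Poly_Mapping.keys (expo I) = I"
  by (auto simp: in_keys_iff lookup_expo split: if_splits)

lemma expo_remove: "finite I \<Longrightarrow> i \<in> I \<Longrightarrow> expo I = Poly_Mapping.single i 1 + expo (I - {i})"
  unfolding expo_def by (rule sum.remove)

lemma mdeg_expo: "finite I \<Longrightarrow> mdeg (expo I) = card I"
  by (simp add: mdeg_def keys_expo lookup_expo)

lemma expo_inj: "finite I \<Longrightarrow> finite J \<Longrightarrow> expo I = expo J \<longleftrightarrow> I = J"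
  using keys_expo by metis

abbreviation csets :: "nat \<Rightarrow> nat \<Rightarrow> nat set set" where
  "csets n k \<equiv> {I \<in> Pow {1..n - 1}. card I = k}"

text \<open>This will induce an isomorphism from the degree k part of the quotient onto the sum of
  the \<open>DJ n I\<close> with \<open>card I = k\<close>. Adding the components instead of keeping
  a tuple loses nothing, as these subspaces are independent.\<close>

definition Lk :: "nat \<Rightarrow> nat \<Rightarrow> ((nat \<Rightarrow> nat) \<Rightarrow> cpoly) \<Rightarrow> (nat \<Rightarrow> nat) \<Rightarrow> complex" where
  "Lk n k f = (\<Sum>I\<in>csets n k. An n I (coef_fun n (expo I) f))"

lemma csets_D:
  assumes "I \<in> csets n k"
  shows "I \<subseteq> {1..n - 1}" "finite I" "card I = k"
  using assms finite_subset[of I "{1..n - 1}"] by auto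

lemma Lk_add: "Lk n k (\<lambda>w. f w + g w) = Lk n k f + Lk n k g"
  unfolding Lk_def coef_fun_add linear_rop_add sum.distrib ..

lemma Lk_const_mult: "Lk n k (\<lambda>w. const_poly c * f w) = fscale c (Lk n k f)"
  unfolding Lk_def coef_fun_const_mult linear_rop_scale fvs.scale_sum_right ..

lemma Lk_zero: "Lk n k (\<lambda>w. 0) = 0"
  using Lk_const_mult[of n k 0 "\<lambda>w. 0"] by (simp only: const_poly_simps mult_zero_left fvs.scale_zero_left)

lemma coef_fun_expo_FI: "HTp n f \<Longrightarrow> I \<subseteq> {1..n - 1} \<Longrightarrow> coef_fun n (expo I) f \<in> FI n I"
  using coef_fun_FI[of n f "expo I"] keys_expo[of I] finite_subset[of I "{1..n - 1}"] by (simp add: Int_absorb2)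

lemma Lk_in_ssum:
  assumes "HTp n f"
  shows "Lk n k f \<in> ssum (csets n k) (DJ n)"
  unfolding Lk_def
proof (rule ssumI)
  fix I assume "I \<in> csets n k"
  then show "An n I (coef_fun n (expo I) f) \<in> DJ n I"
    unfolding DJ_def using coef_fun_expo_FI[OF assms csets_D(1)] by blast
qed

text \<open>In the new variables t_i is the sum of the x_j with j >= i, so multiples of single x_j
  suffice. Their coefficient at the monomial of I is zero unless j is in I; otherwise it is a
  coefficient at the monomial of \<open>I - {j}\<close>, which is invariant under the transposition
  of j and j + 1 and hence killed by \<open>An n I\<close>.\<close>

lemma Lk_kills_tHT:
  assumes "tHTp n g"
  shows "Lk n k g = 0"
proof -
  obtain f where f: "\<And>i. i \<in> {1..n} \<Longrightarrow> HTp n (f i)" "\<And>w. w permutes {1..n} \<Longrightarrow> g w = (\<Sum>i\<in>{1..n}. tvar i * f i w)"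
    using assms unfolding tHTp_def by blast
  have "An n I (coef_fun n (expo I) g) = 0" if I: "I \<in> csets n k" for I
  proof -
    note ID = csets_D[OF I]
    define c where "c i j = (\<lambda>w. if w permutes {1..n} then
      Poly_Mapping.lookup (tvar j * psubst (sums_subst n) (f i w)) (expo I) else 0)" for i j
    have cA: "An n I (c i j) = 0" if i: "i \<in> {1..n}" for i j
    proof (cases "j \<in> I")
      case True
      have "c i j = coef_fun n (expo (I - {j})) (f i)"
        unfolding c_def coef_fun_def expo_remove[OF ID(2) True] lookup_tvar_mult(2) ..
      moreover have "coef_fun n (expo (I - {j})) (f i) \<in> FI n (I - {j})"
        using coef_fun_expo_FI[OF f(1)[OF i], of "I - {j}"] ID(1) by blast
      ultimately show ?thesis using An_kills[of "c i j" n "I - {j}" j I] True ID(1) by auto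
    next
      case False
      then have "c i j = 0" unfolding c_def using lookup_tvar_mult(1)[of "expo I" j] lookup_expo[OF ID(2), of j]
        by (simp add: fun_eq_iff)
      then show ?thesis by (simp only: linear_rop_zero)
    qed
    have "coef_fun n (expo I) g = (\<Sum>i\<in>{1..n}. \<Sum>j\<in>{i..n}. c i j)"
    proof
      fix w
      show "coef_fun n (expo I) g w = (\<Sum>i\<in>{1..n}. \<Sum>j\<in>{i..n}. c i j) w"
        by (simp add: coef_fun_def f(2) psubst_sum psubst_mult psubst_tvar lookup_sum sums_subst_def
            sum_distrib_right sum_apply_fun c_def)
    qed
    then have "An n I (coef_fun n (expo I) g) = (\<Sum>i\<in>{1..n}. \<Sum>j\<in>{i..n}. An n I (c i j))"
      by (simp only: linear_rop_sum)
    also have "\<dots> = (\<Sum>i\<in>{1..n}. \<Sum>j\<in>{i..n}. 0)" using cA by (intro sum.cong refl)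
    also have "\<dots> = 0" by (simp only: sum.neutral_const)
    finally show ?thesis .
  qed
  then show ?thesis unfolding Lk_def by (rule sum.neutral[rule_format])
qed

text \<open>A homogeneous element of the kernel is expanded into monomials in the new variables.
  Monomials that are not squarefree, or involve \<open>x\<^sub>n\<close>, are multiples of monomials with the same
  support among \<open>x\<^sub>1, \<dots>, x\<^bsub>n-1\<^esub>\<close>; for the squarefree ones \<open>An_kernel\<close> applies.\<close>

lemma Lk_kernel:
  assumes f: "HTp n f" and hom: "\<And>w. w permutes {1..n} \<Longrightarrow> homogeneous k (f w)" and L: "Lk n k f = 0"
  shows "tHTp n f"
proof -
  let ?P = "{p. p permutes {1..n}}" and ?\<theta> = "psubst (sums_subst n)"
  define M where "M = (\<Union>w\<in>?P. Poly_Mapping.keys (?\<theta> (f w)))"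
  define g where "g m w = const_poly (coef_fun n m f w) * monom_val (diffs_subst n) m" for m w
  have finM: "finite M" unfolding M_def by (intro finite_UN_I finite_perms finite_keys)
  have fg: "f w = (\<Sum>m\<in>M. g m w)" if w: "w permutes {1..n}" for w
  proof -
    have "f w = psubst (diffs_subst n) (?\<theta> (f w))" using psubst_diffs_sums_id[OF HTpD[OF f w]] by simp
    also have "\<dots> = (\<Sum>m\<in>M. const_poly (Poly_Mapping.lookup (?\<theta> (f w)) m) * monom_val (diffs_subst n) m)"
      by (rule psubst_superset[OF finM]) (use w in \<open>auto simp: M_def\<close>)
    finally show ?thesis using w by (simp add: g_def coef_fun_def)
  qed
  \<comment> \<open>Independence of the subspaces \<open>DJ n I\<close> splits the single equation
    \<open>Lk n k f = 0\<close> into one equation for each I.\<close>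
  have indep: "An n I (coef_fun n (expo I) f) = 0" if I: "I \<in> csets n k" for I
  proof -
    have "sindep (csets n k) (DJ n)"
      by (rule sindep_subset[OF sindep_DJ]) (use fvs.subspace_0[OF subspace_DJ] in auto)
    moreover have "\<forall>I\<in>csets n k. An n I (coef_fun n (expo I) f) \<in> DJ n I"
      unfolding DJ_def using coef_fun_expo_FI[OF f csets_D(1)] by blast
    ultimately show ?thesis
      using L I unfolding Lk_def sindep_def by (metis (no_types, lifting))
  qed
  have "tHTp n (g m)" if m: "m \<in> M" for m
  proof -
    obtain w where w: "w permutes {1..n}" "m \<in> Poly_Mapping.keys (?\<theta> (f w))" using m by (auto simp: M_def)
    have mk: "Poly_Mapping.keys m \<subseteq> {1..n}"
      using polys_psubst[OF HTpD[OF f w(1)] sums_subst_polys] w(2) by (auto simp: polys_def)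
    have "homogeneous k (?\<theta> (f w))"
      by (rule homogeneous_psubst[OF HTpD[OF f w(1)] hom[OF w(1)] sums_subst_homogeneous])
    then have md: "mdeg m = k" using w(2) by (simp add: homogeneous_mdeg)
    show ?thesis
    proof (cases "\<exists>i\<in>Poly_Mapping.keys m. i = n \<or> Poly_Mapping.lookup m i \<ge> 2")
      case True
      then obtain i where i: "i \<in> Poly_Mapping.keys m" "i = n \<or> Poly_Mapping.lookup m i \<ge> 2" by blast
      define m' where "m' = m - Poly_Mapping.single i 1"
      have mm: "m = Poly_Mapping.single i 1 + m'"
        using i(1) by (intro poly_mapping_eqI) (auto simp: m'_def lookup_add lookup_minus lookup_single when_def in_keys_iff)
      have sub: "Poly_Mapping.keys m' \<subseteq> Poly_Mapping.keys m"
        by (auto simp: m'_def in_keys_iff lookup_minus)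
      have "Poly_Mapping.keys m \<inter> {1..n - 1} \<subseteq> Poly_Mapping.keys m'"
      proof
        fix j assume j: "j \<in> Poly_Mapping.keys m \<inter> {1..n - 1}"
        show "j \<in> Poly_Mapping.keys m'"
        proof (cases "j = i")
          case True
          then have "Poly_Mapping.lookup m i \<ge> 2" using i(2) j by auto
          then show ?thesis using True by (simp add: in_keys_iff m'_def lookup_minus)
        next
          case False
          then show ?thesis using j by (simp add: in_keys_iff m'_def lookup_minus lookup_single)
        qed
      qed
      then have ke: "Poly_Mapping.keys m \<inter> {1..n - 1} = Poly_Mapping.keys m' \<inter> {1..n - 1}" using sub by blast
      have "HTp n (\<lambda>w. const_poly (coef_fun n m f w) * monom_val (diffs_subst n) m')"
        by (rule HTp_monom) (use coef_fun_FI[OF f, of m] ke sub mk in auto)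
      then have "tHTp n (\<lambda>w. diffs_subst n i * (const_poly (coef_fun n m f w) * monom_val (diffs_subst n) m'))"
        by (rule tHTp_diffs[rotated]) (use i(1) mk in blast)
      moreover have "monom_val (diffs_subst n) m = diffs_subst n i * monom_val (diffs_subst n) m'"
        by (subst mm) (simp only: monom_val_add monom_val_single)
      ultimately show ?thesis unfolding g_def by (simp add: mult.left_commute)
    next
      case False
      define I where "I = Poly_Mapping.keys m"
      have finI: "finite I" by (simp add: I_def)
      have l1: "Poly_Mapping.lookup m i = 1" if "i \<in> I" for i
      proof -
        have "Poly_Mapping.lookup m i \<noteq> 0" using that unfolding I_def by (simp add: in_keys_iff)
        moreover have "\<not> 2 \<le> Poly_Mapping.lookup m i" using False that unfolding I_def by blast
        ultimately show ?thesis by linarith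
      qed
      have mI: "m = expo I"
      proof (rule poly_mapping_eqI)
        fix j
        show "Poly_Mapping.lookup m j = Poly_Mapping.lookup (expo I) j"
          unfolding lookup_expo[OF finI] using l1[of j] by (auto simp: I_def in_keys_iff)
      qed
      have IN: "I \<subseteq> {1..n - 1}"
      proof
        fix i assume i: "i \<in> I"
        then have "i \<noteq> n" "i \<in> {1..n}" using False mk unfolding I_def by auto
        then show "i \<in> {1..n - 1}" by auto
      qed
      have Ik: "I \<in> csets n k" using IN md mdeg_expo[OF finI] mI by auto
      have "coef_fun n m f \<in> ssum I (\<lambda>i. FI n (I - {i}))"
        unfolding mI by (rule An_kernel[OF IN coef_fun_expo_FI[OF f IN] indep[OF Ik]])
      then obtain \<psi> where \<psi>: "\<And>i. i \<in> I \<Longrightarrow> \<psi> i \<in> FI n (I - {i})" "coef_fun n m f = (\<Sum>i\<in>I. \<psi> i)"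
        unfolding ssum_def by blast
      have "g m = (\<lambda>w. \<Sum>i\<in>I. diffs_subst n i * (const_poly (\<psi> i w) * monom_val (diffs_subst n) (expo (I - {i}))))"
      proof
        fix w
        have "g m w = (\<Sum>i\<in>I. const_poly (\<psi> i w) * monom_val (diffs_subst n) (expo I))"
          unfolding g_def \<psi>(2) sum_apply_fun const_poly_sum sum_distrib_right by (simp only: mI)
        also have "\<dots> = (\<Sum>i\<in>I. diffs_subst n i * (const_poly (\<psi> i w) * monom_val (diffs_subst n) (expo (I - {i}))))"
        proof (rule sum.cong[OF refl])
          fix i assume i: "i \<in> I"
          show "const_poly (\<psi> i w) * monom_val (diffs_subst n) (expo I) =
            diffs_subst n i * (const_poly (\<psi> i w) * monom_val (diffs_subst n) (expo (I - {i})))"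
            unfolding expo_remove[OF finI i] monom_val_add monom_val_single by (rule mult.left_commute)
        qed
        finally show "g m w = (\<Sum>i\<in>I. diffs_subst n i * (const_poly (\<psi> i w) * monom_val (diffs_subst n) (expo (I - {i}))))" .
      qed
      moreover have "tHTp n (\<lambda>w. \<Sum>i\<in>I. diffs_subst n i * (const_poly (\<psi> i w) * monom_val (diffs_subst n) (expo (I - {i}))))"
      proof (rule tHTp_sum)
        fix i assume i: "i \<in> I"
        have k: "Poly_Mapping.keys (expo (I - {i})) = I - {i}" using keys_expo finI by simp
        have "HTp n (\<lambda>w. const_poly (\<psi> i w) * monom_val (diffs_subst n) (expo (I - {i})))"
        proof (rule HTp_monom)
          have "(I - {i}) \<inter> {1..n - 1} = I - {i}" using IN by blast
          then show "\<psi> i \<in> FI n (Poly_Mapping.keys (expo (I - {i})) \<inter> {1..n - 1})"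
            unfolding k using \<psi>(1)[OF i] by simp
          show "Poly_Mapping.keys (expo (I - {i})) \<subseteq> {1..n}" unfolding k using mk by (auto simp: I_def)
        qed
        then show "tHTp n (\<lambda>w. diffs_subst n i * (const_poly (\<psi> i w) * monom_val (diffs_subst n) (expo (I - {i}))))"
          by (rule tHTp_diffs[rotated]) (use i mk in \<open>auto simp: I_def\<close>)
      qed
      ultimately show ?thesis by simp
    qed
  qed
  then have "tHTp n (\<lambda>w. \<Sum>m\<in>M. g m w)" by (rule tHTp_sum)
  then show ?thesis using tHTp_cong[of n f "\<lambda>w. \<Sum>m\<in>M. g m w"] fg by blast
qed

text \<open>For each I a preimage \<open>\<phi> I\<close> under the antisymmetrizer is multiplied by
  the squarefree monomial of I. Back in the new variables, the coefficient at the monomial of J is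
  \<open>\<phi> J\<close> again.\<close>

lemma Lk_surj:
  assumes "e \<in> ssum (csets n k) (DJ n)"
  obtains f where "HTp n f" "\<And>w. homogeneous k (f w)" "Lk n k f = e"
proof -
  obtain d where d: "\<forall>I\<in>csets n k. d I \<in> DJ n I" "e = (\<Sum>I\<in>csets n k. d I)"
    using assms unfolding ssum_def by blast
  then have "\<forall>I\<in>csets n k. \<exists>\<phi>. \<phi> \<in> FI n I \<and> d I = An n I \<phi>" unfolding DJ_def by blast
  then obtain \<phi> where \<phi>: "\<forall>I\<in>csets n k. \<phi> I \<in> FI n I \<and> d I = An n I (\<phi> I)" by (rule bchoice[THEN exE])
  define f where "f w = (\<Sum>I\<in>csets n k. const_poly (\<phi> I w) * monom_val (diffs_subst n) (expo I))" for w
  have HTf: "HTp n f"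
    unfolding f_def
  proof (rule HTp_sum)
    fix I assume I: "I \<in> csets n k"
    note ID = csets_D[OF I]
    have "I \<inter> {1..n - 1} = I" using ID(1) by blast
    moreover have "I \<subseteq> {1..n}" by (rule subset_trans[OF ID(1)]) auto
    ultimately show "HTp n (\<lambda>w. const_poly (\<phi> I w) * monom_val (diffs_subst n) (expo I))"
      using \<phi> I by (intro HTp_monom) (simp_all only: keys_expo[OF ID(2)])
  qed
  have hom: "homogeneous k (f w)" for w
    unfolding f_def
  proof (rule homogeneous_sum)
    fix I assume I: "I \<in> csets n k"
    have "homogeneous (mdeg (expo I)) (monom_val (diffs_subst n) (expo I))"
      by (rule homogeneous_monom_val) (rule diffs_subst_homogeneous)
    from homogeneous_mult[OF homogeneous_const this]
    show "homogeneous k (const_poly (\<phi> I w) * monom_val (diffs_subst n) (expo I))"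
      using csets_D[OF I] by (simp add: mdeg_expo)
  qed
  have c: "coef_fun n (expo J) f = \<phi> J" if J: "J \<in> csets n k" for J
  proof
    fix w
    show "coef_fun n (expo J) f w = \<phi> J w"
    proof (cases "w permutes {1..n}")
      case True
      have mv: "psubst (sums_subst n) (monom_val (diffs_subst n) (expo I)) = Poly_Mapping.single (expo I) 1"
        if I: "I \<in> csets n k" for I
      proof -
        have "monom_val (\<lambda>i. psubst (sums_subst n) (diffs_subst n i)) (expo I) = monom_val tvar (expo I)"
          unfolding monom_val_def keys_expo[OF csets_D(2)[OF I]]
        proof (rule prod.cong[OF refl])
          fix i assume "i \<in> I"
          then have "i \<in> {1..n - 1}" using csets_D(1)[OF I] by blast
          then have "i \<in> {1..n}" by auto
          then show "psubst (sums_subst n) (diffs_subst n i) ^ Poly_Mapping.lookup (expo I) i =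
              tvar i ^ Poly_Mapping.lookup (expo I) i" by (simp only: psubst_sums_diffs)
        qed
        then show ?thesis by (simp only: psubst_monom_val monom_val_tvar)
      qed
      have "psubst (sums_subst n) (f w) = (\<Sum>I\<in>csets n k. Poly_Mapping.single (expo I) (\<phi> I w))"
        unfolding f_def psubst_sum
        by (intro sum.cong refl) (simp add: psubst_mult psubst_const mv, simp add: const_poly_def mult_single)
      then have "coef_fun n (expo J) f w = (\<Sum>I\<in>csets n k. Poly_Mapping.lookup (Poly_Mapping.single (expo I) (\<phi> I w)) (expo J))"
        using True by (simp add: coef_fun_def lookup_sum)
      also have "\<dots> = (\<Sum>I\<in>csets n k. if I = J then \<phi> I w else 0)"
      proof (rule sum.cong[OF refl])
        fix I assume I: "I \<in> csets n k"
        show "Poly_Mapping.lookup (Poly_Mapping.single (expo I) (\<phi> I w)) (expo J) = (if I = J then \<phi> I w else 0)"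
          using expo_inj[OF csets_D(2)[OF I] csets_D(2)[OF J]] by (simp only: lookup_single when_def)
      qed
      also have "\<dots> = \<phi> J w"
        using J by (subst sum.delta) (auto intro: finite_subset[of _ "Pow {1..n - 1}"])
      finally show ?thesis .
    next
      case False
      have "\<phi> J \<in> FS n" using \<phi> J FI_subset_FS by blast
      then show ?thesis using False by (auto simp: coef_fun_def FS_def)
    qed
  qed
  have "Lk n k f = e"
    unfolding Lk_def d(2)
  proof (rule sum.cong[OF refl])
    fix I assume I: "I \<in> csets n k"
    show "An n I (coef_fun n (expo I) f) = d I" unfolding c[OF I] using bspec[OF \<phi> I] by simp
  qed
  from that[OF HTf hom this] show ?thesis .
qed

text \<open>The coset of f modulo \<open>tHT\<close>, defined for every f, whatever its values off
  the group. Representatives can thus be added, scaled and translated pointwise without being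
  restricted to the carrier.\<close>

definition CS :: "nat \<Rightarrow> ((nat \<Rightarrow> nat) \<Rightarrow> cpoly) \<Rightarrow> ((nat \<Rightarrow> nat) \<Rightarrow> cpoly) set" where
  "CS n f = {g \<in> extensional (carrier (sym_group n)). tHTp n (\<lambda>w. g w - f w)}"

lemma restrict_in_CS: "(\<And>w. w permutes {1..n} \<Longrightarrow> g w = f w) \<Longrightarrow> restrict g (carrier (sym_group n)) \<in> CS n f"
  unfolding CS_def using tHTp_cong[of n "\<lambda>w. restrict g (carrier (sym_group n)) w - f w" "\<lambda>w. 0"] tHTp_zero[of n]
  by (simp add: sym_group_carrier)

lemma tHTp_uminus: "tHTp n f \<Longrightarrow> tHTp n (\<lambda>w. - f w)"
  using tHTp_mult[of "- 1" n f] polys_uminus[of 1 n] by simp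

lemma CS_eqI:
  assumes "tHTp n (\<lambda>w. f w - g w)"
  shows "CS n f = CS n g"
proof -
  have *: "CS n f \<subseteq> CS n g" if t: "tHTp n (\<lambda>w. f w - g w)" for f g
  proof
    fix x assume "x \<in> CS n f"
    then have "x \<in> extensional (carrier (sym_group n))" "tHTp n (\<lambda>w. x w - f w)" by (simp_all add: CS_def)
    then show "x \<in> CS n g" using tHTp_add[OF _ t, of "\<lambda>w. x w - f w"] by (simp add: CS_def)
  qed
  have "tHTp n (\<lambda>w. g w - f w)" using tHTp_uminus[OF assms] by simp
  then show ?thesis using *[OF assms] *[of g f] by blast
qed

lemma CS_cong: "(\<And>w. w permutes {1..n} \<Longrightarrow> f w = g w) \<Longrightarrow> CS n f = CS n g"
  by (rule CS_eqI) (subst tHTp_cong[of n _ "\<lambda>w. 0"], simp_all add: tHTp_zero)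

lemma CS_eq_mem: "g \<in> CS n f \<Longrightarrow> CS n g = CS n f"
  by (rule CS_eqI) (simp add: CS_def)

lemma CS_HTp:
  assumes "g \<in> CS n f" "HTp n f"
  shows "HTp n g"
proof -
  have "HTp n (\<lambda>w. (g w - f w) + f w)"
    using assms by (intro HTp_add[OF tHTp_HTp[of n "\<lambda>w. g w - f w"]]) (simp_all add: CS_def)
  then show ?thesis by simp
qed

lemma HTp_left: 
  assumes s: "s permutes {1..n}" and f: "HTp n f"
  shows "HTp n (\<lambda>w. f (s \<circ> w))"
  unfolding HTp_def
proof (intro conjI allI impI)
  fix w j assume w: "w permutes {1..n}" and j: "j \<in> {1..n - 1}"
  have "s \<circ> w permutes {1..n}" using w s permutes_compose by blast
  then show "\<exists>p\<in>polys n. f (s \<circ> (w \<circ> Transposition.transpose j (j + 1))) - f (s \<circ> w) = diffs_subst n j * p"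
    using f j unfolding HTp_def comp_assoc[symmetric] by blast
next
  fix w assume w: "w permutes {1..n}"
  then show "f (s \<circ> w) \<in> polys n" using f s permutes_compose unfolding HTp_def by blast
qed

lemma tHTp_left:
  assumes s: "s permutes {1..n}" and f: "tHTp n f"
  shows "tHTp n (\<lambda>w. f (s \<circ> w))"
proof -
  obtain a where a: "\<And>i. i \<in> {1..n} \<Longrightarrow> HTp n (a i)" "\<And>w. w permutes {1..n} \<Longrightarrow> f w = (\<Sum>i\<in>{1..n}. tvar i * a i w)"
    using f unfolding tHTp_def by blast
  have "f (s \<circ> w) = (\<Sum>i\<in>{1..n}. tvar i * a i (s \<circ> w))" if "w permutes {1..n}" for w
    using that s permutes_compose by (intro a(2)) blast
  then show ?thesis unfolding tHTp_def using HTp_left[OF s a(1)] by (intro exI[of _ "\<lambda>i w. a i (s \<circ> w)"]) simp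
qed

section \<open>The quotient and the dagger action in terms of representatives\<close>

lemma coset_HT:
  assumes h: "path_hess n h" and f: "f \<in> carrier (HT n h)"
  shows "tHT n h +>\<^bsub>HT n h\<^esub> f = CS n f"
proof -
  let ?S = "carrier (sym_group n)"
  have "tHT n h +>\<^bsub>HT n h\<^esub> f = (\<Union>v\<in>tHT n h. {\<lambda>w\<in>?S. v w + f w})"
    unfolding a_r_coset_def' HT_simps ..
  also have "\<dots> = CS n f"
  proof (intro subset_antisym subsetI)
    fix x assume "x \<in> (\<Union>v\<in>tHT n h. {\<lambda>w\<in>?S. v w + f w})"
    then obtain v where v: "v \<in> tHT n h" "x = (\<lambda>w\<in>?S. v w + f w)" by blast
    then have "tHTp n v" by (simp add: tHT_mem[OF h])
    moreover have "tHTp n (\<lambda>w. x w - f w) \<longleftrightarrow> tHTp n v"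
      by (rule tHTp_cong) (simp add: v(2) sym_group_carrier)
    ultimately show "x \<in> CS n f" by (simp add: CS_def v(2))
  next
    fix x assume x: "x \<in> CS n f"
    let ?v = "\<lambda>w\<in>?S. x w - f w"
    have "tHTp n ?v \<longleftrightarrow> tHTp n (\<lambda>w. x w - f w)" by (rule tHTp_cong) (simp add: sym_group_carrier)
    then have "?v \<in> tHT n h" using x by (simp add: tHT_mem[OF h] CS_def)
    moreover have "x = (\<lambda>w\<in>?S. ?v w + f w)"
      by (rule extensionalityI[where A = ?S]) (use x in \<open>simp_all add: CS_def\<close>)
    ultimately show "x \<in> (\<Union>v\<in>tHT n h. {\<lambda>w\<in>?S. v w + f w})" by blast
  qed
  finally show ?thesis .
qed

lemma carrier_HY:
  assumes h: "path_hess n h"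
  shows "carrier (HY n h) = {CS n f | f. HTp n f}"
proof -
  have "carrier (HY n h) = (\<Union>a\<in>carrier (HT n h). {tHT n h +>\<^bsub>HT n h\<^esub> a})"
    by (simp add: HY_def quot_module_def A_RCOSETS_def')
  also have "\<dots> = (\<Union>a\<in>carrier (HT n h). {CS n a})" using coset_HT[OF h] by simp
  also have "\<dots> = {CS n f | f. HTp n f}"
  proof (intro subset_antisym subsetI)
    fix X assume "X \<in> (\<Union>a\<in>carrier (HT n h). {CS n a})"
    then show "X \<in> {CS n f | f. HTp n f}" using HT_carrier[OF h] by blast
  next
    fix X assume "X \<in> {CS n f | f. HTp n f}"
    then obtain f where f: "HTp n f" "X = CS n f" by blast
    have "X = CS n (restrict f (carrier (sym_group n)))"
      unfolding f(2) by (rule CS_cong) (simp add: sym_group_carrier)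
    then show "X \<in> (\<Union>a\<in>carrier (HT n h). {CS n a})" using restrict_HT[OF h, of f] f(1) by blast
  qed
  finally show ?thesis .
qed

text \<open>A coset is determined by any of its members, so the homogeneous member that the grading
  asks for may replace the original representative.\<close>

lemma carrier_HY_graded:
  assumes h: "path_hess n h"
  shows "carrier (HY_graded n h k) = {CS n f | f. HTp n f \<and> (\<forall>w. w permutes {1..n} \<longrightarrow> homogeneous k (f w))}"
proof (intro subset_antisym subsetI)
  fix X assume "X \<in> carrier (HY_graded n h k)"
  then obtain f g where f: "HTp n f" "X = CS n f" "g \<in> X" "\<forall>w. w permutes {1..n} \<longrightarrow> homogeneous k (g w)"
    by (auto simp: HY_graded_def carrier_HY[OF h] sym_group_carrier)
  then have "X = CS n g" "HTp n g" using CS_eq_mem CS_HTp by blast+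
  then show "X \<in> {CS n f | f. HTp n f \<and> (\<forall>w. w permutes {1..n} \<longrightarrow> homogeneous k (f w))}" using f(4) by blast
next
  fix X assume "X \<in> {CS n f | f. HTp n f \<and> (\<forall>w. w permutes {1..n} \<longrightarrow> homogeneous k (f w))}"
  then obtain f where f: "HTp n f" "X = CS n f" "\<forall>w. w permutes {1..n} \<longrightarrow> homogeneous k (f w)" by blast
  have "restrict f (carrier (sym_group n)) \<in> X" unfolding f(2) by (rule restrict_in_CS) simp
  moreover have "\<forall>w\<in>carrier (sym_group n). homogeneous k (restrict f (carrier (sym_group n)) w)"
    using f(3) by (simp add: sym_group_carrier)
  ultimately have "\<exists>g\<in>X. \<forall>w\<in>carrier (sym_group n). homogeneous k (g w)" by blast
  moreover have "X \<in> carrier (HY n h)" using f(1,2) unfolding carrier_HY[OF h] by blast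
  ultimately show "X \<in> carrier (HY_graded n h k)" by (simp add: HY_graded_def)
qed

lemma HY_zero:
  assumes h: "path_hess n h"
  shows "\<zero>\<^bsub>HY_graded n h k\<^esub> = CS n (\<lambda>w. 0)"
  unfolding HY_graded_def HY_def quot_module_def CS_def using tHT_mem[OF h] by auto

lemma HY_add:
  assumes h: "path_hess n h"
  shows "CS n f \<oplus>\<^bsub>HY_graded n h k\<^esub> CS n g = CS n (\<lambda>w. f w + g w)"
proof -
  let ?S = "carrier (sym_group n)"
  have "CS n f \<oplus>\<^bsub>HY_graded n h k\<^esub> CS n g = (\<Union>x\<in>CS n f. \<Union>y\<in>CS n g. {\<lambda>w\<in>?S. x w + y w})"
    by (simp add: HY_graded_def HY_def quot_module_def set_add_def' HT_simps)
  also have "\<dots> = CS n (\<lambda>w. f w + g w)"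
  proof (intro subset_antisym subsetI)
    fix z assume "z \<in> (\<Union>x\<in>CS n f. \<Union>y\<in>CS n g. {\<lambda>w\<in>?S. x w + y w})"
    then obtain x y where xy: "x \<in> CS n f" "y \<in> CS n g" "z = (\<lambda>w\<in>?S. x w + y w)" by blast
    then have "tHTp n (\<lambda>w. (x w - f w) + (y w - g w))" by (intro tHTp_add) (simp_all add: CS_def)
    moreover have "tHTp n (\<lambda>w. z w - (f w + g w)) \<longleftrightarrow> tHTp n (\<lambda>w. (x w - f w) + (y w - g w))"
      by (rule tHTp_cong) (simp add: xy(3) sym_group_carrier)
    ultimately show "z \<in> CS n (\<lambda>w. f w + g w)" by (simp add: CS_def xy(3))
  next
    fix z assume z: "z \<in> CS n (\<lambda>w. f w + g w)"
    let ?x = "\<lambda>w\<in>?S. z w - g w" and ?y = "restrict g ?S"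
    have "tHTp n (\<lambda>w. ?x w - f w) \<longleftrightarrow> tHTp n (\<lambda>w. z w - (f w + g w))"
      by (rule tHTp_cong) (simp add: sym_group_carrier)
    then have "?x \<in> CS n f" using z by (simp add: CS_def)
    moreover have "?y \<in> CS n g" by (rule restrict_in_CS) simp
    moreover have "z = (\<lambda>w\<in>?S. ?x w + ?y w)"
      by (rule extensionalityI[where A = ?S]) (use z in \<open>simp_all add: CS_def\<close>)
    ultimately show "z \<in> (\<Union>x\<in>CS n f. \<Union>y\<in>CS n g. {\<lambda>w\<in>?S. x w + y w})" by blast
  qed
  finally show ?thesis .
qed

lemma HY_smult:
  assumes h: "path_hess n h" and f: "HTp n f"
  shows "c \<odot>\<^bsub>HY_graded n h k\<^esub> CS n f = CS n (\<lambda>w. const_poly c * f w)"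
proof -
  let ?S = "carrier (sym_group n)"
  have "c \<odot>\<^bsub>HY_graded n h k\<^esub> CS n f = (\<Union>x\<in>CS n f. tHT n h +>\<^bsub>HT n h\<^esub> (\<lambda>w\<in>?S. const_poly c * x w))"
    by (simp add: HY_graded_def HY_def quot_module_def HT_simps)
  also have "\<dots> = CS n (\<lambda>w. const_poly c * f w)"
  proof (rule UN_const)
    show "restrict f ?S \<in> CS n f" by (rule restrict_in_CS) simp
    fix x assume x: "x \<in> CS n f"
    have "HTp n (\<lambda>w. const_poly c * x w)" using CS_HTp[OF x f] by (intro HTp_mult polys_const)
    then have "(\<lambda>w\<in>?S. const_poly c * x w) \<in> carrier (HT n h)" by (simp only: restrict_HT[OF h])
    then have "tHT n h +>\<^bsub>HT n h\<^esub> (\<lambda>w\<in>?S. const_poly c * x w) = CS n (\<lambda>w\<in>?S. const_poly c * x w)"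
      by (rule coset_HT[OF h])
    also have "\<dots> = CS n (\<lambda>w. const_poly c * x w)" by (rule CS_cong) (simp add: sym_group_carrier)
    also have "\<dots> = CS n (\<lambda>w. const_poly c * f w)"
    proof (rule CS_eqI)
      have "tHTp n (\<lambda>w. const_poly c * (x w - f w))" using x by (intro tHTp_mult polys_const) (simp add: CS_def)
      then show "tHTp n (\<lambda>w. const_poly c * x w - const_poly c * f w)" by (simp only: right_diff_distrib)
    qed
    finally show "tHT n h +>\<^bsub>HT n h\<^esub> (\<lambda>w\<in>?S. const_poly c * x w) = CS n (\<lambda>w. const_poly c * f w)" .
  qed
  finally show ?thesis .
qed

lemma dagger_CS:
  assumes \<sigma>: "\<sigma> \<in> carrier (sym_group n)"
  shows "dagger_HY n \<sigma> (CS n f) = CS n (\<lambda>w. f (inv' \<sigma> \<circ> w))"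
proof -
  let ?S = "carrier (sym_group n)"
  have \<sigma>p: "\<sigma> permutes {1..n}" and \<sigma>i: "inv' \<sigma> permutes {1..n}"
    using \<sigma> permutes_inv by (simp_all add: sym_group_carrier)
  have d: "dagger n \<sigma> g = (\<lambda>w\<in>?S. g (inv' \<sigma> \<circ> w))" for g
    using \<sigma> by (simp add: dagger_def sym_group_mult)
  show ?thesis
  proof (intro subset_antisym subsetI)
    fix x assume "x \<in> dagger_HY n \<sigma> (CS n f)"
    then obtain g where g: "g \<in> CS n f" "x = dagger n \<sigma> g" by (auto simp: dagger_HY_def)
    then have "tHTp n (\<lambda>w. g (inv' \<sigma> \<circ> w) - f (inv' \<sigma> \<circ> w))"
      using tHTp_left[OF \<sigma>i, of "\<lambda>w. g w - f w"] by (simp add: CS_def)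
    moreover have "tHTp n (\<lambda>w. x w - f (inv' \<sigma> \<circ> w)) \<longleftrightarrow> tHTp n (\<lambda>w. g (inv' \<sigma> \<circ> w) - f (inv' \<sigma> \<circ> w))"
      by (rule tHTp_cong) (simp add: g(2) d sym_group_carrier)
    ultimately show "x \<in> CS n (\<lambda>w. f (inv' \<sigma> \<circ> w))" by (simp add: CS_def g(2) d)
  next
    fix x assume x: "x \<in> CS n (\<lambda>w. f (inv' \<sigma> \<circ> w))"
    let ?g = "\<lambda>w\<in>?S. x (\<sigma> \<circ> w)"
    have cc: "inv' \<sigma> \<circ> (\<sigma> \<circ> w) = w" "\<sigma> \<circ> (inv' \<sigma> \<circ> w) = w" for w
      using permutes_inv_o[OF \<sigma>p] by (simp_all add: comp_assoc[symmetric])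
    have "tHTp n (\<lambda>w. x (\<sigma> \<circ> w) - f w)"
      using x tHTp_left[OF \<sigma>p, of "\<lambda>w. x w - f (inv' \<sigma> \<circ> w)"] by (simp add: CS_def cc)
    moreover have "tHTp n (\<lambda>w. ?g w - f w) \<longleftrightarrow> tHTp n (\<lambda>w. x (\<sigma> \<circ> w) - f w)"
      by (rule tHTp_cong) (simp add: sym_group_carrier)
    ultimately have "?g \<in> CS n f" by (simp add: CS_def)
    moreover have "x = dagger n \<sigma> ?g"
      unfolding d
    proof (rule extensionalityI[where A = ?S])
      fix w assume "w \<in> ?S"
      then have "inv' \<sigma> \<circ> w \<in> ?S" using \<sigma>i permutes_compose unfolding sym_group_carrier by blast
      then show "x w = (\<lambda>w\<in>?S. ?g (inv' \<sigma> \<circ> w)) w" using \<open>w \<in> ?S\<close> by (simp add: cc)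
    qed (use x in \<open>simp_all add: CS_def\<close>)
    ultimately show "x \<in> dagger_HY n \<sigma> (CS n f)" unfolding dagger_HY_def by blast
  qed
qed

lemma ltr_sum: "ltr \<sigma> (\<Sum>i\<in>A. f i) = (\<Sum>i\<in>A. ltr \<sigma> (f i))"
  by (rule ext) (simp add: ltr_def sum_apply_fun)

text \<open>The action moves only the points w from the left, whereas coefficients are taken
  pointwise and the antisymmetrizers act from the right.\<close>

lemma Lk_dagger:
  assumes "\<sigma> \<in> carrier (sym_group n)"
  shows "Lk n k (\<lambda>w. f (inv' \<sigma> \<circ> w)) = ltr \<sigma> (Lk n k f)"
proof -
  have \<sigma>i: "inv' \<sigma> permutes {1..n}" using assms permutes_inv by (simp add: sym_group_carrier)
  have "coef_fun n m (\<lambda>w. f (inv' \<sigma> \<circ> w)) = ltr \<sigma> (coef_fun n m f)" for m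
    by (rule ext) (simp only: coef_fun_def ltr_def permutes_comp_iff(2)[OF \<sigma>i])
  then show ?thesis unfolding Lk_def ltr_sum by (simp only: rop_ltr)
qed

text \<open>Since \<open>Lk\<close> vanishes on \<open>tHT\<close>, it may be evaluated at an
  arbitrary member of a coset, as T does. Injectivity is \<open>Lk_kernel\<close>, applied to the
  difference of two homogeneous representatives; surjectivity is \<open>Lk_surj\<close>.\<close>

lemma R_HY_eq:
  assumes h: "path_hess n h"
  shows "R_HY n h k = finsum (RS n) (\<lambda>I. rep_class (sym_group n) (fmod (DJ n I)) ltr) (csets n k)"
proof -
  let ?D = "ssum (csets n k) (DJ n)" and ?V = "HY_graded n h k"
  have fin: "finite (csets n k)" by simp
  have ind: "sindep (csets n k) (DJ n)"
    by (rule sindep_subset[OF sindep_DJ]) (use fvs.subspace_0[OF subspace_DJ] in auto)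
  have rc: "gmod (sym_group n) ?D ltr \<and> ?D \<subseteq> FS n \<and> rep_class (sym_group n) (fmod ?D) ltr =
    finsum (rep_ring (sym_group n)) (\<lambda>I. rep_class (sym_group n) (fmod (DJ n I)) ltr) (csets n k)"
    by (rule rep_class_ssum[OF gmod_FS fin _ ind]) (use gmod_DJ DJ_subset_FS in blast)
  define T where "T X = Lk n k (SOME f. f \<in> X)" for X
  have T: "T (CS n f) = Lk n k f" for f
  proof -
    have "restrict f (carrier (sym_group n)) \<in> CS n f" by (rule restrict_in_CS) simp
    then have "(SOME g. g \<in> CS n f) \<in> CS n f" by (rule someI[where P = "\<lambda>g. g \<in> CS n f"])
    then have "tHTp n (\<lambda>w. (SOME g. g \<in> CS n f) w - f w)" by (simp add: CS_def)
    then have "Lk n k (\<lambda>w. (SOME g. g \<in> CS n f) w - f w) = 0" by (rule Lk_kills_tHT)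
    then have "Lk n k (\<lambda>w. ((SOME g. g \<in> CS n f) w - f w) + f w) = 0 + Lk n k f" by (simp only: Lk_add)
    then show ?thesis by (simp add: T_def)
  qed
  let ?H = "\<lambda>f. HTp n f \<and> (\<forall>w. w permutes {1..n} \<longrightarrow> homogeneous k (f w))"
  have V: "X \<in> carrier ?V \<longleftrightarrow> (\<exists>f. X = CS n f \<and> ?H f)" for X
    unfolding carrier_HY_graded[OF h] by blast
  have H_add: "?H (\<lambda>w. f w + g w)" if "?H f" "?H g" for f g
    using that HTp_add homogeneous_add by blast
  have H_scale: "?H (\<lambda>w. const_poly c * f w)" if "?H f" for f c
    using that HTp_mult[OF polys_const] homogeneous_mult[OF homogeneous_const, of k] by fastforce
  have H_left: "?H (\<lambda>w. f (inv' \<sigma> \<circ> w))" if "?H f" "\<sigma> \<in> carrier (sym_group n)" for f \<sigma>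
  proof -
    have \<sigma>i: "inv' \<sigma> permutes {1..n}" using that(2) permutes_inv by (simp add: sym_group_carrier)
    show ?thesis using that(1) HTp_left[OF \<sigma>i] permutes_compose[OF _ \<sigma>i] by blast
  qed
  have "rep_class (sym_group n) ?V (dagger_HY n) = rep_class (sym_group n) (fmod ?D) ltr"
  proof (rule rep_class_transport[where T = T])
    show "gmod (sym_group n) ?D ltr" using rc by blast
    show "bij_betw T (carrier ?V) ?D"
      unfolding bij_betw_def
    proof (rule conjI, rule inj_onI)
      fix X Y assume "X \<in> carrier ?V" "Y \<in> carrier ?V" and TXY: "T X = T Y"
      then obtain f g where f: "X = CS n f" "?H f" and g: "Y = CS n g" "?H g" unfolding V by blast
      have d: "?H (\<lambda>w. f w + const_poly (- 1) * g w)" by (rule H_add[OF f(2) H_scale[OF g(2)]])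
      have "Lk n k (\<lambda>w. f w + const_poly (- 1) * g w) = Lk n k f + fscale (- 1) (Lk n k g)"
        by (simp only: Lk_add Lk_const_mult)
      also have "\<dots> = 0" using TXY unfolding f(1) g(1) T by (simp add: fun_eq_iff)
      finally have "tHTp n (\<lambda>w. f w + const_poly (- 1) * g w)" using Lk_kernel[of n _ k] d by blast
      moreover have "const_poly (- 1) = - 1" using const_poly_simps(5)[of 0 1] by (simp add: const_poly_simps)
      ultimately have "tHTp n (\<lambda>w. f w - g w)" by simp
      then show "X = Y" unfolding f(1) g(1) by (rule CS_eqI)
    next
      show "T ` carrier ?V = ?D"
      proof (intro subset_antisym subsetI)
        fix e assume "e \<in> T ` carrier ?V"
        then obtain X where X: "X \<in> carrier ?V" "e = T X" by (rule imageE)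
        from X(1) obtain f where f: "X = CS n f" "?H f" unfolding V by (elim exE conjE) simp
        show "e \<in> ?D" unfolding X(2) f(1) T by (rule Lk_in_ssum) (use f(2) in simp)
      next
        fix e assume "e \<in> ?D"
        then have "\<exists>f. HTp n f \<and> (\<forall>w. homogeneous k (f w)) \<and> Lk n k f = e"
          by (rule Lk_surj) (intro exI conjI allI)
        then obtain f where f: "HTp n f" "\<And>w. homogeneous k (f w)" "Lk n k f = e" by blast
        have "CS n f \<in> carrier ?V" unfolding V using f(1,2) by (intro exI[of _ f]) simp
        then have "T (CS n f) \<in> T ` carrier ?V" by (rule imageI)
        then show "e \<in> T ` carrier ?V" unfolding T f(3) .
      qed
    qed
    have "?H (\<lambda>w. 0)" using HTp_zero by simp
    then show "\<zero>\<^bsub>?V\<^esub> \<in> carrier ?V" unfolding HY_zero[OF h] V by blast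
    show "T \<zero>\<^bsub>?V\<^esub> = 0" unfolding HY_zero[OF h] T by (rule Lk_zero)
    fix X assume X: "X \<in> carrier ?V"
    then obtain f where f: "X = CS n f" "?H f" unfolding V by blast
    show "c \<odot>\<^bsub>?V\<^esub> X \<in> carrier ?V" for c
      unfolding f(1) HY_smult[OF h conjunct1[OF f(2)]] V using H_scale[OF f(2)] by blast
    show "T (c \<odot>\<^bsub>?V\<^esub> X) = fscale c (T X)" for c
      unfolding f(1) HY_smult[OF h conjunct1[OF f(2)]] T by (rule Lk_const_mult)
    show "X \<oplus>\<^bsub>?V\<^esub> Y \<in> carrier ?V" if "Y \<in> carrier ?V" for Y
    proof -
      from \<open>Y \<in> carrier ?V\<close> obtain g where g: "Y = CS n g" "?H g" unfolding V by blast
      show ?thesis unfolding f(1) g(1) HY_add[OF h] V using H_add[OF f(2) g(2)] by blast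
    qed
    show "T (X \<oplus>\<^bsub>?V\<^esub> Y) = T X + T Y" if "Y \<in> carrier ?V" for Y
    proof -
      from \<open>Y \<in> carrier ?V\<close> obtain g where g: "Y = CS n g" "?H g" unfolding V by blast
      show ?thesis unfolding f(1) g(1) HY_add[OF h] T by (rule Lk_add)
    qed
    fix \<sigma> assume \<sigma>: "\<sigma> \<in> carrier (sym_group n)"
    show "dagger_HY n \<sigma> X \<in> carrier ?V"
      unfolding f(1) dagger_CS[OF \<sigma>] V using H_left[OF f(2) \<sigma>] by blast
    show "T (dagger_HY n \<sigma> X) = ltr \<sigma> (T X)"
      unfolding f(1) dagger_CS[OF \<sigma>] T by (rule Lk_dagger[OF \<sigma>])
  qed
  then show ?thesis using rc unfolding R_HY_def RS_def by simp
qed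

section \<open>The faces of the permutohedron\<close>

lemma abel_summation:
  fixes v :: "nat \<Rightarrow> 'a::real_vector"
  assumes "m \<ge> 1"
  shows "(\<Sum>k\<in>{1..m}. x k *\<^sub>R v k) =
    (\<Sum>k\<in>{1..m}. x k) *\<^sub>R v m + (\<Sum>i\<in>{1..<m}. (\<Sum>k\<in>{1..i}. x k) *\<^sub>R (v i - v (i + 1)))"
  using assms
proof (induction m rule: nat_induct_at_least)
  case base
  show ?case by simp
next
  case (Suc m)
  have "{1..<Suc m} = insert m {1..<m}" "{1..Suc m} = insert (Suc m) {1..m}" using Suc.hyps by auto
  then show ?case using Suc.IH by (simp add: algebra_simps)
qed

text \<open>A and {1..i} have the same size, so each has equally many elements outside the other.
  Those of A are at least i + 1, the missing ones at most i, and every exchange costs at least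
  1.\<close>

lemma sum_ge_sum_prefix:
  fixes A :: "nat set"
  assumes "finite A" "card A = i" "0 \<notin> A"
  shows "\<Sum>A \<ge> \<Sum>{1..i} + card (A - {1..i})"
proof -
  let ?B = "{1..i}"
  have A: "\<Sum>A = \<Sum>(A \<inter> ?B) + \<Sum>(A - ?B)" using sum.Int_Diff[OF assms(1), of "\<lambda>x. x" ?B] .
  have B: "\<Sum>?B = \<Sum>(A \<inter> ?B) + \<Sum>(?B - A)" using sum.Int_Diff[of ?B "\<lambda>x. x" A] by (simp add: Int_commute)
  have "card A = card (A \<inter> ?B) + card (A - ?B)" using sum.Int_Diff[OF assms(1), of "\<lambda>x. 1::nat" ?B] by simp
  moreover have "card ?B = card (A \<inter> ?B) + card (?B - A)" using sum.Int_Diff[of ?B "\<lambda>x. 1::nat" A] by (simp add: Int_commute)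
  ultimately have c: "card (?B - A) = card (A - ?B)" using assms(2) by simp
  have "\<Sum>(?B - A) \<le> of_nat (card (?B - A)) * i" by (rule sum_bounded_above) auto
  moreover have "of_nat (card (A - ?B)) * (i + 1) \<le> \<Sum>(A - ?B)"
  proof (rule sum_bounded_below)
    fix k assume k: "k \<in> A - ?B"
    have "k \<noteq> 0"
    proof
      assume "k = 0"
      then show False using k assms(3) by simp
    qed
    then have "1 \<le> k" by linarith
    then show "i + 1 \<le> k" using k by simp
  qed
  ultimately show ?thesis using A B c by (simp add: algebra_simps)
qed

text \<open>The coefficient of \<open>v i - v (i + 1)\<close> in Abel summation. For a permutation
  of {1..n} and i <= n it is nonnegative, and it vanishes exactly if u preserves the prefix {1..i},
  which is the condition defining \<open>yg\<close>.\<close>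

definition excess :: "(nat \<Rightarrow> nat) \<Rightarrow> nat \<Rightarrow> real" where
  "excess u i = (\<Sum>k\<in>{1..i}. real (u k) - real k)"

lemma excess_eq_0: "u ` {1..i} = {1..i} \<Longrightarrow> inj u \<Longrightarrow> excess u i = 0"
proof -
  assume h: "u ` {1..i} = {1..i}" "inj u"
  have "inj_on u {1..i}" using h(2) by (rule inj_on_subset) simp
  then have "(\<Sum>k\<in>{1..i}. real (u k)) = (\<Sum>k\<in>u ` {1..i}. real k)" by (simp only: sum.reindex comp_def)
  then show ?thesis unfolding excess_def sum_subtractf h(1) by simp
qed

lemma excess_nonneg:
  assumes "u permutes {1..n}" "i \<le> n"
  shows "excess u i \<ge> 0" "u ` {1..i} \<noteq> {1..i} \<Longrightarrow> excess u i > 0"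
proof -
  have inj: "inj_on u {1..i}" using permutes_inj[OF assms(1)] by (rule inj_on_subset) simp
  have "u k \<noteq> 0" if "k \<in> {1..i}" for k using permutes_in_image[OF assms(1), of k] that assms(2) by force
  then have z: "0 \<notin> u ` {1..i}" by force
  have c: "card (u ` {1..i}) = i" using card_image[OF inj] by simp
  have s: "\<Sum>(u ` {1..i}) = (\<Sum>k\<in>{1..i}. u k)" using sum.reindex[OF inj, of "\<lambda>x. x"] by simp
  have "(\<Sum>k\<in>{1..i}. u k) \<ge> \<Sum>{1..i} + card (u ` {1..i} - {1..i})"
    using sum_ge_sum_prefix[OF _ c z] s by simp
  then have "real (\<Sum>k\<in>{1..i}. u k) \<ge> real (\<Sum>{1..i}) + real (card (u ` {1..i} - {1..i}))"
    by (simp only: of_nat_le_iff of_nat_add[symmetric])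
  then have *: "excess u i \<ge> real (card (u ` {1..i} - {1..i}))"
    unfolding excess_def sum_subtractf by simp
  then show "excess u i \<ge> 0" by linarith
  assume ne: "u ` {1..i} \<noteq> {1..i}"
  have "\<not> u ` {1..i} \<subseteq> {1..i}"
  proof
    assume sub: "u ` {1..i} \<subseteq> {1..i}"
    show False using card_subset_eq[OF _ sub] c ne by simp
  qed
  then have "u ` {1..i} - {1..i} \<noteq> {}" by blast
  then have "card (u ` {1..i} - {1..i}) > 0" by (simp add: card_gt_0_iff)
  then show "excess u i > 0" using * by linarith
qed

text \<open>Abel summation; the boundary term is the excess at n, which is zero because a
  permutation preserves the total.\<close>

lemma permuted_sum:
  fixes v :: "nat \<Rightarrow> 'a::real_vector"
  assumes "u permutes {1..n}" "n \<ge> 1"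
  shows "(\<Sum>k\<in>{1..n}. real (u k) *\<^sub>R v k) - (\<Sum>k\<in>{1..n}. real k *\<^sub>R v k) =
    (\<Sum>i\<in>{1..n - 1}. excess u i *\<^sub>R (v i - v (i + 1)))"
proof -
  have "excess u n = 0" using excess_eq_0 permutes_image[OF assms(1)] permutes_inj[OF assms(1)] by blast
  moreover have "{1..<n} = {1..n - 1}" using assms(2) by auto
  ultimately show ?thesis
    using abel_summation[OF assms(2), of "\<lambda>k. real (u k) - real k" v]
    by (simp add: excess_def scaleR_left_diff_distrib sum_subtractf)
qed

text \<open>The vector \<open>g j\<close> is orthogonal to the span of the other members, but not to
  \<open>f j\<close>.\<close>

lemma dual_family_independent:
  fixes f g :: "'i \<Rightarrow> 'a::euclidean_space"
  assumes "\<And>i j. i \<in> J \<Longrightarrow> j \<in> J \<Longrightarrow> inner (g j) (f i) = (if i = j then 1 else 0)"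
  shows "independent (f ` J)" "inj_on f J"
proof -
  show "inj_on f J"
  proof (rule inj_onI, rule ccontr)
    fix i j assume "i \<in> J" "j \<in> J" "f i = f j" "i \<noteq> j"
    then show False using assms[of i i] assms[of j i] by simp
  qed
  show "independent (f ` J)"
  proof
    assume "dependent (f ` J)"
    then obtain j where j: "j \<in> J" "f j \<in> span (f ` J - {f j})" unfolding dependent_def by blast
    have "real_inner_class.orthogonal (g j) (f j)"
    proof (rule orthogonal_to_span[OF j(2)])
      fix y assume "y \<in> f ` J - {f j}"
      then obtain i where "i \<in> J" "y = f i" "i \<noteq> j" by blast
      then show "real_inner_class.orthogonal (g j) y" using assms[of i j] j(1) by (simp add: real_inner_class.orthogonal_def)
    qed
    then show False using assms[OF j(1) j(1)] by (simp add: real_inner_class.orthogonal_def)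
  qed
qed

text \<open>The list 1, ..., n is sorted by the key c; list positions start at 0, hence the shift
  \<open>k - 1\<close>.\<close>

lemma exists_sorting_perm:
  fixes c :: "nat \<Rightarrow> 'a::linorder"
  obtains w where "w permutes {1..n}" "\<And>i. i \<in> {1..n - 1} \<Longrightarrow> c (w i) \<le> c (w (i + 1))"
proof -
  define xs where "xs = sort_key c [1..<n + 1]"
  have len: "length xs = n" and st: "set xs = {1..n}" and d: "distinct xs"
    by (auto simp: xs_def)
  define w where "w = (\<lambda>k. if k \<in> {1..n} then xs ! (k - 1) else k)"
  have "bij_betw (\<lambda>k. k - 1) {1..n} {..<n}"
    by (rule bij_betw_byWitness[where f' = "\<lambda>k. k + 1"]) auto
  moreover have "bij_betw ((!) xs) {..<n} {1..n}"
    by (rule bij_betw_nth) (use d len st in auto)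
  ultimately have "bij_betw ((!) xs \<circ> (\<lambda>k. k - 1)) {1..n} {1..n}" by (rule bij_betw_trans)
  then have b: "bij_betw w {1..n} {1..n}"
    by (rule bij_betw_cong[THEN iffD1, rotated]) (simp add: w_def)
  have "w permutes {1..n}" by (rule bij_imp_permutes[OF b]) (auto simp: w_def)
  moreover have "c (w i) \<le> c (w (i + 1))" if "i \<in> {1..n - 1}" for i
  proof -
    have i: "i \<in> {1..n}" "i + 1 \<in> {1..n}" using that by auto
    have "sorted (map c xs)" by (simp add: xs_def)
    then have "map c xs ! (i - 1) \<le> map c xs ! i"
      by (rule sorted_nth_mono) (use i len in auto)
    then show ?thesis using i len unfolding w_def by auto
  qed
  ultimately show ?thesis by (rule that)
qed

lemma yg_comp_iff:
  assumes "t \<in> yg n I"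
  shows "u \<circ> t \<in> yg n I \<longleftrightarrow> u \<in> yg n I"
proof
  assume "u \<circ> t \<in> yg n I"
  then have "(u \<circ> t) \<circ> inv' t \<in> yg n I" by (rule comp_in_yg[OF _ inv_in_yg[OF assms]])
  then show "u \<in> yg n I" using permutes_inv_o(1)[OF ygD[OF assms]] by (simp add: comp_assoc)
qed (rule comp_in_yg[OF _ assms])

lemma transpose_not_in_yg:
  assumes "i \<in> I" "1 \<le> i"
  shows "Transposition.transpose i (i + 1) \<notin> yg n I"
proof
  assume "Transposition.transpose i (i + 1) \<in> yg n I"
  then have "Transposition.transpose i (i + 1) ` {1..i} = {1..i}" using assms(1) by (simp add: yg_def)
  moreover have "i + 1 \<in> Transposition.transpose i (i + 1) ` {1..i}"
    by (rule image_eqI[of _ _ i]) (use assms(2) in auto)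
  ultimately show False by auto
qed

text \<open>The cuts can be read off the group: i is a cut exactly if the transposition of i and i +
  1 is missing from it.\<close>

lemma yg_eqD:
  assumes "yg n I = yg n J" "I \<subseteq> {1..n - 1}" "J \<subseteq> {1..n - 1}"
  shows "I = J"
proof -
  have "I \<subseteq> J" if h: "yg n I = yg n J" "I \<subseteq> {1..n - 1}" for I J
  proof
    fix i assume i: "i \<in> I"
    then have i1: "i \<in> {1..n - 1}" using h(2) by blast
    show "i \<in> J"
      using transpose_not_in_yg[OF i, of n] transpose_in_yg[OF i1, of J] i1 h(1) by auto
  qed
  from this[OF assms(1,2)] this[OF assms(1)[symmetric] assms(3)] show ?thesis by blast
qed

section \<open>Faces of the permutohedron as cosets of Young subgroups\<close>

locale numbered_coords =
  fixes n :: nat and e :: "nat \<Rightarrow> 'n::finite"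
  assumes n: "n \<ge> 1" and e: "bij_betw e {1..n} UNIV"
begin

lemma vec_of_coords_nth: "i \<in> {1..n} \<Longrightarrow> vec_nth (vec_of_coords n e c) (e i) = c i"
  using inv_into_f_f[OF bij_betw_imp_inj_on[OF e]] by (simp add: vec_of_coords_def)

lemma coord_cases:
  obtains i where "i \<in> {1..n}" "k = e i"
proof -
  have "k \<in> e ` {1..n}" using bij_betw_imp_surj_on[OF e] by simp
  then show ?thesis by (rule imageE) (rule that)
qed

lemma vec_eqI: "(\<And>i. i \<in> {1..n} \<Longrightarrow> vec_nth x (e i) = vec_nth y (e i)) \<Longrightarrow> x = y"
proof -
  assume h: "\<And>i. i \<in> {1..n} \<Longrightarrow> vec_nth x (e i) = vec_nth y (e i)"
  have "vec_nth x k = vec_nth y k" for k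
    by (rule coord_cases[of k]) (simp only: h)
  then show "x = y" unfolding Finite_Cartesian_Product.vec_eq_iff by blast
qed

lemma inner_coords: "inner x y = (\<Sum>i\<in>{1..n}. vec_nth x (e i) * vec_nth y (e i))"
  unfolding inner_vec_def inner_real_def
  using sum.reindex_bij_betw[OF e, of "\<lambda>k. vec_nth x k * vec_nth y k"] by simp

definition perm_vec :: "(nat \<Rightarrow> nat) \<Rightarrow> real ^ 'n" where
  "perm_vec w = vec_of_coords n e (\<lambda>i. real (w i))"

lemma perm_vec_nth: "i \<in> {1..n} \<Longrightarrow> vec_nth (perm_vec w) (e i) = real (w i)"
  unfolding perm_vec_def by (rule vec_of_coords_nth)

lemma permutohedron_eq: "permutohedron n e = convex hull (perm_vec ` {z. z permutes {1..n}})"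
  by (simp add: permutohedron_def perm_vec_def sym_group_def)

text \<open>The faces are indexed by the left cosets of Young subgroups; the vertices of a face are the
  inverses of the elements of the coset.\<close>

definition coset_face :: "nat set \<Rightarrow> (nat \<Rightarrow> nat) \<Rightarrow> (real ^ 'n) set" where
  "coset_face I w = convex hull (perm_vec ` {z. z permutes {1..n} \<and> z \<circ> w \<in> yg n I})"

lemma sum_reindex_perm:
  assumes "w permutes {1..n}"
  shows "(\<Sum>i\<in>{1..n}. f i) = (\<Sum>k\<in>{1..n}. f (w k))"
  using sum.reindex_bij_betw[OF permutes_imp_bij[OF assms], of f] by simp

lemma inner_perm_vec:
  assumes "w permutes {1..n}"
  shows "inner a (perm_vec z) = (\<Sum>k\<in>{1..n}. vec_nth a (e (w k)) * real (z (w k)))"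
proof -
  have "inner a (perm_vec z) = (\<Sum>i\<in>{1..n}. vec_nth a (e i) * real (z i))"
    unfolding inner_coords using perm_vec_nth by (intro sum.cong) auto
  also have "\<dots> = (\<Sum>k\<in>{1..n}. vec_nth a (e (w k)) * real (z (w k)))"
    by (rule sum_reindex_perm[OF assms])
  finally show ?thesis .
qed

text \<open>Abel summation: a linear functional that is increasing along \<open>w\<close> attains its maximum over the
  vertices exactly at the coset given by its strict ascents.\<close>

lemma inner_perm_vec_le:
  assumes w: "w permutes {1..n}" and z: "z permutes {1..n}"
    and mono: "\<And>i. i \<in> {1..n - 1} \<Longrightarrow> vec_nth a (e (w i)) \<le> vec_nth a (e (w (i + 1)))"
    and M: "M = (\<Sum>k\<in>{1..n}. vec_nth a (e (w k)) * real k)"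
    and I: "I = {i \<in> {1..n - 1}. vec_nth a (e (w i)) < vec_nth a (e (w (i + 1)))}"
  shows "inner a (perm_vec z) \<le> M" "inner a (perm_vec z) = M \<longleftrightarrow> z \<circ> w \<in> yg n I"
proof -
  let ?b = "\<lambda>k. vec_nth a (e (w k))" and ?u = "z \<circ> w"
  have u: "?u permutes {1..n}" by (rule permutes_compose[OF w z])
  have "inner a (perm_vec z) - M = (\<Sum>i\<in>{1..n - 1}. excess ?u i * (?b i - ?b (i + 1)))"
    unfolding inner_perm_vec[OF w] M using permuted_sum[OF u n, of ?b] by (simp add: mult.commute)
  then have eq: "M - inner a (perm_vec z) = (\<Sum>i\<in>{1..n - 1}. excess ?u i * (?b (i + 1) - ?b i))"
    by (simp add: algebra_simps sum_subtractf)
  have nn: "excess ?u i * (?b (i + 1) - ?b i) \<ge> 0" if i: "i \<in> {1..n - 1}" for i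
    by (rule mult_nonneg_nonneg) (use excess_nonneg(1)[OF u, of i] mono[OF i] i in auto)
  have "0 \<le> (\<Sum>i\<in>{1..n - 1}. excess ?u i * (?b (i + 1) - ?b i))" by (rule sum_nonneg[OF nn])
  then show "inner a (perm_vec z) \<le> M" unfolding eq[symmetric] by simp
  have "inner a (perm_vec z) = M \<longleftrightarrow> M - inner a (perm_vec z) = 0" by auto
  also have "\<dots> \<longleftrightarrow> (\<forall>i\<in>{1..n - 1}. excess ?u i * (?b (i + 1) - ?b i) = 0)"
    unfolding eq by (rule sum_nonneg_eq_0_iff[OF _ nn]) simp
  also have "\<dots> \<longleftrightarrow> (\<forall>i\<in>I. ?u ` {1..i} = {1..i})"
  proof (intro iffI ballI)
    fix i assume h: "\<forall>i\<in>{1..n - 1}. excess ?u i * (?b (i + 1) - ?b i) = 0" and i: "i \<in> I"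
    have i1: "i \<in> {1..n - 1}" using i I by simp
    have "excess ?u i = 0" using h[THEN bspec, OF i1] i unfolding I by simp
    then show "?u ` {1..i} = {1..i}" using excess_nonneg(2)[OF u, of i] i1 by fastforce
  next
    fix i assume h: "\<forall>i\<in>I. ?u ` {1..i} = {1..i}" and i: "i \<in> {1..n - 1}"
    show "excess ?u i * (?b (i + 1) - ?b i) = 0"
    proof (cases "i \<in> I")
      case True
      then show ?thesis using excess_eq_0[OF h[THEN bspec, OF True] permutes_inj[OF u]] by simp
    next
      case False
      then show ?thesis using mono[OF i] i unfolding I by simp
    qed
  qed
  also have "\<dots> \<longleftrightarrow> ?u \<in> yg n I" using u by (simp add: yg_def)
  finally show "inner a (perm_vec z) = M \<longleftrightarrow> z \<circ> w \<in> yg n I" .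
qed

text \<open>The hyperplane section is a face, hence the convex hull of some of the vertices. Those
  vertices lie on the hyperplane, so \<open>inner_perm_vec_le\<close> places them in the
  coset.\<close>

lemma supporting_face:
  assumes w: "w permutes {1..n}"
    and mono: "\<And>i. i \<in> {1..n - 1} \<Longrightarrow> vec_nth a (e (w i)) \<le> vec_nth a (e (w (i + 1)))"
    and M: "M = (\<Sum>k\<in>{1..n}. vec_nth a (e (w k)) * real k)"
    and I: "I = {i \<in> {1..n - 1}. vec_nth a (e (w i)) < vec_nth a (e (w (i + 1)))}"
  shows "permutohedron n e \<subseteq> {x. inner a x \<le> M}"
    "permutohedron n e \<inter> {x. inner a x = M} face_of permutohedron n e"
    "permutohedron n e \<inter> {x. inner a x = M} = coset_face I w"
proof -
  let ?V = "perm_vec ` {z. z permutes {1..n}}" and ?P = "permutohedron n e"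
  note le = inner_perm_vec_le[OF w _ mono M I]
  have "?V \<subseteq> {x. inner a x \<le> M}" using le(1) by blast
  then show P: "?P \<subseteq> {x. inner a x \<le> M}"
    unfolding permutohedron_eq by (rule hull_minimal) (rule convex_halfspace_le)
  have cP: "convex ?P" by (simp add: permutohedron_eq)
  show F: "?P \<inter> {x. inner a x = M} face_of ?P"
    by (rule face_of_Int_supporting_hyperplane_le[OF cP]) (use P in blast)
  show "?P \<inter> {x. inner a x = M} = coset_face I w"
  proof (rule subset_antisym)
    have "compact ?V" by (intro finite_imp_compact finite_imageI finite_perms)
    then obtain S where S: "S \<subseteq> ?V" "?P \<inter> {x. inner a x = M} = convex hull S"
      using F unfolding permutohedron_eq by (rule face_of_convex_hull_subset)
    have "S \<subseteq> perm_vec ` {z. z permutes {1..n} \<and> z \<circ> w \<in> yg n I}"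
    proof
      fix x assume x: "x \<in> S"
      then obtain z where z: "z permutes {1..n}" "x = perm_vec z" using S(1) by blast
      have "x \<in> convex hull S" using x by (rule hull_inc)
      then have "inner a x = M" using S(2) by blast
      then have "z \<circ> w \<in> yg n I" using le(2)[OF z(1)] z(2) by simp
      then show "x \<in> perm_vec ` {z. z permutes {1..n} \<and> z \<circ> w \<in> yg n I}" using z by blast
    qed
    then show "?P \<inter> {x. inner a x = M} \<subseteq> coset_face I w"
      unfolding S(2) coset_face_def by (rule hull_mono)
    show "coset_face I w \<subseteq> ?P \<inter> {x. inner a x = M}"
      unfolding coset_face_def
    proof (rule hull_minimal)
      show "convex (?P \<inter> {x. inner a x = M})" by (intro convex_Int cP convex_hyperplane)
      show "perm_vec ` {z. z permutes {1..n} \<and> z \<circ> w \<in> yg n I} \<subseteq> ?P \<inter> {x. inner a x = M}"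
      proof
        fix x assume "x \<in> perm_vec ` {z. z permutes {1..n} \<and> z \<circ> w \<in> yg n I}"
        then obtain z where z: "z permutes {1..n}" "z \<circ> w \<in> yg n I" "x = perm_vec z" by blast
        have "x \<in> ?P" unfolding permutohedron_eq by (rule hull_inc) (use z in blast)
        then show "x \<in> ?P \<inter> {x. inner a x = M}" using le(2)[OF z(1)] z(2,3) by simp
      qed
    qed
  qed
qed

text \<open>A staircase: the coordinate of a at \<open>w k\<close> is the number of cuts below k,
  which increases by one from i to i + 1 if i is a cut and is constant otherwise.\<close>

lemma coset_face_functional:
  assumes w: "w permutes {1..n}" and I: "I \<subseteq> {1..n - 1}"
  shows "\<exists>a :: real ^ 'n. (\<forall>i\<in>{1..n - 1}. vec_nth a (e (w i)) \<le> vec_nth a (e (w (i + 1)))) \<and>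
    I = {i \<in> {1..n - 1}. vec_nth a (e (w i)) < vec_nth a (e (w (i + 1)))}"
proof -
  define a where "a = vec_of_coords n e (\<lambda>i. real (card {j \<in> I. j < inv' w i}))"
  have fin: "finite I" using I finite_subset by blast
  have a: "vec_nth a (e (w k)) = real (card {j \<in> I. j < k})" if "k \<in> {1..n}" for k
    unfolding a_def using that permutes_in_image[OF w, of k] permutes_inverses(2)[OF w, of k]
    by (simp add: vec_of_coords_nth)
  have step: "vec_nth a (e (w (i + 1))) = vec_nth a (e (w i)) + (if i \<in> I then 1 else 0)"
    if i: "i \<in> {1..n - 1}" for i
  proof -
    have s: "{j \<in> I. j < i + 1} = (if i \<in> I then insert i {j \<in> I. j < i} else {j \<in> I. j < i})"
      by (auto simp: less_Suc_eq)
    have "i \<in> {1..n}" "i + 1 \<in> {1..n}" using i by auto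
    then show ?thesis unfolding a[OF \<open>i \<in> {1..n}\<close>] a[OF \<open>i + 1 \<in> {1..n}\<close>] s using fin by simp
  qed
  have "\<forall>i\<in>{1..n - 1}. vec_nth a (e (w i)) \<le> vec_nth a (e (w (i + 1)))"
    using step by (intro ballI) simp
  moreover have "I = {i \<in> {1..n - 1}. vec_nth a (e (w i)) < vec_nth a (e (w (i + 1)))}"
  proof (rule Set.set_eqI)
    fix i
    show "i \<in> I \<longleftrightarrow> i \<in> {i \<in> {1..n - 1}. vec_nth a (e (w i)) < vec_nth a (e (w (i + 1)))}"
      using step[of i] I by (cases "i \<in> {1..n - 1}") auto
  qed
  ultimately show ?thesis by (intro exI[of _ a] conjI)
qed

lemma coset_face_face_of:
  assumes "w permutes {1..n}" "I \<subseteq> {1..n - 1}"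
  shows "coset_face I w face_of permutohedron n e"
proof -
  obtain a :: "real ^ 'n" where a: "\<forall>i\<in>{1..n - 1}. vec_nth a (e (w i)) \<le> vec_nth a (e (w (i + 1)))"
    "I = {i \<in> {1..n - 1}. vec_nth a (e (w i)) < vec_nth a (e (w (i + 1)))}"
    using coset_face_functional[OF assms] by blast
  show ?thesis
    using supporting_face(2)[OF assms(1) a(1)[rule_format] refl a(2)]
    by (simp only: supporting_face(3)[OF assms(1) a(1)[rule_format] refl a(2)])
qed

text \<open>A further vertex might a priori lie in the hull of those of the coset; the supporting
  functional, which attains its maximum only on the coset, excludes this.\<close>

lemma perm_vec_in_coset_face:
  assumes w: "w permutes {1..n}" and I: "I \<subseteq> {1..n - 1}" and z: "z permutes {1..n}"
  shows "perm_vec z \<in> coset_face I w \<longleftrightarrow> z \<circ> w \<in> yg n I"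
proof
  obtain a :: "real ^ 'n" where a: "\<forall>i\<in>{1..n - 1}. vec_nth a (e (w i)) \<le> vec_nth a (e (w (i + 1)))"
    "I = {i \<in> {1..n - 1}. vec_nth a (e (w i)) < vec_nth a (e (w (i + 1)))}"
    using coset_face_functional[OF w I] by blast
  assume "perm_vec z \<in> coset_face I w"
  then have "inner a (perm_vec z) = (\<Sum>k\<in>{1..n}. vec_nth a (e (w k)) * real k)"
    using supporting_face(3)[OF w a(1)[rule_format] refl a(2)] by (auto dest: equalityD2)
  then show "z \<circ> w \<in> yg n I" using inner_perm_vec_le(2)[OF w z a(1)[rule_format] refl a(2)] by (simp only: simp_thms)
next
  assume "z \<circ> w \<in> yg n I"
  then show "perm_vec z \<in> coset_face I w" unfolding coset_face_def by (intro hull_inc) (use z in blast)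
qed

text \<open>Faces of a polytope are exposed. Sorting the coordinates of the exposing functional
  yields w, and its strict ascents yield I. The level b equals the maximum \<open>?M\<close>,
  because the vertex of the inverse of w attains \<open>?M\<close> and F is nonempty.\<close>

lemma face_is_coset_face:
  assumes F: "F face_of permutohedron n e" and ne: "F \<noteq> {}"
  obtains I w where "I \<subseteq> {1..n - 1}" "w permutes {1..n}" "F = coset_face I w"
proof -
  have "polytope (permutohedron n e)" unfolding permutohedron_eq polytope_def
    using finite_imageI[OF finite_perms] by blast
  then have "F exposed_face_of permutohedron n e"
    using exposed_face_of_polyhedron[OF polytope_imp_polyhedron] F by blast
  then obtain a b where ab: "permutohedron n e \<subseteq> {x. inner a x \<le> b}"
    "F = permutohedron n e \<inter> {x. inner a x = b}" unfolding exposed_face_of_def by blast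
  obtain w where w: "w permutes {1..n}"
    and mono: "\<And>i. i \<in> {1..n - 1} \<Longrightarrow> vec_nth a (e (w i)) \<le> vec_nth a (e (w (i + 1)))"
    by (rule exists_sorting_perm[of n "\<lambda>i. vec_nth a (e i)"]) blast
  let ?M = "\<Sum>k\<in>{1..n}. vec_nth a (e (w k)) * real k"
  define I where "I = {i \<in> {1..n - 1}. vec_nth a (e (w i)) < vec_nth a (e (w (i + 1)))}"
  note sf = supporting_face[OF w mono refl I_def]
  have iw: "inv' w permutes {1..n}" by (rule permutes_inv[OF w])
  have "inv' w \<circ> w \<in> yg n I" using permutes_inv_o(2)[OF w] by simp
  then have "perm_vec (inv' w) \<in> coset_face I w" unfolding coset_face_def using iw by (intro hull_inc) blast
  then have "perm_vec (inv' w) \<in> permutohedron n e \<inter> {x. inner a x = ?M}" by (simp only: sf(3))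
  then have "?M \<le> b" using ab(1) by auto
  moreover obtain x where "x \<in> F" using ne by blast
  then have "b \<le> ?M" using ab(2) sf(1) by auto
  ultimately have "b = ?M" by simp
  then have "F = coset_face I w" using ab(2) sf(3) by simp
  then show ?thesis by (rule that[rotated 2]) (use w I_def in auto)
qed

lemma coset_face_cong:
  assumes "u \<in> yg n I"
  shows "coset_face I (w \<circ> u) = coset_face I w"
  unfolding coset_face_def comp_assoc[symmetric] by (simp only: yg_comp_iff[OF assms])

text \<open>Equal faces contain the same vertices. The vertex of the inverse of v shows that v and w
  differ by an element t of \<open>yg n I\<close>; the vertices of \<open>x \<circ> inv' v\<close>,
  with x arbitrary, then show that both groups have the same elements.\<close>

lemma coset_face_eqD:
  assumes w: "w permutes {1..n}" and v: "v permutes {1..n}" and I: "I \<subseteq> {1..n - 1}" and J: "J \<subseteq> {1..n - 1}"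
    and eq: "coset_face I w = coset_face J v"
  shows "I = J" "\<exists>u\<in>yg n I. w = v \<circ> u"
proof -
  have z: "z \<circ> w \<in> yg n I \<longleftrightarrow> z \<circ> v \<in> yg n J" if "z permutes {1..n}" for z
    using perm_vec_in_coset_face[OF w I that] perm_vec_in_coset_face[OF v J that] eq by simp
  define t where "t = inv' v \<circ> w"
  have iv: "inv' v permutes {1..n}" by (rule permutes_inv[OF v])
  have wt: "w = v \<circ> t" using permutes_inv_o(1)[OF v] by (simp add: t_def comp_assoc[symmetric])
  have t: "t \<in> yg n I" using z[OF iv] permutes_inv_o(2)[OF v] by (simp add: t_def)
  have "x \<in> yg n I \<longleftrightarrow> x \<in> yg n J" if x: "x permutes {1..n}" for x
  proof -
    let ?z = "x \<circ> inv' v"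
    have "?z \<circ> v = x" using permutes_inv_o(2)[OF v] by (simp add: comp_assoc)
    moreover have "?z \<circ> w = x \<circ> t" by (simp add: t_def comp_assoc)
    ultimately show ?thesis using z[OF permutes_compose[OF iv x]] yg_comp_iff[OF t] by simp
  qed
  then have "yg n I = yg n J" using ygD by blast
  then show "I = J" by (rule yg_eqD[OF _ I J])
  show "\<exists>u\<in>yg n I. w = v \<circ> u" using t wt by blast
qed

text \<open>Seen from the vertex of the inverse of w, the vertices of the face are combinations of
  the \<open>d i\<close> with i outside I, as the excess vanishes at the cuts. Each such
  \<open>d i\<close> is itself a difference of two vertices, obtained by composing with an adjacent
  transposition.\<close>

lemma aff_dim_coset_face:
  assumes w: "w permutes {1..n}" and I: "I \<subseteq> {1..n - 1}"
  shows "aff_dim (coset_face I w) = int (n - 1 - card I)"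
proof -
  let ?S = "perm_vec ` {z. z permutes {1..n} \<and> z \<circ> w \<in> yg n I}" and ?p = "perm_vec (inv' w)"
  define v :: "nat \<Rightarrow> real ^ 'n" where "v k = axis (e (w k)) 1" for k
  define d where "d i = v i - v (i + 1)" for i
  let ?J = "{1..n - 1} - I"
  have iw: "inv' w permutes {1..n}" by (rule permutes_inv[OF w])
  have exp: "perm_vec z = (\<Sum>k\<in>{1..n}. real (z (w k)) *\<^sub>R v k)" for z
  proof (rule vec_eqI)
    fix i assume i: "i \<in> {1..n}"
    have ej: "e j = e i \<longleftrightarrow> j = i" if "j \<in> {1..n}" for j
      using inj_on_eq_iff[OF bij_betw_imp_inj_on[OF e] that i] .
    have "vec_nth (\<Sum>k\<in>{1..n}. real (z (w k)) *\<^sub>R v k) (e i) =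
        (\<Sum>k\<in>{1..n}. real (z (w k)) * vec_nth (axis (e (w k)) 1) (e i))"
      by (simp add: v_def sum_component)
    also have "\<dots> = (\<Sum>j\<in>{1..n}. real (z j) * vec_nth (axis (e j) 1) (e i))"
      by (rule sum_reindex_perm[OF w, symmetric])
    also have "\<dots> = (\<Sum>j\<in>{1..n}. if j = i then real (z i) else 0)"
      using ej by (intro sum.cong refl) (simp add: axis_def eq_commute[of "e i"])
    also have "\<dots> = vec_nth (perm_vec z) (e i)" using i by (simp add: perm_vec_nth)
    finally show "vec_nth (perm_vec z) (e i) = vec_nth (\<Sum>k\<in>{1..n}. real (z (w k)) *\<^sub>R v k) (e i)" by simp
  qed
  have diff: "perm_vec z - ?p = (\<Sum>i\<in>{1..n - 1}. excess (z \<circ> w) i *\<^sub>R d i)" if z: "z permutes {1..n}" for z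
    using permuted_sum[OF permutes_compose[OF w z] n, of v] permutes_inverses(2)[OF w]
    unfolding exp d_def by simp
  \<comment> \<open>The dual vectors are indicators of prefixes along w: the one for j pairs to 1
    with \<open>v k\<close> exactly if k <= j, so it separates \<open>v i\<close> from
    \<open>v (i + 1)\<close> only for i = j.\<close>
  have dual: "inner (vec_of_coords n e (\<lambda>i. if inv' w i \<le> j then 1 else 0)) (d i) = (if i = j then 1 else 0)"
    if "i \<in> ?J" "j \<in> ?J" for i j
  proof -
    have c: "vec_nth (vec_of_coords n e (\<lambda>i. if inv' w i \<le> j then 1 else 0)) (e (w k)) = (if k \<le> j then 1 else 0)"
      if "k \<in> {1..n}" for k
      using permutes_in_image[OF w, of k] that permutes_inverses(2)[OF w, of k] by (simp add: vec_of_coords_nth)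
    have "i \<in> {1..n}" "i + 1 \<in> {1..n}" using that by auto
    then show ?thesis unfolding d_def v_def inner_diff_right inner_axis
      unfolding c[OF \<open>i \<in> {1..n}\<close>] c[OF \<open>i + 1 \<in> {1..n}\<close>] by simp
  qed
  note ind = dual_family_independent[of ?J _ d, OF dual]
  have "?p \<in> ?S" using iw permutes_inv_o(2)[OF w] by (intro imageI) simp
  then have "?p \<in> affine hull ?S" by (rule hull_inc)
  then have "aff_dim (coset_face I w) = int (dim ((+) (- ?p) ` ?S))"
    unfolding coset_face_def aff_dim_convex_hull by (rule aff_dim_eq_dim)
  moreover have "dim ((+) (- ?p) ` ?S) = card ?J"
  proof (rule dim_unique[OF _ _ ind(1) card_image[OF ind(2)]])
    show "d ` ?J \<subseteq> (+) (- ?p) ` ?S"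
    proof
      fix x assume "x \<in> d ` ?J"
      then obtain i where i: "i \<in> {1..n - 1}" "i \<notin> I" "x = d i" by blast
      let ?t = "Transposition.transpose i (i + 1)"
      have t: "?t \<in> yg n I" by (rule transpose_in_yg[OF i(1,2)])
      have tw: "(?t \<circ> inv' w) \<circ> w = ?t" using permutes_inv_o(2)[OF w] by (simp add: comp_assoc)
      have z: "?t \<circ> inv' w permutes {1..n}" by (rule permutes_compose[OF iw ygD[OF t]])
      have "excess ?t j = (if j = i then 1 else 0)" if j: "j \<in> {1..n - 1}" for j
      proof (cases "j = i")
        case True
        have "{1..i} = insert i {1..<i}" using i(1) by auto
        then have "excess ?t i = (\<Sum>k\<in>insert i {1..<i}. real (?t k) - real k)" by (simp add: excess_def)
        also have "\<dots> = 1 + (\<Sum>k\<in>{1..<i}. real (?t k) - real k)" by simp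
        also have "(\<Sum>k\<in>{1..<i}. real (?t k) - real k) = 0" by (intro sum.neutral) simp
        finally show ?thesis using True by simp
      next
        case False
        have "?t \<in> yg n {j}" by (rule transpose_in_yg) (use i False in auto)
        then have "?t ` {1..j} = {1..j}" by (simp add: yg_def)
        then show ?thesis using False excess_eq_0[OF _ permutes_inj[OF ygD[OF t]]] by simp
      qed
      then have "(\<Sum>j\<in>{1..n - 1}. excess ?t j *\<^sub>R d j) = (\<Sum>j\<in>{1..n - 1}. if j = i then d i else 0)"
        by (intro sum.cong) auto
      also have "\<dots> = d i" using i(1) by simp
      finally have "perm_vec (?t \<circ> inv' w) - ?p = d i" using diff[OF z] tw by simp
      then have x: "x = - ?p + perm_vec (?t \<circ> inv' w)" unfolding i(3) by simp
      show "x \<in> (+) (- ?p) ` ?S" unfolding x by (intro imageI CollectI conjI z) (simp only: tw t)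
    qed
    show "(+) (- ?p) ` ?S \<subseteq> span (d ` ?J)"
    proof
      fix x assume "x \<in> (+) (- ?p) ` ?S"
      then obtain z where z: "z permutes {1..n}" "z \<circ> w \<in> yg n I" and x: "x = perm_vec z - ?p" by auto
      have "excess (z \<circ> w) i *\<^sub>R d i \<in> span (d ` ?J)" if i: "i \<in> {1..n - 1}" for i
      proof (cases "i \<in> I")
        case True
        then have "(z \<circ> w) ` {1..i} = {1..i}" using z(2) unfolding yg_def by simp
        then have "excess (z \<circ> w) i = 0" by (rule excess_eq_0[OF _ permutes_inj[OF ygD[OF z(2)]]])
        then show ?thesis by (simp add: span_zero)
      next
        case False
        then show ?thesis using i by (intro span_scale span_base imageI) simp
      qed
      then show "x \<in> span (d ` ?J)" unfolding x diff[OF z(1)] by (rule span_sum)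
    qed
  qed
  moreover have "card ?J = n - 1 - card I" using card_Diff_subset[OF _ I] finite_subset[OF I] by simp
  ultimately show ?thesis by simp
qed

lemma perm_faces_eq:
  assumes "i \<le> n - 1"
  shows "perm_faces n e i = {coset_face I w | I w. I \<in> csets n (n - 1 - i) \<and> w permutes {1..n}}"
proof (intro subset_antisym subsetI)
  have card: "card I \<le> n - 1" if "I \<subseteq> {1..n - 1}" for I using card_mono[OF _ that] by simp
  fix F assume "F \<in> perm_faces n e i"
  then have F: "F face_of permutohedron n e" "aff_dim F = int i" by (simp_all add: perm_faces_def)
  \<comment> \<open>The empty face has affine dimension -1, so it is not counted for any i.\<close>
  then have "F \<noteq> {}" by auto
  then obtain I w where Iw: "I \<subseteq> {1..n - 1}" "w permutes {1..n}" "F = coset_face I w"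
    by (rule face_is_coset_face[OF F(1)])
  have "i = n - 1 - card I" using F(2) aff_dim_coset_face[OF Iw(2,1)] Iw(3) by simp
  then have "card I = n - 1 - i" using card[OF Iw(1)] assms by simp
  then show "F \<in> {coset_face I w | I w. I \<in> csets n (n - 1 - i) \<and> w permutes {1..n}}" using Iw by blast
next
  fix F assume "F \<in> {coset_face I w | I w. I \<in> csets n (n - 1 - i) \<and> w permutes {1..n}}"
  then obtain I w where Iw: "F = coset_face I w" "I \<in> csets n (n - 1 - i)" "w permutes {1..n}" by blast
  note I = csets_D[OF Iw(2)]
  show "F \<in> perm_faces n e i"
    using coset_face_face_of[OF Iw(3) I(1)] aff_dim_coset_face[OF Iw(3) I(1)] I(3) assms
    by (simp add: perm_faces_def Iw(1))
qed

section \<open>The action on the faces\<close>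

lemma permute_coords_nth:
  assumes "\<sigma> permutes {1..n}" "i \<in> {1..n}"
  shows "vec_nth (permute_coords n e \<sigma> x) (e i) = vec_nth x (e (inv' \<sigma> i))"
  unfolding permute_coords_def vec_of_coords_nth[OF assms(2)]
  using sym_group_inv_equality[of \<sigma> n] assms(1) by (simp add: sym_group_carrier)

lemma permute_coords_comp:
  assumes s: "\<sigma> permutes {1..n}" and t: "\<tau> permutes {1..n}"
  shows "permute_coords n e \<sigma> (permute_coords n e \<tau> x) = permute_coords n e (\<sigma> \<circ> \<tau>) x"
proof (rule vec_eqI)
  fix i assume i: "i \<in> {1..n}"
  have si: "inv' \<sigma> i \<in> {1..n}" using permutes_in_image[OF permutes_inv[OF s]] i by blast
  have "inv' (\<sigma> \<circ> \<tau>) = inv' \<tau> \<circ> inv' \<sigma>" using s t by (intro o_inv_distrib) (auto simp: permutes_bij)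
  then show "vec_nth (permute_coords n e \<sigma> (permute_coords n e \<tau> x)) (e i) =
      vec_nth (permute_coords n e (\<sigma> \<circ> \<tau>) x) (e i)"
    unfolding permute_coords_nth[OF s i] permute_coords_nth[OF t si]
      permute_coords_nth[OF permutes_compose[OF t s] i] by simp
qed

lemma permute_coords_id: "permute_coords n e id x = x"
  by (rule vec_eqI) (simp add: permute_coords_nth[OF permutes_id])

text \<open>The vertex of z moves to the vertex of \<open>z \<circ> inv' \<sigma>\<close>, so the
  coset that indexes the face is translated by \<sigma> from the left.\<close>

lemma permute_coords_coset_face:
  assumes s: "\<sigma> permutes {1..n}"
  shows "permute_coords n e \<sigma> ` coset_face I w = coset_face I (\<sigma> \<circ> w)"
proof -
  have iv: "inv' \<sigma> permutes {1..n}" by (rule permutes_inv[OF s])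
  have lin: "linear (permute_coords n e \<sigma>)"
    by (intro linearI vec_eqI) (simp_all add: permute_coords_nth[OF s])
  have pv: "permute_coords n e \<sigma> (perm_vec z) = perm_vec (z \<circ> inv' \<sigma>)" for z
  proof (rule vec_eqI)
    fix i assume i: "i \<in> {1..n}"
    have "inv' \<sigma> i \<in> {1..n}" using permutes_in_image[OF iv] i by blast
    then show "vec_nth (permute_coords n e \<sigma> (perm_vec z)) (e i) = vec_nth (perm_vec (z \<circ> inv' \<sigma>)) (e i)"
      unfolding permute_coords_nth[OF s i] perm_vec_nth[OF i] by (simp add: perm_vec_nth)
  qed
  have "(\<lambda>z. z \<circ> inv' \<sigma>) ` {z. z permutes {1..n} \<and> z \<circ> w \<in> yg n I} =
      {z. z permutes {1..n} \<and> z \<circ> (\<sigma> \<circ> w) \<in> yg n I}"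
  proof (intro subset_antisym subsetI)
    fix z assume "z \<in> (\<lambda>z. z \<circ> inv' \<sigma>) ` {z. z permutes {1..n} \<and> z \<circ> w \<in> yg n I}"
    then obtain y where y: "z = y \<circ> inv' \<sigma>" "y permutes {1..n}" "y \<circ> w \<in> yg n I" by blast
    have "z \<circ> (\<sigma> \<circ> w) = y \<circ> (inv' \<sigma> \<circ> \<sigma>) \<circ> w" by (simp add: y(1) comp_assoc)
    also have "\<dots> = y \<circ> w" using permutes_inv_o(2)[OF s] by simp
    finally show "z \<in> {z. z permutes {1..n} \<and> z \<circ> (\<sigma> \<circ> w) \<in> yg n I}"
      using y permutes_compose[OF iv y(2)] by simp
  next
    fix z assume z: "z \<in> {z. z permutes {1..n} \<and> z \<circ> (\<sigma> \<circ> w) \<in> yg n I}"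
    have "z = (z \<circ> \<sigma>) \<circ> inv' \<sigma>" using permutes_inv_o(1)[OF s] by (simp add: comp_assoc)
    moreover have "z \<circ> \<sigma> \<in> {z. z permutes {1..n} \<and> z \<circ> w \<in> yg n I}"
      using z permutes_compose[OF s] by (simp add: comp_assoc)
    ultimately show "z \<in> (\<lambda>z. z \<circ> inv' \<sigma>) ` {z. z permutes {1..n} \<and> z \<circ> w \<in> yg n I}" by (rule image_eqI)
  qed
  moreover have "permute_coords n e \<sigma> ` perm_vec ` A = perm_vec ` (\<lambda>z. z \<circ> inv' \<sigma>) ` A" for A
    by (simp only: image_image pv)
  ultimately show ?thesis
    unfolding coset_face_def convex_hull_linear_image[OF lin] by (simp only:)
qed

end

section \<open>Permutation modules on the sets of faces\<close>

lemma
  assumes fin: "finite K" and dis: "\<And>i j x. i \<in> K \<Longrightarrow> j \<in> K \<Longrightarrow> x \<in> X i \<Longrightarrow> x \<in> X j \<Longrightarrow> i = j"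
  shows ssum_supp_fun: "ssum K (\<lambda>i. supp_fun (X i)) = supp_fun (\<Union>i\<in>K. X i)"
    and sindep_supp_fun: "sindep K (\<lambda>i. supp_fun (X i))"
proof -
  show "ssum K (\<lambda>i. supp_fun (X i)) = supp_fun (\<Union>i\<in>K. X i)"
  proof (rule subset_antisym)
    show "ssum K (\<lambda>i. supp_fun (X i)) \<subseteq> supp_fun (\<Union>i\<in>K. X i)"
      by (rule ssum_subset[OF subspace_supp_fun]) (auto simp: supp_fun_def)
    show "supp_fun (\<Union>i\<in>K. X i) \<subseteq> ssum K (\<lambda>i. supp_fun (X i))"
    proof
      fix f assume f: "f \<in> supp_fun (\<Union>i\<in>K. X i)"
      have "f = (\<Sum>i\<in>K. (\<lambda>x. if x \<in> X i then f x else 0))"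
      proof
        fix x
        have "(\<Sum>i\<in>K. if x \<in> X i then f x else 0) = f x"
        proof (cases "\<exists>j\<in>K. x \<in> X j")
          case True
          then obtain j where j: "j \<in> K" "x \<in> X j" by blast
          have "(\<Sum>i\<in>K. if x \<in> X i then f x else 0) = (\<Sum>i\<in>K. if i = j then f x else 0)"
          proof (intro sum.cong refl)
            fix i assume i: "i \<in> K"
            show "(if x \<in> X i then f x else 0) = (if i = j then f x else 0)"
            proof (cases "i = j")
              case False
              then have "x \<notin> X i" using dis[OF i j(1) _ j(2)] by blast
              then show ?thesis using False by simp
            qed (simp add: j(2))
          qed
          then show ?thesis using fin j(1) by simp
        next
          case False
          then have "f x = 0" using f unfolding supp_fun_def by blast
          then show ?thesis by simp
        qed
        then show "f x = (\<Sum>i\<in>K. (\<lambda>x. if x \<in> X i then f x else 0)) x" by (simp add: sum_apply_fun)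
      qed
      also have "\<dots> \<in> ssum K (\<lambda>i. supp_fun (X i))" by (rule ssumI) (simp add: supp_fun_def)
      finally show "f \<in> ssum K (\<lambda>i. supp_fun (X i))" .
    qed
  qed
  show "sindep K (\<lambda>i. supp_fun (X i))"
    unfolding sindep_def
  proof (intro allI impI ballI)
    fix f j assume f: "(\<forall>i\<in>K. f i \<in> supp_fun (X i)) \<and> (\<Sum>i\<in>K. f i) = 0" and j: "j \<in> K"
    have fi: "f i \<in> supp_fun (X i)" if "i \<in> K" for i using f that by blast
    show "f j = 0"
    proof
      fix x
      show "f j x = 0 x"
      proof (cases "x \<in> X j")
        case True
        have "(\<Sum>i\<in>K. f i x) = (\<Sum>i\<in>K. if i = j then f j x else 0)"
        proof (intro sum.cong refl)
          fix i assume i: "i \<in> K"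
          show "f i x = (if i = j then f j x else 0)"
          proof (cases "i = j")
            case False
            then have "x \<notin> X i" using dis[OF i j _ True] by blast
            then show ?thesis using supp_funD[OF fi[OF i]] False by simp
          qed simp
        qed
        also have "\<dots> = f j x" using fin j by simp
        finally show ?thesis using conjunct2[OF f] sum_apply_fun[of f K x] by simp
      next
        case False
        then show ?thesis using supp_funD[OF fi[OF j]] by simp
      qed
    qed
  qed
qed

context numbered_coords
begin

text \<open>The permutation action for functions extended by zero. Functions on the faces of
  different types I then lie in one space, where their direct sum can be formed.\<close>

definition face_act :: "(nat \<Rightarrow> nat) \<Rightarrow> ((real ^ 'n) set \<Rightarrow> complex) \<Rightarrow> (real ^ 'n) set \<Rightarrow> complex" where
  "face_act \<sigma> f = (\<lambda>F. f (permute_coords n e (inv' \<sigma>) ` F))"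

definition faces :: "nat set \<Rightarrow> (real ^ 'n) set set" where
  "faces I = coset_face I ` {w. w permutes {1..n}}"

lemma facesI: "w permutes {1..n} \<Longrightarrow> coset_face I w \<in> faces I"
  by (simp add: faces_def)

lemma finite_faces: "finite (faces I)"
  unfolding faces_def by (intro finite_imageI finite_perms)

lemma permute_image_comp:
  assumes "\<sigma> permutes {1..n}" "\<tau> permutes {1..n}"
  shows "permute_coords n e \<sigma> ` permute_coords n e \<tau> ` F = permute_coords n e (\<sigma> \<circ> \<tau>) ` F"
  by (simp only: image_image permute_coords_comp[OF assms])

lemma permute_image_id: "permute_coords n e id ` F = F"
  by (simp add: permute_coords_id)

lemma permute_faces_iff:
  assumes s: "\<sigma> permutes {1..n}"
  shows "permute_coords n e \<sigma> ` F \<in> faces I \<longleftrightarrow> F \<in> faces I"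
proof -
  have *: "permute_coords n e \<tau> ` F \<in> faces I" if F: "F \<in> faces I" and t: "\<tau> permutes {1..n}" for F \<tau>
  proof -
    obtain w where w: "w permutes {1..n}" "F = coset_face I w" using F unfolding faces_def by blast
    show ?thesis unfolding w(2) permute_coords_coset_face[OF t] by (rule facesI[OF permutes_compose[OF w(1) t]])
  qed
  have iv: "inv' \<sigma> permutes {1..n}" by (rule permutes_inv[OF s])
  have "permute_coords n e (inv' \<sigma>) ` permute_coords n e \<sigma> ` F = F"
    unfolding permute_image_comp[OF iv s] permutes_inv_o(2)[OF s] by (rule permute_image_id)
  then show ?thesis using *[OF _ iv, of "permute_coords n e \<sigma> ` F"] *[OF _ s, of F] by auto
qed

lemma gmod_face_act:
  assumes fin: "finite X"
    and X: "\<And>\<sigma> F. \<sigma> permutes {1..n} \<Longrightarrow> permute_coords n e \<sigma> ` F \<in> X \<longleftrightarrow> F \<in> X"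
  shows "gmod (sym_group n) (supp_fun X) face_act"
proof (rule gmodI[OF subspace_supp_fun supp_fun_finite_span[OF fin]])
  fix g h f assume g: "g \<in> carrier (sym_group n)" and h: "h \<in> carrier (sym_group n)"
  then have p: "g permutes {1..n}" "h permutes {1..n}" by (simp_all add: sym_group_carrier)
  have "inv' (g \<circ> h) = inv' h \<circ> inv' g" using p by (intro o_inv_distrib) (auto simp: permutes_bij)
  then show "face_act (g \<otimes>\<^bsub>sym_group n\<^esub> h) f = face_act g (face_act h f)"
    unfolding face_act_def sym_group_mult permute_image_comp[OF permutes_inv[OF p(2)] permutes_inv[OF p(1)]]
    by simp
next
  fix g f assume "g \<in> carrier (sym_group n)" and f: "f \<in> supp_fun X"
  then have "inv' g permutes {1..n}" by (intro permutes_inv) (simp add: sym_group_carrier)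
  note X[OF this]
  then show "face_act g f \<in> supp_fun X" using f by (simp add: supp_fun_def face_act_def)
next
  fix f
  show "face_act \<one>\<^bsub>sym_group n\<^esub> f = f"
    unfolding face_act_def sym_group_one inv_id permute_image_id ..
qed (simp_all add: face_act_def fun_eq_iff)

text \<open>Pulling a function on faces back along \<open>coset_face I\<close> gives a
  right-invariant function on the group. This is bijective because two permutations give the same
  face exactly if they lie in the same left coset of the Young subgroup.\<close>

lemma rep_class_faces:
  assumes I: "I \<subseteq> {1..n - 1}"
  shows "rep_class (sym_group n) (fmod (supp_fun (faces I))) face_act = ind_class n I"
proof -
  define T where "T f = (\<lambda>w. if w permutes {1..n} then f (coset_face I w) else 0 :: complex)" for f
  have G: "gmod (sym_group n) (supp_fun (faces I)) face_act"
    by (rule gmod_face_act[OF finite_faces permute_faces_iff])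
  have T: "T f w = f (coset_face I w)" if "w permutes {1..n}" for f w using that by (simp add: T_def)
  have "rep_class (sym_group n) (fmod (supp_fun (faces I))) face_act = rep_class (sym_group n) (fmod (FI n I)) ltr"
  proof (rule rep_class_transport[where T = T])
    show "gmod (sym_group n) (FI n I) ltr" by (rule gmod_FI)
    show "bij_betw T (carrier (fmod (supp_fun (faces I)))) (FI n I)"
      unfolding fmod_simps
    proof (rule bij_betw_imageI)
      show "inj_on T (supp_fun (faces I))"
      proof (rule inj_onI)
        fix f g assume f: "f \<in> supp_fun (faces I)" and g: "g \<in> supp_fun (faces I)" and eq: "T f = T g"
        show "f = g"
        proof
          fix F
          show "f F = g F"
          proof (cases "F \<in> faces I")
            case True
            then obtain w where w: "w permutes {1..n}" "F = coset_face I w" unfolding faces_def by blast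
            then show ?thesis using T[OF w(1), of f] T[OF w(1), of g] eq by simp
          next
            case False
            then show ?thesis using supp_funD[OF f] supp_funD[OF g] by simp
          qed
        qed
      qed
      show "T ` supp_fun (faces I) = FI n I"
      proof (rule subset_antisym; rule subsetI)
        fix \<phi> assume "\<phi> \<in> T ` supp_fun (faces I)"
        then obtain f where f: "\<phi> = T f" by blast
        have "T f (w \<circ> u) = T f w" if u: "u \<in> yg n I" for w u
          unfolding T_def permutes_comp_iff(1)[OF ygD[OF u]] coset_face_cong[OF u] ..
        moreover have "T f \<in> FS n" by (simp add: T_def FS_def)
        ultimately show "\<phi> \<in> FI n I" by (simp add: f FI_def)
      next
        fix \<phi> assume \<phi>: "\<phi> \<in> FI n I"
        define f where "f F = (if F \<in> faces I then \<phi> (SOME w. w permutes {1..n} \<and> F = coset_face I w) else 0)" for F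
        have val: "f (coset_face I w) = \<phi> w" if w: "w permutes {1..n}" for w
        proof -
          define v where "v = (SOME v. v permutes {1..n} \<and> coset_face I w = coset_face I v)"
          have v: "v permutes {1..n} \<and> coset_face I w = coset_face I v"
            unfolding v_def by (rule someI[of _ w]) (intro conjI w refl)
          obtain u where u: "u \<in> yg n I" "w = v \<circ> u"
            using coset_face_eqD(2)[OF w conjunct1[OF v] I I conjunct2[OF v]] by blast
          have "\<phi> (v \<circ> u) = \<phi> v" using \<phi> u(1) unfolding FI_def by blast
          then have "\<phi> v = \<phi> w" by (simp only: u(2))
          then show ?thesis unfolding f_def if_P[OF facesI[OF w]] v_def .
        qed
        have "f \<in> supp_fun (faces I)" by (simp add: f_def supp_fun_def)
        moreover have "\<phi> = T f"
        proof
          fix w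
          show "\<phi> w = T f w"
          proof (cases "w permutes {1..n}")
            case True
            then show ?thesis using val[OF True] T[OF True, of f] by simp
          next
            case False
            then have "\<phi> w = 0" using \<phi> FI_subset_FS unfolding FS_def by blast
            then show ?thesis unfolding T_def if_not_P[OF False] .
          qed
        qed
        ultimately show "\<phi> \<in> T ` supp_fun (faces I)" by blast
      qed
    qed
    show "T (face_act g f) = ltr g (T f)" if g: "g \<in> carrier (sym_group n)" for g f
    proof -
      have ig: "inv' g permutes {1..n}" using g by (intro permutes_inv) (simp add: sym_group_carrier)
      show ?thesis
        unfolding T_def face_act_def ltr_def permute_coords_coset_face[OF ig] permutes_comp_iff(2)[OF ig] ..
    qed
    show "face_act g f \<in> carrier (fmod (supp_fun (faces I)))"
      if "g \<in> carrier (sym_group n)" "f \<in> carrier (fmod (supp_fun (faces I)))" for g f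
      using gmodD(3)[OF G that(1)] that(2) by simp
    show "\<zero>\<^bsub>fmod (supp_fun (faces I))\<^esub> \<in> carrier (fmod (supp_fun (faces I)))"
      using fvs.subspace_0[OF subspace_supp_fun] by simp
  qed (simp_all add: T_def fun_eq_iff fvs.subspace_add[OF subspace_supp_fun] fvs.subspace_scale[OF subspace_supp_fun])
  then show ?thesis unfolding rep_class_FI[OF I] ind_class_eq[OF I] .
qed

text \<open>A face of dimension i has a type I with n - 1 - i elements; the type is determined by
  the face and preserved by the action, so the functions on the faces split by type.\<close>

lemma face_class_eq:
  assumes i: "i \<le> n - 1"
  shows "face_class n e i = finsum (RS n) (ind_class n) (csets n (n - 1 - i))"
proof -
  let ?K = "csets n (n - 1 - i)"
  define X where "X = perm_faces n e i"
  have K: "finite ?K" by simp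
  have XU: "X = (\<Union>I\<in>?K. faces I)"
    unfolding X_def perm_faces_eq[OF i] faces_def by blast
  have finX: "finite X" unfolding XU by (intro finite_UN_I K finite_faces)
  have pX: "permute_coords n e \<sigma> ` F \<in> X \<longleftrightarrow> F \<in> X" if "\<sigma> permutes {1..n}" for \<sigma> F
    unfolding XU UN_iff permute_faces_iff[OF that] ..
  have G: "gmod (sym_group n) (supp_fun X) face_act" by (rule gmod_face_act[OF finX pX])
  have dis: "I = J" if h: "I \<in> ?K" "J \<in> ?K" "F \<in> faces I" "F \<in> faces J" for I J F
  proof -
    obtain w where w: "w permutes {1..n}" "F = coset_face I w" using h(3) unfolding faces_def by blast
    obtain v where v: "v permutes {1..n}" "F = coset_face J v" using h(4) unfolding faces_def by blast
    have "coset_face I w = coset_face J v" using w(2) v(2) by simp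
    then show ?thesis by (rule coset_face_eqD(1)[OF w(1) v(1) csets_D(1)[OF h(1)] csets_D(1)[OF h(2)]])
  qed
  have ss: "ssum ?K (\<lambda>I. supp_fun (faces I)) = supp_fun X"
    unfolding XU by (rule ssum_supp_fun[OF K dis])
  have si: "sindep ?K (\<lambda>I. supp_fun (faces I))" by (rule sindep_supp_fun[OF K dis])
  have sub: "gmod (sym_group n) (supp_fun (faces I)) face_act \<and> supp_fun (faces I) \<subseteq> supp_fun X" if "I \<in> ?K" for I
  proof
    show "gmod (sym_group n) (supp_fun (faces I)) face_act"
      by (rule gmod_face_act[OF finite_faces permute_faces_iff])
    have "faces I \<subseteq> X" unfolding XU using that by blast
    then show "supp_fun (faces I) \<subseteq> supp_fun X" unfolding supp_fun_def by blast
  qed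
  have "rep_class (sym_group n) (fmod (supp_fun X)) face_act =
      finsum (RS n) (\<lambda>I. rep_class (sym_group n) (fmod (supp_fun (faces I))) face_act) ?K"
    using rep_class_ssum[OF G K sub si] unfolding ss RS_def by blast
  also have "\<dots> = finsum (RS n) (ind_class n) ?K"
  proof -
    interpret R: cring "RS n" unfolding RS_def by (rule cring_rep_ring)
    have ic: "ind_class n I \<in> carrier (RS n)" if "I \<in> ?K" for I
      using rep_class_faces[OF csets_D(1)[OF that]] rep_class_in[OF conjunct1[OF sub[OF that]]] by (simp add: RS_def)
    show ?thesis
      by (rule R.finsum_cong'[OF refl]) (use ic rep_class_faces csets_D(1) in blast)+
  qed
  also have "rep_class (sym_group n) (fmod (supp_fun X)) face_act = face_class n e i"
    unfolding face_class_def X_def[symmetric]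
  proof (rule rep_class_transport[symmetric, where T = "\<lambda>f F. if F \<in> X then f F else 0", OF G])
    show "bij_betw (\<lambda>f F. if F \<in> X then f F else 0) (carrier (perm_module X)) (supp_fun X)"
      by (rule bij_betw_byWitness[where f' = "\<lambda>f. restrict f X"])
        (auto simp: perm_module_def supp_fun_def fun_eq_iff PiE_def extensional_def)
    fix g f assume g: "g \<in> carrier (sym_group n)" and f: "f \<in> carrier (perm_module X)"
    let ?a = "perm_action (sym_group n) (\<lambda>\<sigma> F. permute_coords n e \<sigma> ` F) X g f"
    have ig: "inv' g permutes {1..n}" using g by (intro permutes_inv) (simp add: sym_group_carrier)
    have inv: "inv\<^bsub>sym_group n\<^esub> g = inv' g" by (rule sym_group_inv_equality[OF g])
    show "?a \<in> carrier (perm_module X)" by (simp add: perm_action_def perm_module_def)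
    show "(\<lambda>F. if F \<in> X then ?a F else 0) = face_act g (\<lambda>F. if F \<in> X then f F else 0)"
      unfolding face_act_def perm_action_def inv pX[OF ig] by (simp add: fun_eq_iff)
  qed (auto simp: perm_module_def fun_eq_iff)
  finally show ?thesis .
qed

end

section \<open>Polynomials over the representation ring\<close>

lemma (in abelian_monoid) finsum_Pow_insert:
  assumes "finite S" "x \<notin> S" "f \<in> Pow (insert x S) \<rightarrow> carrier G"
  shows "finsum G f (Pow (insert x S)) = finsum G f (Pow S) \<oplus> finsum G (\<lambda>I. f (insert x I)) (Pow S)"
proof -
  have inj: "inj_on (insert x) (Pow S)" using assms(2) unfolding inj_on_def by (metis Pow_iff insert_ident subsetD)
  have "finsum G f (Pow (insert x S)) = finsum G f (Pow S) \<oplus> finsum G f (insert x ` Pow S)"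
    unfolding Pow_insert by (rule finsum_Un_disjoint) (use assms in \<open>auto simp: Pow_insert\<close>)
  also have "finsum G f (insert x ` Pow S) = finsum G (\<lambda>I. f (insert x I)) (Pow S)"
    by (rule add.finprod_reindex[OF _ inj]) (use assms(3) in \<open>auto simp: Pow_insert\<close>)
  finally show ?thesis .
qed

text \<open>For fixed J the powers of a over all I between J and S add up to a power of a + 1. When
  x joins S, the subsets without x gain a factor a, and those with x give the old sum once for E and
  once for the shifted family \<open>?E'\<close>.\<close>

lemma (in cring) finsum_Pow_binomial:
  assumes "finite S" "a \<in> carrier R" "\<And>J. E J \<in> carrier R"
  shows "(\<Oplus>I\<in>Pow S. (\<Oplus>J\<in>Pow I. E J) \<otimes> a [^] (card S - card I)) =
    (\<Oplus>J\<in>Pow S. E J \<otimes> (a \<oplus> \<one>) [^] (card S - card J))"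
  using assms(1,3)
proof (induction S arbitrary: E rule: finite_induct)
  case empty
  then show ?case by (simp add: finsum_insert[of "{}"])
next
  case (insert x S)
  let ?E' = "\<lambda>J. E (insert x J)"
  note E = insert.prems and a = assms(2)
  have Ecl: "E \<in> X \<rightarrow> carrier R" "?E' \<in> X \<rightarrow> carrier R" for X using E by auto
  have fcl: "(\<Oplus>J\<in>Pow I. E J) \<in> carrier R" "(\<Oplus>J\<in>Pow I. ?E' J) \<in> carrier R" for I
    using Ecl by (auto intro: finsum_closed)
  have step: "(\<Oplus>I\<in>Pow S. F I \<otimes> b [^] (Suc (card S) - card I)) = (\<Oplus>I\<in>Pow S. F I \<otimes> b [^] (card S - card I)) \<otimes> b"
    if F: "\<And>I. F I \<in> carrier R" and b: "b \<in> carrier R" for F b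
  proof -
    have "(\<Oplus>I\<in>Pow S. F I \<otimes> b [^] (card S - card I)) \<otimes> b = (\<Oplus>I\<in>Pow S. (F I \<otimes> b [^] (card S - card I)) \<otimes> b)"
      using F b insert.hyps(1) by (intro finsum_ldistr) auto
    also have "\<dots> = (\<Oplus>I\<in>Pow S. F I \<otimes> b [^] (Suc (card S) - card I))"
    proof (rule finsum_cong'[OF refl])
      fix I assume "I \<in> Pow S"
      then have "Suc (card S) - card I = Suc (card S - card I)"
        using card_mono[OF insert.hyps(1), of I] by auto
      then show "F I \<otimes> b [^] (card S - card I) \<otimes> b = F I \<otimes> b [^] (Suc (card S) - card I)"
        using F b by (simp add: m_assoc)
    qed (use F b in auto)
    finally show ?thesis ..
  qed
  have cins: "card (insert x I) = Suc (card I)" if "I \<in> Pow S" for I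
    using that insert.hyps finite_subset[of I S] by (subst card_insert_disjoint) auto
  have cardS: "card (insert x S) = Suc (card S)" using insert.hyps by simp
  let ?f = "\<lambda>I. (\<Oplus>J\<in>Pow I. E J) \<otimes> a [^] (card (insert x S) - card I)"
  let ?g = "\<lambda>J. E J \<otimes> (a \<oplus> \<one>) [^] (card (insert x S) - card J)"
  let ?A = "\<Oplus>J\<in>Pow S. E J \<otimes> (a \<oplus> \<one>) [^] (card S - card J)"
  let ?A' = "\<Oplus>J\<in>Pow S. ?E' J \<otimes> (a \<oplus> \<one>) [^] (card S - card J)"
  have A: "?A \<in> carrier R" "?A' \<in> carrier R" using E a by (auto intro!: finsum_closed)
  have "(\<Oplus>I\<in>Pow S. ?f I) = ?A \<otimes> a"
    unfolding cardS using step[OF fcl(1) a] insert.IH[OF E] by simp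
  moreover have "(\<Oplus>I\<in>Pow S. ?f (insert x I)) = ?A \<oplus> ?A'"
  proof -
    have "(\<Oplus>I\<in>Pow S. ?f (insert x I)) =
        (\<Oplus>I\<in>Pow S. (\<Oplus>J\<in>Pow I. E J) \<otimes> a [^] (card S - card I) \<oplus> (\<Oplus>J\<in>Pow I. ?E' J) \<otimes> a [^] (card S - card I))"
    proof (rule finsum_cong'[OF refl])
      fix I assume I: "I \<in> Pow S"
      then have "finite I" "x \<notin> I" using insert.hyps finite_subset by auto
      then have "(\<Oplus>J\<in>Pow (insert x I). E J) = (\<Oplus>J\<in>Pow I. E J) \<oplus> (\<Oplus>J\<in>Pow I. ?E' J)"
        by (rule finsum_Pow_insert) (use E in auto)
      then show "?f (insert x I) =
          (\<Oplus>J\<in>Pow I. E J) \<otimes> a [^] (card S - card I) \<oplus> (\<Oplus>J\<in>Pow I. ?E' J) \<otimes> a [^] (card S - card I)"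
        using cins[OF I] cardS fcl a by (simp add: l_distr)
    qed (use fcl a in auto)
    also have "\<dots> = ?A \<oplus> ?A'"
      using insert.IH[OF E] insert.IH[of ?E'] E fcl a by (subst finsum_addf) auto
    finally show ?thesis .
  qed
  moreover have "(\<Oplus>I\<in>Pow (insert x S). ?f I) = (\<Oplus>I\<in>Pow S. ?f I) \<oplus> (\<Oplus>I\<in>Pow S. ?f (insert x I))"
    by (rule finsum_Pow_insert[OF insert.hyps]) (use fcl a in auto)
  moreover have "(\<Oplus>J\<in>Pow (insert x S). ?g J) = (\<Oplus>J\<in>Pow S. ?g J) \<oplus> (\<Oplus>J\<in>Pow S. ?g (insert x J))"
    by (rule finsum_Pow_insert[OF insert.hyps]) (use E a in auto)
  moreover have "(\<Oplus>J\<in>Pow S. ?g J) = ?A \<otimes> (a \<oplus> \<one>)"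
    unfolding cardS using a E by (intro step) auto
  moreover have "(\<Oplus>J\<in>Pow S. ?g (insert x J)) = ?A'"
    by (rule finsum_cong'[OF refl]) (use E a cins cardS in auto)
  ultimately show ?case using A a by (simp add: r_distr a_assoc)
qed

section \<open>Evaluation at q - 1 and comparison of coefficients\<close>

lemma (in UP_cring) monom_eq_const_mult:
  assumes "a \<in> carrier R"
  shows "monom P a k = monom P a 0 \<otimes>\<^bsub>P\<^esub> monom P \<one> 1 [^]\<^bsub>P\<^esub> k"
  using monom_mult[OF assms R.one_closed, of 0 k] monom_pow[of \<one> 1 k] assms by simp

lemma (in UP_cring) eval_shift_finsum:
  assumes "finite A" "s \<in> carrier P" "c \<in> A \<rightarrow> carrier R"
  shows "eval R P (\<lambda>a. monom P a 0) s (\<Oplus>\<^bsub>P\<^esub>i\<in>A. monom P (c i) i) =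
    (\<Oplus>\<^bsub>P\<^esub>i\<in>A. monom P (c i) 0 \<otimes>\<^bsub>P\<^esub> s [^]\<^bsub>P\<^esub> i)"
proof -
  let ?h = "\<lambda>a. monom P a 0" and ?t = "\<lambda>i. monom P (c i) i"
  have "ring_hom_cring R P ?h"
    by (rule ring_hom_cringI[OF R.cring_axioms P.cring_axioms const_ring_hom])
  then have pre: "UP_pre_univ_prop R P ?h"
    by (rule UP_pre_univ_prop.intro) (rule UP_cring_axioms)
  have hom: "ring_hom_cring P P (eval R P ?h s)"
    by (rule ring_hom_cringI[OF P.cring_axioms P.cring_axioms UP_pre_univ_prop.eval_ring_hom[OF pre assms(2), folded P_def]])
  have m: "?t \<in> A \<rightarrow> carrier P"
  proof
    fix i assume "i \<in> A"
    then have "c i \<in> carrier R" using assms(3) by blast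
    then show "?t i \<in> carrier P" by (rule monom_closed)
  qed
  show ?thesis
    unfolding ring_hom_cring.hom_finsum[OF hom m]
  proof (rule P.finsum_cong'[OF refl])
    fix i assume "i \<in> A"
    then have ci: "c i \<in> carrier R" using assms(3) by blast
    show "(eval R P ?h s \<circ> ?t) i = ?h (c i) \<otimes>\<^bsub>P\<^esub> s [^]\<^bsub>P\<^esub> i"
      unfolding comp_def by (rule UP_pre_univ_prop.eval_monom[OF pre ci assms(2), folded P_def])
  next
    show "(\<lambda>i. ?h (c i) \<otimes>\<^bsub>P\<^esub> s [^]\<^bsub>P\<^esub> i) \<in> A \<rightarrow> carrier P"
    proof
      fix i assume "i \<in> A"
      then have "c i \<in> carrier R" using assms(3) by blast
      then show "?h (c i) \<otimes>\<^bsub>P\<^esub> s [^]\<^bsub>P\<^esub> i \<in> carrier P"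
        by (intro P.m_closed monom_closed P.nat_pow_closed assms(2))
    qed
  qed
qed

text \<open>The index is reversed because faces are counted by dimension, and the dimension is the
  number of positions that are not cuts.\<close>

lemma (in abelian_monoid) finsum_by_card:
  assumes "finite S" "\<And>I. I \<in> Pow S \<Longrightarrow> f I \<in> carrier G"
  shows "(\<Oplus>i\<in>{0..card S}. finsum G f {I \<in> Pow S. card I = card S - i}) = finsum G f (Pow S)"
proof -
  let ?C = "\<lambda>i. {I \<in> Pow S. card I = card S - i}"
  have "finsum G f (\<Union>i\<in>{0..card S}. ?C i) = (\<Oplus>i\<in>{0..card S}. finsum G f (?C i))"
  proof (rule add.finprod_UN_disjoint)
    show "pairwise (\<lambda>i j. disjnt (?C i) (?C j)) {0..card S}"
      by (auto simp: pairwise_def disjnt_def)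
    show "finite (?C i)" for i using assms(1) by simp
    show "f I \<in> carrier G" if "I \<in> ?C i" for i I using assms(2) that by blast
  qed simp
  also have "(\<Union>i\<in>{0..card S}. ?C i) = Pow S"
  proof (rule subset_antisym)
    show "Pow S \<subseteq> (\<Union>i\<in>{0..card S}. ?C i)"
    proof
      fix I assume I: "I \<in> Pow S"
      then have "card I \<le> card S" using card_mono[OF assms(1), of I] by blast
      then have "card S - card I \<in> {0..card S}" "I \<in> ?C (card S - card I)" using I by simp_all
      then show "I \<in> (\<Union>i\<in>{0..card S}. ?C i)" by (rule UN_I)
    qed
  qed blast
  finally show ?thesis ..
qed

lemma UP_coeff_eq: "p \<in> carrier (UP R) \<Longrightarrow> up_ring.coeff (UP R) p k = p k"
  by (simp add: UP_def)

context UP_cring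
begin

abbreviation Const where
  "Const a \<equiv> monom P a 0"

lemma Const_finsum:
  assumes "f \<in> A \<rightarrow> carrier R"
  shows "Const (finsum R f A) = (\<Oplus>\<^bsub>P\<^esub>i\<in>A. Const (f i))"
  using ring_hom_cring.hom_finsum[OF ring_hom_cringI[OF R.cring_axioms P.cring_axioms const_ring_hom] assms]
  by (simp only: comp_def)

text \<open>The substitution s for the variable in the face polynomial: each I contributes to the
  coefficient of degree \<open>card S - card I\<close> and so keeps this exponent on s.\<close>

lemma eval_cardinality_series:
  assumes fin: "finite S" and B: "\<And>I. I \<in> Pow S \<Longrightarrow> B I \<in> carrier R" and s: "s \<in> carrier P"
    and F: "\<And>i. i \<le> card S \<Longrightarrow> F i = finsum R B {I \<in> Pow S. card I = card S - i}"
  shows "eval R P (\<lambda>a. Const a) s (\<Oplus>\<^bsub>P\<^esub>i\<in>{0..card S}. monom P (F i) i) =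
    (\<Oplus>\<^bsub>P\<^esub>I\<in>Pow S. Const (B I) \<otimes>\<^bsub>P\<^esub> s [^]\<^bsub>P\<^esub> (card S - card I))"
proof -
  let ?C = "\<lambda>i. {I \<in> Pow S. card I = card S - i}"
  let ?t = "\<lambda>I. Const (B I) \<otimes>\<^bsub>P\<^esub> s [^]\<^bsub>P\<^esub> (card S - card I)"
  have BC: "B \<in> ?C i \<rightarrow> carrier R" for i using B by blast
  have BP: "Const (B I) \<in> carrier P" if "I \<in> Pow S" for I by (rule monom_closed[OF B[OF that]])
  have tc: "?t I \<in> carrier P" if "I \<in> Pow S" for I
    by (rule P.m_closed[OF BP[OF that] P.nat_pow_closed[OF s]])
  have tC: "?t \<in> ?C i \<rightarrow> carrier P" for i using tc by blast
  have Fc: "F \<in> {0..card S} \<rightarrow> carrier R"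
  proof
    fix i assume "i \<in> {0..card S}"
    then have i: "i \<le> card S" by simp
    show "F i \<in> carrier R" unfolding F[OF i] by (rule R.finsum_closed[OF BC])
  qed
  have "eval R P (\<lambda>a. Const a) s (\<Oplus>\<^bsub>P\<^esub>i\<in>{0..card S}. monom P (F i) i) =
      (\<Oplus>\<^bsub>P\<^esub>i\<in>{0..card S}. Const (F i) \<otimes>\<^bsub>P\<^esub> s [^]\<^bsub>P\<^esub> i)"
    by (rule eval_shift_finsum[OF _ s Fc]) simp
  also have "\<dots> = (\<Oplus>\<^bsub>P\<^esub>i\<in>{0..card S}. finsum P ?t (?C i))"
  proof (rule P.finsum_cong'[OF refl])
    show "(\<lambda>i. finsum P ?t (?C i)) \<in> {0..card S} \<rightarrow> carrier P" using P.finsum_closed[OF tC] by blast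
    fix i assume "i \<in> {0..card S}"
    then have i: "i \<le> card S" by simp
    have CB: "(\<lambda>I. Const (B I)) \<in> ?C i \<rightarrow> carrier P" using BP by blast
    have "Const (F i) \<otimes>\<^bsub>P\<^esub> s [^]\<^bsub>P\<^esub> i = (\<Oplus>\<^bsub>P\<^esub>I\<in>?C i. Const (B I)) \<otimes>\<^bsub>P\<^esub> s [^]\<^bsub>P\<^esub> i"
      unfolding F[OF i] Const_finsum[OF BC] ..
    also have "\<dots> = (\<Oplus>\<^bsub>P\<^esub>I\<in>?C i. Const (B I) \<otimes>\<^bsub>P\<^esub> s [^]\<^bsub>P\<^esub> i)"
      by (rule P.finsum_ldistr[OF _ P.nat_pow_closed[OF s] CB]) (simp add: fin)
    also have "\<dots> = finsum P ?t (?C i)"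
    proof (rule P.finsum_cong'[OF refl tC])
      fix I assume "I \<in> ?C i"
      then have "card S - card I = i" using i by simp
      then show "Const (B I) \<otimes>\<^bsub>P\<^esub> s [^]\<^bsub>P\<^esub> i = ?t I" by simp
    qed
    finally show "Const (F i) \<otimes>\<^bsub>P\<^esub> s [^]\<^bsub>P\<^esub> i = finsum P ?t (?C i)" .
  qed
  also have "\<dots> = finsum P ?t (Pow S)" by (rule P.finsum_by_card[OF fin tc])
  finally show ?thesis .
qed

text \<open>The hypothesis on s says that s is q - 1; the binomial identity then collects the powers
  of s into powers of q with coefficients \<open>E J\<close>.\<close>

lemma Pow_binomial_monom:
  assumes fin: "finite S" and E: "\<And>J. E J \<in> carrier R" and s: "s \<in> carrier P" "s \<oplus>\<^bsub>P\<^esub> \<one>\<^bsub>P\<^esub> = monom P \<one> 1"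
    and B: "\<And>I. I \<in> Pow S \<Longrightarrow> B I = finsum R E (Pow I)"
  shows "(\<Oplus>\<^bsub>P\<^esub>I\<in>Pow S. Const (B I) \<otimes>\<^bsub>P\<^esub> s [^]\<^bsub>P\<^esub> (card S - card I)) =
    (\<Oplus>\<^bsub>P\<^esub>J\<in>Pow S. monom P (E J) (card S - card J))"
proof -
  have c: "Const (E J) \<in> carrier P" for J by (rule monom_closed[OF E])
  have EC: "E \<in> X \<rightarrow> carrier R" for X using E by blast
  have cC: "(\<lambda>J. Const (E J)) \<in> X \<rightarrow> carrier P" for X using c by blast
  have "(\<Oplus>\<^bsub>P\<^esub>I\<in>Pow S. Const (B I) \<otimes>\<^bsub>P\<^esub> s [^]\<^bsub>P\<^esub> (card S - card I)) =
      (\<Oplus>\<^bsub>P\<^esub>I\<in>Pow S. (\<Oplus>\<^bsub>P\<^esub>J\<in>Pow I. Const (E J)) \<otimes>\<^bsub>P\<^esub> s [^]\<^bsub>P\<^esub> (card S - card I))"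
  proof (rule P.finsum_cong'[OF refl])
    show "(\<lambda>I. (\<Oplus>\<^bsub>P\<^esub>J\<in>Pow I. Const (E J)) \<otimes>\<^bsub>P\<^esub> s [^]\<^bsub>P\<^esub> (card S - card I)) \<in> Pow S \<rightarrow> carrier P"
      using P.m_closed[OF P.finsum_closed[OF cC] P.nat_pow_closed[OF s(1)]] by blast
    fix I assume I: "I \<in> Pow S"
    show "Const (B I) \<otimes>\<^bsub>P\<^esub> s [^]\<^bsub>P\<^esub> (card S - card I) =
        (\<Oplus>\<^bsub>P\<^esub>J\<in>Pow I. Const (E J)) \<otimes>\<^bsub>P\<^esub> s [^]\<^bsub>P\<^esub> (card S - card I)"
      unfolding B[OF I] Const_finsum[OF EC] ..
  qed
  also have "\<dots> = (\<Oplus>\<^bsub>P\<^esub>J\<in>Pow S. Const (E J) \<otimes>\<^bsub>P\<^esub> monom P \<one> 1 [^]\<^bsub>P\<^esub> (card S - card J))"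
    unfolding s(2)[symmetric] by (rule P.finsum_Pow_binomial[OF fin s(1) c])
  also have "\<dots> = (\<Oplus>\<^bsub>P\<^esub>J\<in>Pow S. monom P (E J) (card S - card J))"
    by (simp only: monom_eq_const_mult[OF E, symmetric])
  finally show ?thesis .
qed

text \<open>Like \<open>R_HY\<close>, f is a bare coefficient function, so it has to be recognized
  as a polynomial by comparing coefficients. Multiplication by u moves the term of I to the index S
  - I, and its degree \<open>card I\<close> is the exponent belonging to that complement.\<close>

lemma complementary_series:
  assumes fin: "finite S" and D: "\<And>I. D I \<in> carrier R" and E: "\<And>J. E J \<in> carrier R" and u: "u \<in> carrier R"
    and f: "\<And>k. f k = finsum R D {I \<in> Pow S. card I = k}"
    and DE: "\<And>I. I \<in> Pow S \<Longrightarrow> D I \<otimes> u = E (S - I)"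
  shows "f \<otimes>\<^bsub>P\<^esub> Const u = (\<Oplus>\<^bsub>P\<^esub>J\<in>Pow S. monom P (E J) (card S - card J))"
proof -
  let ?r = "\<Oplus>\<^bsub>P\<^esub>I\<in>Pow S. monom P (D I) (card I)"
  have mD: "(\<lambda>I. monom P (D I) (card I)) \<in> Pow S \<rightarrow> carrier P" using monom_closed[OF D] by blast
  have mE: "(\<lambda>J. monom P (E J) (g J)) \<in> X \<rightarrow> carrier P" for X g using monom_closed[OF E] by blast
  have r: "?r \<in> carrier P" by (rule P.finsum_closed[OF mD])
  have compl: "(\<lambda>I. S - I) ` Pow S = Pow S"
  proof (rule subset_antisym)
    show "Pow S \<subseteq> (\<lambda>I. S - I) ` Pow S"
    proof
      fix J assume "J \<in> Pow S"
      then have "S - (S - J) = J" by (intro double_diff PowD subset_refl)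
      moreover have "S - (S - J) \<in> (\<lambda>I. S - I) ` Pow S" by (rule imageI) (rule PowI[OF Diff_subset])
      ultimately show "J \<in> (\<lambda>I. S - I) ` Pow S" by (simp only:)
    qed
  qed (intro image_subsetI PowI Diff_subset)
  have "f = ?r"
  proof
    fix k
    have "?r k = coeff P ?r k" by (rule UP_coeff_eq[of _ R, folded P_def, OF r, symmetric])
    also have "\<dots> = (\<Oplus>I\<in>Pow S. coeff P (monom P (D I) (card I)) k)"
      by (rule coeff_finsum[OF _ mD]) (simp add: fin)
    also have "\<dots> = (\<Oplus>I\<in>Pow S. if card I = k then D I else \<zero>)"
      by (simp only: coeff_monom[OF D])
    also have "\<dots> = finsum R D {I \<in> Pow S. card I = k}"
      by (rule R.add.finprod_mono_neutral_cong_right) (use D fin in auto)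
    finally show "f k = ?r k" unfolding f ..
  qed
  then have "f \<otimes>\<^bsub>P\<^esub> Const u = ?r \<otimes>\<^bsub>P\<^esub> Const u" by simp
  also have "\<dots> = (\<Oplus>\<^bsub>P\<^esub>I\<in>Pow S. monom P (D I) (card I) \<otimes>\<^bsub>P\<^esub> Const u)"
    by (rule P.finsum_ldistr[OF _ monom_closed[OF u] mD]) (simp add: fin)
  also have "\<dots> = (\<Oplus>\<^bsub>P\<^esub>I\<in>Pow S. monom P (E (S - I)) (card S - card (S - I)))"
  proof (rule P.finsum_cong'[OF refl])
    show "(\<lambda>I. monom P (E (S - I)) (card S - card (S - I))) \<in> Pow S \<rightarrow> carrier P"
      using monom_closed[OF E] by blast
    fix I assume I: "I \<in> Pow S"
    have "I \<subseteq> S" using I by blast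
    then have "card (S - I) = card S - card I" by (rule card_Diff_subset[OF finite_subset[OF \<open>I \<subseteq> S\<close> fin]])
    moreover have "card I \<le> card S" using card_mono[OF fin] I by blast
    ultimately have "card S - card (S - I) = card I" by simp
    then show "monom P (D I) (card I) \<otimes>\<^bsub>P\<^esub> Const u = monom P (E (S - I)) (card S - card (S - I))"
      using monom_mult[OF D u, of I "card I" 0] by (simp only: DE[OF I] add_0_right)
  qed
  also have "\<dots> = (\<Oplus>\<^bsub>P\<^esub>J\<in>(\<lambda>I. S - I) ` Pow S. monom P (E J) (card S - card J))"
  proof (rule P.add.finprod_reindex[symmetric])
    show "inj_on (\<lambda>I. S - I) (Pow S)" by (rule inj_on_inverseI[where g = "\<lambda>I. S - I"]) (intro double_diff PowD subset_refl)
  qed (rule mE)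
  finally show ?thesis unfolding compl .
qed

lemma shifted_variable:
  "monom P \<one> 1 \<ominus>\<^bsub>P\<^esub> \<one>\<^bsub>P\<^esub> \<in> carrier P" "(monom P \<one> 1 \<ominus>\<^bsub>P\<^esub> \<one>\<^bsub>P\<^esub>) \<oplus>\<^bsub>P\<^esub> \<one>\<^bsub>P\<^esub> = monom P \<one> 1"
proof -
  have X: "monom P \<one> 1 \<in> carrier P" by (rule monom_closed[OF R.one_closed])
  show "monom P \<one> 1 \<ominus>\<^bsub>P\<^esub> \<one>\<^bsub>P\<^esub> \<in> carrier P" by (rule P.minus_closed[OF X P.one_closed])
  show "(monom P \<one> 1 \<ominus>\<^bsub>P\<^esub> \<one>\<^bsub>P\<^esub>) \<oplus>\<^bsub>P\<^esub> \<one>\<^bsub>P\<^esub> = monom P \<one> 1"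
    unfolding P.minus_eq P.a_assoc[OF X P.a_inv_closed[OF P.one_closed] P.one_closed] P.l_neg[OF P.one_closed]
    by (rule P.r_zero[OF X])
qed

end

theorem theorem6p1:
  fixes n :: nat and h :: "nat \<Rightarrow> nat" and e :: "nat \<Rightarrow> 'n::finite"
  assumes "n \<ge> 1"
    and "bij_betw e {1..n} UNIV"
    and "\<forall>j\<in>{1..n - 1}. h j = j + 1"
    and "h n = n"
  shows "H_Pi n e = R_HY n h \<otimes>\<^bsub>RSq n\<^esub> const_RSq n (alt_class n) \<and>
         H_Pi n e = (\<Oplus>\<^bsub>RSq n\<^esub>I\<in>Pow {1..n - 1}.
           const_RSq n (ind_class n I) \<otimes>\<^bsub>RSq n\<^esub> q_minus_1 n [^]\<^bsub>RSq n\<^esub> (n - 1 - card I))"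
proof -
  let ?S = "{1..n - 1}" and ?P = "RSq n" and ?q = "q_minus_1 n"
  have cr: "cring (RS n)" unfolding RS_def by (rule cring_rep_ring)
  interpret AM: abelian_monoid "RS n"
    by (rule abelian_group.axioms(1)[OF ring.is_abelian_group[OF cring.axioms(1)[OF cr]]])
  have U: "UP_cring (RS n)" by (rule UP_cring.intro[OF cr])
  have C: "numbered_coords n e" by (rule numbered_coords.intro[OF assms(1,2)])
  have h: "path_hess n h" using assms(1,3,4) unfolding path_hess_def by blast
  have N: "card ?S = n - 1" by simp
  have fin: "finite ?S" by simp
  \<comment> \<open>All that is used of q - 1 is that it is a polynomial which becomes the variable
    q when 1 is added.\<close>
  have q: "?q \<in> carrier ?P" "?q \<oplus>\<^bsub>?P\<^esub> \<one>\<^bsub>?P\<^esub> = up_ring.monom ?P \<one>\<^bsub>RS n\<^esub> 1"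
    using UP_cring.shifted_variable[OF U] unfolding q_minus_1_def by blast+
  have ind: "ind_class n I = finsum (RS n) (eclass n) (Pow I)" if "I \<in> Pow ?S" for I
    by (rule ind_class_eq) (rule PowD[OF that])
  have indc: "ind_class n I \<in> carrier (RS n)" if "I \<in> Pow ?S" for I
    unfolding ind[OF that] by (intro AM.finsum_closed funcsetI eclass_in)
  have faces: "face_class n e i = finsum (RS n) (ind_class n) {I \<in> Pow ?S. card I = card ?S - i}"
    if "i \<le> card ?S" for i
    unfolding N by (rule numbered_coords.face_class_eq[OF C]) (use that N in simp)
  have second: "H_Pi n e = (\<Oplus>\<^bsub>?P\<^esub>I\<in>Pow ?S. const_RSq n (ind_class n I) \<otimes>\<^bsub>?P\<^esub> ?q [^]\<^bsub>?P\<^esub> (n - 1 - card I))"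
    using UP_cring.eval_cardinality_series[OF U fin indc q(1) faces]
    unfolding H_Pi_def F_Pi_def const_RSq_def[abs_def] N .
  also have "\<dots> = (\<Oplus>\<^bsub>?P\<^esub>J\<in>Pow ?S. up_ring.monom ?P (eclass n J) (n - 1 - card J))"
    using UP_cring.Pow_binomial_monom[OF U fin eclass_in q ind]
    unfolding const_RSq_def N .
  also have "\<dots> = R_HY n h \<otimes>\<^bsub>?P\<^esub> const_RSq n (alt_class n)"
  proof -
    have D: "rep_class (sym_group n) (fmod (DJ n I)) ltr \<in> carrier (RS n)" for I
      unfolding RS_def by (rule rep_class_in[OF gmod_DJ])
    have DE: "rep_class (sym_group n) (fmod (DJ n I)) ltr \<otimes>\<^bsub>RS n\<^esub> alt_class n = eclass n (?S - I)"
      if "I \<in> Pow ?S" for I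
      by (rule rep_class_DJ_twist) (rule PowD[OF that])
    show ?thesis
      using UP_cring.complementary_series[OF U fin D eclass_in alt_class_in R_HY_eq[OF h] DE, symmetric]
      unfolding const_RSq_def N .
  qed
  finally show ?thesis using second by (simp only: simp_thms)
qed

end
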